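(* For every $\phi\in \mathcal{C}^{+1}(\Omega)$, the spectral radius $r_\phi$ is a simple, single dominating eigenvalue of $\mathcal{L}_\phi$ acting on $\mathcal{C}^{+1}(\Omega)$ (that is, $r_\phi$ is a simple eigenvalue and it is the only spectral value of maximal modulus, the rest of the spectrum being contained in a disk centered at $0$ of radius strictly smaller than $r_\phi$). Moreover, for every $q\ge 1$ and every $\vec{\psi}=(\psi_1,\dots,\psi_q)$ with $\psi_i\in \mathcal{C}^{+1}(\Omega)$ for all $i$, the map $\mathcal{P}:\mathbb{R}^q\to\mathbb{R}$, $\mathcal{P}(t)=\log r_{t\cdot\vec{\psi}}$, is infinitely differentiable. Furthermore, for $z\in\mathbb{R}^q$: (1) $\mathcal{H}(z,\vec{\psi})=-\infty$ if $z\notin I(\vec{\psi})$; (2) $\mathcal{H}(z,\vec{\psi})$ is finite if $z\in\nabla\mathcal{P}(\mathbb{R}^q)$.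
   Context: Setting: $(E,d)$ is a compact metric space and $\rho$ is a Borel probability measure on $E$ with full support such that, for every sufficiently small $\varepsilon>0$, the map $x\mapsto\rho(B(x,\varepsilon))$ is continuous on $E$. $A:E\times E\to[0,1]$ satisfies: (i) $A$ is continuous with values in $\{0,1\}$; (ii) $A$ is Lipschitz continuous with respect to the second variable with Lipschitz constant $\mathrm{Lip}(A)$; (iii) there is $N\ge1$ such that for all $n\ge N$ and all $a,b\in E$ there exist $z_1,\dots,z_{n-1}\in E$ with $A(a,z_1)A(z_1,z_2)\cdots A(z_{n-1},b)=1$. Put $\Omega=\{x=x_0x_1x_2\ldots\in E^{\mathbb{N}}: A(x_i,x_{i+1})>0\ \forall i\in\mathbb{N}\}$, with metric $d_\Omega(x,y)=\sum_{n\ge0}d(x_n,y_n)/2^{n+1}$ and shift $\sigma(x_0x_1x_2\ldots)=x_1x_2\ldots$. $\mathcal{C}^0(\Omega)$ is the space of real continuous functions on $\Omega$ with the sup norm $\|\cdot\|_\infty$; $\mathcal{C}^{+1}(\Omega)$ is the space of real Lipschitz functions with norm $\|\phi\|_L=\|\phi\|_\infty+\mathrm{Lip}(\phi)$. $M_\sigma(\Omega)$ is the set of $\sigma$-invariant Borel probability measures on $\Omega$. For $\phi\in\mathcal{C}^{+1}(\Omega)$ the transfer operator is $\mathcal{L}_\phi(f)(\omega)=\int_E e^{\phi(t\omega)}A(t,\omega_0)f(t\omega)\,d\rho(t)$, where $t\omega=t\omega_0\omega_1\ldots$ and the integrand is $0$ when $A(t,\omega_0)=0$. It acts on $\mathcal{C}^0(\Omega)$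 and on $\mathcal{C}^{+1}(\Omega)$; $r_\phi$ denotes the spectral radius of $\mathcal{L}_\phi$ on $\mathcal{C}^0(\Omega)$. Spectra on real Banach spaces are understood via complexification. For $t\in\mathbb{R}^q$ and $\vec{\psi}=(\psi_1,\dots,\psi_q)$, $t\cdot\vec{\psi}=\sum_i t_i\psi_i$. For $z\in\mathbb{R}^q$, $\mathcal{H}(z,\vec{\psi})=\inf_{t\in\mathbb{R}^q}\{\log r_{t\cdot\vec{\psi}}-t\cdot z\}$, and $I(\vec{\psi})=\{\int\vec{\psi}\,d\mu:\ \mu\in M_\sigma(\Omega)\}\subset\mathbb{R}^q$. *)

theory Defs
  imports "HOL-Probability.Probability"
begin

section \<open>The shift space\<close>

definition Omega :: "('a \<Rightarrow> 'a \<Rightarrow> real) \<Rightarrow> (nat \<Rightarrow> 'a) set" where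
  "Omega A = {x. \<forall>i. A (x i) (x (Suc i)) > 0}"

text \<open>The library also makes the type \<^typ>\<open>nat \<Rightarrow> 'a\<close> a metric space, but with
  a different (truncated) metric, so \<open>dOmega\<close> has to be used wherever Lipschitz constants
  are involved. For compact \<open>'a\<close> both metrics induce the product topology (see the lemma
  \<open>openin_dOmega\<close> below), so that \<^const>\<open>continuous_on\<close> and \<^const>\<open>borel\<close>
  on \<^typ>\<open>nat \<Rightarrow> 'a\<close> have the intended meaning.\<close>

definition dOmega :: "(nat \<Rightarrow> 'a::metric_space) \<Rightarrow> (nat \<Rightarrow> 'a) \<Rightarrow> real" where
  "dOmega x y = (\<Sum>n. dist (x n) (y n) / 2 ^ (n + 1))"

definition shift :: "(nat \<Rightarrow> 'a) \<Rightarrow> nat \<Rightarrow> 'a" where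
  "shift x = (\<lambda>n. x (Suc n))"

context
  assumes comp: "compact (UNIV :: 'a::metric_space set)"
begin

lemma summable_dOmega: "summable (\<lambda>n. dist (x n) (y n :: 'a) / 2 ^ (n + 1))"
  and continuous_dOmega: "continuous_on UNIV (dOmega (x :: nat \<Rightarrow> 'a))"
proof -
  obtain D where D: "dist a b \<le> D" for a b :: 'a
    using compact_imp_bounded[OF comp] by (meson UNIV_I bounded_two_points)
  have D': "\<bar>dist a b\<bar> / 2 ^ (n + 1) \<le> D * (1/2) ^ (n + 1)" for a b :: 'a and n
    using D[of a b] by (simp add: power_divide divide_right_mono)
  have S: "summable (\<lambda>n. D * (1/2) ^ (n + 1))"
    by (intro summable_mult summable_ignore_initial_segment summable_geometric) simp
  show "summable (\<lambda>n. dist (x n) (y n :: 'a) / 2 ^ (n + 1))"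
    using D' by (intro summable_comparison_test'[OF S]) (simp add: abs_divide)
  have "uniform_limit UNIV (\<lambda>n y. \<Sum>i<n. dist (x i) (y i :: 'a) / 2 ^ (i + 1)) (dOmega x) sequentially"
    unfolding dOmega_def using D' by (intro Weierstrass_m_test[OF _ S]) (simp add: abs_divide)
  then show "continuous_on UNIV (dOmega x)"
    by (rule uniform_limit_theorem[rotated])
       (auto intro!: always_eventually continuous_intros)
qed

lemma openin_dOmega:
  fixes U S :: "(nat \<Rightarrow> 'a) set"
  shows "openin (top_of_set S) U \<longleftrightarrow>
         U \<subseteq> S \<and> (\<forall>x\<in>U. \<exists>r>0. \<forall>y\<in>S. dOmega x y < r \<longrightarrow> y \<in> U)"
proof safe
  assume U: "openin (top_of_set S) U"
  then show "x \<in> S" if "x \<in> U" for x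
    using that openin_imp_subset by blast
  fix x assume "x \<in> U"
  obtain T where T: "open T" "U = S \<inter> T"
    using U openin_open by blast
  with \<open>x \<in> U\<close> have "\<exists>X. x \<in> Pi\<^sub>E UNIV X \<and> (\<forall>i. openin euclidean (X i))
      \<and> finite {i. X i \<noteq> topspace euclidean} \<and> Pi\<^sub>E UNIV X \<subseteq> T"
    by (intro product_topology_open_contains_basis)
       (auto simp: open_fun_def)
  then obtain X where X: "x \<in> Pi\<^sub>E UNIV X" "\<And>i. open (X i)" "finite {i. X i \<noteq> UNIV}"
      "Pi\<^sub>E UNIV X \<subseteq> T"
    by auto
  have "\<exists>e>0. \<forall>b. dist (x i) b < e \<longrightarrow> b \<in> X i" for i
    using X(1,2) by (metis PiE_E UNIV_I open_dist dist_commute)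
  then obtain e where e: "\<And>i. e i > 0" "\<And>i b. dist (x i) b < e i \<Longrightarrow> b \<in> X i"
    by metis
  define r where "r = Min (insert 1 ((\<lambda>i. e i / 2 ^ (i + 1)) ` {i. X i \<noteq> UNIV}))"
  have "r > 0"
    unfolding r_def using X(3) e(1) by (subst Min_gr_iff) auto
  moreover have "y \<in> U" if y: "y \<in> S" "dOmega x y < r" for y
  proof -
    have "y i \<in> X i" for i
    proof (cases "X i = UNIV")
      case False
      have "dist (x i) (y i) / 2 ^ (i + 1) \<le> dOmega x y"
        unfolding dOmega_def
        using sum_le_suminf[OF summable_dOmega, of "{i}" x y] by simp
      also have "\<dots> < r" by (rule y)
      also have "r \<le> e i / 2 ^ (i + 1)"
        unfolding r_def using X(3) False by (intro Min_le) auto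
      finally have "dist (x i) (y i) < e i"
        by (simp add: divide_less_cancel)
      then show ?thesis by (rule e)
    qed simp
    then show ?thesis using X(4) T y by auto
  qed
  ultimately show "\<exists>r>0. \<forall>y\<in>S. dOmega x y < r \<longrightarrow> y \<in> U" by blast
next
  assume "U \<subseteq> S" and *: "\<forall>x\<in>U. \<exists>r>0. \<forall>y\<in>S. dOmega x y < r \<longrightarrow> y \<in> U"
  show "openin (top_of_set S) U"
  proof (subst openin_subopen, safe)
    fix x assume "x \<in> U"
    with * obtain r where r: "r > 0" "\<forall>y\<in>S. dOmega x y < r \<longrightarrow> y \<in> U" by blast
    have "open (dOmega x -` {..<r})"
      by (rule open_vimage[OF _ continuous_dOmega]) simp
    then have "openin (top_of_set S) (S \<inter> dOmega x -` {..<r})" by auto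
    moreover have "dOmega x x = 0" by (simp add: dOmega_def)
    ultimately show "\<exists>T. openin (top_of_set S) T \<and> x \<in> T \<and> T \<subseteq> U"
      using r \<open>x \<in> U\<close> \<open>U \<subseteq> S\<close> by (intro exI[of _ "S \<inter> dOmega x -` {..<r}"]) auto
  qed
qed

end

section \<open>Function spaces on the shift space\<close>

text \<open>A function on \<open>Omega A\<close> is represented by its extension by \<open>0\<close> to the whole
  type; with this convention the spaces below are real vector spaces under the pointwise
  operations, and two functions that agree on \<open>Omega A\<close> are equal.\<close>

definition C0 :: "('a::metric_space \<Rightarrow> 'a \<Rightarrow> real) \<Rightarrow> ((nat \<Rightarrow> 'a) \<Rightarrow> real) set" where
  "C0 A = {f. continuous_on (Omega A) f \<and> (\<forall>x. x \<notin> Omega A \<longrightarrow> f x = 0)}"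

definition sup_norm :: "('a \<Rightarrow> 'a \<Rightarrow> real) \<Rightarrow> ((nat \<Rightarrow> 'a) \<Rightarrow> real) \<Rightarrow> real" where
  "sup_norm A f = (SUP x\<in>Omega A. \<bar>f x\<bar>)"

definition lip_bounds :: "('a::metric_space \<Rightarrow> 'a \<Rightarrow> real) \<Rightarrow> ((nat \<Rightarrow> 'a) \<Rightarrow> real) \<Rightarrow> real set" where
  "lip_bounds A f = {L. 0 \<le> L \<and> (\<forall>x\<in>Omega A. \<forall>y\<in>Omega A. \<bar>f x - f y\<bar> \<le> L * dOmega x y)}"

definition Lip1 :: "('a::metric_space \<Rightarrow> 'a \<Rightarrow> real) \<Rightarrow> ((nat \<Rightarrow> 'a) \<Rightarrow> real) set" where
  "Lip1 A = {f. lip_bounds A f \<noteq> {} \<and> (\<forall>x. x \<notin> Omega A \<longrightarrow> f x = 0)}"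

definition lip_norm :: "('a::metric_space \<Rightarrow> 'a \<Rightarrow> real) \<Rightarrow> ((nat \<Rightarrow> 'a) \<Rightarrow> real) \<Rightarrow> real" where
  "lip_norm A f = sup_norm A f + Inf (lip_bounds A f)"

definition transfer_op :: "'a measure \<Rightarrow> ('a \<Rightarrow> 'a \<Rightarrow> real) \<Rightarrow> ((nat \<Rightarrow> 'a) \<Rightarrow> real) \<Rightarrow>
    ((nat \<Rightarrow> 'a) \<Rightarrow> real) \<Rightarrow> (nat \<Rightarrow> 'a) \<Rightarrow> real" where
  "transfer_op \<rho> A \<phi> f \<omega> =
     (if \<omega> \<in> Omega A
      then \<integral>t. exp (\<phi> (case_nat t \<omega>)) * A t (\<omega> 0) * f (case_nat t \<omega>) \<partial>\<rho> else 0)"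

section \<open>Complexification and spectrum\<close>

text \<open>A real normed space is given here by a linear space \<open>V\<close> of real-valued functions and a
  norm \<open>N\<close> on it. The element \<open>f + \<i>g\<close> of its complexification is the complex-valued
  function with real part \<open>f\<close> and imaginary part \<open>g\<close>, and an operator \<open>T\<close> on
  \<open>V\<close> acts by \<open>f + \<i>g \<mapsto> T f + \<i> T g\<close>. The norm is the Taylor norm, the supremum
  over \<open>\<theta>\<close> of the norms of \<open>cos \<theta> f - sin \<theta> g\<close>; the other complex norms on the
  complexification that induce the product topology give the same spectrum.\<close>

definition cplx_space :: "('x \<Rightarrow> real) set \<Rightarrow> ('x \<Rightarrow> complex) set" where
  "cplx_space V = {h. (\<lambda>x. Re (h x)) \<in> V \<and> (\<lambda>x. Im (h x)) \<in> V}"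

definition cplx_norm :: "(('x \<Rightarrow> real) \<Rightarrow> real) \<Rightarrow> ('x \<Rightarrow> complex) \<Rightarrow> real" where
  "cplx_norm N h = (SUP \<theta>::real. N (\<lambda>x. Re (cis \<theta> * h x)))"

definition cplx_op :: "(('x \<Rightarrow> real) \<Rightarrow> 'x \<Rightarrow> real) \<Rightarrow> ('x \<Rightarrow> complex) \<Rightarrow> 'x \<Rightarrow> complex" where
  "cplx_op T h = (\<lambda>x. Complex (T (\<lambda>y. Re (h y)) x) (T (\<lambda>y. Im (h y)) x))"

definition shifted_op :: "(('x \<Rightarrow> real) \<Rightarrow> 'x \<Rightarrow> real) \<Rightarrow> complex \<Rightarrow> ('x \<Rightarrow> complex) \<Rightarrow> 'x \<Rightarrow> complex" where
  "shifted_op T \<zeta> h = (\<lambda>x. \<zeta> * h x - cplx_op T h x)"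

definition resolvent_set ::
    "('x \<Rightarrow> real) set \<Rightarrow> (('x \<Rightarrow> real) \<Rightarrow> real) \<Rightarrow> (('x \<Rightarrow> real) \<Rightarrow> 'x \<Rightarrow> real) \<Rightarrow> complex set" where
  "resolvent_set V N T =
     {\<zeta>. bij_betw (shifted_op T \<zeta>) (cplx_space V) (cplx_space V) \<and>
         (\<exists>C. \<forall>h\<in>cplx_space V. cplx_norm N h \<le> C * cplx_norm N (shifted_op T \<zeta> h))}"

definition spectrum_on ::
    "('x \<Rightarrow> real) set \<Rightarrow> (('x \<Rightarrow> real) \<Rightarrow> real) \<Rightarrow> (('x \<Rightarrow> real) \<Rightarrow> 'x \<Rightarrow> real) \<Rightarrow> complex set" where
  "spectrum_on V N T = - resolvent_set V N T"

definition spectral_radius_on ::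
    "('x \<Rightarrow> real) set \<Rightarrow> (('x \<Rightarrow> real) \<Rightarrow> real) \<Rightarrow> (('x \<Rightarrow> real) \<Rightarrow> 'x \<Rightarrow> real) \<Rightarrow> real" where
  "spectral_radius_on V N T = Sup (cmod ` spectrum_on V N T)"

definition generalized_eigenspace ::
    "('x \<Rightarrow> real) set \<Rightarrow> (('x \<Rightarrow> real) \<Rightarrow> 'x \<Rightarrow> real) \<Rightarrow> complex \<Rightarrow> ('x \<Rightarrow> complex) set" where
  "generalized_eigenspace V T \<zeta> = {h \<in> cplx_space V. \<exists>n. (shifted_op T \<zeta> ^^ n) h = (\<lambda>_. 0)}"

text \<open>Simple means algebraic multiplicity one.\<close>

definition simple_eigenvalue ::
    "('x \<Rightarrow> real) set \<Rightarrow> (('x \<Rightarrow> real) \<Rightarrow> 'x \<Rightarrow> real) \<Rightarrow> complex \<Rightarrow> bool" where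
  "simple_eigenvalue V T \<zeta> \<longleftrightarrow>
     (\<exists>v\<in>cplx_space V. v \<noteq> (\<lambda>_. 0) \<and> cplx_op T v = (\<lambda>x. \<zeta> * v x) \<and>
        generalized_eigenspace V T \<zeta> = {\<lambda>x. c * v x |c. True})"

definition simple_dominating_eigenvalue ::
    "('x \<Rightarrow> real) set \<Rightarrow> (('x \<Rightarrow> real) \<Rightarrow> real) \<Rightarrow> (('x \<Rightarrow> real) \<Rightarrow> 'x \<Rightarrow> real) \<Rightarrow> real \<Rightarrow> bool" where
  "simple_dominating_eigenvalue V N T r \<longleftrightarrow>
     simple_eigenvalue V T (complex_of_real r) \<and>
     (\<exists>s. 0 \<le> s \<and> s < r \<and> spectrum_on V N T - {complex_of_real r} \<subseteq> cball 0 s)"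

section \<open>Pressure and invariant measures\<close>

definition r_transfer :: "'a::metric_space measure \<Rightarrow> ('a \<Rightarrow> 'a \<Rightarrow> real) \<Rightarrow> ((nat \<Rightarrow> 'a) \<Rightarrow> real) \<Rightarrow> real" where
  "r_transfer \<rho> A \<phi> = spectral_radius_on (C0 A) (sup_norm A) (transfer_op \<rho> A \<phi>)"

definition pressure :: "'a::metric_space measure \<Rightarrow> ('a \<Rightarrow> 'a \<Rightarrow> real) \<Rightarrow>
    ('q::finite \<Rightarrow> (nat \<Rightarrow> 'a) \<Rightarrow> real) \<Rightarrow> real ^ 'q \<Rightarrow> real" where
  "pressure \<rho> A \<psi> t = ln (r_transfer \<rho> A (\<lambda>\<omega>. \<Sum>i\<in>UNIV. t $ i * \<psi> i \<omega>))"

definition entropy_H :: "'a::metric_space measure \<Rightarrow> ('a \<Rightarrow> 'a \<Rightarrow> real) \<Rightarrow>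
    real ^ 'q \<Rightarrow> ('q::finite \<Rightarrow> (nat \<Rightarrow> 'a) \<Rightarrow> real) \<Rightarrow> ereal" where
  "entropy_H \<rho> A z \<psi> = (INF t. ereal (pressure \<rho> A \<psi> t - t \<bullet> z))"

definition invariant_measures :: "('a::metric_space \<Rightarrow> 'a \<Rightarrow> real) \<Rightarrow> (nat \<Rightarrow> 'a) measure set" where
  "invariant_measures A =
     {\<mu>. prob_space \<mu> \<and> sets \<mu> = sets (restrict_space borel (Omega A)) \<and> distr \<mu> \<mu> shift = \<mu>}"

definition rotation_set :: "('a::metric_space \<Rightarrow> 'a \<Rightarrow> real) \<Rightarrow>
    ('q::finite \<Rightarrow> (nat \<Rightarrow> 'a) \<Rightarrow> real) \<Rightarrow> (real ^ 'q) set" where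
  "rotation_set A \<psi> = {\<chi> i. \<integral>\<omega>. \<psi> i \<omega> \<partial>\<mu> |\<mu>. \<mu> \<in> invariant_measures A}"

section \<open>Smooth functions\<close>

fun times_differentiable :: "nat \<Rightarrow> ('v::real_normed_vector \<Rightarrow> 'w::real_normed_vector) \<Rightarrow> bool" where
  "times_differentiable 0 f \<longleftrightarrow> continuous_on UNIV f"
| "times_differentiable (Suc n) f \<longleftrightarrow>
     (\<forall>x. f differentiable at x) \<and>
     (\<forall>v. times_differentiable n (\<lambda>x. frechet_derivative f (at x) v))"

definition infinitely_differentiable :: "('v::real_normed_vector \<Rightarrow> 'w::real_normed_vector) \<Rightarrow> bool" where
  "infinitely_differentiable f \<longleftrightarrow> (\<forall>n. times_differentiable n f)"

end

theory Submission
  imports Defs "HOL-Library.Function_Algebras"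
begin

text \<open>Mixing makes an iterate of the transfer operator strictly positive, so it contracts, by a fixed
  factor, order intervals of the cone of positive functions with locally Lipschitz logarithm. This
  yields a positive eigenfunction and exponential convergence of the normalised iterates; removing the
  rank-one part leaves an operator whose resolvent is a Neumann series outside a smaller disk.

  The eigenvalue and the normalised eigenfunction solve a nonlinear system whose linearisation, a
  bordered operator, is bijective precisely because the eigenvalue is simple; differentiating the system
  again and again shows that both depend smoothly on the potential.

  The pressure is convex, so its graph lies above its tangents, which bounds the infimum at gradients
  from below. The pressure is also bounded by suprema of Birkhoff averages: if the infimum is not
  \<open>-\<infinity>\<close>, then by separation \<open>z\<close> lies in the convex hull of the vectors of Birkhoff averages of every
  length, and a weak limit of the corresponding measures is an invariant measure with integral \<open>z\<close>.\<close>

section \<open>Normed spaces of real functions\<close>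

text \<open>Two facts drive the estimates. Prepending a symbol halves \<open>dOmega\<close>, so a
  slope \<open>a\<close> in the cone becomes \<open>(a + lc) / 2\<close>; for
  \<open>a = lc + 2\<close> the image has slope \<open>lc + 1\<close>, and this gap of 1 puts images
  into the interior of the cone. And \<open>A\<close>, continuous with values 0 and 1 on a compact
  space, is locally constant: points whose zeroth coordinates are within \<open>\<delta>0\<close>
  have the same admissible preimages. Only such pairs can be compared under the transfer operator,
  hence the local form of the cone; all other pairs are at distance at least
  \<open>\<delta>0 / 2\<close>, where a Lipschitz bound costs only the sup norm.

  The cone constants depend on the potential only through the bounds \<open>lc\<close> and
  \<open>B\<close>, so the eigenfunctions of a bounded set of potentials are uniformly bounded.
  Together with the Lipschitz dependence of the pressure, which a comparison principle gives, this
  controls the nonlinear increments in advance and replaces an implicit function theorem; the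
  derivatives of every order then come from linear equations with the one bordered operator.\<close>

instantiation "fun" :: (type, real_vector) real_vector
begin

definition scaleR_fun_def: "r *\<^sub>R f = (\<lambda>x. r *\<^sub>R f x)"

instance
  by standard (auto simp: scaleR_fun_def fun_eq_iff algebra_simps)

end

lemma scaleR_fun_apply [simp]: "(r *\<^sub>R f) x = r *\<^sub>R f x"
  by (simp add: scaleR_fun_def)

lemma sum_fun_apply: "(\<Sum>i\<in>I. f i) x = (\<Sum>i\<in>I. f i x)"
  for f :: "'i \<Rightarrow> 'x \<Rightarrow> 'b::comm_monoid_add"
  by (induction I rule: infinite_finite_induct) auto

text \<open>Covers the sup norm and the Lipschitz norm at once, so that the Neumann series is done
  once. Completeness is stated for absolutely convergent series with pointwise sums, the form in
  which the resolvent uses it.\<close>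

locale fun_space =
  fixes V :: "('x \<Rightarrow> real) set" and N :: "('x \<Rightarrow> real) \<Rightarrow> real"
  assumes subspace: "subspace V"
    and N_triangle: "f \<in> V \<Longrightarrow> g \<in> V \<Longrightarrow> N (f + g) \<le> N f + N g"
    and N_scale: "f \<in> V \<Longrightarrow> N (c *\<^sub>R f) \<le> \<bar>c\<bar> * N f"
    and abs_le_N: "f \<in> V \<Longrightarrow> \<bar>f x\<bar> \<le> N f"
    and N_complete: "(\<And>k::nat. F k \<in> V) \<Longrightarrow> summable (\<lambda>k. N (F k)) \<Longrightarrow>
          (\<lambda>x. \<Sum>k. F k x) \<in> V \<and> N (\<lambda>x. \<Sum>k. F k x) \<le> (\<Sum>k. N (F k))"
begin

lemmas V_add = subspace_add[OF subspace]
  and V_diff = subspace_diff[OF subspace]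
  and V_scale = subspace_scale[OF subspace]
  and V_0 = subspace_0[OF subspace]
  and V_sum = subspace_sum[OF subspace]

lemma N_nonneg: "f \<in> V \<Longrightarrow> 0 \<le> N f"
  using abs_le_N[of f undefined] by linarith

lemma N_minus_le: "f \<in> V \<Longrightarrow> g \<in> V \<Longrightarrow> N (f - g) \<le> N f + N g"
  using N_triangle[of f "(-1) *\<^sub>R g"] N_scale[of g "-1"] V_scale[of g "-1"] by simp

lemma N_lincomb:
  assumes "f \<in> V" "g \<in> V"
  shows "N (c *\<^sub>R f + d *\<^sub>R g) \<le> \<bar>c\<bar> * N f + \<bar>d\<bar> * N g"
  using N_triangle[of "c *\<^sub>R f" "d *\<^sub>R g"] N_scale[of f c] N_scale[of g d] V_scale assms
  by fastforce

lemma summable_N: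
  assumes "\<And>k::nat. F k \<in> V" "summable s" "\<And>k. N (F k) \<le> s k"
  shows "summable (\<lambda>k. N (F k))" "summable (\<lambda>k. F k x)"
    "(\<lambda>x. \<Sum>k. F k x) \<in> V" "N (\<lambda>x. \<Sum>k. F k x) \<le> suminf s"
proof -
  show 1: "summable (\<lambda>k. N (F k))"
    by (rule summable_comparison_test'[OF assms(2)]) (use assms N_nonneg in auto)
  show "summable (\<lambda>k. F k x)"
    by (rule summable_comparison_test'[OF 1]) (use assms abs_le_N in auto)
  show "(\<lambda>x. \<Sum>k. F k x) \<in> V" "N (\<lambda>x. \<Sum>k. F k x) \<le> suminf s"
    using N_complete[OF assms(1) 1] suminf_le[OF assms(3) 1 assms(2)] by auto
qed

end

text \<open>The bound on all powers takes the place of the operator norm: \<open>\<tau>\<close> may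
  be far below the norm of \<open>T\<close>, at the price of the factor \<open>C\<close>.\<close>

locale fun_space_op = fun_space +
  fixes T :: "('x \<Rightarrow> real) \<Rightarrow> 'x \<Rightarrow> real" and C \<tau> :: real
  assumes T_in: "f \<in> V \<Longrightarrow> T f \<in> V"
    and T_add: "f \<in> V \<Longrightarrow> g \<in> V \<Longrightarrow> T (f + g) = T f + T g"
    and T_scale: "f \<in> V \<Longrightarrow> T (c *\<^sub>R f) = c *\<^sub>R T f"
    and \<tau>_nonneg: "0 \<le> \<tau>"
    and T_pow: "f \<in> V \<Longrightarrow> N ((T ^^ k) f) \<le> C * \<tau> ^ k * N f"
begin

lemma T_diff: "f \<in> V \<Longrightarrow> g \<in> V \<Longrightarrow> T (f - g) = T f - T g"
  using T_add[of f "(-1) *\<^sub>R g"] T_scale[of g "-1"] V_scale[of g "-1"] by simp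

lemma Tk_in: "f \<in> V \<Longrightarrow> (T ^^ k) f \<in> V"
  by (induction k) (auto intro: T_in)

lemma T_0: "T 0 = 0"
  using T_scale[OF V_0, of 0] by simp

lemma T_finite_sum: "(\<And>i. i \<in> I \<Longrightarrow> f i \<in> V) \<Longrightarrow> T (\<Sum>i\<in>I. f i) = (\<Sum>i\<in>I. T (f i))"
  by (induction I rule: infinite_finite_induct) (auto simp: T_0 T_add V_sum)

text \<open>Continuity of \<open>T\<close> seen through tails: the partial sums miss
  \<open>T\<close> of the sum by \<open>T\<close> of a tail, whose norm is at most the tail of the
  norms.\<close>

lemma T_suminf:
  assumes F: "\<And>k::nat. F k \<in> V" and s: "summable s" "\<And>k. N (F k) \<le> s k"
  shows "(\<lambda>k. T (F k) x) sums T (\<lambda>x. \<Sum>k. F k x) x"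
proof -
  let ?S = "\<lambda>x. \<Sum>k. F k x"
  have S: "?S \<in> V" and sm: "\<And>x. summable (\<lambda>k. F k x)" and sN: "summable (\<lambda>k. N (F k))"
    using summable_N[OF F s] by auto
  have tail: "\<bar>(\<Sum>k<n. T (F k) x) - T ?S x\<bar> \<le> C * \<tau> * (\<Sum>k. N (F (k + n)))" (is "?l \<le> ?r") for n
  proof -
    have C0: "0 \<le> C * \<tau> * N f" if "f \<in> V" for f
      using T_pow[OF that, of 1] N_nonneg[OF T_in[OF that]] by simp
    have DV: "?S - (\<Sum>k<n. F k) \<in> V" by (intro V_diff S V_sum F)
    have eq: "?S - (\<Sum>k<n. F k) = (\<lambda>x. \<Sum>k. F (k + n) x)"
      by (rule ext) (simp add: sum_fun_apply suminf_minus_initial_segment[OF sm])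
    have "T ?S - (\<Sum>k<n. T (F k)) = T (?S - (\<Sum>k<n. F k))"
      using S F by (simp add: T_diff V_sum T_finite_sum)
    from fun_cong[OF this, of x]
    have "(\<Sum>k<n. T (F k) x) - T ?S x = - T (?S - (\<Sum>k<n. F k)) x"
      by (simp only: minus_apply sum_fun_apply minus_diff_eq)
    also have "\<bar>\<dots>\<bar> \<le> N (T (?S - (\<Sum>k<n. F k)))"
      using abs_le_N[OF T_in[OF DV], of x] by simp
    also have "\<dots> \<le> C * \<tau> * N (?S - (\<Sum>k<n. F k))"
      using T_pow[OF DV, of 1] by simp
    also have "\<dots> \<le> ?r"
    proof (cases "C * \<tau> \<ge> 0")
      case True
      have "N (\<lambda>x. \<Sum>k. F (k + n) x) \<le> (\<Sum>k. N (F (k + n)))"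
        by (rule N_complete[THEN conjunct2]) (use F sN in \<open>auto intro: summable_ignore_initial_segment\<close>)
      then show ?thesis unfolding eq by (rule mult_left_mono[OF _ True])
    next
      case False
      \<comment> \<open>A negative \<open>C * \<tau>\<close> is compatible only with
        \<open>N\<close> vanishing on \<open>V\<close>, where the claim is trivial.\<close>
      then have z: "N f = 0" if "f \<in> V" for f
        using C0[OF that] N_nonneg[OF that] False mult_neg_pos[of "C * \<tau>" "N f"] by linarith
      show ?thesis using z[OF DV] z F by simp
    qed
    finally show ?thesis .
  qed
  have "(\<lambda>n. C * \<tau> * (\<Sum>k. N (F (k + n)))) \<longlonglongrightarrow> 0"
    by (rule tendsto_mult_right_zero[OF suminf_exist_split2[OF sN]])
  moreover have "\<forall>\<^sub>F n in sequentially. norm ((\<Sum>k<n. T (F k) x) - T ?S x) \<le> C * \<tau> * (\<Sum>k. N (F (k + n)))"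
    unfolding real_norm_def by (intro always_eventually allI tail)
  ultimately have "(\<lambda>n. (\<Sum>k<n. T (F k) x) - T ?S x) \<longlonglongrightarrow> 0"
    by (rule Lim_null_comparison[rotated])
  then show ?thesis
    unfolding sums_def by (simp add: LIM_zero_iff)
qed

lemma cplx_iter:
  assumes "h \<in> cplx_space V"
  shows "(\<lambda>x. Re ((cplx_op T ^^ k) h x)) = (T ^^ k) (\<lambda>x. Re (h x))"
    and "(\<lambda>x. Im ((cplx_op T ^^ k) h x)) = (T ^^ k) (\<lambda>x. Im (h x))"
  by (induction k) (auto simp: cplx_op_def)

lemma cplx_norm_bounds:
  assumes "h \<in> cplx_space V"
  shows "N (\<lambda>x. Re (h x)) \<le> cplx_norm N h" "N (\<lambda>x. Im (h x)) \<le> cplx_norm N h"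
    "cplx_norm N h \<le> N (\<lambda>x. Re (h x)) + N (\<lambda>x. Im (h x))"
proof -
  let ?a = "\<lambda>x. Re (h x)" and ?b = "\<lambda>x. Im (h x)"
  have V: "?a \<in> V" "?b \<in> V" using assms by (auto simp: cplx_space_def)
  have eq: "(\<lambda>x. Re (cis t * h x)) = cos t *\<^sub>R ?a + (- sin t) *\<^sub>R ?b" for t
    by (rule ext) simp
  have le: "N (\<lambda>x. Re (cis t * h x)) \<le> N ?a + N ?b" for t
  proof -
    have "N (\<lambda>x. Re (cis t * h x)) \<le> \<bar>cos t\<bar> * N ?a + \<bar>- sin t\<bar> * N ?b"
      unfolding eq by (rule N_lincomb) (use V in auto)
    also have "\<dots> \<le> 1 * N ?a + 1 * N ?b"
      by (intro add_mono mult_right_mono) (auto simp: N_nonneg V)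
    finally show ?thesis by simp
  qed
  have bdd: "bdd_above (range (\<lambda>t. N (\<lambda>x. Re (cis t * h x))))"
    using le by (intro bdd_aboveI[of _ "N ?a + N ?b"]) auto
  show "cplx_norm N h \<le> N ?a + N ?b"
    unfolding cplx_norm_def by (rule cSUP_least) (use le in auto)
  show "N ?a \<le> cplx_norm N h"
    unfolding cplx_norm_def using cSUP_upper[OF UNIV_I bdd, of 0] by simp
  \<comment> \<open>Multiplication by \<open>cis (- pi / 2)\<close>, that is by
    \<open>- \<i>\<close>, moves the imaginary part into the real part.\<close>
  show "N ?b \<le> cplx_norm N h"
    unfolding cplx_norm_def using cSUP_upper[OF UNIV_I bdd, of "- pi / 2"] by simp
qed

text \<open>Neumann series: the preimage of \<open>h\<close> is the sum of
  \<open>(T ^^ k) h / \<zeta> ^ (k + 1)\<close>, split into real and imaginary parts because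
  \<open>T\<close> acts on real functions only. It yields surjectivity with the norm bound;
  injectivity comes from iterating the eigenvalue equation.\<close>

lemma in_resolvent_set:
  assumes z: "cmod \<zeta> > \<tau>"
  shows "\<zeta> \<in> resolvent_set V N T"
proof -
  let ?W = "cplx_space V"
  have z0: "\<zeta> \<noteq> 0" "cmod \<zeta> > 0" using z \<tau>_nonneg by auto
  define q where "q = \<tau> / cmod \<zeta>"
  have q: "0 \<le> q" "q < 1" using z z0 \<tau>_nonneg by (auto simp: q_def)
  define S where "S = (\<Sum>k. \<bar>C\<bar> / cmod \<zeta> * q ^ k)"
  have S_sm: "summable (\<lambda>k. \<bar>C\<bar> / cmod \<zeta> * q ^ k)"
    using q by (intro summable_mult summable_geometric) auto
  have S0: "0 \<le> S" unfolding S_def using q by (intro suminf_nonneg S_sm) auto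
  have W_in: "shifted_op T \<zeta> h \<in> ?W" if "h \<in> ?W" for h
  proof -
    let ?a = "\<lambda>x. Re (h x)" and ?b = "\<lambda>x. Im (h x)"
    have V: "?a \<in> V" "?b \<in> V" using that by (auto simp: cplx_space_def)
    have "(\<lambda>x. Re (shifted_op T \<zeta> h x)) = Re \<zeta> *\<^sub>R ?a - Im \<zeta> *\<^sub>R ?b - T ?a"
      "(\<lambda>x. Im (shifted_op T \<zeta> h x)) = Re \<zeta> *\<^sub>R ?b + Im \<zeta> *\<^sub>R ?a - T ?b"
      by (auto simp: shifted_op_def cplx_op_def fun_eq_iff)
    then show ?thesis using V by (auto simp: cplx_space_def intro!: V_add V_diff V_scale T_in)
  qed
  have ex: "\<exists>G\<in>?W. shifted_op T \<zeta> G = h \<and> cplx_norm N G \<le> 4 * S * cplx_norm N h"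
    if h: "h \<in> ?W" for h
  proof -
    define c where "c k = inverse \<zeta> ^ Suc k" for k
    define u where "u k = (T ^^ k) (\<lambda>x. Re (h x))" for k
    define w where "w k = (T ^^ k) (\<lambda>x. Im (h x))" for k
    let ?n = "cplx_norm N h"
    have V: "(\<lambda>x. Re (h x)) \<in> V" "(\<lambda>x. Im (h x)) \<in> V" using h by (auto simp: cplx_space_def)
    have uV: "u k \<in> V" and wV: "w k \<in> V" for k using V by (auto simp: u_def w_def Tk_in)
    have n: "N (\<lambda>x. Re (h x)) \<le> ?n" "N (\<lambda>x. Im (h x)) \<le> ?n" "0 \<le> ?n"
      using cplx_norm_bounds[OF h] N_nonneg V by (auto intro: order_trans)
    have pw: "N ((T ^^ k) f) \<le> \<bar>C\<bar> * \<tau> ^ k * ?n" if "f \<in> V" "N f \<le> ?n" for f k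
    proof -
      have "N ((T ^^ k) f) \<le> C * \<tau> ^ k * N f" by (rule T_pow[OF that(1)])
      also have "\<dots> \<le> \<bar>C\<bar> * \<tau> ^ k * ?n"
        using that \<tau>_nonneg N_nonneg n by (intro mult_mono) auto
      finally show ?thesis .
    qed
    have cm: "cmod (c k) * (\<bar>C\<bar> * \<tau> ^ k) = \<bar>C\<bar> / cmod \<zeta> * q ^ k" for k
    proof -
      have "cmod (c k) = inverse (cmod \<zeta>) * inverse (cmod \<zeta>) ^ k"
        by (simp add: c_def norm_mult norm_power norm_inverse)
      then show ?thesis using z0 by (simp add: q_def power_divide field_simps)
    qed
    have cu: "N (r *\<^sub>R u k + r' *\<^sub>R w k) \<le> 2 * ?n * (\<bar>C\<bar> / cmod \<zeta> * q ^ k)"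
      if "\<bar>r\<bar> \<le> cmod (c k)" "\<bar>r'\<bar> \<le> cmod (c k)" for r r' k
    proof -
      have "N (r *\<^sub>R u k + r' *\<^sub>R w k) \<le> \<bar>r\<bar> * N (u k) + \<bar>r'\<bar> * N (w k)"
        by (rule N_lincomb[OF uV wV])
      also have "\<dots> \<le> cmod (c k) * (\<bar>C\<bar> * \<tau> ^ k * ?n) + cmod (c k) * (\<bar>C\<bar> * \<tau> ^ k * ?n)"
        using that pw V n by (intro add_mono mult_mono) (auto simp: u_def w_def N_nonneg Tk_in)
      also have "\<dots> = 2 * ?n * (cmod (c k) * (\<bar>C\<bar> * \<tau> ^ k))" by simp
      finally show ?thesis unfolding cm .
    qed
    define F1 where "F1 k = Re (c k) *\<^sub>R u k + (- Im (c k)) *\<^sub>R w k" for k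
    define F2 where "F2 k = Im (c k) *\<^sub>R u k + Re (c k) *\<^sub>R w k" for k
    define s where "s k = 2 * ?n * (\<bar>C\<bar> / cmod \<zeta> * q ^ k)" for k
    have s: "summable s" "suminf s = 2 * ?n * S"
      unfolding s_def S_def by (intro summable_mult S_sm, rule suminf_mult[OF S_sm])
    have F: "F1 k \<in> V" "F2 k \<in> V" for k
      by (auto simp: F1_def F2_def intro!: V_add V_scale V_diff uV wV)
    have Fs: "N (F1 k) \<le> s k" "N (F2 k) \<le> s k" for k
      unfolding F1_def F2_def s_def by (intro cu; simp add: abs_Re_le_cmod abs_Im_le_cmod)+
    note sm1 = summable_N[OF F(1) s(1) Fs(1)] and sm2 = summable_N[OF F(2) s(1) Fs(2)]
    define U where "U k x = Complex (u k x) (w k x)" for k x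
    define G where "G x = Complex (\<Sum>k. F1 k x) (\<Sum>k. F2 k x)" for x
    have GW: "G \<in> ?W" using sm1(3) sm2(3) by (simp add: cplx_space_def G_def)
    have cU: "c k * U k x = Complex (F1 k x) (F2 k x)" for k x
      by (simp add: U_def F1_def F2_def complex_eq_iff)
    have "G x = (\<Sum>k. c k * U k x)" "summable (\<lambda>k. c k * U k x)" for x
    proof -
      have "(\<lambda>k. c k * U k x) sums G x"
        unfolding cU G_def sums_complex_iff using sm1(2) sm2(2) by (simp add: summable_sums)
      then show "G x = (\<Sum>k. c k * U k x)" "summable (\<lambda>k. c k * U k x)"
        by (auto simp: sums_iff)
    qed note G_sum = this
    have "shifted_op T \<zeta> G x = h x" for x
    proof -
      have TF: "T (F1 k) = Re (c k) *\<^sub>R u (Suc k) + (- Im (c k)) *\<^sub>R w (Suc k)"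
        "T (F2 k) = Im (c k) *\<^sub>R u (Suc k) + Re (c k) *\<^sub>R w (Suc k)" for k
        unfolding F1_def F2_def using uV wV
        by (simp_all only: T_add T_scale V_scale u_def w_def funpow.simps o_apply)
      have 1: "(\<lambda>k. c k * U (Suc k) x) sums cplx_op T G x"
        unfolding sums_complex_iff cplx_op_def G_def complex.sel
        using T_suminf[OF F(1) s(1) Fs(1)] T_suminf[OF F(2) s(1) Fs(2)]
        by (simp add: TF U_def add.commute)
      \<comment> \<open>Multiplying by \<open>\<zeta>\<close> shifts the series by one index and
        leaves the term \<open>U 0\<close>, which is \<open>h\<close>, over.\<close>
      have c': "\<zeta> * c 0 = 1" "\<zeta> * c (Suc k) = c k" for k
        using z0 by (simp_all add: c_def)
      have "(\<lambda>k. \<zeta> * (c k * U k x)) sums (\<zeta> * G x)"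
        using G_sum[of x] by (intro sums_mult) (simp add: summable_sums)
      then have "(\<lambda>k. \<zeta> * (c (Suc k) * U (Suc k) x)) sums (\<zeta> * G x - \<zeta> * (c 0 * U 0 x))"
        by (subst sums_Suc_iff) simp
      then have "(\<lambda>k. c k * U (Suc k) x) sums (\<zeta> * G x - U 0 x)"
        using c' by (simp add: mult.assoc[symmetric])
      with 1 have "cplx_op T G x = \<zeta> * G x - U 0 x" by (rule sums_unique2)
      then show ?thesis by (simp add: shifted_op_def U_def u_def w_def)
    qed
    moreover have "cplx_norm N G \<le> 4 * S * ?n"
      using cplx_norm_bounds(3)[OF GW] sm1(4) sm2(4) s(2) by (simp add: G_def algebra_simps)
    ultimately show ?thesis using GW by blast
  qed
  have inj: "h = (\<lambda>_. 0)" if h: "h \<in> ?W" and 0: "shifted_op T \<zeta> h = (\<lambda>_. 0)" for h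
  proof
    fix x
    have V: "(\<lambda>x. Re (h x)) \<in> V" "(\<lambda>x. Im (h x)) \<in> V" using h by (auto simp: cplx_space_def)
    have e: "cplx_op T h = (\<lambda>x. \<zeta> * h x)"
      using 0 by (auto simp: shifted_op_def fun_eq_iff)
    have hom: "cplx_op T (\<lambda>x. z * h x) = (\<lambda>x. z * cplx_op T h x)" for z
    proof -
      have "(\<lambda>x. Re (z * h x)) = Re z *\<^sub>R (\<lambda>x. Re (h x)) + (- Im z) *\<^sub>R (\<lambda>x. Im (h x))"
        "(\<lambda>x. Im (z * h x)) = Im z *\<^sub>R (\<lambda>x. Re (h x)) + Re z *\<^sub>R (\<lambda>x. Im (h x))"
        by (auto simp: fun_eq_iff)
      then have "T (\<lambda>x. Re (z * h x)) = Re z *\<^sub>R T (\<lambda>x. Re (h x)) + (- Im z) *\<^sub>R T (\<lambda>x. Im (h x))"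
        "T (\<lambda>x. Im (z * h x)) = Im z *\<^sub>R T (\<lambda>x. Re (h x)) + Re z *\<^sub>R T (\<lambda>x. Im (h x))"
        using V by (simp_all only: T_add T_scale V_scale)
      then show ?thesis unfolding cplx_op_def by (auto simp: fun_eq_iff complex_eq_iff)
    qed
    have it: "(cplx_op T ^^ k) h = (\<lambda>x. \<zeta> ^ k * h x)" for k
      by (induction k) (simp_all add: hom e mult.assoc mult.left_commute)
    \<comment> \<open>On an eigenvector, the power \<open>k\<close> of the operator is
      multiplication by \<open>\<zeta> ^ k\<close>, which outgrows
      \<open>\<tau> ^ k\<close>.\<close>
    have b: "cmod (h x) \<le> (\<bar>C\<bar> * (N (\<lambda>x. Re (h x)) + N (\<lambda>x. Im (h x)))) * q ^ k" for k
    proof -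
      have "cmod \<zeta> ^ k * cmod (h x) = cmod ((cplx_op T ^^ k) h x)"
        by (simp add: it norm_mult norm_power)
      also have "\<dots> \<le> \<bar>Re ((cplx_op T ^^ k) h x)\<bar> + \<bar>Im ((cplx_op T ^^ k) h x)\<bar>"
        by (rule cmod_le)
      also have "\<dots> = \<bar>(T ^^ k) (\<lambda>x. Re (h x)) x\<bar> + \<bar>(T ^^ k) (\<lambda>x. Im (h x)) x\<bar>"
        using cplx_iter[OF h, of k, THEN fun_cong, of x] by simp
      also have "\<dots> \<le> C * \<tau> ^ k * N (\<lambda>x. Re (h x)) + C * \<tau> ^ k * N (\<lambda>x. Im (h x))"
        using V by (intro add_mono order_trans[OF abs_le_N T_pow] Tk_in)
      also have "\<dots> = C * (\<tau> ^ k * (N (\<lambda>x. Re (h x)) + N (\<lambda>x. Im (h x))))" by (simp add: algebra_simps)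
      also have "\<dots> \<le> \<bar>C\<bar> * (\<tau> ^ k * (N (\<lambda>x. Re (h x)) + N (\<lambda>x. Im (h x))))"
        using \<tau>_nonneg V by (intro mult_right_mono) (auto simp: N_nonneg)
      finally show ?thesis using z0 unfolding q_def by (simp add: power_divide field_simps)
    qed
    have "(\<lambda>k. (\<bar>C\<bar> * (N (\<lambda>x. Re (h x)) + N (\<lambda>x. Im (h x)))) * q ^ k) \<longlonglongrightarrow> 0"
      using q by (intro tendsto_mult_right_zero LIMSEQ_realpow_zero) auto
    then have "cmod (h x) \<le> 0" using b by (intro LIMSEQ_le_const) auto
    then show "h x = 0" by simp
  qed
  have diff: "shifted_op T \<zeta> (\<lambda>x. h x - g x) = (\<lambda>x. shifted_op T \<zeta> h x - shifted_op T \<zeta> g x)"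
    and dW: "(\<lambda>x. h x - g x) \<in> ?W"
    if "h \<in> ?W" "g \<in> ?W" for h g
  proof -
    have V: "(\<lambda>x. Re (h x)) \<in> V" "(\<lambda>x. Im (h x)) \<in> V" "(\<lambda>x. Re (g x)) \<in> V" "(\<lambda>x. Im (g x)) \<in> V"
      using that by (auto simp: cplx_space_def)
    show "shifted_op T \<zeta> (\<lambda>x. h x - g x) = (\<lambda>x. shifted_op T \<zeta> h x - shifted_op T \<zeta> g x)"
      "(\<lambda>x. h x - g x) \<in> ?W"
      using T_diff[OF V(1,3)] T_diff[OF V(2,4)] V_diff[OF V(1,3)] V_diff[OF V(2,4)]
      by (auto simp: shifted_op_def cplx_op_def cplx_space_def fun_eq_iff complex_eq_iff algebra_simps fun_diff_def)
  qed
  have inj2: "h = g" if "h \<in> ?W" "g \<in> ?W" "shifted_op T \<zeta> h = shifted_op T \<zeta> g" for h g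
    using inj[OF dW[OF that(1,2)]] diff[OF that(1,2)] that(3) by (auto simp: fun_eq_iff)
  have bij: "bij_betw (shifted_op T \<zeta>) ?W ?W"
    unfolding bij_betw_def
  proof (intro conjI inj_onI)
    show "shifted_op T \<zeta> ` ?W = ?W"
    proof
      show "?W \<subseteq> shifted_op T \<zeta> ` ?W" using ex by blast
    qed (use W_in in blast)
  qed (use inj2 in blast)
  have "cplx_norm N h \<le> (4 * S) * cplx_norm N (shifted_op T \<zeta> h)" if h: "h \<in> ?W" for h
  proof -
    obtain G where G: "G \<in> ?W" "shifted_op T \<zeta> G = shifted_op T \<zeta> h"
      "cplx_norm N G \<le> 4 * S * cplx_norm N (shifted_op T \<zeta> h)"
      using ex[OF W_in[OF h]] by blast
    with inj2[OF G(1) h G(2)] show ?thesis by simp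
  qed
  with bij show ?thesis
    unfolding resolvent_set_def by (intro CollectI conjI exI[of _ "4 * S"] ballI)
qed

end

section \<open>A Perron--Frobenius theorem for cones of functions\<close>

text \<open>Think of \<open>f \<le> g\<close> as \<open>g - f \<in> K\<close>. By
  \<open>distortion\<close>, \<open>L ^^ n0\<close> squeezes every cone element between multiples of
  \<open>e\<close> whose ratio is fixed, i.e. its image has finite projective diameter. What follows
  is Birkhoff's contraction, done with order intervals instead of Hilbert's metric; evaluation at
  \<open>x0\<close> serves as normalisation.\<close>

locale cone_operator =
  fixes V K :: "('x \<Rightarrow> real) set" and e :: "'x \<Rightarrow> real" and x0 :: 'x
    and L :: "('x \<Rightarrow> real) \<Rightarrow> 'x \<Rightarrow> real" and n0 :: nat and \<kappa> :: real
  assumes sub: "subspace V"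
    and K_V: "f \<in> K \<Longrightarrow> f \<in> V"
    and K_add: "f \<in> K \<Longrightarrow> g \<in> K \<Longrightarrow> f + g \<in> K"
    and K_scale: "f \<in> K \<Longrightarrow> 0 \<le> c \<Longrightarrow> c *\<^sub>R f \<in> K"
    and K_nonneg: "f \<in> K \<Longrightarrow> 0 \<le> f x"
    and K_closed: "(\<And>n::nat. F n \<in> K) \<Longrightarrow> (\<And>x. (\<lambda>n. F n x) \<longlonglongrightarrow> g x) \<Longrightarrow> g \<in> K"
    and e_K: "e \<in> K" and e_x0: "e x0 = 1" and e_le: "e x \<le> 1"
    and order_unit: "f \<in> V \<Longrightarrow> \<exists>s\<ge>0. s *\<^sub>R e - f \<in> K \<and> s *\<^sub>R e + f \<in> K"
    and L_V: "f \<in> V \<Longrightarrow> L f \<in> V"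
    and L_add: "f \<in> V \<Longrightarrow> g \<in> V \<Longrightarrow> L (f + g) = L f + L g"
    and L_scale: "f \<in> V \<Longrightarrow> L (c *\<^sub>R f) = c *\<^sub>R L f"
    and L_K: "f \<in> K \<Longrightarrow> L f \<in> K"
    and n0: "0 < n0" and \<kappa>: "0 < \<kappa>" "\<kappa> \<le> 1"
    and distortion: "f \<in> K \<Longrightarrow> (L ^^ n0) f - (\<kappa> * (L ^^ n0) f x0) *\<^sub>R e \<in> K"
       "f \<in> K \<Longrightarrow> ((L ^^ n0) f x0) *\<^sub>R e - \<kappa> *\<^sub>R (L ^^ n0) f \<in> K"
    and T_pos: "0 < (L ^^ n0) e x0"
begin

lemmas V_add = subspace_add[OF sub]
  and V_diff = subspace_diff[OF sub]
  and V_scale = subspace_scale[OF sub]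

definition T :: "('x \<Rightarrow> real) \<Rightarrow> 'x \<Rightarrow> real" where "T = L ^^ n0"
definition S :: "('x \<Rightarrow> real) \<Rightarrow> real" where "S f = T f x0"
text \<open>Each of the two uses of \<open>distortion\<close> in a contraction step costs a factor
  \<open>\<kappa>\<close>, and the choice of the larger half a factor 1/2; so the fraction
  \<open>\<kappa>\<^sup>2 / 2\<close> of an interval is cut off.\<close>

definition \<theta> :: real where "\<theta> = 1 - \<kappa>\<^sup>2 / 2"

lemma \<theta>: "0 < \<theta>" "\<theta> < 1"
  using \<kappa> power_mono[of \<kappa> 1 2] by (auto simp: \<theta>_def)

lemma Lk_V: "f \<in> V \<Longrightarrow> (L ^^ k) f \<in> V"
  by (induction k) (auto intro: L_V)

lemma Lk_K: "f \<in> K \<Longrightarrow> (L ^^ k) f \<in> K"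
  by (induction k) (auto intro: L_K)

lemma Lk_add: "f \<in> V \<Longrightarrow> g \<in> V \<Longrightarrow> (L ^^ k) (f + g) = (L ^^ k) f + (L ^^ k) g"
  by (induction k) (auto simp: L_add Lk_V)

lemma Lk_scale: "f \<in> V \<Longrightarrow> (L ^^ k) (c *\<^sub>R f) = c *\<^sub>R (L ^^ k) f"
  by (induction k) (auto simp: L_scale Lk_V)

lemma Lk_diff: "f \<in> V \<Longrightarrow> g \<in> V \<Longrightarrow> (L ^^ k) (f - g) = (L ^^ k) f - (L ^^ k) g"
  using Lk_add[of f "(-1) *\<^sub>R g" k] Lk_scale[of g k "-1"] V_scale[of g "-1"] by simp

lemma Tk_eq: "(T ^^ k) = L ^^ (n0 * k)"
  by (simp add: T_def funpow_mult)

lemma T_simps: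
  "f \<in> V \<Longrightarrow> T f \<in> V" "f \<in> K \<Longrightarrow> T f \<in> K"
  "f \<in> V \<Longrightarrow> g \<in> V \<Longrightarrow> T (f + g) = T f + T g"
  "f \<in> V \<Longrightarrow> g \<in> V \<Longrightarrow> T (f - g) = T f - T g"
  "f \<in> V \<Longrightarrow> T (c *\<^sub>R f) = c *\<^sub>R T f"
  unfolding T_def by (simp_all add: Lk_V Lk_K Lk_add Lk_diff Lk_scale)

lemma Tk_simps:
  "f \<in> V \<Longrightarrow> (T ^^ k) f \<in> V" "f \<in> K \<Longrightarrow> (T ^^ k) f \<in> K"
  "f \<in> V \<Longrightarrow> g \<in> V \<Longrightarrow> (T ^^ k) (f + g) = (T ^^ k) f + (T ^^ k) g"
  "f \<in> V \<Longrightarrow> g \<in> V \<Longrightarrow> (T ^^ k) (f - g) = (T ^^ k) f - (T ^^ k) g"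
  "f \<in> V \<Longrightarrow> (T ^^ k) (c *\<^sub>R f) = c *\<^sub>R (T ^^ k) f"
  unfolding Tk_eq by (simp_all add: Lk_V Lk_K Lk_add Lk_diff Lk_scale)

lemma T_dist: "f \<in> K \<Longrightarrow> T f - (\<kappa> * S f) *\<^sub>R e \<in> K" "f \<in> K \<Longrightarrow> S f *\<^sub>R e - \<kappa> *\<^sub>R T f \<in> K"
  using distortion unfolding T_def S_def by auto

text \<open>Either half of the interval \<open>[\<alpha>, \<beta>]\<close> in which \<open>f\<close> is trapped relative to \<open>g\<close> can be cut,
  according to which of \<open>f - \<alpha> g\<close> and \<open>\<beta> g - f\<close> is the larger one.\<close>

lemma contraction:
  assumes f: "f \<in> V" and g: "g \<in> K" and "f - \<alpha> *\<^sub>R g \<in> K" "\<beta> *\<^sub>R g - f \<in> K" "\<alpha> \<le> \<beta>"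
  shows "\<exists>\<alpha>' \<beta>'. \<alpha> \<le> \<alpha>' \<and> \<alpha>' \<le> \<beta>' \<and> \<beta>' \<le> \<beta> \<and> \<beta>' - \<alpha>' \<le> \<theta> * (\<beta> - \<alpha>) \<and>
           T f - \<alpha>' *\<^sub>R T g \<in> K \<and> \<beta>' *\<^sub>R T g - T f \<in> K"
proof -
  define u where "u = f - \<alpha> *\<^sub>R g"
  define w where "w = \<beta> *\<^sub>R g - f"
  define \<delta> where "\<delta> = \<kappa>\<^sup>2 / 2 * (\<beta> - \<alpha>)"
  have gV: "g \<in> V" using g by (rule K_V)
  have uK: "u \<in> K" and wK: "w \<in> K" using assms by (auto simp: u_def w_def)
  have Tu: "T u = T f - \<alpha> *\<^sub>R T g" and Tw: "T w = \<beta> *\<^sub>R T g - T f"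
    unfolding u_def w_def using f gV by (simp_all add: T_simps V_scale)
  have sum: "S u + S w = (\<beta> - \<alpha>) * S g"
    unfolding S_def Tu Tw by (simp add: algebra_simps)
  have \<delta>: "0 \<le> \<delta>" "\<delta> \<le> \<beta> - \<alpha>" "\<beta> - \<alpha> - \<delta> = \<theta> * (\<beta> - \<alpha>)"
  proof -
    have "\<kappa>\<^sup>2 / 2 \<le> 1" using power_mono[of \<kappa> 1 2] \<kappa> by simp
    then show "\<delta> \<le> \<beta> - \<alpha>" unfolding \<delta>_def using mult_right_mono[of "\<kappa>\<^sup>2 / 2" 1 "\<beta> - \<alpha>"] assms(5) by simp
      show "0 \<le> \<delta>" unfolding \<delta>_def using assms(5) by (intro mult_nonneg_nonneg) auto
    show "\<beta> - \<alpha> - \<delta> = \<theta> * (\<beta> - \<alpha>)" by (simp add: \<delta>_def \<theta>_def algebra_simps)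
  qed
  \<comment> \<open>In the order of the cone: \<open>T v\<close> is above
    \<open>\<kappa> * S v\<close> times \<open>e\<close>, this is above
    \<open>\<kappa> * (\<beta> - \<alpha>) / 2 * S g\<close> times \<open>e\<close>, and this is
    above \<open>\<delta>\<close> times \<open>T g\<close>.\<close>
  have key: "T v - \<delta> *\<^sub>R T g \<in> K" if v: "v \<in> K" "(\<beta> - \<alpha>) * S g / 2 \<le> S v" for v
  proof -
    have "(T v - (\<kappa> * S v) *\<^sub>R e) + ((\<kappa> * (S v - (\<beta> - \<alpha>) * S g / 2)) *\<^sub>R e
        + (\<kappa> * (\<beta> - \<alpha>) / 2) *\<^sub>R (S g *\<^sub>R e - \<kappa> *\<^sub>R T g)) \<in> K"
      using v g \<kappa> assms(5) by (intro K_add K_scale e_K T_dist) auto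
    also have "(T v - (\<kappa> * S v) *\<^sub>R e) + ((\<kappa> * (S v - (\<beta> - \<alpha>) * S g / 2)) *\<^sub>R e
        + (\<kappa> * (\<beta> - \<alpha>) / 2) *\<^sub>R (S g *\<^sub>R e - \<kappa> *\<^sub>R T g)) = T v - \<delta> *\<^sub>R T g"
      by (auto simp: fun_eq_iff \<delta>_def field_simps power2_eq_square)
    finally show ?thesis .
  qed
  show ?thesis
  proof (cases "(\<beta> - \<alpha>) * S g / 2 \<le> S u")
    case True
    have "T f - (\<alpha> + \<delta>) *\<^sub>R T g \<in> K"
      using key[OF uK True] by (simp add: Tu algebra_simps)
    moreover have "\<beta> *\<^sub>R T g - T f \<in> K" using T_simps(2)[OF wK] by (simp add: Tw)
    ultimately show ?thesis
      using \<delta> by (intro exI[of _ "\<alpha> + \<delta>"] exI[of _ \<beta>]) auto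
  next
    case False
    then have "(\<beta> - \<alpha>) * S g / 2 \<le> S w" using sum by argo
    from key[OF wK this] have "(\<beta> - \<delta>) *\<^sub>R T g - T f \<in> K"
      by (simp add: Tw algebra_simps)
    moreover have "T f - \<alpha> *\<^sub>R T g \<in> K" using T_simps(2)[OF uK] by (simp add: Tu)
    ultimately show ?thesis
      using \<delta> by (intro exI[of _ \<alpha>] exI[of _ "\<beta> - \<delta>"]) auto
  qed
qed

lemma iterated_contraction:
  assumes f: "f \<in> V" and g: "g \<in> K" and "f - \<alpha> *\<^sub>R g \<in> K" "\<beta> *\<^sub>R g - f \<in> K" "\<alpha> \<le> \<beta>"
  shows "\<exists>\<alpha>' \<beta>'. \<alpha> \<le> \<alpha>' \<and> \<alpha>' \<le> \<beta>' \<and> \<beta>' \<le> \<beta> \<and> \<beta>' - \<alpha>' \<le> \<theta> ^ k * (\<beta> - \<alpha>) \<and>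
           (T ^^ k) f - \<alpha>' *\<^sub>R (T ^^ k) g \<in> K \<and> \<beta>' *\<^sub>R (T ^^ k) g - (T ^^ k) f \<in> K"
proof -
  define P where "P k \<longleftrightarrow> (\<exists>\<alpha>' \<beta>'. \<alpha> \<le> \<alpha>' \<and> \<alpha>' \<le> \<beta>' \<and> \<beta>' \<le> \<beta> \<and> \<beta>' - \<alpha>' \<le> \<theta> ^ k * (\<beta> - \<alpha>) \<and>
     (T ^^ k) f - \<alpha>' *\<^sub>R (T ^^ k) g \<in> K \<and> \<beta>' *\<^sub>R (T ^^ k) g - (T ^^ k) f \<in> K)" for k
  have "P k"
  proof (induction k)
    case 0
    show ?case unfolding P_def using assms by - (rule exI[of _ \<alpha>], rule exI[of _ \<beta>], simp)
  next
    case (Suc k)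
    then obtain a b where ab: "\<alpha> \<le> a" "a \<le> b" "b \<le> \<beta>" "b - a \<le> \<theta> ^ k * (\<beta> - \<alpha>)"
      "(T ^^ k) f - a *\<^sub>R (T ^^ k) g \<in> K" "b *\<^sub>R (T ^^ k) g - (T ^^ k) f \<in> K"
      unfolding P_def by auto
    obtain a' b' where ab': "a \<le> a'" "a' \<le> b'" "b' \<le> b" "b' - a' \<le> \<theta> * (b - a)"
      "T ((T ^^ k) f) - a' *\<^sub>R T ((T ^^ k) g) \<in> K" "b' *\<^sub>R T ((T ^^ k) g) - T ((T ^^ k) f) \<in> K"
      using contraction[OF Tk_simps(1)[OF f] Tk_simps(2)[OF g] ab(5,6,2)] by auto
    have "\<theta> * (b - a) \<le> \<theta> * (\<theta> ^ k * (\<beta> - \<alpha>))"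
      using \<theta> ab by (intro mult_left_mono) auto
    then show ?case
      unfolding P_def using ab ab' by - (rule exI[of _ a'], rule exI[of _ b'], auto)
  qed
  then show ?thesis by (simp add: P_def)
qed

lemma bd_abs: "s *\<^sub>R e - f \<in> K \<Longrightarrow> s *\<^sub>R e + f \<in> K \<Longrightarrow> 0 \<le> s \<Longrightarrow> \<bar>f x\<bar> \<le> s"
  using K_nonneg[of "s *\<^sub>R e - f" x] K_nonneg[of "s *\<^sub>R e + f" x] e_le[of x]
    mult_left_mono[of "e x" 1 s] by auto

text \<open>Power iteration from \<open>e\<close>: consecutive iterates are trapped relative to each
  other in intervals of geometrically shrinking width, so the iterates normalised at
  \<open>x0\<close> are Cauchy in the order sense. As \<open>K\<close> is closed under pointwise
  limits, it contains the limit.\<close>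

lemma eigenvector_T:
  "\<exists>h \<mu>. h \<in> K \<and> h x0 = 1 \<and> h - \<kappa> *\<^sub>R e \<in> K \<and> e - \<kappa> *\<^sub>R h \<in> K \<and> 0 < \<mu> \<and> T h = \<mu> *\<^sub>R h"
proof -
  define g where "g n = (T ^^ n) e" for n
  define p where "p n = g n x0" for n
  define G where "G n = inverse (p n) *\<^sub>R g n" for n
  have eV: "e \<in> V" by (rule K_V[OF e_K])
  have gK: "g n \<in> K" for n unfolding g_def by (rule Tk_simps(2)[OF e_K])
  have gV: "g n \<in> V" for n by (rule K_V[OF gK])
  have gS: "g (Suc n) = T (g n)" for n by (simp add: g_def)
  have pS: "p (Suc n) = S (g n)" for n by (simp add: p_def gS S_def)
  have Se: "0 < S e" using T_pos by (simp add: S_def T_def)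
  define \<alpha>0 where "\<alpha>0 = \<kappa> * S e"
  define \<beta>0 where "\<beta>0 = S e / \<kappa>"
  have \<alpha>0: "0 < \<alpha>0" "\<alpha>0 \<le> \<beta>0"
  proof -
    show "0 < \<alpha>0" using Se \<kappa> by (simp add: \<alpha>0_def)
    have "\<kappa> * \<kappa> \<le> 1" using \<kappa> mult_mono[of \<kappa> 1 \<kappa> 1] by simp
    then show "\<alpha>0 \<le> \<beta>0"
      using Se \<kappa> mult_right_mono[of "\<kappa> * \<kappa>" 1 "S e"] by (simp add: \<alpha>0_def \<beta>0_def field_simps)
  qed
  have "T e - \<alpha>0 *\<^sub>R e \<in> K" unfolding \<alpha>0_def by (rule T_dist[OF e_K])
  moreover have "\<beta>0 *\<^sub>R e - T e \<in> K"
  proof -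
    have "\<beta>0 *\<^sub>R e - T e = (1 / \<kappa>) *\<^sub>R (S e *\<^sub>R e - \<kappa> *\<^sub>R T e)"
      using \<kappa> by (auto simp: fun_eq_iff \<beta>0_def field_simps)
    then show ?thesis using K_scale[OF T_dist(2)[OF e_K]] \<kappa> by simp
  qed
  \<comment> \<open>The contraction is applied to the pair \<open>T e\<close>, \<open>e\<close>,
    which \<open>T ^^ n\<close> turns into \<open>g (Suc n)\<close>, \<open>g n\<close>.\<close>
  ultimately have "\<exists>a b. \<alpha>0 \<le> a \<and> a \<le> b \<and> b \<le> \<beta>0 \<and> b - a \<le> \<theta> ^ n * (\<beta>0 - \<alpha>0) \<and>
           g (Suc n) - a *\<^sub>R g n \<in> K \<and> b *\<^sub>R g n - g (Suc n) \<in> K" for n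
    using iterated_contraction[OF T_simps(1)[OF eV] e_K _ _ \<alpha>0(2), of n]
    by (simp add: g_def funpow_swap1)
  then obtain a b where ab: "\<And>n. \<alpha>0 \<le> a n" "\<And>n. a n \<le> b n"
    "\<And>n. b n - a n \<le> \<theta> ^ n * (\<beta>0 - \<alpha>0)"
    "\<And>n. g (Suc n) - a n *\<^sub>R g n \<in> K" "\<And>n. b n *\<^sub>R g n - g (Suc n) \<in> K" by metis
  have p_ab: "a n * p n \<le> p (Suc n)" "p (Suc n) \<le> b n * p n" for n
    using K_nonneg[OF ab(4)[of n], of x0] K_nonneg[OF ab(5)[of n], of x0] by (auto simp: p_def)
  have p_pos: "0 < p n" for n
  proof (induction n)
    case (Suc n)
    have "0 < a n * p n" using ab(1)[of n] \<alpha>0 Suc by simp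
    then show ?case using p_ab(1)[of n] by linarith
  qed (simp add: p_def g_def e_x0)
  have GK: "G n \<in> K" for n unfolding G_def using gK p_pos[of n] by (intro K_scale) auto
  have GV: "G n \<in> V" for n by (rule K_V[OF GK])
  have Gx0: "G n x0 = 1" for n using p_pos[of n] by (simp add: G_def p_def)
  have Glow: "G n - \<kappa> *\<^sub>R e \<in> K" and Gup: "e - \<kappa> *\<^sub>R G n \<in> K" for n
  proof -
    have "G n - \<kappa> *\<^sub>R e \<in> K \<and> e - \<kappa> *\<^sub>R G n \<in> K"
    proof (cases n)
      case 0
      then show ?thesis using K_scale[OF e_K, of "1 - \<kappa>"] \<kappa>
        by (simp add: G_def p_def g_def e_x0 algebra_simps)
    next
      case (Suc m)
      have "G n - \<kappa> *\<^sub>R e = inverse (p n) *\<^sub>R (T (g m) - (\<kappa> * S (g m)) *\<^sub>R e)"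
        "e - \<kappa> *\<^sub>R G n = inverse (p n) *\<^sub>R (S (g m) *\<^sub>R e - \<kappa> *\<^sub>R T (g m))"
        using p_pos[of n] unfolding Suc by (auto simp: fun_eq_iff G_def gS pS field_simps)
      then show ?thesis using T_dist[OF gK[of m]] p_pos[of n] K_scale by simp
    qed
    then show "G n - \<kappa> *\<^sub>R e \<in> K" "e - \<kappa> *\<^sub>R G n \<in> K" by auto
  qed
  \<comment> \<open>\<open>\<theta> ^ n * (\<beta>0 - \<alpha>0) / \<alpha>0\<close> bounds the
    relative width \<open>(b n - a n) / a n\<close>; the last \<open>\<kappa>\<close> converts
    multiples of \<open>G n\<close> into multiples of \<open>e\<close>.\<close>
  define D where "D n = (\<theta> ^ n * (\<beta>0 - \<alpha>0) / \<alpha>0) / \<kappa>" for n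
  have D0: "0 \<le> D n" for n using \<theta> \<alpha>0 \<kappa> by (simp add: D_def)
  have step: "D n *\<^sub>R e - (G (Suc n) - G n) \<in> K \<and> D n *\<^sub>R e + (G (Suc n) - G n) \<in> K" for n
  proof -
    define q where "q = p n / p (Suc n)"
    define d where "d = \<theta> ^ n * (\<beta>0 - \<alpha>0) / \<alpha>0"
    have q: "0 < q" using p_pos by (simp add: q_def)
    have an: "0 < a n" "0 < b n" using ab(1,2)[of n] \<alpha>0 by linarith+
    have aq: "a n * q \<le> 1" "1 \<le> b n * q"
      using p_ab[of n] p_pos[of "Suc n"] by (auto simp: q_def field_simps)
    have d0: "0 \<le> d" using \<theta> \<alpha>0 by (simp add: d_def)
    have ba: "(b n - a n) / a n \<le> d"
    proof -
      have "(b n - a n) / a n \<le> (\<theta> ^ n * (\<beta>0 - \<alpha>0)) / \<alpha>0"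
        using ab(1,2,3)[of n] \<alpha>0 \<theta> by (intro frac_le) auto
      then show ?thesis by (simp add: d_def)
    qed
    have "b n * q \<le> b n / a n" using aq an q by (simp add: field_simps)
    also have "\<dots> = 1 + (b n - a n) / a n" using an by (simp add: field_simps)
    finally have 1: "0 \<le> d - (b n * q - 1)" using ba by linarith
    have "a n / b n \<le> a n * q" using aq an q by (simp add: field_simps)
    moreover have "1 - a n / b n \<le> (b n - a n) / a n"
    proof -
      have "1 - a n / b n = (b n - a n) / b n" using an by (simp add: field_simps)
      also have "\<dots> \<le> (b n - a n) / a n" using ab(2)[of n] an by (intro divide_left_mono) auto
      finally show ?thesis .
    qed
    ultimately have 2: "0 \<le> d - (1 - a n * q)" using ba by linarith
    have gG: "g n = p n *\<^sub>R G n" for n using p_pos[of n] by (simp add: G_def)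
    have e1: "d *\<^sub>R G n - (G (Suc n) - G n)
        = inverse (p (Suc n)) *\<^sub>R (b n *\<^sub>R g n - g (Suc n)) + (d - (b n * q - 1)) *\<^sub>R G n"
      unfolding gG q_def using p_pos[of "Suc n"] by (auto simp: fun_eq_iff field_simps)
    have e2: "d *\<^sub>R G n + (G (Suc n) - G n)
        = inverse (p (Suc n)) *\<^sub>R (g (Suc n) - a n *\<^sub>R g n) + (d - (1 - a n * q)) *\<^sub>R G n"
      unfolding gG q_def using p_pos[of "Suc n"] by (auto simp: fun_eq_iff field_simps)
    have G1: "d *\<^sub>R G n - (G (Suc n) - G n) \<in> K"
      unfolding e1 using 1 p_pos[of "Suc n"] by (intro K_add K_scale ab GK) auto
    have G2: "d *\<^sub>R G n + (G (Suc n) - G n) \<in> K"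
      unfolding e2 using 2 p_pos[of "Suc n"] by (intro K_add K_scale ab GK) auto
    have ee: "D n *\<^sub>R e = d *\<^sub>R G n + (d / \<kappa>) *\<^sub>R (e - \<kappa> *\<^sub>R G n)"
    proof -
      have "D n = d / \<kappa>" by (simp add: D_def d_def)
      then show ?thesis using \<kappa> by (auto simp: fun_eq_iff algebra_simps)
    qed
    have dk: "(d / \<kappa>) *\<^sub>R (e - \<kappa> *\<^sub>R G n) \<in> K" using d0 \<kappa> by (intro K_scale Gup) auto
    show ?thesis using K_add[OF G1 dk] K_add[OF G2 dk] unfolding ee by (simp add: algebra_simps)
  qed
  define R where "R n = (\<Sum>i. D (i + n))" for n
  have Dsm: "summable D"
  proof -
    have "D = (\<lambda>n. ((\<beta>0 - \<alpha>0) / \<alpha>0 / \<kappa>) * \<theta> ^ n)" by (auto simp: D_def)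
    then show ?thesis using \<theta> by (simp only:) (intro summable_mult summable_geometric, auto)
  qed
  have Dsm': "summable (\<lambda>i. D (i + n))" for n by (rule summable_ignore_initial_segment[OF Dsm])
  have R0: "R \<longlonglongrightarrow> 0" unfolding R_def by (rule suminf_exist_split2[OF Dsm])
  have Rnn: "0 \<le> R n" for n unfolding R_def by (intro suminf_nonneg Dsm' D0)
  have fin: "R n *\<^sub>R e - (G (n + m) - G n) \<in> K \<and> R n *\<^sub>R e + (G (n + m) - G n) \<in> K" for n m
  proof -
    define P where "P m \<longleftrightarrow> (\<Sum>i<m. D (i + n)) *\<^sub>R e - (G (n + m) - G n) \<in> K
        \<and> (\<Sum>i<m. D (i + n)) *\<^sub>R e + (G (n + m) - G n) \<in> K" for m
    have "P m"
    proof (induction m)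
      case 0
      show ?case unfolding P_def using K_scale[OF e_K, of 0] by simp
    next
      case (Suc m)
      then have "(\<Sum>i<m. D (i + n)) *\<^sub>R e - (G (n + m) - G n) \<in> K"
        "(\<Sum>i<m. D (i + n)) *\<^sub>R e + (G (n + m) - G n) \<in> K" by (auto simp: P_def)
      then show ?case
        unfolding P_def using K_add[OF _ conjunct1[OF step[of "n + m"]]] K_add[OF _ conjunct2[OF step[of "n + m"]]]
        by (fastforce simp: algebra_simps)
    qed
    then have "(\<Sum>i<m. D (i + n)) *\<^sub>R e - (G (n + m) - G n) \<in> K
        \<and> (\<Sum>i<m. D (i + n)) *\<^sub>R e + (G (n + m) - G n) \<in> K" unfolding P_def .
    moreover have "(\<Sum>i<m. D (i + n)) \<le> R n"
      unfolding R_def by (rule sum_le_suminf[OF Dsm']) (auto simp: D0)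
    then have "(R n - (\<Sum>i<m. D (i + n))) *\<^sub>R e \<in> K" by (intro K_scale e_K) auto
    moreover have "R n *\<^sub>R e - X = ((\<Sum>i<m. D (i + n)) *\<^sub>R e - X) + (R n - (\<Sum>i<m. D (i + n))) *\<^sub>R e"
      "R n *\<^sub>R e + X = ((\<Sum>i<m. D (i + n)) *\<^sub>R e + X) + (R n - (\<Sum>i<m. D (i + n))) *\<^sub>R e" for X
      by (auto simp: fun_eq_iff algebra_simps)
    ultimately show ?thesis by (metis K_add)
  qed
  have "\<exists>l. (\<lambda>n. G n x) \<longlonglongrightarrow> l" for x
  proof -
    have "Cauchy (\<lambda>n. G n x)"
    proof (rule metric_CauchyI)
      fix \<epsilon> :: real assume "0 < \<epsilon>"
      then have "eventually (\<lambda>n. R n < \<epsilon> / 2) sequentially"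
        by (intro order_tendstoD(2)[OF R0]) simp
      then obtain M where M: "R M < \<epsilon> / 2" by (auto simp: eventually_sequentially)
      have "\<bar>G n x - G M x\<bar> \<le> R M" if "n \<ge> M" for n
      proof -
        have "n = M + (n - M)" using that by simp
        then show ?thesis
          using bd_abs[OF conjunct1[OF fin[of M "n - M"]] conjunct2[OF fin[of M "n - M"]] Rnn, of x] by simp
      qed
      then have "dist (G m x) (G n x) < \<epsilon>" if "m \<ge> M" "n \<ge> M" for m n
        using that M unfolding dist_real_def by (smt (verit) field_sum_of_halves)
      then show "\<exists>M. \<forall>m\<ge>M. \<forall>n\<ge>M. dist (G m x) (G n x) < \<epsilon>" by blast
    qed
    then show ?thesis by (metis Cauchy_convergent_iff convergent_def)
  qed
  then obtain h where h: "\<And>x. (\<lambda>n. G n x) \<longlonglongrightarrow> h x" by metis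
  have hK: "h \<in> K" by (rule K_closed[OF GK h])
  have hV: "h \<in> V" by (rule K_V[OF hK])
  have hx0: "h x0 = 1" using LIMSEQ_unique[OF h[of x0]] by (simp add: Gx0)
  have hlow: "h - \<kappa> *\<^sub>R e \<in> K"
    by (rule K_closed[OF Glow]) (auto intro!: tendsto_intros h)
  have hup: "e - \<kappa> *\<^sub>R h \<in> K"
    by (rule K_closed[OF Gup]) (auto intro!: tendsto_intros h)
  have hG: "R n *\<^sub>R e - (h - G n) \<in> K" "R n *\<^sub>R e + (h - G n) \<in> K" for n
    by (rule K_closed[OF conjunct1[OF fin[of n]]], auto intro!: tendsto_intros LIMSEQ_ignore_initial_segment h simp: add.commute[of n])
       (rule K_closed[OF conjunct2[OF fin[of n]]], auto intro!: tendsto_intros LIMSEQ_ignore_initial_segment h simp: add.commute[of n])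
  \<comment> \<open>Positivity replaces continuity of \<open>T\<close>: the order bound
    \<open>R n\<close> on \<open>h - G n\<close> passes through \<open>T\<close> and becomes
    \<open>R n * T e x\<close>.\<close>
  have TG: "(\<lambda>n. T (G n) x) \<longlonglongrightarrow> T h x" for x
  proof -
    have "\<bar>T (G n) x - T h x\<bar> \<le> R n * T e x" for n
    proof -
      have 1: "T (R n *\<^sub>R e - (h - G n)) \<in> K" "T (R n *\<^sub>R e + (h - G n)) \<in> K"
        by (intro T_simps hG)+
      then show ?thesis
        using K_nonneg[OF 1(1), of x] K_nonneg[OF 1(2), of x]
        by (simp add: T_simps V_scale V_diff eV hV GV abs_le_iff)
    qed
    then have "\<forall>\<^sub>F n in sequentially. norm (T (G n) x - T h x) \<le> R n * T e x"
      unfolding real_norm_def by (intro always_eventually allI)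
    moreover have "(\<lambda>n. R n * T e x) \<longlonglongrightarrow> 0" by (rule tendsto_mult_left_zero[OF R0])
    ultimately have "(\<lambda>n. T (G n) x - T h x) \<longlonglongrightarrow> 0"
      by (rule Lim_null_comparison)
    then show ?thesis by (rule LIM_zero_cancel)
  qed
  define \<mu> where "\<mu> = T h x0"
  have TGn: "T (G n) = (T (G n) x0) *\<^sub>R G (Suc n)" for n
  proof -
    have "T (G n) = inverse (p n) *\<^sub>R g (Suc n)" unfolding G_def using gV by (simp add: T_simps gS)
    also have "g (Suc n) = p (Suc n) *\<^sub>R G (Suc n)" using p_pos[of "Suc n"] by (simp add: G_def)
    finally have *: "T (G n) = (inverse (p n) * p (Suc n)) *\<^sub>R G (Suc n)"
      by (simp add: fun_eq_iff mult.assoc)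
    then have "T (G n) x0 = inverse (p n) * p (Suc n)" by (simp add: Gx0)
    with * show ?thesis by simp
  qed
  have "T h = \<mu> *\<^sub>R h"
  proof
    fix x
    have "(\<lambda>n. T (G n) x0 * G (Suc n) x) \<longlonglongrightarrow> \<mu> * h x"
      unfolding \<mu>_def by (intro tendsto_mult TG LIMSEQ_Suc h)
    then have "(\<lambda>n. T (G n) x) \<longlonglongrightarrow> \<mu> * h x"
      by (subst TGn) simp
    then show "T h x = (\<mu> *\<^sub>R h) x" using LIMSEQ_unique[OF TG[of x]] by simp
  qed
  moreover have "0 < \<mu>"
  proof -
    have "T (h - \<kappa> *\<^sub>R e) \<in> K" by (intro T_simps hlow)
    then have "0 \<le> T h x0 - \<kappa> * T e x0"
      using K_nonneg[of "T (h - \<kappa> *\<^sub>R e)" x0] by (simp add: T_simps hV eV V_scale)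
    moreover have "0 < \<kappa> * T e x0" using Se \<kappa> by (simp add: S_def)
    ultimately show ?thesis unfolding \<mu>_def by linarith
  qed
  ultimately show ?thesis using hK hx0 hlow hup by blast
qed

text \<open>\<open>L\<close> commutes with \<open>T\<close>, so \<open>T ^^ k\<close> acts on both
  \<open>L h\<close> and \<open>h\<close> as the scalar \<open>\<mu> ^ k\<close>. The shrinking
  intervals therefore trap \<open>L h\<close> itself between multiples of \<open>h\<close>.\<close>

lemma eigenvector_L:
  "\<exists>h r. h \<in> K \<and> h x0 = 1 \<and> h - \<kappa> *\<^sub>R e \<in> K \<and> e - \<kappa> *\<^sub>R h \<in> K \<and> 0 < r \<and> L h = r *\<^sub>R h"
proof -
  obtain h \<mu> where h: "h \<in> K" "h x0 = 1" "h - \<kappa> *\<^sub>R e \<in> K" "e - \<kappa> *\<^sub>R h \<in> K" "0 < \<mu>" "T h = \<mu> *\<^sub>R h"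
    using eigenvector_T by blast
  have hV: "h \<in> V" by (rule K_V[OF h(1)])
  obtain s where s: "0 \<le> s" "s *\<^sub>R e - L h \<in> K" "s *\<^sub>R e + L h \<in> K"
    using order_unit[OF L_V[OF hV]] by blast
  have *: "L h - (- (s / \<kappa>)) *\<^sub>R h \<in> K" "(s / \<kappa>) *\<^sub>R h - L h \<in> K"
  proof -
    have "(s / \<kappa>) *\<^sub>R (h - \<kappa> *\<^sub>R e) \<in> K" using s \<kappa> by (intro K_scale h) auto
    from K_add[OF this s(3)] K_add[OF this s(2)] show "L h - (- (s / \<kappa>)) *\<^sub>R h \<in> K" "(s / \<kappa>) *\<^sub>R h - L h \<in> K"
      using \<kappa> by (simp_all add: algebra_simps)
  qed
  define r where "r = L h x0"
  have Tkh: "(T ^^ k) h = \<mu> ^ k *\<^sub>R h" for k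
  proof (induction k)
    case (Suc k)
    have "(T ^^ Suc k) h = T (\<mu> ^ k *\<^sub>R h)" by (simp only: Suc funpow.simps o_apply)
    also have "\<dots> = \<mu> ^ Suc k *\<^sub>R h" by (simp only: T_simps(5)[OF hV] h(6) scaleR_scaleR power_Suc2)
    finally show ?case .
  qed simp
  have TkL: "(T ^^ k) (L h) = \<mu> ^ k *\<^sub>R L h" for k
  proof -
    have "(T ^^ k) (L h) = L ((T ^^ k) h)" unfolding Tk_eq by (simp add: funpow_swap1)
    then show ?thesis by (simp add: Tkh L_scale hV)
  qed
  have "L h x = r * h x" for x
  proof -
    have b: "\<bar>L h x - r * h x\<bar> \<le> (2 * (s / \<kappa>) * h x) * \<theta> ^ k" for k
    proof -
      have "- (s / \<kappa>) \<le> s / \<kappa>" using s \<kappa> by simp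
      from iterated_contraction[OF L_V[OF hV] h(1) * this, of k] obtain a b where
        ab: "b - a \<le> \<theta> ^ k * (s / \<kappa> - - (s / \<kappa>))" "(T ^^ k) (L h) - a *\<^sub>R (T ^^ k) h \<in> K"
          "b *\<^sub>R (T ^^ k) h - (T ^^ k) (L h) \<in> K" by blast
      have mk: "0 < \<mu> ^ k" using h by simp
      have i: "a * h y \<le> L h y" "L h y \<le> b * h y" for y
      proof -
        have "0 \<le> \<mu> ^ k * (L h y - a * h y)" "0 \<le> \<mu> ^ k * (b * h y - L h y)"
          using K_nonneg[OF ab(2), of y] K_nonneg[OF ab(3), of y]
          by (simp_all add: Tkh TkL algebra_simps)
        then show "a * h y \<le> L h y" "L h y \<le> b * h y" using mk by (simp_all add: zero_le_mult_iff)
      qed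
      have hx: "0 \<le> h x" by (rule K_nonneg[OF h(1)])
      have r: "a \<le> r" "r \<le> b" using i[of x0] h by (auto simp: r_def)
      then have "a * h x \<le> r * h x" "r * h x \<le> b * h x" using hx by (auto intro: mult_right_mono)
      with i[of x] have "\<bar>L h x - r * h x\<bar> \<le> b * h x - a * h x" by linarith
      also have "\<dots> = (b - a) * h x" by (simp add: algebra_simps)
      also have "\<dots> \<le> (\<theta> ^ k * (s / \<kappa> - - (s / \<kappa>))) * h x" using ab hx by (intro mult_right_mono) auto
      finally show ?thesis by (simp add: algebra_simps)
    qed
    have "(\<lambda>k. (2 * (s / \<kappa>) * h x) * \<theta> ^ k) \<longlonglongrightarrow> 0"
      using \<theta> by (intro tendsto_mult_right_zero LIMSEQ_realpow_zero) auto
    then have "\<bar>L h x - r * h x\<bar> \<le> 0" using b by (intro LIMSEQ_le_const) auto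
    then show ?thesis by simp
  qed
  then have Lh: "L h = r *\<^sub>R h" by (auto simp: fun_eq_iff)
  have "(L ^^ k) h = r ^ k *\<^sub>R h" for k
  proof (induction k)
    case (Suc k)
    have "(L ^^ Suc k) h = L (r ^ k *\<^sub>R h)" by (simp only: Suc funpow.simps o_apply)
    also have "\<dots> = r ^ Suc k *\<^sub>R h" by (simp only: L_scale[OF hV] Lh scaleR_scaleR power_Suc2)
    finally show ?case .
  qed simp
  then have "r ^ n0 *\<^sub>R h = \<mu> *\<^sub>R h" using h(6) by (simp add: T_def)
  then have "r ^ n0 = \<mu>" using h(2) by (metis mult.right_neutral real_scaleR_def scaleR_fun_apply)
  moreover have "0 \<le> r" unfolding r_def by (intro K_nonneg L_K h)
  ultimately have "0 < r" using h(5) n0 by (metis less_eq_real_def power_0_left less_irrefl)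
  then show ?thesis using h Lh by blast
qed

text \<open>\<open>\<nu>\<close> is the limit of the normalised iterates evaluated at
  \<open>x0\<close>. Errors are measured in multiples of \<open>e\<close> because \<open>V\<close>
  carries no norm here; \<open>order_bound_lip_norm\<close> later converts them.\<close>

theorem perron_frobenius:
  obtains h r \<nu> \<tau> C where
    "h \<in> K" "h x0 = 1" "h - \<kappa> *\<^sub>R e \<in> K" "e - \<kappa> *\<^sub>R h \<in> K" "0 < r" "L h = r *\<^sub>R h"
    "0 < \<tau>" "\<tau> < 1" "0 \<le> C"
    "\<And>f g. f \<in> V \<Longrightarrow> g \<in> V \<Longrightarrow> \<nu> (f + g) = \<nu> f + \<nu> g"
    "\<And>f c. f \<in> V \<Longrightarrow> \<nu> (c *\<^sub>R f) = c * \<nu> f"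
    "\<nu> h = (1::real)" "\<And>f. f \<in> V \<Longrightarrow> \<nu> (L f) = r * \<nu> f"
    "\<And>f s. f \<in> V \<Longrightarrow> 0 \<le> s \<Longrightarrow> s *\<^sub>R e - f \<in> K \<Longrightarrow> s *\<^sub>R e + f \<in> K \<Longrightarrow> \<bar>\<nu> f\<bar> \<le> C * s"
    "\<And>f s k. f \<in> V \<Longrightarrow> 0 \<le> s \<Longrightarrow> s *\<^sub>R e - f \<in> K \<Longrightarrow> s *\<^sub>R e + f \<in> K \<Longrightarrow>
       (C * s * \<tau> ^ k) *\<^sub>R e - ((1 / r ^ k) *\<^sub>R (L ^^ k) f - \<nu> f *\<^sub>R h) \<in> K \<and>
       (C * s * \<tau> ^ k) *\<^sub>R e + ((1 / r ^ k) *\<^sub>R (L ^^ k) f - \<nu> f *\<^sub>R h) \<in> K"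
proof -
  obtain h r where h: "h \<in> K" "h x0 = 1" "h - \<kappa> *\<^sub>R e \<in> K" "e - \<kappa> *\<^sub>R h \<in> K" "0 < r" "L h = r *\<^sub>R h"
    using eigenvector_L by blast
  have hV: "h \<in> V" by (rule K_V[OF h(1)])
  define \<Lambda> where "\<Lambda> k f = (1 / r ^ k) *\<^sub>R (L ^^ k) f" for k f
  define \<nu> where "\<nu> f = lim (\<lambda>k. \<Lambda> k f x0)" for f
  \<comment> \<open>\<open>\<theta>\<close> is gained in \<open>n0\<close> applications of
    \<open>L\<close>, so one application is worth its \<open>n0\<close>-th root. In
    \<open>C\<close>, one \<open>\<kappa>\<close> comes from bounding \<open>e\<close> by
    \<open>h\<close>, one from bounding \<open>h\<close> by \<open>e\<close>, and
    \<open>\<theta>\<close> from an incomplete block of \<open>n0\<close> applications.\<close>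
  define \<tau> where "\<tau> = root n0 \<theta>"
  define C where "C = 2 / \<kappa> / \<kappa> / \<theta>"
  have Lh: "(L ^^ k) h = r ^ k *\<^sub>R h" for k
  proof (induction k)
    case (Suc k)
    have "(L ^^ Suc k) h = L (r ^ k *\<^sub>R h)" by (simp only: Suc funpow.simps o_apply)
    also have "\<dots> = r ^ Suc k *\<^sub>R h" by (simp only: L_scale[OF hV] h(6) scaleR_scaleR power_Suc2)
    finally show ?case .
  qed simp
  have \<tau>: "0 < \<tau>" "\<tau> < 1" "\<tau> ^ n0 = \<theta>"
    unfolding \<tau>_def using n0 \<theta> by (auto simp: real_root_gt_0_iff real_root_lt_1_iff)
  have C0: "0 \<le> C" using \<kappa> \<theta> by (simp add: C_def)
  have \<Lambda>_V: "\<Lambda> k f \<in> V" if "f \<in> V" for f k using that by (auto simp: \<Lambda>_def intro: V_scale Lk_V)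
  \<comment> \<open>Once \<open>T ^^ k\<close> has narrowed the interval, further applications of
    the positive operator \<open>L\<close> keep its end points, \<open>h\<close> being an
    eigenvector; so one pair \<open>a\<close>, \<open>b\<close> serves all later
    \<open>j\<close>.\<close>
  have trap: "\<exists>a b. - (s / \<kappa>) \<le> a \<and> b \<le> s / \<kappa> \<and> b - a \<le> \<theta> ^ k * (2 * s / \<kappa>) \<and>
       (\<forall>j\<ge>n0 * k. \<Lambda> j f - a *\<^sub>R h \<in> K \<and> b *\<^sub>R h - \<Lambda> j f \<in> K)"
    if f: "f \<in> V" "0 \<le> s" "s *\<^sub>R e - f \<in> K" "s *\<^sub>R e + f \<in> K" for f s k
  proof -
    have *: "f - (- (s / \<kappa>)) *\<^sub>R h \<in> K" "(s / \<kappa>) *\<^sub>R h - f \<in> K"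
    proof -
      have "(s / \<kappa>) *\<^sub>R (h - \<kappa> *\<^sub>R e) \<in> K" using f \<kappa> by (intro K_scale h) auto
      from K_add[OF this f(4)] K_add[OF this f(3)] show "f - (- (s / \<kappa>)) *\<^sub>R h \<in> K" "(s / \<kappa>) *\<^sub>R h - f \<in> K"
        using \<kappa> by (simp_all add: algebra_simps)
    qed
    have "- (s / \<kappa>) \<le> s / \<kappa>" using f \<kappa> by simp
    from iterated_contraction[OF f(1) h(1) * this, of k] obtain a b where
      ab: "- (s / \<kappa>) \<le> a" "b \<le> s / \<kappa>" "b - a \<le> \<theta> ^ k * (s / \<kappa> - - (s / \<kappa>))"
        "(T ^^ k) f - a *\<^sub>R (T ^^ k) h \<in> K" "b *\<^sub>R (T ^^ k) h - (T ^^ k) f \<in> K" by blast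
    have "\<Lambda> j f - a *\<^sub>R h \<in> K \<and> b *\<^sub>R h - \<Lambda> j f \<in> K" if j: "j \<ge> n0 * k" for j
    proof -
      define i where "i = j - n0 * k"
      have ji: "j = i + n0 * k" using j by (simp add: i_def)
      have Lj: "(L ^^ i) ((T ^^ k) g) = (L ^^ j) g" for g
        unfolding Tk_eq ji by (simp add: funpow_add)
      have 1: "(L ^^ i) ((T ^^ k) f - a *\<^sub>R (T ^^ k) h) \<in> K" "(L ^^ i) (b *\<^sub>R (T ^^ k) h - (T ^^ k) f) \<in> K"
        by (intro Lk_K ab)+
      have 2: "(L ^^ j) f - a *\<^sub>R r ^ j *\<^sub>R h \<in> K" "b *\<^sub>R r ^ j *\<^sub>R h - (L ^^ j) f \<in> K"
        using 1 by (simp_all add: Lk_diff Lk_scale Tk_simps f hV V_scale Lj Lh)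
      have rj: "0 < r ^ j" using h by simp
      have "\<Lambda> j f - a *\<^sub>R h = (1 / r ^ j) *\<^sub>R ((L ^^ j) f - a *\<^sub>R r ^ j *\<^sub>R h)"
        "b *\<^sub>R h - \<Lambda> j f = (1 / r ^ j) *\<^sub>R (b *\<^sub>R r ^ j *\<^sub>R h - (L ^^ j) f)"
        using rj h(5) by (auto simp: fun_eq_iff \<Lambda>_def field_simps)
      then show ?thesis using K_scale[OF 2(1), of "1 / r ^ j"] K_scale[OF 2(2), of "1 / r ^ j"] rj by simp
    qed
    then show ?thesis using ab by (intro exI[of _ a] exI[of _ b]) auto
  qed
  have conv: "(\<lambda>k. \<Lambda> k f x0) \<longlonglongrightarrow> \<nu> f" if f: "f \<in> V" for f
  proof -
    obtain s where s: "0 \<le> s" "s *\<^sub>R e - f \<in> K" "s *\<^sub>R e + f \<in> K" using order_unit[OF f] by blast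
    have "Cauchy (\<lambda>k. \<Lambda> k f x0)"
    proof (rule metric_CauchyI)
      fix \<epsilon> :: real assume "0 < \<epsilon>"
      moreover have "(\<lambda>k. \<theta> ^ k * (2 * s / \<kappa>)) \<longlonglongrightarrow> 0"
        using \<theta> by (intro tendsto_mult_left_zero LIMSEQ_realpow_zero) auto
      ultimately obtain k where k: "\<theta> ^ k * (2 * s / \<kappa>) < \<epsilon>"
        using order_tendstoD(2)[of _ 0 sequentially \<epsilon>] by (auto simp: eventually_sequentially)
      obtain a b where ab: "b - a \<le> \<theta> ^ k * (2 * s / \<kappa>)"
        "\<And>j. j \<ge> n0 * k \<Longrightarrow> \<Lambda> j f - a *\<^sub>R h \<in> K \<and> b *\<^sub>R h - \<Lambda> j f \<in> K"
        using trap[OF f s, of k] by blast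
      have "a \<le> \<Lambda> j f x0 \<and> \<Lambda> j f x0 \<le> b" if "j \<ge> n0 * k" for j
        using ab(2)[OF that] K_nonneg[of "\<Lambda> j f - a *\<^sub>R h" x0] K_nonneg[of "b *\<^sub>R h - \<Lambda> j f" x0] h by simp
      then show "\<exists>M. \<forall>m\<ge>M. \<forall>n\<ge>M. dist (\<Lambda> m f x0) (\<Lambda> n f x0) < \<epsilon>"
        using ab(1) k unfolding dist_real_def by (intro exI[of _ "n0 * k"]) (smt (verit))
    qed
    then show ?thesis unfolding \<nu>_def by (simp add: Cauchy_convergent_iff convergent_LIMSEQ_iff)
  qed
  have bound: "\<bar>\<nu> f\<bar> \<le> C * s \<and> (C * s * \<tau> ^ k) *\<^sub>R e - (\<Lambda> k f - \<nu> f *\<^sub>R h) \<in> K \<and>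
       (C * s * \<tau> ^ k) *\<^sub>R e + (\<Lambda> k f - \<nu> f *\<^sub>R h) \<in> K"
    if f: "f \<in> V" "0 \<le> s" "s *\<^sub>R e - f \<in> K" "s *\<^sub>R e + f \<in> K" for f s k
  proof -
    define q where "q = k div n0"
    obtain a b where ab: "- (s / \<kappa>) \<le> a" "b \<le> s / \<kappa>" "b - a \<le> \<theta> ^ q * (2 * s / \<kappa>)"
        "\<And>j. j \<ge> n0 * q \<Longrightarrow> \<Lambda> j f - a *\<^sub>R h \<in> K \<and> b *\<^sub>R h - \<Lambda> j f \<in> K"
      using trap[OF f, of q] by blast
    have ev: "a \<le> \<Lambda> j f x0 \<and> \<Lambda> j f x0 \<le> b" if "j \<ge> n0 * q" for j
      using ab(4)[OF that] K_nonneg[of "\<Lambda> j f - a *\<^sub>R h" x0] K_nonneg[of "b *\<^sub>R h - \<Lambda> j f" x0] h by simp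
    have \<nu>: "a \<le> \<nu> f" "\<nu> f \<le> b"
      using ev by (auto intro!: LIMSEQ_le_const[OF conv[OF f(1)]] LIMSEQ_le_const2[OF conv[OF f(1)]])
    have "\<bar>\<nu> f\<bar> \<le> s / \<kappa>" using \<nu> ab(1,2) by linarith
    also have "s / \<kappa> \<le> C * s"
    proof -
      have "\<kappa> * \<theta> \<le> 1 * 1" using \<kappa> \<theta> by (intro mult_mono) auto
      then have "1 \<le> 2 / \<kappa> / \<theta>" using \<kappa> \<theta> by (simp add: field_simps)
      then have "1 * (s / \<kappa>) \<le> 2 / \<kappa> / \<theta> * (s / \<kappa>)" using f \<kappa> by (intro mult_right_mono) auto
      then show ?thesis by (simp add: C_def field_simps)
    qed
    finally have 1: "\<bar>\<nu> f\<bar> \<le> C * s" .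
    have "\<theta> ^ q * \<theta> \<le> \<tau> ^ k"
    proof -
      have "k \<le> n0 * q + n0" unfolding q_def using n0
        by (metis add.commute div_mult_mod_eq mod_less_divisor mult.commute nat_add_left_cancel_le less_imp_le)
      then have "\<tau> ^ (n0 * q + n0) \<le> \<tau> ^ k" using \<tau> by (intro power_decreasing) auto
      then show ?thesis by (simp add: power_add power_mult \<tau>)
    qed
    then have "\<theta> ^ q \<le> \<tau> ^ k / \<theta>" using \<theta> by (simp add: field_simps)
    then have "\<theta> ^ q * (2 * s / \<kappa>) \<le> \<tau> ^ k / \<theta> * (2 * s / \<kappa>)" using f \<kappa> by (intro mult_right_mono) auto
    also have "\<tau> ^ k / \<theta> * (2 * s / \<kappa>) = C * s * \<tau> ^ k * \<kappa>" using \<kappa> by (simp add: C_def mult_ac)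
    finally have w: "b - a \<le> C * s * \<tau> ^ k * \<kappa>" using ab(3) by linarith
    have j: "k \<ge> n0 * q" by (simp add: q_def)
    define c where "c = C * s * \<tau> ^ k"
    have c0: "0 \<le> c" unfolding c_def using C0 f \<tau> by simp
    have e1: "c *\<^sub>R e - (\<Lambda> k f - \<nu> f *\<^sub>R h) = c *\<^sub>R (e - \<kappa> *\<^sub>R h) +
      ((b *\<^sub>R h - \<Lambda> k f) + (c * \<kappa> + \<nu> f - b) *\<^sub>R h)"
      and e2: "c *\<^sub>R e + (\<Lambda> k f - \<nu> f *\<^sub>R h) = c *\<^sub>R (e - \<kappa> *\<^sub>R h) +
      ((\<Lambda> k f - a *\<^sub>R h) + (c * \<kappa> + a - \<nu> f) *\<^sub>R h)"
      by (auto simp: fun_eq_iff algebra_simps)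
    have "c *\<^sub>R e - (\<Lambda> k f - \<nu> f *\<^sub>R h) \<in> K"
      unfolding e1 using ab(4)[OF j] h c0 w \<nu> by (intro K_add K_scale) (auto simp: c_def)
    moreover have "c *\<^sub>R e + (\<Lambda> k f - \<nu> f *\<^sub>R h) \<in> K"
      unfolding e2 using ab(4)[OF j] h c0 w \<nu> by (intro K_add K_scale) (auto simp: c_def)
    ultimately show ?thesis using 1 by (simp add: c_def)
  qed
  show ?thesis
  proof (rule that[of h r \<tau> C \<nu>])
    show "\<nu> (f + g) = \<nu> f + \<nu> g" if "f \<in> V" "g \<in> V" for f g
    proof -
      have "(\<lambda>k. \<Lambda> k (f + g) x0) \<longlonglongrightarrow> \<nu> f + \<nu> g"
        using tendsto_add[OF conv[OF that(1)] conv[OF that(2)]]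
        by (simp add: \<Lambda>_def Lk_add that distrib_left add_divide_distrib)
      then show ?thesis using LIMSEQ_unique conv V_add that by blast
    qed
    show "\<nu> (c *\<^sub>R f) = c * \<nu> f" if "f \<in> V" for f c
    proof -
      have "(\<lambda>k. \<Lambda> k (c *\<^sub>R f) x0) \<longlonglongrightarrow> c * \<nu> f"
        using tendsto_mult_left[OF conv[OF that], of c] by (simp add: \<Lambda>_def Lk_scale that)
      then show ?thesis using LIMSEQ_unique conv V_scale that by blast
    qed
    have "\<Lambda> k h = h" for k using h by (simp add: \<Lambda>_def Lh)
    then show "\<nu> h = 1" using LIMSEQ_unique[OF conv[OF hV]] h by simp
    show "\<nu> (L f) = r * \<nu> f" if f: "f \<in> V" for f
    proof -
      have "\<Lambda> k (L f) x0 = r * \<Lambda> (Suc k) f x0" for k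
        using h(5) by (simp add: \<Lambda>_def funpow_swap1)
      moreover have "(\<lambda>k. r * \<Lambda> (Suc k) f x0) \<longlonglongrightarrow> r * \<nu> f"
        by (intro tendsto_mult_left LIMSEQ_Suc conv f)
      ultimately show ?thesis using LIMSEQ_unique conv[OF L_V[OF f]] by simp
    qed
  qed (use h \<tau> C0 bound in \<open>auto simp: \<Lambda>_def\<close>)
qed

end

section \<open>The shift space and its function spaces\<close>

locale shift_system =
  fixes \<rho> :: "'a::metric_space measure" and A :: "'a \<Rightarrow> 'a \<Rightarrow> real"
  assumes compact_E: "compact (UNIV :: 'a set)"
    and prob: "prob_space \<rho>"
    and borel: "sets \<rho> = sets borel"
    and full_support: "\<And>U. open U \<Longrightarrow> U \<noteq> {} \<Longrightarrow> measure \<rho> U > 0"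
    and A_values: "\<And>x y. A x y \<in> {0, 1}"
    and A_continuous: "continuous_on UNIV (\<lambda>(x, y). A x y)"
    and A_mixing: "\<exists>N\<ge>1. \<forall>n\<ge>N. \<forall>a b. \<exists>z :: nat \<Rightarrow> 'a.
        z 0 = a \<and> z n = b \<and> (\<Prod>i<n. A (z i) (z (Suc i))) = 1"
begin

abbreviation \<Omega> :: "(nat \<Rightarrow> 'a) set" where "\<Omega> \<equiv> Omega A"
abbreviation cons :: "'a \<Rightarrow> (nat \<Rightarrow> 'a) \<Rightarrow> nat \<Rightarrow> 'a" where "cons t x \<equiv> case_nat t x"

lemma A_pos_iff: "A x y > 0 \<longleftrightarrow> A x y = 1"
  using A_values[of x y] by auto

lemma Omega_iff: "x \<in> \<Omega> \<longleftrightarrow> (\<forall>i. A (x i) (x (Suc i)) = 1)"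
  by (simp add: Omega_def A_pos_iff)

lemma cons_in_iff: "x \<in> \<Omega> \<Longrightarrow> cons t x \<in> \<Omega> \<longleftrightarrow> A t (x 0) = 1"
proof
  assume "cons t x \<in> \<Omega>"
  then have "A (cons t x 0) (cons t x (Suc 0)) = 1" unfolding Omega_iff by blast
  then show "A t (x 0) = 1" by simp
next
  assume x: "x \<in> \<Omega>" and "A t (x 0) = 1"
  then show "cons t x \<in> \<Omega>" unfolding Omega_iff
    by (auto split: nat.split)
qed

lemma shift_in: "x \<in> \<Omega> \<Longrightarrow> shift x \<in> \<Omega>"
  by (simp add: Omega_iff shift_def)

lemma cont_A: "continuous_on S f \<Longrightarrow> continuous_on S g \<Longrightarrow> continuous_on S (\<lambda>p. A (f p) (g p))"
  using continuous_on_compose2[OF A_continuous, of S "\<lambda>p. (f p, g p)"]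
  by (simp add: continuous_on_Pair)

lemma closed_Omega: "closed \<Omega>"
proof -
  have "\<Omega> = (\<Inter>i. {x. A (x i) (x (Suc i)) = 1})" by (auto simp: Omega_iff)
  moreover have "closed {x. A (x i) (x (Suc i)) = 1}" for i
    by (intro closed_Collect_eq cont_A continuous_on_const) simp_all
  ultimately show ?thesis by (simp add: closed_INT)
qed

lemma compact_Omega: "compact \<Omega>"
proof -
  have "compact_space (product_topology (\<lambda>_::nat. euclidean :: 'a topology) UNIV)"
    unfolding compact_space_product_topology using compact_E
    by (auto simp: compact_space_def simp del: euclidean_product_topology)
  then have "compact (UNIV :: (nat \<Rightarrow> 'a) set)"
    by (simp add: euclidean_product_topology compact_space_def)
  then show ?thesis using closed_Omega compact_Int_closed by fastforce
qed

lemma path_ex: "\<exists>N\<ge>1. \<forall>a b. \<exists>z. z 0 = a \<and> z N = b \<and> (\<forall>i<N. A (z i) (z (Suc i)) = 1)"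
proof -
  have "A (z i) (z (Suc i)) = 1" if "(\<Prod>i<n. A (z i) (z (Suc i))) = 1" "i < n" for z :: "nat \<Rightarrow> 'a" and i n
  proof (rule ccontr)
    assume "A (z i) (z (Suc i)) \<noteq> 1"
    then have "A (z i) (z (Suc i)) = 0" using A_values[of "z i" "z (Suc i)"] by auto
    then have "(\<Prod>i<n. A (z i) (z (Suc i))) = 0" using that(2) by (intro prod_zero) auto
    with that(1) show False by simp
  qed
  then show ?thesis using A_mixing by (meson order_refl)
qed

text \<open>A mixing time; it becomes the \<open>n0\<close> of the cone theorem.\<close>

definition NN :: nat where
  "NN = (SOME N. N \<ge> 1 \<and> (\<forall>a b. \<exists>z. z 0 = a \<and> z N = b \<and> (\<forall>i<N. A (z i) (z (Suc i)) = 1)))"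

lemma NN: "NN \<ge> 1" "\<exists>z. z 0 = a \<and> z NN = b \<and> (\<forall>i<NN. A (z i) (z (Suc i)) = 1)"
  using someI_ex[OF path_ex, folded NN_def] by auto

lemma Omega_nonempty: "\<Omega> \<noteq> {}"
proof -
  have "\<exists>b. A a b = 1" for a
  proof -
    obtain z where z: "z 0 = a" "\<forall>i<NN. A (z i) (z (Suc i)) = 1" using NN(2)[of a a] by blast
    have "0 < NN" using NN(1) by simp
    with z have "A (z 0) (z (Suc 0)) = 1" by blast
    then show ?thesis using z(1) by auto
  qed
  then obtain s where s: "\<And>a. A a (s a) = 1" by metis
  have "(\<lambda>n. (s ^^ n) undefined) \<in> \<Omega>" by (simp add: Omega_iff s)
  then show ?thesis by blast
qed

definition x0 :: "nat \<Rightarrow> 'a" where "x0 = (SOME x. x \<in> \<Omega>)"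

lemma x0: "x0 \<in> \<Omega>"
  unfolding x0_def using Omega_nonempty by (simp add: some_in_eq)

definition diam :: real where "diam = (SOME D. 0 < D \<and> (\<forall>a b :: 'a. dist a b \<le> D))"

lemma diam: "0 < diam" "dist (a :: 'a) b \<le> diam"
proof -
  obtain D where D: "dist a b \<le> D" for a b :: 'a
    using compact_imp_bounded[OF compact_E] by (meson UNIV_I bounded_two_points)
  then have "\<exists>D>0. \<forall>a b :: 'a. dist a b \<le> D" by (intro exI[of _ "max D 1"]) (auto intro: max.coboundedI1)
  from someI_ex[OF this, folded diam_def] show "0 < diam" "dist a b \<le> diam" by auto
qed

lemma sum_half: "(\<lambda>n. c / 2 ^ (n + 1)) sums (c :: real)"
proof -
  have "(\<lambda>n. c / 2 * (1 / 2) ^ n) sums (c / 2 * (1 / (1 - 1 / 2)))"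
    by (intro sums_mult geometric_sums) simp
  then show ?thesis by (simp add: power_divide)
qed

lemmas summable_d = summable_dOmega[OF compact_E]

lemma d_nonneg: "0 \<le> dOmega x (y :: nat \<Rightarrow> 'a)"
  unfolding dOmega_def by (intro suminf_nonneg summable_d) simp

lemma d_refl [simp]: "dOmega x (x :: nat \<Rightarrow> 'a) = 0"
  by (simp add: dOmega_def)

lemma d_sym: "dOmega x (y :: nat \<Rightarrow> 'a) = dOmega y x"
  by (simp add: dOmega_def dist_commute)

lemma d_le_diam: "dOmega x (y :: nat \<Rightarrow> 'a) \<le> diam"
proof -
  have "dOmega x y \<le> (\<Sum>n. diam / 2 ^ (n + 1))"
    unfolding dOmega_def using diam sum_half[of diam]
    by (intro suminf_le summable_d) (auto simp: sums_iff divide_right_mono)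
  then show ?thesis using sum_half[of diam] by (simp add: sums_iff)
qed

lemma dist_0_le_d: "dist (x 0) (y 0 :: 'a) \<le> 2 * dOmega x y"
  using sum_le_suminf[OF summable_d, of "{0}" x y] by (simp add: dOmega_def)

text \<open>The source of all contraction: matching preimages are twice as close.\<close>

lemma d_cons: "dOmega (cons t x) (cons t y) = dOmega x (y :: nat \<Rightarrow> 'a) / 2"
proof -
  have "dOmega (cons t x) (cons t y) = (\<Sum>n. dist (cons t x (Suc n)) (cons t y (Suc n)) / 2 ^ (Suc n + 1))"
    unfolding dOmega_def using suminf_split_head[OF summable_d, of "cons t x" "cons t y"] by simp
  also have "\<dots> = (\<Sum>n. (1 / 2) * (dist (x n) (y n) / 2 ^ (n + 1)))" by simp
  also have "\<dots> = (1 / 2) * dOmega x y"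
    unfolding dOmega_def by (rule suminf_mult[OF summable_d])
  finally show ?thesis by simp
qed

text \<open>Uniform continuity with tolerance 1 is enough, since two values in {0, 1} less than 1
  apart agree.\<close>

lemma A_locally_constant: "\<exists>\<delta>>0. \<forall>a b c. dist a b < \<delta> \<longrightarrow> A a c = A b c \<and> A c a = A c b"
proof -
  have "compact (UNIV :: ('a \<times> 'a) set)"
    using compact_Times[OF compact_E compact_E] by simp
  from compact_uniformly_continuous[OF A_continuous this]
  obtain \<delta> where \<delta>: "\<delta> > 0" "\<And>p q :: 'a \<times> 'a. dist p q < \<delta> \<Longrightarrow> dist (A (fst p) (snd p)) (A (fst q) (snd q)) < 1"
    unfolding uniformly_continuous_on_def by (metis UNIV_I case_prod_beta' dist_commute zero_less_one)
  have eq: "A a b = A a' b'" if "dist (A a b) (A a' b') < 1" for a b a' b'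
    using that A_values[of a b] A_values[of a' b'] by (auto simp: dist_real_def)
  have "A a c = A b c \<and> A c a = A c b" if "dist a b < \<delta>" for a b c
    using \<delta>(2)[of "(a, c)" "(b, c)"] \<delta>(2)[of "(c, a)" "(c, b)"] that
    by (auto simp: dist_Pair_Pair intro!: eq)
  then show ?thesis using \<delta>(1) by blast
qed

definition \<delta>0 :: real where
  "\<delta>0 = (SOME \<delta>. \<delta> > 0 \<and> (\<forall>a b c. dist a b < \<delta> \<longrightarrow> A a c = A b c \<and> A c a = A c b))"

lemma \<delta>0: "\<delta>0 > 0" "dist a b < \<delta>0 \<Longrightarrow> A a c = A b c" "dist a b < \<delta>0 \<Longrightarrow> A c a = A c b"
  using someI_ex[OF A_locally_constant, folded \<delta>0_def] by auto

text \<open>Finitely many balls of radius \<open>\<delta>0 / 2\<close> cover the space, and their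
  measures have a positive minimum by full support; every ball of radius \<open>\<delta>0\<close>
  contains one of them.\<close>

lemma ball_measure: "\<exists>r>0. \<forall>p. r \<le> measure \<rho> (ball p \<delta>0)"
proof -
  interpret prob_space \<rho> by (rule prob)
  have "UNIV \<subseteq> (\<Union>p\<in>UNIV. ball p (\<delta>0 / 2))" using \<delta>0(1) by auto
  then obtain C where C: "finite C" "(UNIV :: 'a set) \<subseteq> (\<Union>p\<in>C. ball p (\<delta>0 / 2))"
    using compactE_image[OF compact_E, of UNIV "\<lambda>p. ball p (\<delta>0 / 2)"] by (metis open_ball)
  then have Cne: "C \<noteq> {}" by auto
  define r where "r = Min ((\<lambda>p. measure \<rho> (ball p (\<delta>0 / 2))) ` C)"
  have "0 < r" unfolding r_def using C Cne \<delta>0(1)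
    by (auto simp: Min_gr_iff intro!: full_support)
  moreover have "r \<le> measure \<rho> (ball p \<delta>0)" for p
  proof -
    have "p \<in> (\<Union>p\<in>C. ball p (\<delta>0 / 2))" using C(2) by blast
    then obtain q where q: "q \<in> C" "p \<in> ball q (\<delta>0 / 2)" by blast
    have "r \<le> measure \<rho> (ball q (\<delta>0 / 2))" unfolding r_def using C q by (intro Min_le) auto
    also have "\<dots> \<le> measure \<rho> (ball p \<delta>0)"
    proof (rule finite_measure_mono)
      show "ball q (\<delta>0 / 2) \<subseteq> ball p \<delta>0"
      proof
        fix y assume "y \<in> ball q (\<delta>0 / 2)"
        then show "y \<in> ball p \<delta>0" using q dist_triangle[of p y q]
          by (simp add: dist_commute)
      qed
    qed (simp add: borel)
    finally show ?thesis .
  qed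
  ultimately show ?thesis by blast
qed

definition r0 :: real where "r0 = (SOME r. r > 0 \<and> (\<forall>p. r \<le> measure \<rho> (ball p \<delta>0)))"

lemma r0: "0 < r0" "r0 \<le> measure \<rho> (ball p \<delta>0)"
  using someI_ex[OF ball_measure, folded r0_def] by auto

subsection \<open>Continuous and Lipschitz functions\<close>

lemma C0_D: "f \<in> C0 A \<Longrightarrow> continuous_on \<Omega> f" "f \<in> C0 A \<Longrightarrow> x \<notin> \<Omega> \<Longrightarrow> f x = 0"
  by (auto simp: C0_def)

lemma C0_I: "continuous_on \<Omega> f \<Longrightarrow> (\<And>x. x \<notin> \<Omega> \<Longrightarrow> f x = 0) \<Longrightarrow> f \<in> C0 A"
  by (auto simp: C0_def)

lemma C0_bdd: "f \<in> C0 A \<Longrightarrow> bdd_above ((\<lambda>x. \<bar>f x\<bar>) ` \<Omega>)"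
  by (intro bounded_imp_bdd_above compact_imp_bounded compact_continuous_image compact_Omega
      continuous_on_rabs C0_D)

lemma abs_le_sup: 
  assumes f: "f \<in> C0 A" shows "\<bar>f x\<bar> \<le> sup_norm A f"
proof -
  have *: "\<bar>f x\<bar> \<le> sup_norm A f" if "x \<in> \<Omega>" for x
    unfolding sup_norm_def by (rule cSUP_upper[OF that C0_bdd[OF f]])
  show ?thesis
  proof (cases "x \<in> \<Omega>")
    case False
    then show ?thesis using *[OF x0] C0_D(2)[OF f] by simp
  qed (rule *)
qed

lemma sup_le: "(\<And>x. x \<in> \<Omega> \<Longrightarrow> \<bar>f x\<bar> \<le> c) \<Longrightarrow> sup_norm A f \<le> c"
  unfolding sup_norm_def by (rule cSUP_least[OF Omega_nonempty])

lemma subspace_C0: "subspace (C0 A)"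
  unfolding subspace_def
  by (auto intro!: C0_I continuous_intros simp: C0_D plus_fun_def zero_fun_def scaleR_fun_def)

sublocale C0: fun_space "C0 A" "sup_norm A"
proof
  show "sup_norm A (f + g) \<le> sup_norm A f + sup_norm A g" if "f \<in> C0 A" "g \<in> C0 A" for f g
    by (rule sup_le) (use abs_le_sup[OF that(1)] abs_le_sup[OF that(2)] in
      \<open>auto intro!: order_trans[OF abs_triangle_ineq] add_mono\<close>)
  show "sup_norm A (c *\<^sub>R f) \<le> \<bar>c\<bar> * sup_norm A f" if "f \<in> C0 A" for f c
    by (rule sup_le) (use abs_le_sup[OF that] in \<open>auto simp: abs_mult intro!: mult_left_mono\<close>)
  fix F :: "nat \<Rightarrow> (nat \<Rightarrow> 'a) \<Rightarrow> real"
  assume F: "\<And>k. F k \<in> C0 A" and sm: "summable (\<lambda>k. sup_norm A (F k))"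
  have le: "norm (F k x) \<le> sup_norm A (F k)" for k x using abs_le_sup[OF F] by simp
  have "uniform_limit \<Omega> (\<lambda>n x. \<Sum>k<n. F k x) (\<lambda>x. \<Sum>k. F k x) sequentially"
    by (rule Weierstrass_m_test[OF le sm])
  then have "continuous_on \<Omega> (\<lambda>x. \<Sum>k. F k x)"
    by (rule uniform_limit_theorem[rotated])
      (auto intro!: always_eventually continuous_intros C0_D[OF F])
  then have "(\<lambda>x. \<Sum>k. F k x) \<in> C0 A"
    by (intro C0_I) (auto simp: C0_D(2)[OF F])
  moreover have "sup_norm A (\<lambda>x. \<Sum>k. F k x) \<le> (\<Sum>k. sup_norm A (F k))"
  proof (rule sup_le)
    fix x
    show "\<bar>\<Sum>k. F k x\<bar> \<le> (\<Sum>k. sup_norm A (F k))"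
      using norm_suminf_le[OF le[of _ x] sm] by simp
  qed
  ultimately show "(\<lambda>x. \<Sum>k. F k x) \<in> C0 A \<and> sup_norm A (\<lambda>x. \<Sum>k. F k x) \<le> (\<Sum>k. sup_norm A (F k))"
    by blast
qed (use subspace_C0 abs_le_sup in auto)

definition lip :: "((nat \<Rightarrow> 'a) \<Rightarrow> real) \<Rightarrow> real" where "lip f = Inf (lip_bounds A f)"

text \<open>Each difference quotient is a lower bound of the set of Lipschitz constants, hence at
  most its infimum. For points at distance 0 any member of the set already forces equal
  values.\<close>

lemma Lip1_D:
  assumes f: "f \<in> Lip1 A"
  shows "0 \<le> lip f" "x \<in> \<Omega> \<Longrightarrow> y \<in> \<Omega> \<Longrightarrow> \<bar>f x - f y\<bar> \<le> lip f * dOmega x y"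
    "x \<notin> \<Omega> \<Longrightarrow> f x = 0" "f \<in> C0 A"
proof -
  have ne: "lip_bounds A f \<noteq> {}" using f by (simp add: Lip1_def)
  show l0: "0 \<le> lip f" unfolding lip_def by (rule cInf_greatest[OF ne]) (simp add: lip_bounds_def)
  show lip: "\<bar>f x - f y\<bar> \<le> lip f * dOmega x y" if "x \<in> \<Omega>" "y \<in> \<Omega>" for x y
  proof (cases "dOmega x y = 0")
    case True
    then show ?thesis using ne that by (force simp: lip_bounds_def)
  next
    case False
    then have p: "dOmega x y > 0" using d_nonneg[of x y] by linarith
    have "\<bar>f x - f y\<bar> / dOmega x y \<le> lip f"
      unfolding lip_def
      by (rule cInf_greatest[OF ne]) (use p that in \<open>auto simp: lip_bounds_def field_simps\<close>)
    then show ?thesis using p by (simp add: field_simps)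
  qed
  show z: "f x = 0" if "x \<notin> \<Omega>" for x using f that by (simp add: Lip1_def)
  show "f \<in> C0 A"
  proof (rule C0_I[OF _ z])
    show "continuous_on \<Omega> f"
      unfolding continuous_on_def
    proof
      fix x assume x: "x \<in> \<Omega>"
      have "(dOmega x \<longlongrightarrow> dOmega x x) (at x within \<Omega>)"
        using continuous_dOmega[OF compact_E, of x] continuous_on_subset subset_UNIV x
        unfolding continuous_on_def by (meson iso_tuple_UNIV_I tendsto_within_subset)
      then have l: "((\<lambda>y. lip f * dOmega x y) \<longlongrightarrow> 0) (at x within \<Omega>)"
        using tendsto_mult_right_zero by simp
      have "((\<lambda>y. f y - f x) \<longlongrightarrow> 0) (at x within \<Omega>)"
      proof (rule Lim_null_comparison[OF _ l])
        show "\<forall>\<^sub>F y in at x within \<Omega>. norm (f y - f x) \<le> lip f * dOmega x y"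
          unfolding eventually_at_filter using lip[OF x]
          by (intro always_eventually) (auto simp: abs_minus_commute)
      qed
      then show "(f \<longlongrightarrow> f x) (at x within \<Omega>)" by (rule LIM_zero_cancel)
    qed
  qed
qed

lemma lip_norm_eq: "lip_norm A f = sup_norm A f + lip f"
  by (simp add: lip_norm_def lip_def)

lemma Lip1_I:
  assumes "\<And>x. x \<notin> \<Omega> \<Longrightarrow> f x = 0" "0 \<le> l"
    and "\<And>x y. x \<in> \<Omega> \<Longrightarrow> y \<in> \<Omega> \<Longrightarrow> \<bar>f x - f y\<bar> \<le> l * dOmega x y"
  shows "f \<in> Lip1 A" "lip f \<le> l"
proof -
  have l: "l \<in> lip_bounds A f" using assms by (simp add: lip_bounds_def)
  then show "f \<in> Lip1 A" using assms(1) by (auto simp: Lip1_def)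
  show "lip f \<le> l" unfolding lip_def
    by (rule cInf_lower[OF l]) (auto intro!: bdd_belowI[of _ 0] simp: lip_bounds_def)
qed

lemma lip_norm_le:
  assumes "\<And>x. x \<notin> \<Omega> \<Longrightarrow> f x = 0" "0 \<le> l" "\<And>x. x \<in> \<Omega> \<Longrightarrow> \<bar>f x\<bar> \<le> s"
    and "\<And>x y. x \<in> \<Omega> \<Longrightarrow> y \<in> \<Omega> \<Longrightarrow> \<bar>f x - f y\<bar> \<le> l * dOmega x y"
  shows "lip_norm A f \<le> s + l"
  unfolding lip_norm_eq using Lip1_I(2)[of f l, OF assms(1,2,4)] sup_le[of f s, OF assms(3)] by linarith

lemma sup_le_lip_norm: "f \<in> Lip1 A \<Longrightarrow> sup_norm A f \<le> lip_norm A f"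
  using Lip1_D(1) by (simp add: lip_norm_eq)

lemma abs_le_lip_norm: "f \<in> Lip1 A \<Longrightarrow> \<bar>f x\<bar> \<le> lip_norm A f"
  using sup_le_lip_norm abs_le_sup[OF Lip1_D(4), of f x] by fastforce

lemma Lip1_add:
  assumes f: "f \<in> Lip1 A" and g: "g \<in> Lip1 A"
  shows "f + g \<in> Lip1 A" "lip (f + g) \<le> lip f + lip g"
proof -
  have *: "\<bar>(f + g) x - (f + g) y\<bar> \<le> (lip f + lip g) * dOmega x y" if "x \<in> \<Omega>" "y \<in> \<Omega>" for x y
    using Lip1_D(2)[OF f that] Lip1_D(2)[OF g that] by (simp add: algebra_simps)
  show "f + g \<in> Lip1 A" "lip (f + g) \<le> lip f + lip g"
    by (rule Lip1_I[OF _ _ *]; simp add: Lip1_D f g)+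
qed

lemma Lip1_scale:
  assumes f: "f \<in> Lip1 A"
  shows "c *\<^sub>R f \<in> Lip1 A" "lip (c *\<^sub>R f) \<le> \<bar>c\<bar> * lip f"
proof -
  have *: "\<bar>(c *\<^sub>R f) x - (c *\<^sub>R f) y\<bar> \<le> (\<bar>c\<bar> * lip f) * dOmega x y" if "x \<in> \<Omega>" "y \<in> \<Omega>" for x y
    using mult_left_mono[OF Lip1_D(2)[OF f that], of "\<bar>c\<bar>"]
    by (simp add: abs_mult[symmetric] right_diff_distrib mult.assoc)
  show "c *\<^sub>R f \<in> Lip1 A" "lip (c *\<^sub>R f) \<le> \<bar>c\<bar> * lip f"
    by (rule Lip1_I[OF _ _ *]; simp add: Lip1_D f)+
qed

lemma subspace_Lip1: "subspace (Lip1 A)"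
  unfolding subspace_def
proof (intro conjI ballI allI)
  show "0 \<in> Lip1 A" by (rule Lip1_I[of _ 0]) auto
qed (auto intro: Lip1_add Lip1_scale)

sublocale Lip: fun_space "Lip1 A" "lip_norm A"
proof
  show "lip_norm A (f + g) \<le> lip_norm A f + lip_norm A g" if "f \<in> Lip1 A" "g \<in> Lip1 A" for f g
    using C0.N_triangle[of f g] Lip1_add[OF that] that by (simp add: Lip1_D lip_norm_eq)
  show "lip_norm A (c *\<^sub>R f) \<le> \<bar>c\<bar> * lip_norm A f" if "f \<in> Lip1 A" for f c
    using C0.N_scale[of f c] Lip1_scale[OF that] that by (simp add: Lip1_D lip_norm_eq distrib_left add_mono)
  fix F :: "nat \<Rightarrow> (nat \<Rightarrow> 'a) \<Rightarrow> real"
  assume F: "\<And>k. F k \<in> Lip1 A" and sm: "summable (\<lambda>k. lip_norm A (F k))"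
  have s1: "summable (\<lambda>k. sup_norm A (F k))"
    by (rule summable_comparison_test'[OF sm])
      (use F Lip1_D sup_le_lip_norm C0.N_nonneg in auto)
  have s2: "summable (\<lambda>k. lip (F k))"
    by (rule summable_comparison_test'[OF sm])
      (use F Lip1_D(1) C0.N_nonneg[OF Lip1_D(4)] in \<open>auto simp: lip_norm_eq\<close>)
  have FC: "F k \<in> C0 A" for k by (rule Lip1_D(4)[OF F])
  have sx: "summable (\<lambda>k. F k x)" for x
    by (rule summable_comparison_test'[OF s1]) (use abs_le_sup[OF FC] in auto)
  have l: "\<bar>(\<Sum>k. F k x) - (\<Sum>k. F k y)\<bar> \<le> (\<Sum>k. lip (F k)) * dOmega x y" if "x \<in> \<Omega>" "y \<in> \<Omega>" for x y
  proof -
    have "(\<Sum>k. F k x) - (\<Sum>k. F k y) = (\<Sum>k. F k x - F k y)" by (rule suminf_diff[OF sx sx])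
    also have "\<bar>\<dots>\<bar> \<le> (\<Sum>k. lip (F k) * dOmega x y)"
      using norm_suminf_le[of "\<lambda>k. F k x - F k y" "\<lambda>k. lip (F k) * dOmega x y"]
        Lip1_D(2)[OF F that] summable_mult2[OF s2] by simp
    also have "\<dots> = (\<Sum>k. lip (F k)) * dOmega x y" by (rule suminf_mult2[OF s2, symmetric])
    finally show ?thesis .
  qed
  have "(\<lambda>x. \<Sum>k. F k x) \<in> Lip1 A" "lip (\<lambda>x. \<Sum>k. F k x) \<le> (\<Sum>k. lip (F k))"
    by (rule Lip1_I[OF _ _ l]; simp add: Lip1_D[OF F] suminf_nonneg s2)+
  moreover have "(\<Sum>k. lip_norm A (F k)) = (\<Sum>k. sup_norm A (F k)) + (\<Sum>k. lip (F k))"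
    unfolding lip_norm_eq by (rule suminf_add[OF s1 s2, symmetric])
  ultimately show "(\<lambda>x. \<Sum>k. F k x) \<in> Lip1 A \<and> lip_norm A (\<lambda>x. \<Sum>k. F k x) \<le> (\<Sum>k. lip_norm A (F k))"
    using conjunct2[OF C0.N_complete[OF FC s1]] by (simp add: lip_norm_eq)
qed (use subspace_Lip1 abs_le_lip_norm in auto)

text \<open>The cross terms of the product rule are part of the product of the norms; this Banach
  algebra property supports products of smooth families.\<close>

lemma Lip1_mult:
  assumes f: "f \<in> Lip1 A" and g: "g \<in> Lip1 A"
  shows "f * g \<in> Lip1 A" "lip_norm A (f * g) \<le> lip_norm A f * lip_norm A g"
proof -
  let ?a = "sup_norm A f" and ?b = "sup_norm A g"
  have nn: "0 \<le> ?a" "0 \<le> ?b" "0 \<le> lip f" "0 \<le> lip g"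
    using C0.N_nonneg Lip1_D f g by auto
  have fx: "\<bar>f x\<bar> \<le> ?a" and gx: "\<bar>g x\<bar> \<le> ?b" for x using abs_le_sup Lip1_D f g by auto
  have *: "\<bar>(f * g) x - (f * g) y\<bar> \<le> (?a * lip g + lip f * ?b) * dOmega x y" if "x \<in> \<Omega>" "y \<in> \<Omega>" for x y
  proof -
    have "(f * g) x - (f * g) y = f x * (g x - g y) + (f x - f y) * g y" by (simp add: algebra_simps)
    also have "\<bar>\<dots>\<bar> \<le> \<bar>f x\<bar> * \<bar>g x - g y\<bar> + \<bar>f x - f y\<bar> * \<bar>g y\<bar>"
      by (metis abs_mult abs_triangle_ineq)
    also have "\<dots> \<le> ?a * (lip g * dOmega x y) + (lip f * dOmega x y) * ?b"
      using Lip1_D(2)[OF f that] Lip1_D(2)[OF g that] fx gx nn d_nonneg[of x y]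
      by (intro add_mono mult_mono) auto
    finally show ?thesis by (simp add: algebra_simps)
  qed
  have m: "\<bar>(f * g) x\<bar> \<le> ?a * ?b" for x
    using fx[of x] gx[of x] nn by (auto simp: abs_mult intro!: mult_mono)
  show "f * g \<in> Lip1 A"
    by (rule Lip1_I(1)[OF _ _ *]) (use nn in \<open>auto simp: Lip1_D f\<close>)
  have "lip_norm A (f * g) \<le> ?a * ?b + (?a * lip g + lip f * ?b)"
    by (rule lip_norm_le[OF _ _ m *]) (use nn in \<open>auto simp: Lip1_D f\<close>)
  also have "\<dots> \<le> lip_norm A f * lip_norm A g"
    using nn mult_nonneg_nonneg[OF nn(3,4)] by (simp add: lip_norm_eq algebra_simps)
  finally show "lip_norm A (f * g) \<le> lip_norm A f * lip_norm A g" .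
qed

text \<open>The constant 1 under the convention that functions vanish outside
  \<open>\<Omega>\<close>: the unit for multiplication and the order unit of the cones.\<close>

definition e :: "(nat \<Rightarrow> 'a) \<Rightarrow> real" where "e x = (if x \<in> \<Omega> then 1 else 0)"

lemma e_Lip1: "e \<in> Lip1 A" "lip_norm A (c *\<^sub>R e) = \<bar>c\<bar>"
proof -
  show 1: "e \<in> Lip1 A" by (rule Lip1_I[of _ 0]) (auto simp: e_def)
  have "lip_norm A (c *\<^sub>R e) \<le> \<bar>c\<bar> + 0" by (rule lip_norm_le) (auto simp: e_def)
  moreover have "\<bar>c\<bar> \<le> lip_norm A (c *\<^sub>R e)"
    using abs_le_lip_norm[OF Lip1_scale(1)[OF 1, of c], of x0] x0 by (simp add: e_def)
  ultimately show "lip_norm A (c *\<^sub>R e) = \<bar>c\<bar>" by simp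
qed

lemma e_x0 [simp]: "e x0 = 1"
  using x0 by (simp add: e_def)

lemma e_mult: "f \<in> C0 A \<Longrightarrow> e * f = f"
  by (auto simp: fun_eq_iff e_def C0_D)

definition Exp :: "((nat \<Rightarrow> 'a) \<Rightarrow> real) \<Rightarrow> (nat \<Rightarrow> 'a) \<Rightarrow> real" where
  "Exp f x = (if x \<in> \<Omega> then exp (f x) else 0)"

lemma Exp_C0: "f \<in> C0 A \<Longrightarrow> Exp f \<in> C0 A"
proof (rule C0_I)
  assume f: "f \<in> C0 A"
  have "continuous_on \<Omega> (\<lambda>x. exp (f x))" by (intro continuous_intros C0_D f)
  then show "continuous_on \<Omega> (Exp f)" by (rule continuous_on_cong[THEN iffD1, rotated -1]) (auto simp: Exp_def)
qed (simp add: Exp_def)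

subsection \<open>The averaging operator\<close>

text \<open>Since \<open>A\<close> has values 0 and 1 and functions vanish outside \<open>\<Omega>\<close>, the weight \<open>A t (\<omega> 0)\<close> in the
  transfer operator can be dropped.\<close>

definition avg :: "((nat \<Rightarrow> 'a) \<Rightarrow> real) \<Rightarrow> (nat \<Rightarrow> 'a) \<Rightarrow> real" where
  "avg g x = (if x \<in> \<Omega> then \<integral>t. g (cons t x) \<partial>\<rho> else 0)"

lemma shift_cons [simp]: "shift (cons t x) = x"
  by (simp add: shift_def)

text \<open>Extension by 0 creates no discontinuity: whether \<open>cons t x\<close> is admissible
  depends on \<open>A t (x 0)\<close>, which has two values, so the domain splits into two closed
  pieces, with a composition on one and 0 on the other.\<close>

lemma cont_cons:
  assumes g: "g \<in> C0 A"
  shows "continuous_on (UNIV \<times> \<Omega>) (\<lambda>p. g (cons (fst p) (snd p)))"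
proof -
  define S1 where "S1 = {p \<in> UNIV \<times> \<Omega>. A (fst p) (snd p 0) = 1}"
  define S2 where "S2 = {p \<in> UNIV \<times> \<Omega>. A (fst p) (snd p 0) = 0}"
  have U: "S1 \<union> S2 = UNIV \<times> \<Omega>" using A_values by (auto simp: S1_def S2_def)
  have c0: "continuous_on (UNIV \<times> \<Omega>) (\<lambda>p. A (fst p) (snd p 0))"
    by (rule cont_A[OF continuous_on_fst[OF continuous_on_id]
          continuous_on_product_then_coordinatewise[OF continuous_on_snd[OF continuous_on_id]]])
  have cl: "closedin (top_of_set (S1 \<union> S2)) S1" "closedin (top_of_set (S1 \<union> S2)) S2"
    unfolding U unfolding S1_def S2_def
    using continuous_closedin_preimage_constant[OF c0, of 1] continuous_closedin_preimage_constant[OF c0, of 0] by auto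
  have in1: "p \<in> S1 \<Longrightarrow> cons (fst p) (snd p) \<in> \<Omega>" for p
    using cons_in_iff by (auto simp: S1_def)
  have out2: "p \<in> S2 \<Longrightarrow> cons (fst p) (snd p) \<notin> \<Omega>" for p
    using cons_in_iff by (auto simp: S2_def)
  have cc: "continuous_on S1 (\<lambda>p. cons (fst p) (snd p))"
  proof (rule continuous_on_coordinatewise_then_product)
    fix i show "continuous_on S1 (\<lambda>p. cons (fst p) (snd p) i)"
    proof (cases i)
      case 0
      then show ?thesis by (simp add: continuous_on_fst[OF continuous_on_id])
    next
      case (Suc j)
      then show ?thesis
        using continuous_on_product_then_coordinatewise[OF continuous_on_snd[OF continuous_on_id], of S1 j] by simp
    qed
  qed
  have "continuous_on S1 (\<lambda>p. g (cons (fst p) (snd p)))"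
    by (rule continuous_on_compose2[OF C0_D(1)[OF g] cc]) (use in1 in auto)
  moreover have "continuous_on S2 (\<lambda>p. g (cons (fst p) (snd p)))"
    using continuous_on_const[of S2 0] by (rule continuous_on_eq) (auto simp: C0_D(2)[OF g out2])
  ultimately show ?thesis using continuous_on_Un_local[OF cl] U by simp
qed

lemma cons_measurable:
  assumes g: "g \<in> C0 A" and x: "x \<in> \<Omega>"
  shows "(\<lambda>t. g (cons t x)) \<in> borel_measurable \<rho>"
proof -
  have "continuous_on UNIV (\<lambda>t. (t, x))" by (intro continuous_intros)
  then have "continuous_on UNIV (\<lambda>t. g (cons t x))"
    using continuous_on_compose2[OF cont_cons[OF g], of UNIV "\<lambda>t. (t, x)"] x by auto
  then have "(\<lambda>t. g (cons t x)) \<in> borel_measurable borel" by (rule borel_measurable_continuous_onI)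
  then show ?thesis using measurable_cong_sets[OF borel refl] by blast
qed

lemma cons_integrable:
  assumes g: "g \<in> C0 A" and x: "x \<in> \<Omega>"
  shows "integrable \<rho> (\<lambda>t. g (cons t x))"
proof -
  interpret prob_space \<rho> by (rule prob)
  show ?thesis
    by (rule integrable_const_bound[OF _ cons_measurable[OF assms], of "sup_norm A g"])
      (use abs_le_sup[OF g] in auto)
qed

lemma avg_C0:
  assumes g: "g \<in> C0 A" shows "avg g \<in> C0 A"
proof (rule C0_I)
  interpret prob_space \<rho> by (rule prob)
  show "continuous_on \<Omega> (avg g)"
    unfolding continuous_on_sequentially
  proof (intro allI ballI impI, elim conjE)
    fix X x assume x: "x \<in> \<Omega>" and X: "\<forall>n::nat. X n \<in> \<Omega>" and lim: "X \<longlonglongrightarrow> x"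
    have "(\<lambda>n. g (cons t (X n))) \<longlonglongrightarrow> g (cons t x)" for t
    proof -
      have "continuous_on \<Omega> (\<lambda>y. (t, y))" by (intro continuous_intros)
      then have "continuous_on \<Omega> (\<lambda>y. g (cons t y))"
        using continuous_on_compose2[OF cont_cons[OF g], of \<Omega> "\<lambda>y. (t, y)"] by auto
      then show ?thesis using x X lim unfolding continuous_on_sequentially by (auto simp: o_def)
    qed
    then have "(\<lambda>n. \<integral>t. g (cons t (X n)) \<partial>\<rho>) \<longlonglongrightarrow> (\<integral>t. g (cons t x) \<partial>\<rho>)"
      using x X abs_le_sup[OF g]
      by (intro integral_dominated_convergence[where w = "\<lambda>_. sup_norm A g"] cons_measurable g) auto
    then show "(avg g \<circ> X) \<longlonglongrightarrow> avg g x" using x X by (simp add: avg_def o_def)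
  qed
qed (simp add: avg_def)

lemma avg_add: "f \<in> C0 A \<Longrightarrow> g \<in> C0 A \<Longrightarrow> avg (f + g) = avg f + avg g"
  by (auto simp: avg_def fun_eq_iff cons_integrable)

lemma avg_scale: "avg (c *\<^sub>R f) = c *\<^sub>R avg f"
  by (auto simp: avg_def fun_eq_iff)

lemma avg_diff: "f \<in> C0 A \<Longrightarrow> g \<in> C0 A \<Longrightarrow> avg (f - g) = avg f - avg g"
  by (auto simp: avg_def fun_eq_iff cons_integrable)

lemma avg_mono:
  assumes "f \<in> C0 A" "g \<in> C0 A" "\<And>x. x \<in> \<Omega> \<Longrightarrow> f x \<le> g x"
  shows "avg f x \<le> avg g x"
proof -
  have "f y \<le> g y" for y
    using assms C0_D(2)[OF assms(1), of y] C0_D(2)[OF assms(2), of y] by (cases "y \<in> \<Omega>") auto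
  then show ?thesis
    using integral_mono[OF cons_integrable[OF assms(1)] cons_integrable[OF assms(2)], of x x]
    by (simp add: avg_def)
qed

lemma avg_e_le: "avg e x \<le> 1"
proof -
  interpret prob_space \<rho> by (rule prob)
  have "(\<integral>t. e (cons t x) \<partial>\<rho>) \<le> 1" if "x \<in> \<Omega>"
    using cons_integrable[OF Lip1_D(4)[OF e_Lip1(1)] that]
      integral_mono[of \<rho> "\<lambda>t. e (cons t x)" "\<lambda>_. 1"] by (simp add: e_def prob_space)
  then show ?thesis by (simp add: avg_def)
qed

lemma avg_le:
  assumes "f \<in> C0 A" "\<And>x. x \<in> \<Omega> \<Longrightarrow> f x \<le> c" "0 \<le> c"
  shows "avg f x \<le> c"
proof -
  have "avg f x \<le> avg (c *\<^sub>R e) x"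
    using assms by (intro avg_mono[OF assms(1)] C0.V_scale Lip1_D(4) e_Lip1(1)) (auto simp: e_def)
  also have "\<dots> \<le> c" using mult_left_mono[OF avg_e_le assms(3), of x] by (simp add: avg_scale)
  finally show ?thesis .
qed

lemma avg_abs_le:
  assumes "f \<in> C0 A" "\<And>x. x \<in> \<Omega> \<Longrightarrow> \<bar>f x\<bar> \<le> c" "0 \<le> c"
  shows "\<bar>avg f x\<bar> \<le> c"
proof -
  have "avg f x \<le> c" by (rule avg_le) (use assms in \<open>force simp: abs_le_iff\<close>)+
  moreover have "avg ((-1) *\<^sub>R f) x \<le> c"
    by (rule avg_le[OF C0.V_scale[OF assms(1)] _ assms(3)]) (use assms(2) in \<open>force simp: abs_le_iff\<close>)
  ultimately  show ?thesis unfolding avg_scale by (simp add: abs_le_iff)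
qed

text \<open>Only the preimages near one point are used; the weight is the measure of a ball.\<close>

lemma avg_ge:
  assumes g: "g \<in> C0 A" and x: "x \<in> \<Omega>" and nn: "\<And>y. y \<in> \<Omega> \<Longrightarrow> 0 \<le> g y"
    and c: "\<And>t. dist t p < \<delta>0 \<Longrightarrow> c \<le> g (cons t x)" "0 \<le> c"
  shows "r0 * c \<le> avg g x"
proof -
  interpret prob_space \<rho> by (rule prob)
  have nn': "0 \<le> g y" for y using nn C0_D(2)[OF g] by (cases "y \<in> \<Omega>") auto
  have m: "ball p \<delta>0 \<in> sets \<rho>" by (simp add: borel)
  have i: "integrable \<rho> (\<lambda>t. c * indicat_real (ball p \<delta>0) t)"
    using m by (intro integrable_mult_right integrable_real_indicator) (auto simp: emeasure_eq_measure)
  have "r0 * c \<le> measure \<rho> (ball p \<delta>0) * c" using r0 c by (intro mult_right_mono) auto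
  also have "\<dots> = (\<integral>t. c * indicat_real (ball p \<delta>0) t \<partial>\<rho>)" using m by (simp add: mult.commute)
  also have "\<dots> \<le> (\<integral>t. g (cons t x) \<partial>\<rho>)"
    by (rule integral_mono[OF i cons_integrable[OF g x]])
      (use c nn' in \<open>auto simp: indicator_def dist_commute\<close>)
  finally show ?thesis using x by (simp add: avg_def)
qed

text \<open>Two regimes. For zeroth coordinates within \<open>\<delta>0\<close> the admissible
  preimages match and are twice as close. Otherwise \<open>dOmega x y\<close> is at least
  \<open>\<delta>0 / 2\<close>, and the trivial bound by twice the sup norm is absorbed by
  \<open>4 / \<delta>0\<close>.\<close>

lemma avg_Lip1:
  assumes g: "g \<in> Lip1 A"
  shows "avg g \<in> Lip1 A" "lip_norm A (avg g) \<le> (2 + 4 / \<delta>0) * lip_norm A g"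
proof -
  interpret prob_space \<rho> by (rule prob)
  note gC = Lip1_D(4)[OF g]
  let ?s = "sup_norm A g"
  have nn: "0 \<le> ?s" "0 \<le> lip g" "0 \<le> 4 / \<delta>0 * ?s"
    using C0.N_nonneg[OF gC] Lip1_D(1)[OF g] \<delta>0(1) by auto
  have s: "\<bar>avg g x\<bar> \<le> ?s" for x by (rule avg_abs_le[OF gC]) (use abs_le_sup[OF gC] nn in auto)
  have l: "\<bar>avg g x - avg g y\<bar> \<le> (lip g + 4 / \<delta>0 * ?s) * dOmega x y" if xy: "x \<in> \<Omega>" "y \<in> \<Omega>" for x y
  proof (cases "dist (x 0) (y 0) < \<delta>0")
    case True
    have "\<bar>g (cons t x) - g (cons t y)\<bar> \<le> lip g * dOmega x y" for t
    proof (cases "cons t x \<in> \<Omega>")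
      case c: True
      then have "cons t y \<in> \<Omega>" using \<delta>0(3)[OF True, of t] cons_in_iff xy by simp
      from Lip1_D(2)[OF g c this] have "\<bar>g (cons t x) - g (cons t y)\<bar> \<le> lip g * (dOmega x y / 2)"
        by (simp add: d_cons)
      also have "\<dots> \<le> lip g * dOmega x y" using nn d_nonneg[of x y] by (intro mult_left_mono) auto
      finally show ?thesis .
    next
      case c: False
      then have "cons t y \<notin> \<Omega>" using \<delta>0(3)[OF True, of t] cons_in_iff xy by simp
      with c show ?thesis using Lip1_D(3)[OF g] nn d_nonneg[of x y] by simp
    qed
    then have b: "\<bar>\<integral>t. g (cons t x) - g (cons t y) \<partial>\<rho>\<bar> \<le> (\<integral>t. lip g * dOmega x y \<partial>\<rho>)"
      using cons_integrable[OF gC] xy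
      by (intro order_trans[OF integral_abs_bound] integral_mono) auto
    have "\<bar>avg g x - avg g y\<bar> \<le> lip g * dOmega x y"
      using b cons_integrable[OF gC] xy by (simp add: avg_def prob_space)
    also have "\<dots> \<le> (lip g + 4 / \<delta>0 * ?s) * dOmega x y"
      using nn d_nonneg[of x y] by (intro mult_right_mono) auto
    finally show ?thesis .
  next
    case False
    then have d: "\<delta>0 \<le> 2 * dOmega x y" using dist_0_le_d[of x y] by linarith
    have "\<bar>avg g x - avg g y\<bar> \<le> 2 * ?s" using s[of x] s[of y] by linarith
    also have "\<dots> \<le> 4 / \<delta>0 * ?s * dOmega x y"
    proof -
      have "2 * ?s * \<delta>0 \<le> 2 * ?s * (2 * dOmega x y)" using d nn by (intro mult_left_mono) auto
      then show ?thesis using \<delta>0(1) by (simp add: field_simps)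
    qed
    also have "\<dots> \<le> (lip g + 4 / \<delta>0 * ?s) * dOmega x y"
      using nn d_nonneg[of x y] by (intro mult_right_mono) auto
    finally show ?thesis .
  qed
  have z: "avg g x = 0" if "x \<notin> \<Omega>" for x using that by (simp add: avg_def)
  have n: "0 \<le> lip g + 4 / \<delta>0 * ?s" using nn by simp
  show "avg g \<in> Lip1 A" by (rule Lip1_I(1)[OF z n l])
  have "lip_norm A (avg g) \<le> ?s + (lip g + 4 / \<delta>0 * ?s)" by (rule lip_norm_le[OF z n s l])
  also have "\<dots> \<le> lip_norm A g + 4 / \<delta>0 * lip_norm A g"
    using sup_le_lip_norm[OF g] \<delta>0(1) by (simp add: lip_norm_eq divide_right_mono)
  also have "\<dots> \<le> (2 + 4 / \<delta>0) * lip_norm A g"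
    using Lip.N_nonneg[OF g] by (simp add: algebra_simps)
  finally show "lip_norm A (avg g) \<le> (2 + 4 / \<delta>0) * lip_norm A g" .
qed

lemma transfer_eq:
  assumes f: "\<And>x. x \<notin> \<Omega> \<Longrightarrow> f x = 0"
  shows "transfer_op \<rho> A \<phi> f = avg (Exp \<phi> * f)"
proof
  fix x
  have *: "exp (\<phi> (cons t x)) * A t (x 0) * f (cons t x) = (Exp \<phi> * f) (cons t x)" if "x \<in> \<Omega>" for t
    using cons_in_iff[OF that, of t] f[of "cons t x"] by (auto simp: Exp_def)
  show "transfer_op \<rho> A \<phi> f x = avg (Exp \<phi> * f) x"
  proof (cases "x \<in> \<Omega>")
    case True
    then show ?thesis unfolding transfer_op_def avg_def *[OF True] by simp
  qed (simp add: transfer_op_def avg_def)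
qed

end

section \<open>An invariant cone for the transfer operator\<close>

lemma exp_minus_one_le: "exp u - 1 \<le> u * exp u" for u :: real
proof -
  have "1 - u \<le> exp (- u)" using exp_ge_add_one_self[of "- u"] by simp
  then have "(1 - u) * exp u \<le> exp (- u) * exp u" by (intro mult_right_mono) auto
  then show ?thesis by (simp add: exp_minus algebra_simps)
qed

lemma exp_minus_one_ge: "u \<le> exp u - 1" for u :: real
  using exp_ge_add_one_self[of u] by linarith

lemma exp_diff_le:
  fixes u v B :: real
  assumes "u \<le> B" "v \<le> B"
  shows "\<bar>exp u - exp v\<bar> \<le> exp B * \<bar>u - v\<bar>"
proof -
  have *: "exp u - exp v \<le> exp B * \<bar>u - v\<bar>" if "u \<le> B" for u v :: real
  proof -
    have "exp u * (1 + (v - u)) \<le> exp u * exp (v - u)" by (intro mult_left_mono) auto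
    also have "\<dots> = exp v" by (simp add: exp_add[symmetric])
    finally have "exp u - exp v \<le> exp u * (u - v)" by (simp add: algebra_simps)
    also have "\<dots> \<le> exp u * \<bar>u - v\<bar>" by (intro mult_left_mono) auto
    also have "\<dots> \<le> exp B * \<bar>u - v\<bar>" using that by (intro mult_right_mono) auto
    finally show ?thesis .
  qed
  show ?thesis unfolding abs_le_iff
    using *[OF assms(1), of v] *[OF assms(2), of u] by (simp add: abs_minus_commute)
qed

context shift_system
begin

text \<open>Functions with locally \<open>a\<close>-Lipschitz logarithm, compared only at pairs
  whose preimages can be matched. The multiplicative form admits zeros and is visibly stable under
  sums and pointwise limits.\<close>

definition cone :: "real \<Rightarrow> ((nat \<Rightarrow> 'a) \<Rightarrow> real) set" where
  "cone a = {f. (\<forall>x. x \<notin> \<Omega> \<longrightarrow> f x = 0) \<and> (\<forall>x\<in>\<Omega>. 0 \<le> f x) \<and>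
     (\<forall>x\<in>\<Omega>. \<forall>y\<in>\<Omega>. dist (x 0) (y 0) < \<delta>0 \<longrightarrow> f x \<le> exp (a * dOmega x y) * f y)}"

lemma cone_D:
  assumes "f \<in> cone a"
  shows "x \<notin> \<Omega> \<Longrightarrow> f x = 0" "0 \<le> f x"
    "x \<in> \<Omega> \<Longrightarrow> y \<in> \<Omega> \<Longrightarrow> dist (x 0) (y 0) < \<delta>0 \<Longrightarrow> f x \<le> exp (a * dOmega x y) * f y"
proof -
  show 1: "f x = 0" if "x \<notin> \<Omega>" for x using assms that unfolding cone_def by blast
  show "0 \<le> f x" using assms 1[of x] unfolding cone_def by (cases "x \<in> \<Omega>") auto
qed (use assms in \<open>auto simp: cone_def\<close>)

lemma cone_I:
  assumes "\<And>x. x \<notin> \<Omega> \<Longrightarrow> f x = 0" "\<And>x. x \<in> \<Omega> \<Longrightarrow> 0 \<le> f x"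
    "\<And>x y. x \<in> \<Omega> \<Longrightarrow> y \<in> \<Omega> \<Longrightarrow> dist (x 0) (y 0) < \<delta>0 \<Longrightarrow> f x \<le> exp (a * dOmega x y) * f y"
  shows "f \<in> cone a"
  using assms unfolding cone_def by auto

lemma cone_add: "f \<in> cone a \<Longrightarrow> g \<in> cone a \<Longrightarrow> f + g \<in> cone a"
  by (rule cone_I) (auto simp: cone_D distrib_left intro!: add_mono)

lemma cone_scale: "f \<in> cone a \<Longrightarrow> 0 \<le> c \<Longrightarrow> c *\<^sub>R f \<in> cone a"
proof (rule cone_I)
  fix x y assume f: "f \<in> cone a" and c: "0 \<le> c" and xy: "x \<in> \<Omega>" "y \<in> \<Omega>" "dist (x 0) (y 0) < \<delta>0"
  show "(c *\<^sub>R f) x \<le> exp (a * dOmega x y) * (c *\<^sub>R f) y"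
    using mult_left_mono[OF cone_D(3)[OF f xy] c] by (simp add: algebra_simps)
qed (auto simp: cone_D)

lemma cone_mono: "a \<le> b \<Longrightarrow> f \<in> cone a \<Longrightarrow> f \<in> cone b"
proof (rule cone_I)
  fix x y assume ab: "a \<le> b" and f: "f \<in> cone a" and xy: "x \<in> \<Omega>" "y \<in> \<Omega>" "dist (x 0) (y 0) < \<delta>0"
  have "exp (a * dOmega x y) * f y \<le> exp (b * dOmega x y) * f y"
    using ab d_nonneg[of x y] cone_D(2)[OF f, of y] by (intro mult_right_mono) (auto intro: mult_right_mono)
  with cone_D(3)[OF f xy] show "f x \<le> exp (b * dOmega x y) * f y" by linarith
qed (auto simp: cone_D)

lemma cone_closed:
  assumes F: "\<And>n::nat. F n \<in> cone a" and lim: "\<And>x. (\<lambda>n. F n x) \<longlonglongrightarrow> g x"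
  shows "g \<in> cone a"
proof (rule cone_I)
  fix x assume "x \<notin> \<Omega>"
  then have "(\<lambda>n. F n x) = (\<lambda>n. 0)" using cone_D(1)[OF F] by auto
  then show "g x = 0" using LIMSEQ_unique[OF lim[of x]] by simp
next
  fix x assume "x \<in> \<Omega>"
  show "0 \<le> g x" by (rule LIMSEQ_le_const[OF lim]) (use cone_D(2)[OF F] in auto)
next
  fix x y assume xy: "x \<in> \<Omega>" "y \<in> \<Omega>" "dist (x 0) (y 0) < \<delta>0"
  show "g x \<le> exp (a * dOmega x y) * g y"
    by (rule LIMSEQ_le[OF lim tendsto_mult_left[OF lim]]) (use cone_D(3)[OF F xy] in auto)
qed

text \<open>If \<open>f y\<close> is the smaller value, the cone inequality gives the bound with the
  factor \<open>f y\<close>, which is then enlarged to \<open>f x\<close>; so one factor serves both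
  signs of the difference.\<close>

lemma cone_diff_le:
  assumes f: "f \<in> cone a" and xy: "x \<in> \<Omega>" "y \<in> \<Omega>" "dist (x 0) (y 0) < \<delta>0" and a: "0 \<le> a"
  shows "\<bar>f x - f y\<bar> \<le> (exp (a * dOmega x y) - 1) * f x"
proof -
  let ?E = "exp (a * dOmega x y)"
  have E: "1 \<le> ?E" using a d_nonneg[of x y] by simp
  have 1: "f x \<le> ?E * f y" and 2: "f y \<le> ?E * f x"
    using cone_D(3)[OF f xy] cone_D(3)[OF f xy(2,1)] xy(3) by (simp_all add: dist_commute d_sym)
  have "f x - f y \<le> (?E - 1) * f x"
  proof -
    have "f x + f x \<le> ?E * f x + f y"
    proof (cases "f x \<le> f y")
      case True
      then show ?thesis using mult_right_mono[OF E cone_D(2)[OF f, of x]] by simp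
    next
      case False
      then have "(?E - 1) * f y \<le> (?E - 1) * f x" using E by (intro mult_left_mono) auto
      then show ?thesis using 1 by (simp add: algebra_simps)
    qed
    then show ?thesis by (simp add: algebra_simps)
  qed
  then show ?thesis using 2 by (simp add: abs_le_iff algebra_simps)
qed

lemma cone_C0:
  assumes f: "f \<in> cone a" and a: "0 \<le> a"
  shows "f \<in> C0 A"
proof (rule C0_I)
  show "continuous_on \<Omega> f"
    unfolding continuous_on_def
  proof
    fix x assume x: "x \<in> \<Omega>"
    have d: "(dOmega x \<longlongrightarrow> 0) (at x within \<Omega>)"
      using continuous_dOmega[OF compact_E, of x] d_refl[of x]
      unfolding continuous_on_def by (metis UNIV_I subset_UNIV tendsto_within_subset)
    have l: "((\<lambda>y. (exp (a * dOmega x y) - 1) * f x) \<longlongrightarrow> (exp (a * 0) - 1) * f x) (at x within \<Omega>)"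
      by (rule tendsto_mult_right[OF tendsto_diff[OF tendsto_exp[OF tendsto_mult_left[OF d]] tendsto_const]])
    have "\<forall>\<^sub>F y in at x within \<Omega>. dOmega x y < \<delta>0 / 2"
      using \<delta>0(1) by (intro order_tendstoD(2)[OF d]) simp
    moreover have "\<forall>\<^sub>F y in at x within \<Omega>. y \<in> \<Omega>" by (simp add: eventually_at_filter)
    ultimately have "\<forall>\<^sub>F y in at x within \<Omega>. norm (f y - f x) \<le> (exp (a * dOmega x y) - 1) * f x"
    proof eventually_elim
      case (elim y)
      then have "dist (x 0) (y 0) < \<delta>0" using dist_0_le_d[of x y] by linarith
      from cone_diff_le[OF f x elim(2) this a] show ?case by (simp add: abs_minus_commute)
    qed
    then have "((\<lambda>y. f y - f x) \<longlongrightarrow> 0) (at x within \<Omega>)"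
      by (rule Lim_null_comparison) (use l in simp)
    then show "(f \<longlongrightarrow> f x) (at x within \<Omega>)" by (rule LIM_zero_cancel)
  qed
qed (rule cone_D(1)[OF f])

text \<open>Price of turning a sup bound on a cone element into a bound of its Lipschitz norm: 1 for
  the sup norm, \<open>a * exp (a * diam)\<close> for near pairs, \<open>2 / \<delta>0\<close> for
  pairs with distant zeroth coordinates.\<close>

definition CK :: "real \<Rightarrow> real" where "CK a = 1 + (a * exp (a * diam) + 2 / \<delta>0)"

lemma CK_nonneg: "0 \<le> a \<Longrightarrow> 0 \<le> CK a"
  using \<delta>0(1) by (simp add: CK_def)

lemma cone_Lip1_bound:
  assumes f: "f \<in> cone a" and a: "0 \<le> a" and s: "\<And>x. x \<in> \<Omega> \<Longrightarrow> f x \<le> s"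
  shows "f \<in> Lip1 A" "lip_norm A f \<le> CK a * s"
proof -
  have s0: "0 \<le> s" using s[OF x0] cone_D(2)[OF f, of x0] by linarith
  let ?l = "(a * exp (a * diam) + 2 / \<delta>0) * s"
  have l0: "0 \<le> ?l" using a \<delta>0(1) s0 by simp
  have l: "\<bar>f x - f y\<bar> \<le> ?l * dOmega x y" if xy: "x \<in> \<Omega>" "y \<in> \<Omega>" for x y
  proof (cases "dist (x 0) (y 0) < \<delta>0")
    case True
    let ?d = "dOmega x y"
    have ad: "a * ?d \<le> a * diam" using a d_le_diam by (intro mult_left_mono) auto
    have ad0: "0 \<le> a * ?d" using a d_nonneg[of x y] by simp
    have "\<bar>f x - f y\<bar> \<le> (exp (a * ?d) - 1) * f x" by (rule cone_diff_le[OF f xy True a])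
    also have "\<dots> \<le> (a * ?d * exp (a * diam)) * s"
    proof (intro mult_mono)
      have "exp (a * ?d) - 1 \<le> a * ?d * exp (a * ?d)" by (rule exp_minus_one_le)
      also have "\<dots> \<le> a * ?d * exp (a * diam)" using ad ad0 by (intro mult_left_mono) auto
      finally show "exp (a * ?d) - 1 \<le> a * ?d * exp (a * diam)" .
    qed (use s xy ad0 cone_D(2)[OF f] in auto)
    also have "\<dots> \<le> ?l * ?d"
      using mult_nonneg_nonneg[OF s0 d_nonneg[of x y]] \<delta>0(1) by (simp add: algebra_simps)
    finally show ?thesis .
  next
    case False
    then have d: "\<delta>0 \<le> 2 * dOmega x y" using dist_0_le_d[of x y] by linarith
    have "\<bar>f x - f y\<bar> \<le> s" using s[OF xy(1)] s[OF xy(2)] cone_D(2)[OF f, of x] cone_D(2)[OF f, of y] by linarith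
    also have "\<dots> \<le> 2 / \<delta>0 * s * dOmega x y"
      using mult_left_mono[OF d s0] \<delta>0(1) by (simp add: field_simps)
    also have "\<dots> \<le> ?l * dOmega x y"
      using a s0 d_nonneg[of x y] by (intro mult_right_mono) auto
    finally show ?thesis .
  qed
  show "f \<in> Lip1 A" by (rule Lip1_I(1)[OF cone_D(1)[OF f] l0 l])
  have "lip_norm A f \<le> s + ?l"
    by (rule lip_norm_le[OF cone_D(1)[OF f] l0 _ l]) (use s cone_D(2)[OF f] in \<open>auto simp: abs_le_iff intro: order_trans[of _ 0]\<close>)
  then show "lip_norm A f \<le> CK a * s" by (simp add: CK_def algebra_simps)
qed

lemma cone_Lip1: "f \<in> cone a \<Longrightarrow> 0 \<le> a \<Longrightarrow> f \<in> Lip1 A"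
  using cone_Lip1_bound(1)[of f a "sup_norm A f"] abs_le_sup[OF cone_C0] by (meson abs_le_D1)

lemma e_cone: "0 \<le> a \<Longrightarrow> e \<in> cone a"
  by (rule cone_I) (auto simp: e_def d_nonneg)

text \<open>As the norm is sup norm plus Lipschitz constant, \<open>lip_norm A f + f y\<close> is at
  least \<open>lip f\<close>; multiplied by \<open>exp (a * dOmega x y) - 1\<close>, which is at
  least the distance, it pays for the increment of \<open>f\<close>.\<close>

lemma Lip1_order_unit:
  assumes f: "f \<in> Lip1 A" and a: "1 \<le> a"
  shows "lip_norm A f *\<^sub>R e + f \<in> cone a"
proof (rule cone_I)
  let ?n = "lip_norm A f"
  fix x y assume xy: "x \<in> \<Omega>" "y \<in> \<Omega>" "dist (x 0) (y 0) < \<delta>0"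
  have 1: "\<bar>f y\<bar> \<le> sup_norm A f" by (rule abs_le_sup[OF Lip1_D(4)[OF f]])
  have "f x - f y \<le> lip f * dOmega x y" using Lip1_D(2)[OF f xy(1,2)] by simp
  also have "\<dots> \<le> (?n + f y) * (a * dOmega x y)"
  proof -
    have "lip f * (1 * dOmega x y) \<le> (?n + f y) * (a * dOmega x y)"
      using 1 a d_nonneg[of x y] Lip1_D(1)[OF f] by (intro mult_mono) (auto simp: lip_norm_eq)
    then show ?thesis by simp
  qed
  also have "\<dots> \<le> (?n + f y) * (exp (a * dOmega x y) - 1)"
    using 1 Lip1_D(1)[OF f] by (intro mult_left_mono exp_minus_one_ge) (auto simp: lip_norm_eq)
  finally show "(?n *\<^sub>R e + f) x \<le> exp (a * dOmega x y) * (?n *\<^sub>R e + f) y"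
    using xy by (simp add: e_def algebra_simps)
next
  fix x assume "x \<in> \<Omega>"
  then show "0 \<le> (lip_norm A f *\<^sub>R e + f) x" using abs_le_lip_norm[OF f, of x] by (simp add: e_def)
qed (auto simp: e_def Lip1_D f)

lemma Lip1_order_unit': "f \<in> Lip1 A \<Longrightarrow> 1 \<le> a \<Longrightarrow> lip_norm A f *\<^sub>R e - f \<in> cone a"
proof -
  assume f: "f \<in> Lip1 A" and a: "1 \<le> a"
  let ?g = "(-1) *\<^sub>R f"
  have g: "?g \<in> Lip1 A" by (rule Lip1_scale(1)[OF f])
  have "lip_norm A ?g \<le> lip_norm A f" using Lip.N_scale[OF f, of "-1"] by simp
  then have n: "0 \<le> lip_norm A f - lip_norm A ?g" by simp
  have ec: "e \<in> cone a" using a by (intro e_cone) simp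
  have "(lip_norm A f - lip_norm A ?g) *\<^sub>R e + (lip_norm A ?g *\<^sub>R e + ?g) \<in> cone a"
    by (rule cone_add[OF cone_scale[OF ec n] Lip1_order_unit[OF g a]])
  also have "(lip_norm A f - lip_norm A ?g) *\<^sub>R e + (lip_norm A ?g *\<^sub>R e + ?g) = lip_norm A f *\<^sub>R e - f"
    by (auto simp: fun_eq_iff algebra_simps)
  finally show ?thesis .
qed

text \<open>\<open>s *\<^sub>R e + u\<close> is a cone element of sup at most \<open>2 * s\<close>,
  to which \<open>CK\<close> applies; taking \<open>s *\<^sub>R e\<close> away costs another
  \<open>s\<close>.\<close>

lemma order_bound_lip_norm:
  assumes "s *\<^sub>R e - u \<in> cone a" "s *\<^sub>R e + u \<in> cone a" "0 \<le> a"
  shows "lip_norm A u \<le> (2 * CK a + 1) * s" "u \<in> Lip1 A"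
proof -
  have ub: "(s *\<^sub>R e + u) x \<le> 2 * s" if "x \<in> \<Omega>" for x
    using cone_D(2)[OF assms(1), of x] that by (simp add: e_def)
  have s0: "0 \<le> s"
    using cone_D(2)[OF assms(1), of x0] cone_D(2)[OF assms(2), of x0] by simp
  note 1 = cone_Lip1_bound[OF assms(2,3) ub]
  have u: "u = (s *\<^sub>R e + u) - s *\<^sub>R e" by simp
  show "u \<in> Lip1 A" by (subst u) (intro Lip.V_diff 1(1) Lip.V_scale e_Lip1(1))
  have "lip_norm A u \<le> lip_norm A (s *\<^sub>R e + u) + lip_norm A (s *\<^sub>R e)"
    by (subst (1) u) (intro Lip.N_minus_le 1(1) Lip.V_scale e_Lip1(1))
  also have "\<dots> \<le> CK a * (2 * s) + s" using 1(2) e_Lip1(2)[of s] abs_of_nonneg[OF s0] by linarith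
  finally show "lip_norm A u \<le> (2 * CK a + 1) * s" by (simp add: algebra_simps)
qed

text \<open>The gap between the slopes \<open>a - 1\<close> and \<open>a\<close> makes the smaller cone lie in the interior of the
  larger one.\<close>

lemma cone_interior_lower:
  assumes g: "g \<in> cone (a - 1)" and a: "2 \<le> a" and s: "0 \<le> s"
    and le: "\<And>y. y \<in> \<Omega> \<Longrightarrow> s * (a * exp (a * diam)) \<le> g y"
  shows "g - s *\<^sub>R e \<in> cone a"
proof (rule cone_I)
  have ae: "1 \<le> a * exp (a * diam)"
  proof -
    have "1 * 1 \<le> a * exp (a * diam)" using a diam by (intro mult_mono) auto
    then show ?thesis by simp
  qed
  fix x assume x: "x \<in> \<Omega>"
  have "s * 1 \<le> s * (a * exp (a * diam))" using s ae by (intro mult_left_mono)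
  then show "0 \<le> (g - s *\<^sub>R e) x" using le[OF x] x by (simp add: e_def)
next
  fix x y assume xy: "x \<in> \<Omega>" "y \<in> \<Omega>" "dist (x 0) (y 0) < \<delta>0"
  let ?d = "dOmega x y"
  have d: "0 \<le> ?d" by (rule d_nonneg)
  have 1: "g x \<le> exp ((a - 1) * ?d) * g y" by (rule cone_D(3)[OF g xy])
  have "s * (exp (a * ?d) - 1) \<le> s * (a * ?d * exp (a * diam))"
  proof (intro mult_left_mono s)
    have "exp (a * ?d) - 1 \<le> a * ?d * exp (a * ?d)" by (rule exp_minus_one_le)
    also have "\<dots> \<le> a * ?d * exp (a * diam)"
      using a d d_le_diam[of x y] by (intro mult_left_mono) auto
    finally show "exp (a * ?d) - 1 \<le> a * ?d * exp (a * diam)" .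
  qed
  also have "\<dots> = (s * (a * exp (a * diam))) * ?d" by simp
  also have "\<dots> \<le> g y * ?d" using le[OF xy(2)] d by (intro mult_right_mono)
  \<comment> \<open>Here the gap of 1 between the slopes is spent: it leaves a surplus of at least
    \<open>?d\<close>, against the loss \<open>s * (exp (a * ?d) - 1)\<close> from subtracting a
    constant.\<close>
  also have "\<dots> \<le> g y * (exp (a * ?d) - exp ((a - 1) * ?d))"
  proof (intro mult_left_mono cone_D(2)[OF g])
    have "1 * ?d \<le> exp ((a - 1) * ?d) * (exp ?d - 1)"
      using a d by (intro mult_mono exp_minus_one_ge) auto
    also have "\<dots> = exp (a * ?d) - exp ((a - 1) * ?d)"
      by (simp add: algebra_simps exp_add[symmetric])
    finally show "?d \<le> exp (a * ?d) - exp ((a - 1) * ?d)" by simp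
  qed
  finally show "(g - s *\<^sub>R e) x \<le> exp (a * ?d) * (g - s *\<^sub>R e) y"
    using 1 xy by (simp add: e_def algebra_simps)
qed (auto simp: e_def cone_D[OF g])

text \<open>The constant \<open>M\<close> gains \<open>M * (exp (a * d) - 1)\<close> at distance
  \<open>d\<close>, while subtracting \<open>g\<close> loses at most
  \<open>(exp (2 * a * d) - 1) * g x\<close>; both are of order \<open>d\<close>, so the size of
  \<open>M\<close> decides.\<close>

lemma cone_interior_upper:
  assumes g: "g \<in> cone a" and a: "0 \<le> a"
    and le: "\<And>x. x \<in> \<Omega> \<Longrightarrow> 2 * exp (2 * a * diam) * g x \<le> M"
  shows "M *\<^sub>R e - g \<in> cone a"
proof (rule cone_I)
  fix x assume x: "x \<in> \<Omega>"
  have "1 * g x \<le> 2 * exp (2 * a * diam) * g x"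
  proof (intro mult_right_mono cone_D(2)[OF g])
    have "1 \<le> exp (2 * a * diam)" using a diam by simp
    then show "1 \<le> 2 * exp (2 * a * diam)" by linarith
  qed
  then show "0 \<le> (M *\<^sub>R e - g) x" using le[OF x] x by (simp add: e_def)
next
  fix x y assume xy: "x \<in> \<Omega>" "y \<in> \<Omega>" "dist (x 0) (y 0) < \<delta>0"
  let ?d = "dOmega x y"
  have d: "0 \<le> ?d" by (rule d_nonneg)
  have M0: "0 \<le> M" using le[OF xy(1)] cone_D(2)[OF g, of x] by (smt (verit) exp_gt_zero mult_nonneg_nonneg)
  have "g y \<le> exp (a * ?d) * g x"
    using cone_D(3)[OF g xy(2,1)] xy(3) by (simp add: dist_commute d_sym)
  then have "exp (a * ?d) * g y - g x \<le> exp (a * ?d) * (exp (a * ?d) * g x) - g x" by simp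
  also have "\<dots> = (exp (2 * a * ?d) - 1) * g x" by (simp add: algebra_simps exp_add[symmetric])
  also have "\<dots> \<le> (2 * a * ?d * exp (2 * a * diam)) * g x"
  proof (intro mult_right_mono cone_D(2)[OF g])
    have "exp (2 * a * ?d) - 1 \<le> 2 * a * ?d * exp (2 * a * ?d)" by (rule exp_minus_one_le)
    also have "\<dots> \<le> 2 * a * ?d * exp (2 * a * diam)"
      using a d d_le_diam[of x y] by (intro mult_left_mono) (auto intro: mult_left_mono)
    finally show "exp (2 * a * ?d) - 1 \<le> 2 * a * ?d * exp (2 * a * diam)" .
  qed
  also have "\<dots> = (2 * exp (2 * a * diam) * g x) * (a * ?d)" by simp
  also have "\<dots> \<le> M * (a * ?d)" using a d le[OF xy(1)] by (intro mult_right_mono) auto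
  also have "\<dots> \<le> M * (exp (a * ?d) - 1)"
    using M0 by (intro mult_left_mono exp_minus_one_ge)
  finally show "(M *\<^sub>R e - g) x \<le> exp (a * ?d) * (M *\<^sub>R e - g) y"
    using xy by (simp add: e_def algebra_simps)
qed (auto simp: e_def cone_D[OF g])

lemma Exp_Lip1:
  assumes f: "f \<in> Lip1 A"
  shows "Exp f \<in> Lip1 A"
proof (rule Lip1_I(1))
  let ?B = "sup_norm A f"
  fix x y assume xy: "x \<in> \<Omega>" "y \<in> \<Omega>"
  have B: "f z \<le> ?B" for z using abs_le_sup[OF Lip1_D(4)[OF f], of z] by simp
  have "\<bar>exp (f x) - exp (f y)\<bar> \<le> exp ?B * \<bar>f x - f y\<bar>" by (rule exp_diff_le[OF B B])
  also have "\<dots> \<le> exp ?B * (lip f * dOmega x y)" using Lip1_D(2)[OF f xy] by (intro mult_left_mono) auto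
  finally show "\<bar>Exp f x - Exp f y\<bar> \<le> (exp ?B * lip f) * dOmega x y" using xy by (simp add: Exp_def)
qed (auto simp: Exp_def Lip1_D(1)[OF f])

text \<open>The transfer operator with the weight \<open>A\<close> hidden in the extension by 0; see
  \<open>transfer_LL\<close>.\<close>

definition LL :: "((nat \<Rightarrow> 'a) \<Rightarrow> real) \<Rightarrow> ((nat \<Rightarrow> 'a) \<Rightarrow> real) \<Rightarrow> (nat \<Rightarrow> 'a) \<Rightarrow> real" where
  "LL \<phi> f = avg (Exp \<phi> * f)"

lemma C0_mult:
  assumes "f \<in> C0 A" "g \<in> C0 A" shows "f * g \<in> C0 A"
  by (rule C0_I) (auto simp: times_fun_def C0_D assms intro!: continuous_on_mult)

lemma LL_C0: "\<phi> \<in> C0 A \<Longrightarrow> f \<in> C0 A \<Longrightarrow> LL \<phi> f \<in> C0 A"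
  unfolding LL_def by (intro avg_C0 C0_mult Exp_C0)

lemma LL_Lip1: "\<phi> \<in> Lip1 A \<Longrightarrow> f \<in> Lip1 A \<Longrightarrow> LL \<phi> f \<in> Lip1 A"
  unfolding LL_def by (intro avg_Lip1 Lip1_mult Exp_Lip1)

lemma LL_add: "\<phi> \<in> C0 A \<Longrightarrow> f \<in> C0 A \<Longrightarrow> g \<in> C0 A \<Longrightarrow> LL \<phi> (f + g) = LL \<phi> f + LL \<phi> g"
  unfolding LL_def by (subst avg_add[symmetric]) (auto intro: C0_mult Exp_C0 simp: distrib_left)

lemma LL_scale: "LL \<phi> (c *\<^sub>R f) = c *\<^sub>R LL \<phi> f"
proof -
  have "Exp \<phi> * (c *\<^sub>R f) = c *\<^sub>R (Exp \<phi> * f)" by (auto simp: fun_eq_iff)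
  then show ?thesis unfolding LL_def by (simp only: avg_scale)
qed

lemma LL_mono:
  assumes "\<phi> \<in> C0 A" "f \<in> C0 A" "g \<in> C0 A" "\<And>x. x \<in> \<Omega> \<Longrightarrow> f x \<le> g x"
  shows "LL \<phi> f x \<le> LL \<phi> g x"
  unfolding LL_def by (intro avg_mono C0_mult Exp_C0 assms) (auto simp: Exp_def assms)

lemma transfer_LL: "f \<in> C0 A \<Longrightarrow> transfer_op \<rho> A \<phi> f = LL \<phi> f"
  unfolding LL_def by (rule transfer_eq) (rule C0_D)

end

text \<open>\<open>lc\<close> and \<open>B\<close> are bounds, not the exact Lipschitz constant and
  sup norm, so the constants below are shared by all potentials of a bounded set.
  \<open>H_bound\<close> relies on this uniformity.\<close>

locale potential = shift_system +
  fixes \<phi> :: "(nat \<Rightarrow> 'a) \<Rightarrow> real" and lc B :: real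
  assumes \<phi>: "\<phi> \<in> Lip1 A" and lc: "0 \<le> lc" "lip \<phi> \<le> lc" and B: "0 \<le> B" "\<And>x. \<bar>\<phi> x\<bar> \<le> B"
begin

text \<open>\<open>c1\<close> is the loss in one step (mass of a ball, smallest weight, variation of
  a cone element), \<open>c2\<close> the loss in \<open>NN\<close> steps, \<open>RR\<close> the
  largest ratio of two values of the \<open>NN\<close>-th image. \<open>kap\<close> is chosen so
  that \<open>kap * RR * ((lc + 2) * exp (2 * (lc + 2) * diam))\<close> is 1/2, which meets the
  conditions of both interior lemmas.\<close>

definition "c1 = r0 * exp (- B - (lc + 2) * diam)"
definition "c2 = c1 ^ NN * exp (- ((lc + 2) * diam))"
definition "RR = exp (real NN * B) / c2"
definition "kap = 1 / (2 * (lc + 2) * exp (2 * (lc + 2) * diam) * RR)"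

abbreviation "K \<equiv> cone (lc + 2)"

lemma \<phi>C: "\<phi> \<in> C0 A" by (rule Lip1_D(4)[OF \<phi>])

lemma lcd: "0 \<le> (lc + 2) * diam"
  using lc diam by simp

lemma c1: "0 < c1" "c1 \<le> 1"
proof -
  interpret prob_space \<rho> by (rule prob)
  show "0 < c1" using r0(1) by (simp add: c1_def)
  have "r0 \<le> 1" using r0(2)[of undefined] prob_le_1 order_trans by blast
  moreover have "exp (- B - (lc + 2) * diam) \<le> 1" using B lcd by simp
  ultimately show "c1 \<le> 1" unfolding c1_def using r0(1)
    using mult_mono[of r0 1 "exp (- B - (lc + 2) * diam)" 1] by simp
qed

lemma c2: "0 < c2" "c2 \<le> 1"
proof -
  show "0 < c2" using c1 by (simp add: c2_def)
  have "c1 ^ NN \<le> 1" using c1 by (intro power_le_one) auto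
  moreover have "exp (- ((lc + 2) * diam)) \<le> 1" using lcd by simp
  ultimately show "c2 \<le> 1" unfolding c2_def using c1
    using mult_mono[of "c1 ^ NN" 1 "exp (- ((lc + 2) * diam))" 1] by simp
qed

lemma RR: "1 \<le> RR"
proof -
  have "1 \<le> exp (real NN * B)" using B by simp
  then have "c2 * 1 \<le> exp (real NN * B)" using c2 by linarith
  then show ?thesis using c2 by (simp add: RR_def field_simps)
qed

lemma kap: "0 < kap" "kap \<le> 1"
proof -
  have "1 \<le> exp (2 * (lc + 2) * diam)" using lc diam by simp
  then have "1 * 1 * 1 \<le> 2 * (lc + 2) * exp (2 * (lc + 2) * diam) * RR"
    using lc RR by (intro mult_mono) auto
  then show "0 < kap" "kap \<le> 1" using lc RR by (auto simp: kap_def)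
qed

text \<open>Prepending the same symbol to \<open>x\<close> and \<open>y\<close> halves their
  distance; there \<open>f\<close> contributes the slope \<open>a\<close> and the weight the slope
  \<open>lc\<close>.\<close>

lemma LL_cone:
  assumes f: "f \<in> cone a" and a: "0 \<le> a"
  shows "LL \<phi> f \<in> cone ((a + lc) / 2)"
proof (rule cone_I)
  have fC: "f \<in> C0 A" by (rule cone_C0[OF f a])
  have gC: "Exp \<phi> * f \<in> C0 A" by (intro C0_mult Exp_C0 fC \<phi>C)
  have gnn: "0 \<le> (Exp \<phi> * f) y" for y using cone_D(2)[OF f] by (simp add: Exp_def)
  fix x assume x: "x \<in> \<Omega>"
  have "avg 0 x \<le> LL \<phi> f x" unfolding LL_def by (rule avg_mono[OF C0.V_0 gC]) (use gnn in auto)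
  moreover have "avg 0 x = 0" by (auto simp: avg_def)
  ultimately show "0 \<le> LL \<phi> f x" by simp
next
  have fC: "f \<in> C0 A" by (rule cone_C0[OF f a])
  have gC: "Exp \<phi> * f \<in> C0 A" by (intro C0_mult Exp_C0 fC \<phi>C)
  fix x y assume xy: "x \<in> \<Omega>" "y \<in> \<Omega>" "dist (x 0) (y 0) < \<delta>0"
  let ?E = "exp ((a + lc) / 2 * dOmega x y)"
  have le: "(Exp \<phi> * f) (cons t x) \<le> ?E * (Exp \<phi> * f) (cons t y)" for t
  proof (cases "cons t x \<in> \<Omega>")
    case True
    then have y: "cons t y \<in> \<Omega>" using \<delta>0(3)[OF xy(3), of t] cons_in_iff xy by simp
    have 1: "f (cons t x) \<le> exp (a * (dOmega x y / 2)) * f (cons t y)"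
      using cone_D(3)[OF f True y] \<delta>0(1) by (simp add: d_cons)
    have "\<phi> (cons t x) - \<phi> (cons t y) \<le> lip \<phi> * (dOmega x y / 2)"
      using Lip1_D(2)[OF \<phi> True y] unfolding d_cons by linarith
    also have "\<dots> \<le> lc * (dOmega x y / 2)" using lc d_nonneg[of x y] by (intro mult_right_mono) auto
    finally have 2: "exp (\<phi> (cons t x)) \<le> exp (lc * (dOmega x y / 2)) * exp (\<phi> (cons t y))"
      by (simp add: exp_add[symmetric])
    have "exp (\<phi> (cons t x)) * f (cons t x)
        \<le> (exp (lc * (dOmega x y / 2)) * exp (\<phi> (cons t y))) * (exp (a * (dOmega x y / 2)) * f (cons t y))"
      using 1 2 cone_D(2)[OF f] by (intro mult_mono) auto
    also have "\<dots> = (exp (lc * (dOmega x y / 2)) * exp (a * (dOmega x y / 2))) * (exp (\<phi> (cons t y)) * f (cons t y))"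
      by simp
    also have "exp (lc * (dOmega x y / 2)) * exp (a * (dOmega x y / 2)) = ?E"
      by (simp add: exp_add[symmetric] field_simps)
    finally show ?thesis using True y by (simp add: Exp_def)
  next
    case False
    then show ?thesis using cone_D(2)[OF f] by (simp add: Exp_def)
  qed
  have "LL \<phi> f x \<le> (\<integral>t. ?E * (Exp \<phi> * f) (cons t y) \<partial>\<rho>)"
    using integral_mono[OF cons_integrable[OF gC xy(1)] integrable_mult_right[OF cons_integrable[OF gC xy(2)]], of ?E] le xy
    by (simp add: LL_def avg_def)
  also have "\<dots> = ?E * LL \<phi> f y" using xy by (simp add: LL_def avg_def)
  finally show "LL \<phi> f x \<le> ?E * LL \<phi> f y" .
qed (simp add: LL_def avg_def)

lemma LL_K: "f \<in> K \<Longrightarrow> LL \<phi> f \<in> cone (lc + 1)"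
proof -
  have eq: "(lc + 2 + lc) / 2 = lc + 1" by simp
  show "f \<in> K \<Longrightarrow> LL \<phi> f \<in> cone (lc + 1)" using LL_cone[of f "lc + 2"] lc unfolding eq by simp
qed

lemma LL_K': "f \<in> K \<Longrightarrow> LL \<phi> f \<in> K"
  using LL_K cone_mono[of "lc + 1" "lc + 2"] by simp

lemma LLk_K: "f \<in> K \<Longrightarrow> (LL \<phi> ^^ k) f \<in> K"
  by (induction k) (auto intro: LL_K')

lemma K_C0: "f \<in> K \<Longrightarrow> f \<in> C0 A"
  using cone_C0 lc by auto

text \<open>All symbols \<open>t\<close> within \<open>\<delta>0\<close> of \<open>p\<close> may be
  prepended to \<open>x\<close> as well, give comparable values of \<open>f\<close>, and have mass
  at least \<open>r0\<close>.\<close>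

lemma LL_lower:
  assumes f: "f \<in> K" and x: "x \<in> \<Omega>" and p: "A p (x 0) = 1"
  shows "c1 * f (cons p x) \<le> LL \<phi> f x"
proof -
  let ?D = "(lc + 2) * diam"
  have px: "cons p x \<in> \<Omega>" using cons_in_iff[OF x] p by simp
  have "r0 * (exp (- B - ?D) * f (cons p x)) \<le> avg (Exp \<phi> * f) x"
  proof (rule avg_ge[OF _ x, where p = p])
    show "Exp \<phi> * f \<in> C0 A" by (intro C0_mult Exp_C0 K_C0 f \<phi>C)
    show "0 \<le> (Exp \<phi> * f) y" for y using cone_D(2)[OF f] by (simp add: Exp_def)
    show "0 \<le> exp (- B - ?D) * f (cons p x)" using cone_D(2)[OF f] by simp
    fix t assume t: "dist t p < \<delta>0"
    have tx: "cons t x \<in> \<Omega>" using cons_in_iff[OF x] p \<delta>0(2)[OF t, of "x 0"] by simp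
    have "f (cons p x) \<le> exp ((lc + 2) * dOmega (cons p x) (cons t x)) * f (cons t x)"
      using cone_D(3)[OF f px tx] t by (simp add: dist_commute)
    also have "\<dots> \<le> exp ?D * f (cons t x)"
      using lc d_le_diam cone_D(2)[OF f] by (intro mult_right_mono) (auto intro: mult_left_mono)
    finally have 1: "f (cons p x) \<le> exp ?D * f (cons t x)" .
    have "- B \<le> \<phi> (cons t x)" using B(2)[of "cons t x"] by (simp add: abs_le_iff)
    then have "exp (- B) * (exp (- ?D) * f (cons p x)) \<le> exp (\<phi> (cons t x)) * (exp (- ?D) * (exp ?D * f (cons t x)))"
      using 1 cone_D(2)[OF f] by (intro mult_mono) auto
    also have "exp (- ?D) * (exp ?D * f (cons t x)) = f (cons t x)"
      by (simp add: mult.assoc[symmetric] exp_add[symmetric])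
    also have "exp (\<phi> (cons t x)) * f (cons t x) = (Exp \<phi> * f) (cons t x)" using tx by (simp add: Exp_def)
    also have "exp (- B) * (exp (- ?D) * f (cons p x)) = exp (- B - ?D) * f (cons p x)"
      by (simp only: mult.assoc[symmetric] exp_add[symmetric]) simp
    finally show "exp (- B - ?D) * f (cons p x) \<le> (Exp \<phi> * f) (cons t x)" .
  qed
  then show ?thesis by (simp add: c1_def LL_def mult.assoc)
qed

text \<open>An admissible path ending in \<open>x 0\<close> is followed backwards at a cost
  \<open>c1\<close> per step. \<open>y\<close> is the path prepended to \<open>x\<close>, of which
  only the zeroth coordinate is recorded.\<close>

lemma LLk_lower:
  assumes f: "f \<in> K"
  shows "x \<in> \<Omega> \<Longrightarrow> z n = x 0 \<Longrightarrow> (\<forall>i<n. A (z i) (z (Suc i)) = 1) \<Longrightarrow>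
     \<exists>y\<in>\<Omega>. y 0 = z 0 \<and> c1 ^ n * f y \<le> (LL \<phi> ^^ n) f x"
proof (induction n arbitrary: x)
  case 0
  then show ?case by (intro bexI[of _ x]) auto
next
  case (Suc n)
  have p: "A (z n) (x 0) = 1" using Suc.prems(2,3) by (metis lessI)
  have in\<Omega>: "cons (z n) x \<in> \<Omega>" using cons_in_iff[OF Suc.prems(1)] p by simp
  obtain y where y: "y \<in> \<Omega>" "y 0 = z 0" "c1 ^ n * f y \<le> (LL \<phi> ^^ n) f (cons (z n) x)"
    using Suc.IH[OF in\<Omega>] Suc.prems(3) by auto
  have "c1 * (c1 ^ n * f y) \<le> c1 * (LL \<phi> ^^ n) f (cons (z n) x)"
    using y c1 by (intro mult_left_mono) auto
  also have "\<dots> \<le> LL \<phi> ((LL \<phi> ^^ n) f) x" by (rule LL_lower[OF LLk_K[OF f] Suc.prems(1) p])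
  finally show ?case using y by (intro bexI[of _ y]) (auto simp: mult.assoc)
qed

text \<open>Mixing provides a path from \<open>y 0\<close> to \<open>x 0\<close>, hence a point
  \<open>w\<close> with the same zeroth coordinate as \<open>y\<close>; the cone condition then
  compares \<open>f y\<close> with \<open>f w\<close>.\<close>

lemma LLN_lower:
  assumes f: "f \<in> K" and x: "x \<in> \<Omega>" and y: "y \<in> \<Omega>"
  shows "c2 * f y \<le> (LL \<phi> ^^ NN) f x"
proof -
  obtain z where z: "z 0 = y 0" "z NN = x 0" "\<forall>i<NN. A (z i) (z (Suc i)) = 1"
    using NN(2)[of "y 0" "x 0"] by blast
  obtain w where w: "w \<in> \<Omega>" "w 0 = z 0" "c1 ^ NN * f w \<le> (LL \<phi> ^^ NN) f x"
    using LLk_lower[OF f x z(2,3)] by blast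
  have "f y \<le> exp ((lc + 2) * dOmega y w) * f w"
    using cone_D(3)[OF f y w(1)] w(2) z(1) \<delta>0(1) by simp
  also have "\<dots> \<le> exp ((lc + 2) * diam) * f w"
    using lc d_le_diam cone_D(2)[OF f] by (intro mult_right_mono) (auto intro: mult_left_mono)
  finally have "exp (- ((lc + 2) * diam)) * f y \<le> exp (- ((lc + 2) * diam)) * (exp ((lc + 2) * diam) * f w)"
    by (intro mult_left_mono) auto
  also have "\<dots> = f w" by (simp add: mult.assoc[symmetric] exp_add[symmetric])
  finally have "exp (- ((lc + 2) * diam)) * f y \<le> f w" .
  then have "c1 ^ NN * (exp (- ((lc + 2) * diam)) * f y) \<le> c1 ^ NN * f w"
    using c1 by (intro mult_left_mono) auto
  then show ?thesis using w(3) by (simp add: c2_def mult.assoc)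
qed

lemma LLk_upper:
  assumes f: "f \<in> K" and s: "\<And>x. x \<in> \<Omega> \<Longrightarrow> f x \<le> s"
  shows "(LL \<phi> ^^ k) f x \<le> exp (real k * B) * s"
proof (induction k arbitrary: x)
  case 0
  have "0 \<le> s" using s[OF x0] cone_D(2)[OF f, of x0] by linarith
  then show ?case using s cone_D(1)[OF f] by (cases "x \<in> \<Omega>") auto
next
  case (Suc k)
  have s0: "0 \<le> s" using s[OF x0] cone_D(2)[OF f, of x0] by linarith
  have "LL \<phi> ((LL \<phi> ^^ k) f) x \<le> exp B * (exp (real k * B) * s)"
    unfolding LL_def
  proof (rule avg_le)
    show "Exp \<phi> * ((\<lambda>f. avg (Exp \<phi> * f)) ^^ k) f \<in> C0 A"
      using LLk_K[OF f, of k] by (intro C0_mult Exp_C0 K_C0 \<phi>C) (simp add: LL_def[abs_def])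
    show "(Exp \<phi> * ((\<lambda>f. avg (Exp \<phi> * f)) ^^ k) f) x \<le> exp B * (exp (real k * B) * s)" if "x \<in> \<Omega>" for x
      using that B(2)[of x] Suc.IH[of x] cone_D(2)[OF LLk_K[OF f, of k], of x] s0
      by (auto simp: Exp_def LL_def[abs_def] intro!: mult_mono)
  qed (use s0 in simp)
  moreover have "exp (real (Suc k) * B) = exp B * exp (real k * B)"
    by (simp add: exp_add[symmetric] algebra_simps)
  ultimately show ?case by (simp only: funpow.simps o_apply mult.assoc)
qed

text \<open>\<open>LLN_lower\<close> bounds \<open>f\<close> everywhere in terms of the iterate at
  \<open>y\<close>; the crude growth bound then controls the iterate at \<open>x\<close>.\<close>

lemma LLN_ratio:
  assumes f: "f \<in> K" and x: "x \<in> \<Omega>" and y: "y \<in> \<Omega>"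
  shows "(LL \<phi> ^^ NN) f x \<le> RR * (LL \<phi> ^^ NN) f y"
proof -
  have "f z \<le> (LL \<phi> ^^ NN) f y / c2" if "z \<in> \<Omega>" for z
    using LLN_lower[OF f y that] c2 by (simp add: field_simps)
  from LLk_upper[OF f this, of NN x] show ?thesis by (simp add: RR_def)
qed

text \<open>The iterate is comparable with its value at \<open>x0\<close> by
  \<open>LLN_ratio\<close>, and the last application of \<open>LL \<phi>\<close> has lowered its
  slope to \<open>lc + 1\<close>; it therefore lies inside \<open>K\<close> at a depth measured by
  \<open>kap\<close>.\<close>

lemma distortion:
  assumes f: "f \<in> K"
  shows "(LL \<phi> ^^ NN) f - (kap * (LL \<phi> ^^ NN) f x0) *\<^sub>R e \<in> K"
    "((LL \<phi> ^^ NN) f x0) *\<^sub>R e - kap *\<^sub>R (LL \<phi> ^^ NN) f \<in> K"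
proof -
  define g where "g = (LL \<phi> ^^ NN) f"
  let ?a = "lc + 2"
  have g1: "g \<in> cone (?a - 1)"
  proof -
    obtain m where "NN = Suc m" using NN(1) by (cases NN) auto
    then have "g = LL \<phi> ((LL \<phi> ^^ m) f)" by (simp add: g_def)
    then show ?thesis using LL_K[OF LLk_K[OF f, of m]] by (simp add: add.commute)
  qed
  have gK: "g \<in> K" using cone_mono[OF _ g1] by simp
  have gnn: "0 \<le> g x" for x by (rule cone_D(2)[OF gK])
  have r: "g x \<le> RR * g y" if "x \<in> \<Omega>" "y \<in> \<Omega>" for x y
    unfolding g_def by (rule LLN_ratio[OF f that])
  have kE: "kap * RR * (?a * exp (2 * ?a * diam)) = 1 / 2"
  proof -
    define E where "E = exp (2 * ?a * diam)"
    have "0 < E" by (simp add: E_def)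
    then show ?thesis using lc RR unfolding kap_def E_def[symmetric] by simp
  qed
  have E: "1 \<le> exp (?a * diam)" "1 \<le> exp (2 * ?a * diam)" "exp (?a * diam) \<le> exp (2 * ?a * diam)"
    using lc diam by auto
  show "(LL \<phi> ^^ NN) f - (kap * (LL \<phi> ^^ NN) f x0) *\<^sub>R e \<in> K"
    unfolding g_def[symmetric]
  proof (rule cone_interior_lower[OF g1])
    fix y assume y: "y \<in> \<Omega>"
    have "kap * g x0 * (?a * exp (?a * diam)) \<le> kap * (RR * g y) * (?a * exp (2 * ?a * diam))"
      using r[OF x0 y] kap lc E gnn RR by (intro mult_mono) auto
    also have "\<dots> = (kap * RR * (?a * exp (2 * ?a * diam))) * g y" by simp
    also have "kap * RR * (?a * exp (2 * ?a * diam)) = 1 / 2" by (rule kE)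
    also have "1 / 2 * g y \<le> g y" using gnn[of y] by simp
    finally show "kap * g x0 * (?a * exp (?a * diam)) \<le> g y" .
  qed (use lc kap gnn in auto)
  show "((LL \<phi> ^^ NN) f x0) *\<^sub>R e - kap *\<^sub>R (LL \<phi> ^^ NN) f \<in> K"
    unfolding g_def[symmetric]
  proof (rule cone_interior_upper)
    show "kap *\<^sub>R g \<in> K" using gK kap by (intro cone_scale) auto
    fix x assume x: "x \<in> \<Omega>"
    have "2 * exp (2 * ?a * diam) * (kap *\<^sub>R g) x \<le> 2 * exp (2 * ?a * diam) * (kap * (RR * g x0))"
      using r[OF x x0] kap by (intro mult_left_mono) auto
    also have "\<dots> = (2 * exp (2 * ?a * diam) * kap * RR) * g x0" by simp
    also have "2 * exp (2 * ?a * diam) * kap * RR = 1 / ?a"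
    proof -
      have "(2 * exp (2 * ?a * diam) * kap * RR) * ?a = 2 * (kap * RR * (?a * exp (2 * ?a * diam)))"
        by (simp only: mult_ac)
      also have "\<dots> = 1" unfolding kE by simp
      finally show ?thesis using lc by (simp add: eq_divide_eq)
    qed
    also have "1 / ?a * g x0 \<le> 1 * g x0" using lc gnn by (intro mult_right_mono) auto
    finally show "2 * exp (2 * ?a * diam) * (kap *\<^sub>R g) x \<le> g x0" by simp
  qed (use lc in auto)
qed

sublocale cone_operator "Lip1 A" K e x0 "LL \<phi>" NN kap
proof
  show "subspace (Lip1 A)" by (rule subspace_Lip1)
  show "e x \<le> 1" for x by (simp add: e_def)
  show "f \<in> Lip1 A" if "f \<in> K" for f using cone_Lip1[OF that] lc by simp
  show "g \<in> K" if "\<And>n. F n \<in> K" "\<And>x. (\<lambda>n. F n x) \<longlonglongrightarrow> g x" for F :: "nat \<Rightarrow> _" and g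
    by (rule cone_closed[OF that])
  show "e \<in> K" using e_cone lc by simp
  show "\<exists>s\<ge>0. s *\<^sub>R e - f \<in> K \<and> s *\<^sub>R e + f \<in> K" if "f \<in> Lip1 A" for f
    using Lip1_order_unit[OF that] Lip1_order_unit'[OF that] Lip.N_nonneg[OF that] lc
    by (intro exI[of _ "lip_norm A f"]) auto
  show "0 < (LL \<phi> ^^ NN) e x0"
  proof -
    have "c2 * e x0 \<le> (LL \<phi> ^^ NN) e x0" using lc by (intro LLN_lower x0 e_cone) auto
    then show ?thesis using c2 by simp
  qed
  show "LL \<phi> (f + g) = LL \<phi> f + LL \<phi> g" if "f \<in> Lip1 A" "g \<in> Lip1 A" for f g
    using that by (intro LL_add \<phi>C Lip1_D)
qed (use cone_add cone_scale cone_D(2) kap NN(1) LL_K' LL_Lip1[OF \<phi>] LL_scale distortion in auto)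

text \<open>Norm version of \<open>perron_frobenius\<close>: \<open>Lip1_order_unit\<close> turns a
  norm into an order bound, \<open>order_bound_lip_norm\<close> turns the resulting order bound
  back.\<close>

lemma RPF:
  obtains h r \<nu> \<tau> C where
    "h \<in> Lip1 A" "h x0 = 1" "lip_norm A h \<le> CK (lc + 2) / kap" "\<And>x. x \<in> \<Omega> \<Longrightarrow> kap \<le> h x"
    "0 < r" "LL \<phi> h = r *\<^sub>R h" "0 < \<tau>" "\<tau> < 1" "0 \<le> C"
    "\<And>f g. f \<in> Lip1 A \<Longrightarrow> g \<in> Lip1 A \<Longrightarrow> \<nu> (f + g) = \<nu> f + \<nu> g"
    "\<And>f c. f \<in> Lip1 A \<Longrightarrow> \<nu> (c *\<^sub>R f) = c * \<nu> f"
    "\<nu> h = (1::real)" "\<And>f. f \<in> Lip1 A \<Longrightarrow> \<nu> (LL \<phi> f) = r * \<nu> f"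
    "\<And>f. f \<in> Lip1 A \<Longrightarrow> \<bar>\<nu> f\<bar> \<le> C * lip_norm A f"
    "\<And>f k. f \<in> Lip1 A \<Longrightarrow> lip_norm A ((1 / r ^ k) *\<^sub>R (LL \<phi> ^^ k) f - \<nu> f *\<^sub>R h) \<le> C * \<tau> ^ k * lip_norm A f"
proof -
  let ?a = "lc + 2"
  have a: "0 \<le> ?a" "1 \<le> ?a" using lc by auto
  obtain h r \<nu> \<tau> C where 
    h: "h \<in> K" "h x0 = 1" "h - kap *\<^sub>R e \<in> K" "e - kap *\<^sub>R h \<in> K" "0 < r" "LL \<phi> h = r *\<^sub>R h"
    and \<tau>: "0 < \<tau>" "\<tau> < 1" "0 \<le> C"
    and \<nu>: "\<And>f g. f \<in> Lip1 A \<Longrightarrow> g \<in> Lip1 A \<Longrightarrow> \<nu> (f + g) = \<nu> f + \<nu> g"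
    "\<And>f c. f \<in> Lip1 A \<Longrightarrow> \<nu> (c *\<^sub>R f) = c * \<nu> f"
    "\<nu> h = (1::real)" "\<And>f. f \<in> Lip1 A \<Longrightarrow> \<nu> (LL \<phi> f) = r * \<nu> f"
    and b1: "\<And>f s. f \<in> Lip1 A \<Longrightarrow> 0 \<le> s \<Longrightarrow> s *\<^sub>R e - f \<in> K \<Longrightarrow> s *\<^sub>R e + f \<in> K \<Longrightarrow> \<bar>\<nu> f\<bar> \<le> C * s"
    and b2: "\<And>f s k. f \<in> Lip1 A \<Longrightarrow> 0 \<le> s \<Longrightarrow> s *\<^sub>R e - f \<in> K \<Longrightarrow> s *\<^sub>R e + f \<in> K \<Longrightarrow>
       (C * s * \<tau> ^ k) *\<^sub>R e - ((1 / r ^ k) *\<^sub>R (LL \<phi> ^^ k) f - \<nu> f *\<^sub>R h) \<in> K \<and>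
       (C * s * \<tau> ^ k) *\<^sub>R e + ((1 / r ^ k) *\<^sub>R (LL \<phi> ^^ k) f - \<nu> f *\<^sub>R h) \<in> K"
    by (rule perron_frobenius) blast
  define C' where "C' = (2 * CK ?a + 1) * C"
  have CK1: "1 \<le> 2 * CK ?a + 1" using CK_nonneg[OF a(1)] by simp
  have CC': "C \<le> C'" using mult_right_mono[OF CK1 \<tau>(3)] by (simp add: C'_def)
  have hup: "h x \<le> 1 / kap" if "x \<in> \<Omega>" for x
    using cone_D(2)[OF h(4), of x] that kap by (simp add: e_def field_simps)
  show ?thesis
  proof (rule that[of h r \<tau> C' \<nu>])
    show "h \<in> Lip1 A" by (rule cone_Lip1[OF h(1) a(1)])
    show "lip_norm A h \<le> CK ?a / kap" using cone_Lip1_bound(2)[OF h(1) a(1) hup] by simp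
    show "kap \<le> h x" if "x \<in> \<Omega>" for x using cone_D(2)[OF h(3), of x] that by (simp add: e_def)
    show "\<bar>\<nu> f\<bar> \<le> C' * lip_norm A f" if f: "f \<in> Lip1 A" for f
      using b1[OF f Lip.N_nonneg[OF f] Lip1_order_unit'[OF f a(2)] Lip1_order_unit[OF f a(2)]]
        mult_right_mono[OF CC' Lip.N_nonneg[OF f]] by linarith
    show "lip_norm A ((1 / r ^ k) *\<^sub>R (LL \<phi> ^^ k) f - \<nu> f *\<^sub>R h) \<le> C' * \<tau> ^ k * lip_norm A f"
      if f: "f \<in> Lip1 A" for f k
    proof -
      from b2[OF f Lip.N_nonneg[OF f] Lip1_order_unit'[OF f a(2)] Lip1_order_unit[OF f a(2)], of k]
      show ?thesis using order_bound_lip_norm(1)[OF _ _ a(1)] by (fastforce simp: C'_def mult_ac)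
    qed
    show "0 \<le> C'" using CC' \<tau> by simp
  qed (use h \<tau> \<nu> in auto)
qed

end

section \<open>The spectrum of the transfer operator\<close>

context fun_space_op
begin

lemma cplx_space_lin:
  assumes "h \<in> cplx_space V" "g \<in> cplx_space V"
  shows "(\<lambda>x. c * h x + d * g x) \<in> cplx_space V"
    and "cplx_op T (\<lambda>x. c * h x + d * g x) = (\<lambda>x. c * cplx_op T h x + d * cplx_op T g x)"
proof -
  let ?a = "\<lambda>x. Re (h x)" and ?b = "\<lambda>x. Im (h x)" and ?a' = "\<lambda>x. Re (g x)" and ?b' = "\<lambda>x. Im (g x)"
  have V: "?a \<in> V" "?b \<in> V" "?a' \<in> V" "?b' \<in> V" using assms by (auto simp: cplx_space_def)
  have eq: "(\<lambda>x. Re (c * h x + d * g x)) = (Re c *\<^sub>R ?a + (- Im c) *\<^sub>R ?b) + (Re d *\<^sub>R ?a' + (- Im d) *\<^sub>R ?b')"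
    "(\<lambda>x. Im (c * h x + d * g x)) = (Im c *\<^sub>R ?a + Re c *\<^sub>R ?b) + (Im d *\<^sub>R ?a' + Re d *\<^sub>R ?b')"
    by (auto simp: fun_eq_iff)
  show "(\<lambda>x. c * h x + d * g x) \<in> cplx_space V"
    unfolding cplx_space_def mem_Collect_eq eq by (intro conjI V_add V_scale V)
  have T: "T (\<lambda>x. Re (c * h x + d * g x)) = (Re c *\<^sub>R T ?a + (- Im c) *\<^sub>R T ?b) + (Re d *\<^sub>R T ?a' + (- Im d) *\<^sub>R T ?b')"
    "T (\<lambda>x. Im (c * h x + d * g x)) = (Im c *\<^sub>R T ?a + Re c *\<^sub>R T ?b) + (Im d *\<^sub>R T ?a' + Re d *\<^sub>R T ?b')"
    unfolding eq using V by (simp_all only: T_add T_scale V_scale V_add)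
  show "cplx_op T (\<lambda>x. c * h x + d * g x) = (\<lambda>x. c * cplx_op T h x + d * cplx_op T g x)"
    unfolding cplx_op_def T by (auto simp: fun_eq_iff complex_eq_iff algebra_simps)
qed

lemma shifted_lin:
  assumes "h \<in> cplx_space V" "g \<in> cplx_space V"
  shows "shifted_op T \<zeta> (\<lambda>x. c * h x + d * g x) = (\<lambda>x. c * shifted_op T \<zeta> h x + d * shifted_op T \<zeta> g x)"
  unfolding shifted_op_def cplx_space_lin(2)[OF assms] by (auto simp: fun_eq_iff algebra_simps)

lemma shifted_in:
  assumes "h \<in> cplx_space V" shows "shifted_op T \<zeta> h \<in> cplx_space V"
proof -
  have "cplx_op T h \<in> cplx_space V" using assms by (simp add: cplx_space_def cplx_op_def T_in)
  from cplx_space_lin(1)[OF assms this, of \<zeta> "-1"] show ?thesis by (simp add: shifted_op_def)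
qed

lemma cplx_of_real_in: "f \<in> V \<Longrightarrow> (\<lambda>x. complex_of_real (f x)) \<in> cplx_space V"
  using V_0 by (simp add: cplx_space_def zero_fun_def)

lemma shifted_of_real:
  "f \<in> V \<Longrightarrow> shifted_op T (complex_of_real c) (\<lambda>x. complex_of_real (f x)) = (\<lambda>x. complex_of_real ((c *\<^sub>R f - T f) x))"
  using T_0 by (auto simp: shifted_op_def cplx_op_def fun_eq_iff complex_eq_iff zero_fun_def)

lemma cplx_norm_lin:
  assumes h: "h \<in> cplx_space V" and g: "g \<in> V"
  shows "cplx_norm N (\<lambda>x. h x + c * complex_of_real (g x)) \<le> 2 * cplx_norm N h + 2 * cmod c * N g"
proof -
  have V: "(\<lambda>x. Re (h x)) \<in> V" "(\<lambda>x. Im (h x)) \<in> V" using h by (auto simp: cplx_space_def)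
  have W: "(\<lambda>x. h x + c * complex_of_real (g x)) \<in> cplx_space V"
    using cplx_space_lin(1)[OF h cplx_of_real_in[OF g], of 1 c] by simp
  have eq: "(\<lambda>x. Re (h x + c * complex_of_real (g x))) = 1 *\<^sub>R (\<lambda>x. Re (h x)) + Re c *\<^sub>R g"
    "(\<lambda>x. Im (h x + c * complex_of_real (g x))) = 1 *\<^sub>R (\<lambda>x. Im (h x)) + Im c *\<^sub>R g"
    by (auto simp: fun_eq_iff)
  have "cplx_norm N (\<lambda>x. h x + c * complex_of_real (g x))
      \<le> N (1 *\<^sub>R (\<lambda>x. Re (h x)) + Re c *\<^sub>R g) + N (1 *\<^sub>R (\<lambda>x. Im (h x)) + Im c *\<^sub>R g)"
    using cplx_norm_bounds(3)[OF W] unfolding eq .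
  also have "\<dots> \<le> (\<bar>1\<bar> * N (\<lambda>x. Re (h x)) + \<bar>Re c\<bar> * N g) + (\<bar>1\<bar> * N (\<lambda>x. Im (h x)) + \<bar>Im c\<bar> * N g)"
    by (intro add_mono N_lincomb V g)
  also have "\<dots> \<le> (cplx_norm N h + cmod c * N g) + (cplx_norm N h + cmod c * N g)"
    using cplx_norm_bounds(1,2)[OF h] N_nonneg[OF g]
    by (intro add_mono mult_right_mono) (auto simp: abs_Re_le_cmod abs_Im_le_cmod)
  finally show ?thesis by (simp add: mult_ac)
qed

text \<open>For real \<open>c\<close> the complex resolvent restricts to real functions: the real
  part of a complex solution solves the real equation.\<close>

lemma resolvent_real:
  assumes c: "\<tau> < c"
  shows "\<exists>M. 0 \<le> M \<and> (\<forall>f\<in>V. N f \<le> M * N (c *\<^sub>R f - T f)) \<and> (\<forall>g\<in>V. \<exists>f\<in>V. c *\<^sub>R f - T f = g)"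
proof -
  let ?c = "complex_of_real c"
  have "\<tau> < cmod ?c" using c \<tau>_nonneg by simp
  from in_resolvent_set[OF this] obtain M where
    bij: "bij_betw (shifted_op T ?c) (cplx_space V) (cplx_space V)"
    and M: "\<And>h. h \<in> cplx_space V \<Longrightarrow> cplx_norm N h \<le> M * cplx_norm N (shifted_op T ?c h)"
    unfolding resolvent_set_def by blast
  have N0: "N (\<lambda>x. 0) = 0" using N_scale[OF V_0, of 0] N_nonneg[OF V_0] by (simp add: zero_fun_def)
  have nr: "cplx_norm N (\<lambda>x. complex_of_real (f x)) = N f" if "f \<in> V" for f
    using cplx_norm_bounds(1,3)[OF cplx_of_real_in[OF that]] N0 by simp
  have 1: "N f \<le> \<bar>M\<bar> * N (c *\<^sub>R f - T f)" if f: "f \<in> V" for f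
  proof -
    have d: "c *\<^sub>R f - T f \<in> V" by (intro V_diff V_scale T_in f)
    have "N f \<le> M * N (c *\<^sub>R f - T f)"
      using M[OF cplx_of_real_in[OF f]] unfolding shifted_of_real[OF f] nr[OF f] nr[OF d] .
    also have "\<dots> \<le> \<bar>M\<bar> * N (c *\<^sub>R f - T f)" using N_nonneg[OF d] by (intro mult_right_mono) auto
    finally show ?thesis .
  qed
  have 2: "\<exists>f\<in>V. c *\<^sub>R f - T f = g" if g: "g \<in> V" for g
  proof -
    obtain G where G: "G \<in> cplx_space V" "shifted_op T ?c G = (\<lambda>x. complex_of_real (g x))"
      using bij cplx_of_real_in[OF g] unfolding bij_betw_def by (metis imageE)
    have "c *\<^sub>R (\<lambda>x. Re (G x)) - T (\<lambda>x. Re (G x)) = g"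
    proof
      fix x
      from fun_cong[OF G(2), of x] show "(c *\<^sub>R (\<lambda>x. Re (G x)) - T (\<lambda>x. Re (G x))) x = g x"
        by (simp add: shifted_op_def cplx_op_def complex_eq_iff)
    qed
    then show ?thesis using G(1) by (auto simp: cplx_space_def)
  qed
  show ?thesis using 1 2 by (intro exI[of _ "\<bar>M\<bar>"]) auto
qed

end

context potential
begin

abbreviation "TT \<equiv> transfer_op \<rho> A \<phi>"

lemma LL_h_bound:
  assumes f: "f \<in> C0 A" and h: "h \<in> C0 A" "LL \<phi> h = r *\<^sub>R h" and le: "\<And>x. x \<in> \<Omega> \<Longrightarrow> \<bar>f x\<bar> \<le> c * h x"
  shows "\<bar>LL \<phi> f x\<bar> \<le> c * (r * h x)"
proof -
  have ch: "c *\<^sub>R h \<in> C0 A" "(-1) *\<^sub>R f \<in> C0 A" by (intro C0.V_scale h f)+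
  have "LL \<phi> f x \<le> LL \<phi> (c *\<^sub>R h) x"
    by (rule LL_mono[OF \<phi>C f ch(1)]) (use le in \<open>force simp: abs_le_iff\<close>)
  moreover have "LL \<phi> ((-1) *\<^sub>R f) x \<le> LL \<phi> (c *\<^sub>R h) x"
    by (rule LL_mono[OF \<phi>C ch(2,1)]) (use le in \<open>force simp: abs_le_iff\<close>)
  ultimately show ?thesis unfolding LL_scale h(2) by (simp add: abs_le_iff)
qed

text \<open>A positive operator is controlled by one positive eigenfunction: a bound of
  \<open>\<bar>f\<bar>\<close> by \<open>c * h\<close> becomes the bound
  \<open>c * r ^ k * h\<close> after \<open>k\<close> steps.\<close>

lemma C0_op:
  assumes h: "h \<in> C0 A" "LL \<phi> h = r *\<^sub>R h" "\<And>x. x \<in> \<Omega> \<Longrightarrow> kap \<le> h x" and r: "0 < r"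
  shows "fun_space_op (C0 A) (sup_norm A) TT (sup_norm A h / kap) r"
proof
  fix f k assume f: "f \<in> C0 A"
  let ?c = "sup_norm A f / kap"
  have c0: "0 \<le> ?c" using C0.N_nonneg[OF f] kap by simp
  have h0: "0 \<le> h x" if "x \<in> \<Omega>" for x using h(3)[OF that] kap by linarith
  have "(TT ^^ k) f \<in> C0 A \<and> (\<forall>x\<in>\<Omega>. \<bar>(TT ^^ k) f x\<bar> \<le> (?c * r ^ k) * h x)"
  proof (induction k)
    case 0
    have "\<bar>f x\<bar> \<le> ?c * h x" if "x \<in> \<Omega>" for x
    proof -
      have "\<bar>f x\<bar> \<le> ?c * kap" using abs_le_sup[OF f] kap by simp
      also have "\<dots> \<le> ?c * h x" using h(3)[OF that] c0 by (intro mult_left_mono)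
      finally show ?thesis .
    qed
    then show ?case using f by simp
  next
    case (Suc k)
    then have IH: "(TT ^^ k) f \<in> C0 A" "\<And>x. x \<in> \<Omega> \<Longrightarrow> \<bar>(TT ^^ k) f x\<bar> \<le> (?c * r ^ k) * h x" by auto
    have "(TT ^^ Suc k) f = LL \<phi> ((TT ^^ k) f)" using transfer_LL[OF IH(1)] by simp
    then show ?case
      using LL_C0[OF \<phi>C IH(1)] LL_h_bound[OF IH(1) h(1,2) IH(2)]
      by (auto simp: mult_ac)
  qed
  then have b: "\<bar>(TT ^^ k) f x\<bar> \<le> (?c * r ^ k) * h x" if "x \<in> \<Omega>" for x using that by blast
  have "sup_norm A ((TT ^^ k) f) \<le> (?c * r ^ k) * sup_norm A h"
  proof (rule sup_le)
    fix x assume "x \<in> \<Omega>"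
    note b[OF this]
    also have "(?c * r ^ k) * h x \<le> (?c * r ^ k) * sup_norm A h"
      using abs_le_sup[OF h(1), of x] r by (intro mult_left_mono mult_nonneg_nonneg c0) auto
    finally show "\<bar>(TT ^^ k) f x\<bar> \<le> (?c * r ^ k) * sup_norm A h" .
  qed
  then show "sup_norm A ((TT ^^ k) f) \<le> sup_norm A h / kap * r ^ k * sup_norm A f"
    by (simp add: mult_ac)
qed (use r \<phi>C in \<open>auto simp: transfer_LL LL_C0 LL_add C0.V_add C0.V_scale LL_scale\<close>)

text \<open>The Neumann series on \<open>C0 A\<close> excludes moduli above \<open>r\<close>, and
  \<open>h\<close> makes \<open>r\<close> an eigenvalue, so the supremum is attained at
  \<open>r\<close>.\<close>

lemma r_transfer_eq:
  assumes h: "h \<in> C0 A" "LL \<phi> h = r *\<^sub>R h" "\<And>x. x \<in> \<Omega> \<Longrightarrow> kap \<le> h x" and r: "0 < r"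
  shows "r_transfer \<rho> A \<phi> = r"
proof -
  interpret op: fun_space_op "C0 A" "sup_norm A" TT "sup_norm A h / kap" r by (rule C0_op[OF assms])
  let ?S = "spectrum_on (C0 A) (sup_norm A) TT"
  have le: "cmod \<zeta> \<le> r" if "\<zeta> \<in> ?S" for \<zeta>
    using op.in_resolvent_set[of \<zeta>] that by (force simp: spectrum_on_def)
  have "complex_of_real r \<notin> resolvent_set (C0 A) (sup_norm A) TT"
  proof
    let ?h = "\<lambda>x. complex_of_real (h x)" and ?z = "\<lambda>x. complex_of_real ((0 :: _ \<Rightarrow> real) x)"
    assume "complex_of_real r \<in> resolvent_set (C0 A) (sup_norm A) TT"
    then have inj: "inj_on (shifted_op TT (complex_of_real r)) (cplx_space (C0 A))"
      by (simp add: resolvent_set_def bij_betw_def)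
    have "TT h = r *\<^sub>R h" using transfer_LL[OF h(1)] h(2) by simp
    then have "shifted_op TT (complex_of_real r) ?h = shifted_op TT (complex_of_real r) ?z"
      unfolding op.shifted_of_real[OF h(1)] op.shifted_of_real[OF C0.V_0] op.T_0 by simp
    from inj_onD[OF inj this op.cplx_of_real_in[OF h(1)] op.cplx_of_real_in[OF C0.V_0]]
    have "h x0 = 0" by (metis of_real_eq_0_iff zero_fun_apply)
    then show False using h(3)[OF x0] kap by simp
  qed
  then have rS: "complex_of_real r \<in> ?S" by (simp add: spectrum_on_def)
  have "Sup (cmod ` ?S) = r"
  proof (rule cSup_eq_maximum)
    have "cmod (complex_of_real r) \<in> cmod ` ?S" using rS by (rule imageI)
    then show "r \<in> cmod ` ?S" using r by simp
  qed (use le in auto)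
  then show ?thesis by (simp add: r_transfer_def spectral_radius_on_def)
qed

text \<open>Subtracting the rank one operator \<open>r \<nu> \<otimes> h\<close> from the transfer operator removes the leading
  eigenvalue.\<close>

theorem spectral_gap:
  obtains h r where
    "h \<in> Lip1 A" "h x0 = 1" "lip_norm A h \<le> CK (lc + 2) / kap" "\<And>x. x \<in> \<Omega> \<Longrightarrow> 0 < h x"
    "0 < r" "LL \<phi> h = r *\<^sub>R h" "r_transfer \<rho> A \<phi> = r"
    "simple_dominating_eigenvalue (Lip1 A) (lip_norm A) TT r"
    "\<exists>M\<ge>0. \<forall>f\<in>Lip1 A. lip_norm A f \<le> M * lip_norm A (f - (1 / r) *\<^sub>R LL \<phi> f + f x0 *\<^sub>R h)"
    "\<And>g. g \<in> Lip1 A \<Longrightarrow> \<exists>f\<in>Lip1 A. f - (1 / r) *\<^sub>R LL \<phi> f + f x0 *\<^sub>R h = g"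
proof -
  obtain h r \<nu> \<tau> C where
    h: "h \<in> Lip1 A" "h x0 = 1" "lip_norm A h \<le> CK (lc + 2) / kap" "\<And>x. x \<in> \<Omega> \<Longrightarrow> kap \<le> h x"
    and r: "0 < r" "LL \<phi> h = r *\<^sub>R h" and \<tau>: "0 < \<tau>" "\<tau> < 1" "0 \<le> C"
    and \<nu>: "\<And>f g. f \<in> Lip1 A \<Longrightarrow> g \<in> Lip1 A \<Longrightarrow> \<nu> (f + g) = \<nu> f + \<nu> g"
    "\<And>f c. f \<in> Lip1 A \<Longrightarrow> \<nu> (c *\<^sub>R f) = c * \<nu> f"
    "\<nu> h = (1::real)" "\<And>f. f \<in> Lip1 A \<Longrightarrow> \<nu> (LL \<phi> f) = r * \<nu> f"
    "\<And>f. f \<in> Lip1 A \<Longrightarrow> \<bar>\<nu> f\<bar> \<le> C * lip_norm A f"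
    and gap: "\<And>f k. f \<in> Lip1 A \<Longrightarrow> lip_norm A ((1 / r ^ k) *\<^sub>R (LL \<phi> ^^ k) f - \<nu> f *\<^sub>R h) \<le> C * \<tau> ^ k * lip_norm A f"
    by (rule RPF) blast
  let ?V = "Lip1 A" and ?N = "lip_norm A"
  have hC: "h \<in> C0 A" by (rule Lip1_D(4)[OF h(1)])
  have rt: "r_transfer \<rho> A \<phi> = r" by (rule r_transfer_eq[OF hC r(2) h(4) r(1)])
  have TLL: "TT f = LL \<phi> f" if "f \<in> ?V" for f by (rule transfer_LL[OF Lip1_D(4)[OF that]])
  have \<nu>_diff: "\<nu> (f - g) = \<nu> f - \<nu> g" if "f \<in> ?V" "g \<in> ?V" for f g
    using \<nu>(1)[OF that(1) Lip.V_scale[OF that(2), of "-1"]] \<nu>(2)[OF that(2), of "-1"] by simp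

  \<comment> \<open>Deflation by a rank one operator\<close>
  define T' where "T' f = LL \<phi> f - (r * \<nu> f) *\<^sub>R h" for f
  have T'V: "T' f \<in> ?V" if "f \<in> ?V" for f
    unfolding T'_def by (intro Lip.V_diff Lip.V_scale h LL_Lip1 \<phi> that)
  have \<nu>T': "\<nu> (T' f) = 0" if f: "f \<in> ?V" for f
    unfolding T'_def using f h by (simp add: \<nu>_diff \<nu> LL_Lip1 \<phi> Lip.V_scale)
  have LLk: "(LL \<phi> ^^ k) f \<in> ?V \<and> \<nu> ((LL \<phi> ^^ k) f) = r ^ k * \<nu> f" if "f \<in> ?V" for f k
    by (induction k) (auto simp: that \<nu> LL_Lip1 \<phi>)
  \<comment> \<open>The image of \<open>T'\<close> lies in the kernel of \<open>\<nu>\<close>, so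
    the correction acts in the first step only. The exponent is positive because the zeroth power is
    not corrected at all.\<close>
  have T'k: "(T' ^^ Suc k) f = (LL \<phi> ^^ Suc k) f - (r ^ Suc k * \<nu> f) *\<^sub>R h" if f: "f \<in> ?V" for f k
  proof -
    define P where "P k \<longleftrightarrow> (T' ^^ Suc k) f = (LL \<phi> ^^ Suc k) f - (r ^ Suc k * \<nu> f) *\<^sub>R h" for k
    have "P k"
    proof (induction k)
      case 0 then show ?case by (simp add: P_def T'_def)
    next
      case (Suc k)
      let ?u = "(LL \<phi> ^^ Suc k) f"
      have u: "?u \<in> ?V" "\<nu> ?u = r ^ Suc k * \<nu> f" using LLk[OF f, of "Suc k"] by auto
      have IH: "(T' ^^ Suc k) f = ?u - (r ^ Suc k * \<nu> f) *\<^sub>R h" using Suc by (simp only: P_def)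
      have hh: "(r ^ Suc k * \<nu> f) *\<^sub>R h \<in> ?V" by (intro Lip.V_scale h)
      have z: "\<nu> (?u - (r ^ Suc k * \<nu> f) *\<^sub>R h) = 0" using u hh h(1) by (simp add: \<nu>_diff \<nu>)
      have "(T' ^^ Suc (Suc k)) f = T' (?u - (r ^ Suc k * \<nu> f) *\<^sub>R h)" by (simp only: funpow.simps(2)[of "Suc k"] o_apply IH)
      also have "\<dots> = LL \<phi> (?u - (r ^ Suc k * \<nu> f) *\<^sub>R h)" unfolding T'_def z by simp
      also have "\<dots> = LL \<phi> ?u - (r ^ Suc k * \<nu> f) *\<^sub>R r *\<^sub>R h"
      proof -
        have "LL \<phi> (?u + (- (r ^ Suc k * \<nu> f)) *\<^sub>R h) = LL \<phi> ?u + (- (r ^ Suc k * \<nu> f)) *\<^sub>R r *\<^sub>R h"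
          by (simp only: LL_add[OF \<phi>C Lip1_D(4)[OF u(1)] C0.V_scale[OF hC]] LL_scale r(2))
        then show ?thesis by (simp only: scaleR_minus_left add_uminus_conv_diff)
      qed
      also have "\<dots> = (LL \<phi> ^^ Suc (Suc k)) f - (r ^ Suc (Suc k) * \<nu> f) *\<^sub>R h"
        by (auto simp: fun_eq_iff)
      finally show ?case by (simp only: P_def)
    qed
    then show ?thesis by (simp only: P_def)
  qed
  interpret op: fun_space_op ?V ?N T' "C + 1" "r * \<tau>"
  proof
    show "T' f \<in> ?V" if "f \<in> ?V" for f by (rule T'V[OF that])
    show "T' (f + g) = T' f + T' g" if "f \<in> ?V" "g \<in> ?V" for f g
      unfolding T'_def \<nu>(1)[OF that] LL_add[OF \<phi>C Lip1_D(4)[OF that(1)] Lip1_D(4)[OF that(2)]]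
      by (auto simp: fun_eq_iff algebra_simps)
    show "T' (c *\<^sub>R f) = c *\<^sub>R T' f" if "f \<in> ?V" for f c
      unfolding T'_def \<nu>(2)[OF that] LL_scale by (auto simp: fun_eq_iff algebra_simps)
    show "0 \<le> r * \<tau>" using r \<tau> by simp
    show "?N ((T' ^^ k) f) \<le> (C + 1) * (r * \<tau>) ^ k * ?N f" if f: "f \<in> ?V" for f k
    proof (cases k)
      case 0
      have "1 * ?N f \<le> (C + 1) * ?N f" using \<tau> Lip.N_nonneg[OF f] by (intro mult_right_mono) auto
      then show ?thesis using 0 by simp
    next
      case (Suc m)
      have rk: "0 < r ^ k" using r by simp
      have eq: "(T' ^^ k) f = r ^ k *\<^sub>R ((1 / r ^ k) *\<^sub>R (LL \<phi> ^^ k) f - \<nu> f *\<^sub>R h)"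
        unfolding Suc T'k[OF f] using rk[unfolded Suc] by (auto simp: fun_eq_iff algebra_simps)
      have V: "(1 / r ^ k) *\<^sub>R (LL \<phi> ^^ k) f - \<nu> f *\<^sub>R h \<in> ?V"
        using LLk[OF f] h by (intro Lip.V_diff Lip.V_scale) auto
      have "?N ((T' ^^ k) f) \<le> \<bar>r ^ k\<bar> * ?N ((1 / r ^ k) *\<^sub>R (LL \<phi> ^^ k) f - \<nu> f *\<^sub>R h)"
        unfolding eq by (rule Lip.N_scale[OF V])
      also have "\<dots> \<le> r ^ k * (C * \<tau> ^ k * ?N f)" using rk gap[OF f] by (simp add: mult_left_mono)
      also have "\<dots> = C * ((r * \<tau>) ^ k * ?N f)" by (simp add: power_mult_distrib)
      also have "\<dots> \<le> (C + 1) * ((r * \<tau>) ^ k * ?N f)"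
        using r \<tau> Lip.N_nonneg[OF f] by (intro mult_right_mono) auto
      finally show ?thesis by (simp add: mult.assoc)
    qed
  qed

  \<comment> \<open>Complexification of the functional and of the deflated operator\<close>
  let ?W = "cplx_space ?V"
  let ?h = "\<lambda>x. complex_of_real (h x)"
  define \<nu>c where "\<nu>c g = Complex (\<nu> (\<lambda>x. Re (g x))) (\<nu> (\<lambda>x. Im (g x)))" for g :: "(nat \<Rightarrow> 'a) \<Rightarrow> complex"
  have hW: "?h \<in> ?W" by (rule op.cplx_of_real_in[OF h(1)])
  have \<nu>0: "\<nu> (\<lambda>x. 0) = 0" using \<nu>(2)[OF h(1), of 0] by (simp add: zero_fun_def)
  have \<nu>c_h: "\<nu>c ?h = 1" by (simp add: \<nu>c_def \<nu> \<nu>0 complex_eq_iff)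
  have \<nu>c_lin: "\<nu>c (\<lambda>x. c * f x + d * g x) = c * \<nu>c f + d * \<nu>c g" if "f \<in> ?W" "g \<in> ?W" for f g c d
  proof -
    let ?a = "\<lambda>x. Re (f x)" and ?b = "\<lambda>x. Im (f x)" and ?a' = "\<lambda>x. Re (g x)" and ?b' = "\<lambda>x. Im (g x)"
    have V: "?a \<in> ?V" "?b \<in> ?V" "?a' \<in> ?V" "?b' \<in> ?V" using that by (auto simp: cplx_space_def)
    have eq: "(\<lambda>x. Re (c * f x + d * g x)) = (Re c *\<^sub>R ?a + (- Im c) *\<^sub>R ?b) + (Re d *\<^sub>R ?a' + (- Im d) *\<^sub>R ?b')"
      "(\<lambda>x. Im (c * f x + d * g x)) = (Im c *\<^sub>R ?a + Re c *\<^sub>R ?b) + (Im d *\<^sub>R ?a' + Re d *\<^sub>R ?b')"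
      by (auto simp: fun_eq_iff)
    show ?thesis unfolding \<nu>c_def eq using V
      by (simp add: \<nu> Lip.V_add Lip.V_scale complex_eq_iff del: scaleR_minus_left)
  qed
  have \<nu>c_le: "cmod (\<nu>c g) \<le> 2 * C * cplx_norm ?N g" if g: "g \<in> ?W" for g
  proof -
    have V: "(\<lambda>x. Re (g x)) \<in> ?V" "(\<lambda>x. Im (g x)) \<in> ?V" using g by (auto simp: cplx_space_def)
    have "cmod (\<nu>c g) \<le> \<bar>\<nu> (\<lambda>x. Re (g x))\<bar> + \<bar>\<nu> (\<lambda>x. Im (g x))\<bar>"
      using cmod_le[of "\<nu>c g"] by (simp add: \<nu>c_def)
    also have "\<dots> \<le> C * cplx_norm ?N g + C * cplx_norm ?N g"
      using \<nu>(5)[OF V(1)] \<nu>(5)[OF V(2)] op.cplx_norm_bounds(1,2)[OF g] \<tau>(3)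
      by (intro add_mono) (meson mult_left_mono order_trans)+
    finally show ?thesis by simp
  qed
  have cT: "cplx_op TT g = (\<lambda>x. cplx_op T' g x + r * \<nu>c g * ?h x)" if g: "g \<in> ?W" for g
  proof -
    have V: "(\<lambda>x. Re (g x)) \<in> ?V" "(\<lambda>x. Im (g x)) \<in> ?V" using g by (auto simp: cplx_space_def)
    show ?thesis unfolding cplx_op_def TLL[OF V(1)] TLL[OF V(2)] T'_def \<nu>c_def
      by (auto simp: fun_eq_iff complex_eq_iff)
  qed
  have \<nu>cT': "\<nu>c (cplx_op T' g) = 0" if g: "g \<in> ?W" for g
  proof -
    have V: "(\<lambda>x. Re (g x)) \<in> ?V" "(\<lambda>x. Im (g x)) \<in> ?V" using g by (auto simp: cplx_space_def)
    show ?thesis using \<nu>T'[OF V(1)] \<nu>T'[OF V(2)] by (simp add: \<nu>c_def cplx_op_def complex_eq_iff)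
  qed
  have cT'W: "cplx_op T' g \<in> ?W" if g: "g \<in> ?W" for g
    using g by (simp add: cplx_space_def cplx_op_def T'V)
  have T'h: "cplx_op T' ?h = (\<lambda>x. 0)"
    using r(2) op.T_0 \<nu>(3) by (auto simp: cplx_op_def T'_def fun_eq_iff complex_eq_iff \<nu>0 zero_fun_def[symmetric])
  have sh: "shifted_op TT \<zeta> g = (\<lambda>x. shifted_op T' \<zeta> g x - r * \<nu>c g * ?h x)" if "g \<in> ?W" for g \<zeta>
    unfolding shifted_op_def cT[OF that] by (auto simp: algebra_simps)
  have \<nu>c_sh': "\<nu>c (shifted_op T' \<zeta> g) = \<zeta> * \<nu>c g" if g: "g \<in> ?W" for g \<zeta>
    using \<nu>c_lin[OF g cT'W[OF g], of \<zeta> "-1"] \<nu>cT'[OF g] by (simp add: shifted_op_def)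
  have \<nu>c_sh: "\<nu>c (shifted_op TT \<zeta> g) = (\<zeta> - r) * \<nu>c g" if g: "g \<in> ?W" for g \<zeta>
    using \<nu>c_lin[OF op.shifted_in[OF g, of \<zeta>] hW, of 1 "- (r * \<nu>c g)"] \<nu>c_sh'[OF g] \<nu>c_h
    unfolding sh[OF g] by (simp add: algebra_simps)
  have shW: "shifted_op TT \<zeta> g \<in> ?W" if g: "g \<in> ?W" for g \<zeta>
    using op.cplx_space_lin(1)[OF op.shifted_in[OF g, of \<zeta>] hW, of 1 "- (r * \<nu>c g)"]
    unfolding sh[OF g] by simp
  have sh'h: "shifted_op T' \<zeta> ?h = (\<lambda>x. \<zeta> * ?h x)" for \<zeta>
    unfolding shifted_op_def T'h by simp

  \<comment> \<open>Resolvent outside the smaller disk\<close>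
  have resolvent: "\<zeta> \<in> resolvent_set ?V ?N TT" if z: "r * \<tau> < cmod \<zeta>" "\<zeta> \<noteq> r" for \<zeta>
  proof -
    have z0: "\<zeta> \<noteq> 0" using z(1) mult_pos_pos[OF r(1) \<tau>(1)] by auto
    have zr: "\<zeta> - r \<noteq> 0" using z(2) by simp
    from op.in_resolvent_set[OF z(1)] obtain M where
      bij: "bij_betw (shifted_op T' \<zeta>) ?W ?W"
      and M: "\<And>g. g \<in> ?W \<Longrightarrow> cplx_norm ?N g \<le> M * cplx_norm ?N (shifted_op T' \<zeta> g)"
      unfolding resolvent_set_def by blast
    \<comment> \<open>As \<open>T'\<close> kills \<open>h\<close>, \<open>\<zeta> - T'\<close>
      multiplies \<open>h\<close> by \<open>\<zeta>\<close>; so the rank one term can be absorbed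
      into the argument.\<close>
    have key: "shifted_op T' \<zeta> (\<lambda>x. 1 * g x + (- (r / \<zeta>) * \<nu>c g) * ?h x) = shifted_op TT \<zeta> g" if g: "g \<in> ?W" for g
      unfolding op.shifted_lin[OF g hW] sh[OF g] sh'h using z0 by (auto simp: fun_eq_iff)
    \<comment> \<open>By \<open>\<nu>c_sh\<close>, the image determines \<open>\<nu>c g\<close>
      because \<open>\<zeta>\<close> differs from \<open>r\<close>; the rest is the injectivity of
      the deflated operator.\<close>
    have inj: "g = g'" if g: "g \<in> ?W" "g' \<in> ?W" and eq: "shifted_op TT \<zeta> g = shifted_op TT \<zeta> g'" for g g'
    proof -
      have "\<nu>c g = \<nu>c g'" using \<nu>c_sh[OF g(1), of \<zeta>] \<nu>c_sh[OF g(2), of \<zeta>] zr unfolding eq by simp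
      moreover have "(\<lambda>x. 1 * g x + (- (r / \<zeta>) * \<nu>c g) * ?h x) = (\<lambda>x. 1 * g' x + (- (r / \<zeta>) * \<nu>c g') * ?h x)"
        by (rule inj_onD[OF bij_betw_imp_inj_on[OF bij] _ op.cplx_space_lin(1)[OF g(1) hW] op.cplx_space_lin(1)[OF g(2) hW]])
          (simp only: key[OF g(1)] key[OF g(2)] eq)
      ultimately show ?thesis by (auto simp: fun_eq_iff)
    qed
    have surj: "\<exists>g\<in>?W. shifted_op TT \<zeta> g = y" if y: "y \<in> ?W" for y
    proof -
      have "y \<in> shifted_op T' \<zeta> ` ?W" using y by (simp only: bij_betw_imp_surj_on[OF bij])
      then obtain G where Gy: "y = shifted_op T' \<zeta> G" and GW: "G \<in> ?W" by (rule imageE)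
      note G = GW Gy[symmetric]
      \<comment> \<open>Solves \<open>c * \<zeta> = r * (\<nu>c G + c)\<close>, the condition that
        the multiples of \<open>h\<close> cancel.\<close>
      define c where "c = r * \<nu>c G / (\<zeta> - r)"
      define g where "g = (\<lambda>x. 1 * G x + c * ?h x)"
      have gW: "g \<in> ?W" unfolding g_def by (rule op.cplx_space_lin(1)[OF G(1) hW])
      have ng: "\<nu>c g = \<nu>c G + c" unfolding g_def \<nu>c_lin[OF G(1) hW] \<nu>c_h by simp
      have cz: "c * \<zeta> - r * (\<nu>c G + c) = 0" using zr by (simp add: c_def field_simps)
      have "shifted_op TT \<zeta> g x = y x" for x
      proof -
        have "shifted_op TT \<zeta> g x = y x + c * (\<zeta> * ?h x) - r * (\<nu>c G + c) * ?h x"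
          unfolding sh[OF gW] ng unfolding g_def op.shifted_lin[OF G(1) hW] sh'h G(2) by simp
        also have "\<dots> = y x + (c * \<zeta> - r * (\<nu>c G + c)) * ?h x" by (simp add: algebra_simps)
        finally show ?thesis unfolding cz by simp
      qed
      then show ?thesis by (intro bexI[OF _ gW] ext)
    qed
    have "bij_betw (shifted_op TT \<zeta>) ?W ?W"
      unfolding bij_betw_def
    proof (intro conjI inj_onI)
      show "shifted_op TT \<zeta> ` ?W = ?W"
      proof
        show "?W \<subseteq> shifted_op TT \<zeta> ` ?W"
        proof
          fix y assume "y \<in> ?W"
          from surj[OF this] show "y \<in> shifted_op TT \<zeta> ` ?W" by (auto simp del: o_apply)
        qed
        show "shifted_op TT \<zeta> ` ?W \<subseteq> ?W" by (rule image_subsetI) (rule shW)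
      qed
    qed (rule inj)
    moreover have "cplx_norm ?N g \<le> (2 * \<bar>M\<bar> + 4 * (r / cmod \<zeta>) * (C / cmod (\<zeta> - r)) * ?N h) * cplx_norm ?N (shifted_op TT \<zeta> g)"
      if g: "g \<in> ?W" for g
    proof -
      let ?y = "shifted_op TT \<zeta> g"
      define G where "G = (\<lambda>x. 1 * g x + (- (r / \<zeta>) * \<nu>c g) * ?h x)"
      have GW: "G \<in> ?W" unfolding G_def by (rule op.cplx_space_lin(1)[OF g hW])
      have "(\<lambda>x. Re (?y x)) \<in> ?V" using shW[OF g, of \<zeta>] unfolding cplx_space_def by simp
      then have y0: "0 \<le> cplx_norm ?N ?y"
        by (rule order_trans[OF Lip.N_nonneg op.cplx_norm_bounds(1)[OF shW[OF g]]])
      have "cplx_norm ?N G \<le> M * cplx_norm ?N ?y" using M[OF GW] key[OF g] by (simp only: G_def)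
      also have "\<dots> \<le> \<bar>M\<bar> * cplx_norm ?N ?y" using y0 by (intro mult_right_mono) auto
      finally have 1: "cplx_norm ?N G \<le> \<bar>M\<bar> * cplx_norm ?N ?y" .
      have "cmod (\<zeta> - r) * cmod (\<nu>c g) \<le> 2 * C * cplx_norm ?N ?y"
        using \<nu>c_le[OF shW[OF g, of \<zeta>]] unfolding \<nu>c_sh[OF g] by (simp add: norm_mult)
      then have "cmod (\<nu>c g) \<le> 2 * C * cplx_norm ?N ?y / cmod (\<zeta> - r)" using zr by (simp add: field_simps)
      then have "cmod (r / \<zeta> * \<nu>c g) \<le> r / cmod \<zeta> * (2 * C * cplx_norm ?N ?y / cmod (\<zeta> - r))"
        using r unfolding norm_mult norm_divide by (intro mult_mono) auto
      then have 2: "2 * cmod (r / \<zeta> * \<nu>c g) * ?N h \<le> 2 * (r / cmod \<zeta> * (2 * C * cplx_norm ?N ?y / cmod (\<zeta> - r))) * ?N h"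
        using Lip.N_nonneg[OF h(1)] by (intro mult_right_mono) auto
      have gG: "(\<lambda>x. G x + (r / \<zeta> * \<nu>c g) * ?h x) = g" by (auto simp: G_def fun_eq_iff)
      have "cplx_norm ?N g \<le> 2 * cplx_norm ?N G + 2 * cmod (r / \<zeta> * \<nu>c g) * ?N h"
        using op.cplx_norm_lin[OF GW h(1), of "r / \<zeta> * \<nu>c g"] unfolding gG .
      also have "\<dots> \<le> 2 * (\<bar>M\<bar> * cplx_norm ?N ?y) + 2 * (r / cmod \<zeta> * (2 * C * cplx_norm ?N ?y / cmod (\<zeta> - r))) * ?N h"
        using 1 2 by linarith
      also have "\<dots> = (2 * \<bar>M\<bar> + 4 * (r / cmod \<zeta>) * (C / cmod (\<zeta> - r)) * ?N h) * cplx_norm ?N ?y"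
        by (simp add: distrib_right)
      finally show ?thesis .
    qed
    ultimately show ?thesis unfolding resolvent_set_def
      by (intro CollectI conjI exI[of _ "2 * \<bar>M\<bar> + 4 * (r / cmod \<zeta>) * (C / cmod (\<zeta> - r)) * ?N h"] ballI)
  qed
  have sub: "spectrum_on ?V ?N TT - {complex_of_real r} \<subseteq> cball 0 (r * \<tau>)"
    using resolvent by (force simp: spectrum_on_def)

  \<comment> \<open>Algebraic simplicity of the leading eigenvalue\<close>
  have simple: "simple_eigenvalue ?V TT (complex_of_real r)"
    unfolding simple_eigenvalue_def
  proof (intro bexI conjI)
    show "?h \<noteq> (\<lambda>_. 0)" using h(2) by (metis of_real_eq_0_iff zero_neq_one)
    show eig: "cplx_op TT ?h = (\<lambda>x. complex_of_real r * ?h x)"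
      unfolding cT[OF hW] T'h \<nu>c_h by simp
    let ?S = "shifted_op TT (complex_of_real r)" and ?S' = "shifted_op T' (complex_of_real r)"
    have "r * \<tau> < cmod (complex_of_real r)" using r \<tau> by simp
    from op.in_resolvent_set[OF this] have inj: "inj_on ?S' ?W"
      by (simp add: resolvent_set_def bij_betw_def)
    have zW: "(\<lambda>x. 0) \<in> ?W" using op.cplx_space_lin(1)[OF hW hW, of 0 0] by simp
    have S'0: "?S' (\<lambda>x. 0) = (\<lambda>x. 0)" using op.shifted_lin[OF hW hW, of "complex_of_real r" 0 0] by simp
    have Sh: "?S (\<lambda>x. c * ?h x) = (\<lambda>x. 0)" for c
    proof -
      have cW: "(\<lambda>x. c * ?h x) \<in> ?W" and nc: "\<nu>c (\<lambda>x. c * ?h x) = c"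
        using op.cplx_space_lin(1)[OF hW hW, of c 0] \<nu>c_lin[OF hW hW, of c 0] \<nu>c_h by simp_all
      have "?S' (\<lambda>x. c * ?h x) = (\<lambda>x. c * (r * ?h x))"
        using op.shifted_lin[OF hW hW, of "complex_of_real r" c 0] by (simp add: sh'h)
      then show ?thesis unfolding sh[OF cW] nc by (auto simp: fun_eq_iff)
    qed
    \<comment> \<open>\<open>TT\<close> and \<open>T'\<close> agree on the kernel of
      \<open>\<nu>c\<close>, and \<open>?S\<close> kills \<open>h\<close>; so from the first power
      on the component along \<open>h\<close> is gone and only the injective \<open>?S'\<close>
      acts.\<close>
    have pw: "(?S ^^ n) (\<lambda>x. 1 * g x + c * ?h x) = (?S' ^^ n) g \<and> (?S' ^^ n) g \<in> ?W \<and> \<nu>c ((?S' ^^ n) g) = 0"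
      if g: "g \<in> ?W" "\<nu>c g = 0" and n: "n > 0" for g n c
      using n
    proof (induction n rule: nat_induct_non_zero)
      case 1
      have gW: "(\<lambda>x. 1 * g x + c * ?h x) \<in> ?W" by (rule op.cplx_space_lin(1)[OF g(1) hW])
      have nc: "\<nu>c (\<lambda>x. 1 * g x + c * ?h x) = c" unfolding \<nu>c_lin[OF g(1) hW] g(2) \<nu>c_h by simp
      have "?S (\<lambda>x. 1 * g x + c * ?h x) = ?S' g"
        unfolding sh[OF gW] nc op.shifted_lin[OF g(1) hW] sh'h by (auto simp: fun_eq_iff)
      then show ?case using op.shifted_in[OF g(1)] \<nu>c_sh'[OF g(1)] g(2) by simp
    next
      case (Suc n)
      let ?g = "(?S' ^^ n) g"
      have g': "?g \<in> ?W" "\<nu>c ?g = 0" and IH: "(?S ^^ n) (\<lambda>x. 1 * g x + c * ?h x) = ?g" using Suc.IH by auto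
      have "?S ?g = ?S' ?g" unfolding sh[OF g'(1)] g'(2) by simp
      then show ?case using op.shifted_in[OF g'(1)] \<nu>c_sh'[OF g'(1)] g'(2) IH by simp
    qed
    have inj0: "(?S' ^^ n) g = (\<lambda>x. 0) \<Longrightarrow> g \<in> ?W \<Longrightarrow> g = (\<lambda>x. 0)" for n g
    proof (induction n arbitrary: g)
      case (Suc n)
      have "(?S' ^^ n) (?S' g) = (\<lambda>x. 0)" using Suc.prems(1) by (simp add: funpow_swap1)
      from Suc.IH[OF this op.shifted_in[OF Suc.prems(2)]] have "?S' g = ?S' (\<lambda>x. 0)" unfolding S'0 .
      then show ?case using inj zW Suc.prems(2) by (auto dest: inj_onD)
    qed simp
    show "generalized_eigenspace ?V TT (complex_of_real r) = {\<lambda>x. c * ?h x |c. True}"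
    proof (intro set_eqI iffI)
      fix y assume "y \<in> {\<lambda>x. c * ?h x |c. True}"
      then obtain c where y: "y = (\<lambda>x. c * ?h x)" by blast
      have yW: "y \<in> ?W" using op.cplx_space_lin(1)[OF hW hW, of c 0] by (simp add: y)
      have "(?S ^^ 1) y = (\<lambda>_. 0)" unfolding y using Sh by simp
      then show "y \<in> generalized_eigenspace ?V TT (complex_of_real r)"
        unfolding generalized_eigenspace_def using yW by blast
    next
      fix y assume "y \<in> generalized_eigenspace ?V TT (complex_of_real r)"
      then obtain n where y: "y \<in> ?W" and n: "(?S ^^ n) y = (\<lambda>_. 0)"
        unfolding generalized_eigenspace_def by blast
      define g where "g = (\<lambda>x. 1 * y x + (- \<nu>c y) * ?h x)"
      have g: "g \<in> ?W" "\<nu>c g = 0" unfolding g_def \<nu>c_lin[OF y hW] \<nu>c_h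
        by (rule op.cplx_space_lin(1)[OF y hW]) simp
      have yg: "y = (\<lambda>x. 1 * g x + \<nu>c y * ?h x)" by (auto simp: g_def)
      have "g = (\<lambda>x. 0) \<or> y = (\<lambda>x. 0)"
      proof (cases n)
        case 0 then show ?thesis using n by simp
      next
        case (Suc m)
        have "(?S' ^^ n) g = (\<lambda>_. 0)" using conjunct1[OF pw[OF g, of n "\<nu>c y"]] n Suc yg by simp
        then show ?thesis using inj0 g(1) by blast
      qed
      then have "y = (\<lambda>x. \<nu>c y * ?h x) \<or> y = (\<lambda>x. 0 * ?h x)" using yg by auto
      then show "y \<in> {\<lambda>x. c * ?h x |c. True}" by blast
    qed
  qed (rule hW)
  have dom: "simple_dominating_eigenvalue ?V ?N TT r"
    unfolding simple_dominating_eigenvalue_def using simple sub r \<tau>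
    by (intro conjI exI[of _ "r * \<tau>"]) auto

  \<comment> \<open>Bijectivity of the bordered operator\<close>
  have "r * \<tau> < r" using r \<tau> by simp
  from op.resolvent_real[OF this] obtain M where M: "0 \<le> M" "\<And>f. f \<in> ?V \<Longrightarrow> ?N f \<le> M * ?N (r *\<^sub>R f - T' f)"
    and ex: "\<And>g. g \<in> ?V \<Longrightarrow> \<exists>f\<in>?V. r *\<^sub>R f - T' f = g" by blast
  \<comment> \<open>The border uses evaluation at \<open>x0\<close> instead of \<open>\<nu>\<close>,
    a functional common to all potentials; \<open>\<nu> (MM f) = f x0\<close> still links the
    two.\<close>
  define MM where "MM f = f - (1 / r) *\<^sub>R LL \<phi> f + f x0 *\<^sub>R h" for f
  have MMV: "MM f \<in> ?V" if "f \<in> ?V" for f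
    unfolding MM_def by (intro Lip.V_add Lip.V_diff Lip.V_scale LL_Lip1 \<phi> h that)
  have \<nu>MM: "\<nu> (MM f) = f x0" if f: "f \<in> ?V" for f
    unfolding MM_def using f h r by (simp add: \<nu> \<nu>_diff Lip.V_add Lip.V_diff Lip.V_scale LL_Lip1 \<phi>)
  have T'hh: "T' (c *\<^sub>R h) = 0" for c
    unfolding T'_def \<nu>(2)[OF h(1)] LL_scale r(2) \<nu>(3) by (auto simp: fun_eq_iff)
  have MM1: "\<exists>f\<in>?V. MM f = g" if g: "g \<in> ?V" for g
  proof -
    obtain u where u: "u \<in> ?V" "r *\<^sub>R u - T' u = r *\<^sub>R g" using ex[OF Lip.V_scale[OF g]] by blast
    have "\<nu> (r *\<^sub>R u - T' u) = r * \<nu> u" using u(1) by (simp add: \<nu>_diff \<nu> T'V \<nu>T' Lip.V_scale)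
    then have \<nu>u: "\<nu> u = \<nu> g" using r unfolding u(2) \<nu>(2)[OF g] by simp
    \<comment> \<open>Multiples of \<open>h\<close> do not change
      \<open>f - (1 / r) *\<^sub>R LL \<phi> f\<close>, so \<open>c\<close> is free to give the
      solution the value \<open>\<nu> g\<close> at \<open>x0\<close>.\<close>
    define c where "c = \<nu> g - u x0"
    have fV: "u + c *\<^sub>R h \<in> ?V" by (intro Lip.V_add Lip.V_scale u h)
    have L: "LL \<phi> (u + c *\<^sub>R h) = LL \<phi> u + c *\<^sub>R r *\<^sub>R h"
      by (subst LL_add[OF \<phi>C Lip1_D(4)[OF u(1)] C0.V_scale[OF hC]]) (simp only: LL_scale r(2))
    have "MM (u + c *\<^sub>R h) x = g x" for x
    proof -
      have "r * u x - (LL \<phi> u x - r * \<nu> g * h x) = r * g x"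
        using fun_cong[OF u(2), of x] by (simp add: T'_def \<nu>u)
      then have "u x - (1 / r) * LL \<phi> u x + \<nu> g * h x = g x" using r(1) by (simp add: field_simps)
      moreover have "MM (u + c *\<^sub>R h) x = u x - (1 / r) * LL \<phi> u x + \<nu> g * h x"
        unfolding MM_def L using r(1) h(2) by (simp add: c_def field_simps)
      ultimately show ?thesis by simp
    qed
    then show ?thesis using fV by blast
  qed
  have MM2: "?N f \<le> (M * r + (C + M * r) * ?N h) * ?N (MM f)" if f: "f \<in> ?V" for f
  proof -
    let ?g = "MM f"
    have g: "?g \<in> ?V" by (rule MMV[OF f])
    \<comment> \<open>Shifted along \<open>h\<close> so that \<open>\<nu> u = \<nu> ?g\<close>; the
      deflated equation for \<open>u\<close> then has the right-hand side
      \<open>r *\<^sub>R ?g\<close>.\<close>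
    define u where "u = f + (\<nu> ?g - \<nu> f) *\<^sub>R h"
    have uV: "u \<in> ?V" unfolding u_def by (intro Lip.V_add Lip.V_scale f h)
    have "T' u = T' f" unfolding u_def by (subst op.T_add[OF f Lip.V_scale[OF h(1)]]) (simp add: T'hh)
    then have "(r *\<^sub>R u - T' u) x = (r *\<^sub>R ?g) x" for x
      using \<nu>MM[OF f] r(1) by (simp add: u_def T'_def MM_def field_simps)
    then have "r *\<^sub>R u - T' u = r *\<^sub>R ?g" by blast
    then have "?N u \<le> M * ?N (r *\<^sub>R ?g)" using M(2)[OF uV] by simp
    also have "\<dots> \<le> M * (r * ?N ?g)" using Lip.N_scale[OF g, of r] r M(1) by (intro mult_left_mono) auto
    finally have Nu: "?N u \<le> M * r * ?N ?g" by simp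
    define c where "c = \<nu> ?g - u x0"
    have "f = u + c *\<^sub>R h" unfolding c_def u_def using \<nu>MM[OF f] h(2) by (auto simp: fun_eq_iff algebra_simps)
    then have "?N f \<le> ?N u + \<bar>c\<bar> * ?N h"
      using Lip.N_triangle[OF uV Lip.V_scale[OF h(1)], of c] Lip.N_scale[OF h(1), of c] by simp
    also have "\<bar>c\<bar> \<le> C * ?N ?g + M * r * ?N ?g"
      using \<nu>(5)[OF g] abs_le_lip_norm[OF uV, of x0] Nu unfolding c_def by linarith
    finally have "?N f \<le> M * r * ?N ?g + (C * ?N ?g + M * r * ?N ?g) * ?N h"
      using Nu Lip.N_nonneg[OF h(1)] by (smt (verit) mult_right_mono)
    then show ?thesis by (simp add: algebra_simps)
  qed
  show ?thesis
  proof (rule that[of h r])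
    show "\<exists>M\<ge>0. \<forall>f\<in>?V. ?N f \<le> M * ?N (f - (1 / r) *\<^sub>R LL \<phi> f + f x0 *\<^sub>R h)"
    proof (intro exI conjI ballI)
      show "0 \<le> M * r + (C + M * r) * ?N h" using M(1) r \<tau> Lip.N_nonneg[OF h(1)] by simp
      show "?N f \<le> (M * r + (C + M * r) * ?N h) * ?N (f - (1 / r) *\<^sub>R LL \<phi> f + f x0 *\<^sub>R h)" if "f \<in> ?V" for f
        using MM2[OF that] by (simp only: MM_def)
    qed
    show "\<exists>f\<in>?V. f - (1 / r) *\<^sub>R LL \<phi> f + f x0 *\<^sub>R h = g" if "g \<in> ?V" for g
      using MM1[OF that] by (simp only: MM_def)
    show "0 < h x" if "x \<in> \<Omega>" for x using h(4)[OF that] kap by linarith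
  qed (use h r rt dom in auto)
qed

end

section \<open>Smooth families of Lipschitz functions\<close>

lemma eventually_small_norm: "0 < \<epsilon> \<Longrightarrow> \<forall>\<^sub>F u in nhds (0 :: 'v::real_normed_vector). C * norm u \<le> \<epsilon>"
proof -
  assume e: "0 < \<epsilon>"
  have "((\<lambda>u::'v. C * norm u) \<longlongrightarrow> C * norm (0::'v)) (nhds 0)"
    by (intro tendsto_intros filterlim_ident)
  then have "\<forall>\<^sub>F u in nhds (0::'v). C * norm u < \<epsilon>" using e by (intro order_tendstoD(2)) auto
  then show ?thesis by eventually_elim simp
qed

text \<open>Stated for two points because the remainder of the exponential must be small in the
  Lipschitz seminorm too; 3 is a bound for \<open>exp 1\<close>.\<close>

lemma exp_diff_remainder:
  fixes s s' m :: real
  assumes "\<bar>s\<bar> \<le> m" "\<bar>s'\<bar> \<le> m" "m \<le> 1"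
  shows "\<bar>(exp s - 1 - s) - (exp s' - 1 - s')\<bar> \<le> 3 * m * \<bar>s - s'\<bar>"
proof -
  have a: "\<bar>exp s - 1\<bar> \<le> 3 * m" if "\<bar>s\<bar> \<le> m" for s :: real
  proof (cases "0 \<le> s")
    case True
    have "exp s - 1 \<le> s * exp s" by (rule exp_minus_one_le)
    also have "\<dots> \<le> s * 3" using True that assms(3) exp_le by (intro mult_left_mono) (auto intro: order_trans[of _ "exp 1"])
    finally show ?thesis using True that by simp
  next
    case False
    then have "exp s \<le> 1" by simp
    moreover have "0 \<le> m" using that by linarith
    ultimately show ?thesis unfolding abs_le_iff using exp_ge_add_one_self[of s] that by linarith
  qed
  have b: "exp s - exp s' - (s - s') \<le> 3 * m * \<bar>s - s'\<bar>" if "\<bar>s\<bar> \<le> m" for s s' :: real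
  proof -
    have "exp s * (1 + (s' - s)) \<le> exp s * exp (s' - s)" by (intro mult_left_mono) auto
    also have "\<dots> = exp s'" by (simp add: exp_add[symmetric])
    finally have "exp s - exp s' - (s - s') \<le> (exp s - 1) * (s - s')" by (simp add: algebra_simps)
    also have "\<dots> \<le> \<bar>exp s - 1\<bar> * \<bar>s - s'\<bar>" by (metis abs_ge_self abs_mult)
    also have "\<dots> \<le> 3 * m * \<bar>s - s'\<bar>" using a[OF that] by (intro mult_right_mono) auto
    finally show ?thesis .
  qed
  show ?thesis unfolding abs_le_iff
    using b[OF assms(1), of s'] b[OF assms(2), of s] by (simp add: abs_minus_commute)
qed

context shift_system
begin

abbreviation V where "V \<equiv> Lip1 A"
abbreviation N where "N \<equiv> lip_norm A"

text \<open>The remainders are quadratic rather than just \<open>o(norm u)\<close>; this is no loss for smooth families,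
  and it avoids all \<open>\<epsilon>\<close>-management.\<close>

primrec fC :: "nat \<Rightarrow> ('v::real_normed_vector \<Rightarrow> (nat \<Rightarrow> 'a) \<Rightarrow> real) \<Rightarrow> bool" where
  "fC 0 F \<longleftrightarrow> (\<forall>t. F t \<in> V) \<and> (\<forall>t. \<exists>C. \<forall>\<^sub>F u in nhds 0. N (F (t + u) - F t) \<le> C * norm u)"
| "fC (Suc n) F \<longleftrightarrow> (\<forall>t. F t \<in> V) \<and> (\<exists>D. (\<forall>t v. D t v \<in> V) \<and> (\<forall>t. linear (D t)) \<and>
     (\<forall>t. \<exists>C. \<forall>v. N (D t v) \<le> C * norm v) \<and>
     (\<forall>t. \<exists>C. \<forall>\<^sub>F u in nhds 0. N (F (t + u) - F t - D t u) \<le> C * (norm u)\<^sup>2) \<and>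
     (\<forall>v. fC n (\<lambda>t. D t v)))"

lemma fC_V: "fC n F \<Longrightarrow> F t \<in> V"
  by (cases n) auto

lemma fC_0I:
  assumes "\<And>t. F t \<in> V" "\<And>t. \<exists>C. \<forall>\<^sub>F u in nhds 0. N (F (t + u) - F t) \<le> C * norm u"
  shows "fC 0 F"
  using assms by auto

lemma fC_SucE:
  assumes "fC (Suc n) F"
  obtains D where "\<And>t v. D t v \<in> V" "\<And>t. linear (D t)" "\<And>t. \<exists>C. \<forall>v. N (D t v) \<le> C * norm v"
    "\<And>t. \<exists>C. \<forall>\<^sub>F u in nhds 0. N (F (t + u) - F t - D t u) \<le> C * (norm u)\<^sup>2" "\<And>v. fC n (\<lambda>t. D t v)"
  using assms by auto

lemma fC_SucI:
  assumes "\<And>t. F t \<in> V" "\<And>t v. D t v \<in> V" "\<And>t. linear (D t)" "\<And>t. \<exists>C. \<forall>v. N (D t v) \<le> C * norm v"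
    "\<And>t. \<exists>C. \<forall>\<^sub>F u in nhds 0. N (F (t + u) - F t - D t u) \<le> C * (norm u)\<^sup>2" "\<And>v. fC n (\<lambda>t. D t v)"
  shows "fC (Suc n) F"
  using assms by auto

lemma lip_0E:
  assumes "fC 0 F"
  obtains C where "0 \<le> C" "\<forall>\<^sub>F u in nhds 0. N (F (t + u) - F t) \<le> C * norm u"
proof -
  obtain C where C: "\<forall>\<^sub>F u in nhds 0. N (F (t + u) - F t) \<le> C * norm u" using assms by auto
  have "\<forall>\<^sub>F u in nhds 0. N (F (t + u) - F t) \<le> \<bar>C\<bar> * norm u"
    using C by eventually_elim (meson abs_ge_self mult_right_mono norm_ge_zero order_trans)
  then show ?thesis using that[of "\<bar>C\<bar>"] by simp
qed

lemma quadE: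
  assumes "\<exists>C. \<forall>\<^sub>F u in nhds 0. X u \<le> C * (norm u)\<^sup>2"
  obtains C :: real where "0 \<le> C" "\<forall>\<^sub>F u in nhds 0. X u \<le> C * (norm u)\<^sup>2"
proof -
  obtain C where C: "\<forall>\<^sub>F u in nhds 0. X u \<le> C * (norm u)\<^sup>2" using assms by auto
  have "\<forall>\<^sub>F u in nhds 0. X u \<le> \<bar>C\<bar> * (norm u)\<^sup>2"
    using C by eventually_elim (meson abs_ge_self mult_right_mono zero_le_power2 order_trans)
  then show ?thesis using that[of "\<bar>C\<bar>"] by simp
qed

lemma linE:
  assumes "\<exists>C. \<forall>v. X v \<le> C * norm v"
  obtains C :: real where "0 \<le> C" "\<And>v. X v \<le> C * norm v"
proof -
  obtain C where C: "\<And>v. X v \<le> C * norm v" using assms by auto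
  have "X v \<le> \<bar>C\<bar> * norm v" for v
    using C[of v] mult_right_mono[OF abs_ge_self[of C] norm_ge_zero[of v]] by linarith
  then show ?thesis using that[of "\<bar>C\<bar>"] by simp
qed

lemma fC_Suc_0:
  assumes "fC (Suc n) F" shows "fC 0 F"
proof -
  obtain D where D: "\<And>t v. D t v \<in> V" "\<And>t. \<exists>C. \<forall>v. N (D t v) \<le> C * norm v"
    "\<And>t. \<exists>C. \<forall>\<^sub>F u in nhds 0. N (F (t + u) - F t - D t u) \<le> C * (norm u)\<^sup>2"
    using assms by (rule fC_SucE) blast
  have FV: "F t \<in> V" for t by (rule fC_V[OF assms])
  have "\<exists>C. \<forall>\<^sub>F u in nhds 0. N (F (t + u) - F t) \<le> C * norm u" for t
  proof -
    obtain C1 where C1: "0 \<le> C1" "\<And>v. N (D t v) \<le> C1 * norm v" using linE[OF D(2)] by blast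
    obtain C2 where C2: "0 \<le> C2" "\<forall>\<^sub>F u in nhds 0. N (F (t + u) - F t - D t u) \<le> C2 * (norm u)\<^sup>2"
      using quadE[OF D(3)] by blast
    have "\<forall>\<^sub>F u in nhds 0. N (F (t + u) - F t) \<le> (C1 + C2) * norm u"
      using C2(2) eventually_small_norm[OF zero_less_one, of 1]
    proof eventually_elim
      case (elim u)
      have "N ((F (t + u) - F t - D t u) + D t u) \<le> N (F (t + u) - F t - D t u) + N (D t u)"
        by (intro Lip.N_triangle Lip.V_diff FV D(1))
      then have "N (F (t + u) - F t) \<le> N (F (t + u) - F t - D t u) + N (D t u)" by simp
      also have "\<dots> \<le> C2 * (norm u)\<^sup>2 + C1 * norm u" using elim(1) C1(2)[of u] by linarith
      also have "C2 * (norm u)\<^sup>2 \<le> C2 * (1 * norm u)"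
        unfolding power2_eq_square using C2(1) elim(2) by (intro mult_left_mono mult_right_mono) auto
      finally show ?case by (simp add: algebra_simps)
    qed
    then show ?thesis by blast
  qed
  then show ?thesis using FV by simp
qed

lemma fC_Suc: "fC (Suc n) F \<Longrightarrow> fC n F"
proof (induction n arbitrary: F)
  case 0
  then show ?case by (rule fC_Suc_0)
next
  case (Suc n)
  obtain D where D: "\<And>t v. D t v \<in> V" "\<And>t. linear (D t)" "\<And>t. \<exists>C. \<forall>v. N (D t v) \<le> C * norm v"
    "\<And>t. \<exists>C. \<forall>\<^sub>F u in nhds 0. N (F (t + u) - F t - D t u) \<le> C * (norm u)\<^sup>2" "\<And>v. fC (Suc n) (\<lambda>t. D t v)"
    using Suc.prems by (rule fC_SucE) blast
  show ?case by (rule fC_SucI[OF fC_V[OF Suc.prems] D(1-4) Suc.IH[OF D(5)]])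
qed

lemma fC_0: "fC n F \<Longrightarrow> fC 0 F"
  by (induction n) (auto dest: fC_Suc_0 simp del: fC.simps)

lemma fC_const: "f \<in> V \<Longrightarrow> fC n (\<lambda>t. f)"
proof (induction n arbitrary: f)
  case 0
  have "N (0 :: (nat \<Rightarrow> 'a) \<Rightarrow> real) = 0" using e_Lip1(2)[of 0] by simp
  then show ?case using 0 by (auto intro!: exI[of _ 0])
next
  case (Suc n)
  have N0: "N (0 :: (nat \<Rightarrow> 'a) \<Rightarrow> real) = 0" using e_Lip1(2)[of 0] by simp
  show ?case
    by (rule fC_SucI[where D = "\<lambda>t v. 0"])
      (use Suc N0 Lip.V_0 in \<open>auto intro!: exI[of _ 0] linear_zero simp del: fC.simps\<close>)
qed

text \<open>A bounded linear operator carries derivative and remainder along; scaling,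
  \<open>avg\<close> and evaluation at \<open>x0\<close> are the instances.\<close>

lemma fC_linear_op:
  assumes S: "\<And>f. f \<in> V \<Longrightarrow> S f \<in> V" "\<And>f g. f \<in> V \<Longrightarrow> g \<in> V \<Longrightarrow> S (f + g) = S f + S g"
    "\<And>c f. f \<in> V \<Longrightarrow> S (c *\<^sub>R f) = c *\<^sub>R S f" "\<And>f. f \<in> V \<Longrightarrow> N (S f) \<le> M * N f" "0 \<le> M"
  shows "fC n F \<Longrightarrow> fC n (\<lambda>t. S (F t))"
proof (induction n arbitrary: F)
  case 0
  have S_diff: "S (f - g) = S f - S g" if "f \<in> V" "g \<in> V" for f g
    using S(2)[OF that(1) Lip.V_scale[OF that(2), of "-1"]] S(3)[OF that(2), of "-1"] by simp
  have FV: "F t \<in> V" for t by (rule fC_V[OF 0])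
  have "\<exists>C. \<forall>\<^sub>F u in nhds 0. N (S (F (t + u)) - S (F t)) \<le> C * norm u" for t
  proof -
    obtain C where C: "0 \<le> C" "\<forall>\<^sub>F u in nhds 0. N (F (t + u) - F t) \<le> C * norm u" using lip_0E[OF 0] by blast
    have "\<forall>\<^sub>F u in nhds 0. N (S (F (t + u)) - S (F t)) \<le> (M * C) * norm u"
      using C(2)
    proof eventually_elim
      case (elim u)
      have "N (S (F (t + u)) - S (F t)) \<le> M * N (F (t + u) - F t)"
        unfolding S_diff[OF FV FV, symmetric] by (intro S Lip.V_diff FV)
      also have "\<dots> \<le> M * (C * norm u)" using elim S(5) by (intro mult_left_mono)
      finally show ?case by (simp add: mult.assoc)
    qed
    then show ?thesis by blast
  qed
  then show ?case using FV S by auto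
next
  case (Suc n)
  have S_diff: "S (f - g) = S f - S g" if "f \<in> V" "g \<in> V" for f g
    using S(2)[OF that(1) Lip.V_scale[OF that(2), of "-1"]] S(3)[OF that(2), of "-1"] by simp
  have FV: "F t \<in> V" for t by (rule fC_V[OF Suc.prems])
  obtain D where D: "\<And>t v. D t v \<in> V" "\<And>t. linear (D t)" "\<And>t. \<exists>C. \<forall>v. N (D t v) \<le> C * norm v"
    "\<And>t. \<exists>C. \<forall>\<^sub>F u in nhds 0. N (F (t + u) - F t - D t u) \<le> C * (norm u)\<^sup>2" "\<And>v. fC n (\<lambda>t. D t v)"
    using Suc.prems by (rule fC_SucE) blast
  show ?case
  proof (rule fC_SucI[where D = "\<lambda>t v. S (D t v)"])
    show "linear (\<lambda>v. S (D t v))" for t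
      by (rule linearI) (simp_all add: S D(1) linear_add[OF D(2)] linear_scale[OF D(2)])
    show "\<exists>C. \<forall>v. N (S (D t v)) \<le> C * norm v" for t
    proof -
      obtain C1 where C1: "0 \<le> C1" "\<And>v. N (D t v) \<le> C1 * norm v" using linE[OF D(3)] by blast
      have "N (S (D t v)) \<le> (M * C1) * norm v" for v
        using S(4)[OF D(1)[of t v]] mult_left_mono[OF C1(2)[of v] S(5)] by simp
      then show ?thesis by blast
    qed
    show "\<exists>C. \<forall>\<^sub>F u in nhds 0. N (S (F (t + u)) - S (F t) - S (D t u)) \<le> C * (norm u)\<^sup>2" for t
    proof -
      obtain C2 where C2: "0 \<le> C2" "\<forall>\<^sub>F u in nhds 0. N (F (t + u) - F t - D t u) \<le> C2 * (norm u)\<^sup>2"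
        using quadE[OF D(4)] by blast
      have "\<forall>\<^sub>F u in nhds 0. N (S (F (t + u)) - S (F t) - S (D t u)) \<le> (M * C2) * (norm u)\<^sup>2"
        using C2(2)
      proof eventually_elim
        case (elim u)
        have "S (F (t + u)) - S (F t) - S (D t u) = S (F (t + u) - F t - D t u)"
          by (simp add: S_diff FV D(1) Lip.V_diff)
        then have "N (S (F (t + u)) - S (F t) - S (D t u)) \<le> M * N (F (t + u) - F t - D t u)"
          using S(4)[OF Lip.V_diff[OF Lip.V_diff[OF FV FV] D(1)]] by simp
        also have "\<dots> \<le> M * (C2 * (norm u)\<^sup>2)" using elim S(5) by (intro mult_left_mono)
        finally show ?case by (simp add: mult.assoc)
      qed
      then show ?thesis by blast
    qed
    show "fC n (\<lambda>t. S (D t v))" for v by (rule Suc.IH[OF D(5)])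
  qed (use S FV D(1) in auto)
qed

lemma fC_add: "fC n F \<Longrightarrow> fC n G \<Longrightarrow> fC n (\<lambda>t. F t + G t)"
proof (induction n arbitrary: F G)
  case 0
  have FV: "F t \<in> V" "G t \<in> V" for t using fC_V 0 by auto
  have q: "\<exists>C. \<forall>\<^sub>F u in nhds 0. N (F (t + u) + G (t + u) - (F t + G t)) \<le> C * norm u" for t
  proof -
    obtain C where C: "\<forall>\<^sub>F u in nhds 0. N (F (t + u) - F t) \<le> C * norm u" using lip_0E[OF 0(1)] by blast
    obtain C' where C': "\<forall>\<^sub>F u in nhds 0. N (G (t + u) - G t) \<le> C' * norm u" using lip_0E[OF 0(2)] by blast
    have "\<forall>\<^sub>F u in nhds 0. N (F (t + u) + G (t + u) - (F t + G t)) \<le> (C + C') * norm u"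
      using C C'
    proof eventually_elim
      case (elim u)
      have eq: "F (t + u) + G (t + u) - (F t + G t) = (F (t + u) - F t) + (G (t + u) - G t)" by simp
      have "N (F (t + u) + G (t + u) - (F t + G t)) \<le> N (F (t + u) - F t) + N (G (t + u) - G t)"
        unfolding eq by (intro Lip.N_triangle Lip.V_diff FV)
      then show ?case using elim by (simp add: distrib_right)
    qed
    then show ?thesis by blast
  qed
  show ?case by (rule fC_0I[OF Lip.V_add[OF FV] q])
next
  case (Suc n)
  have FV: "F t \<in> V" "G t \<in> V" for t using fC_V Suc.prems by auto
  obtain D where D: "\<And>t v. D t v \<in> V" "\<And>t. linear (D t)" "\<And>t. \<exists>C. \<forall>v. N (D t v) \<le> C * norm v"
    "\<And>t. \<exists>C. \<forall>\<^sub>F u in nhds 0. N (F (t + u) - F t - D t u) \<le> C * (norm u)\<^sup>2" "\<And>v. fC n (\<lambda>t. D t v)"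
    using Suc.prems(1) by (rule fC_SucE) blast
  obtain D' where D': "\<And>t v. D' t v \<in> V" "\<And>t. linear (D' t)" "\<And>t. \<exists>C. \<forall>v. N (D' t v) \<le> C * norm v"
    "\<And>t. \<exists>C. \<forall>\<^sub>F u in nhds 0. N (G (t + u) - G t - D' t u) \<le> C * (norm u)\<^sup>2" "\<And>v. fC n (\<lambda>t. D' t v)"
    using Suc.prems(2) by (rule fC_SucE) blast
  show ?case
  proof (rule fC_SucI[where D = "\<lambda>t v. D t v + D' t v"])
    show "linear (\<lambda>v. D t v + D' t v)" for t
      by (rule linearI) (simp_all add: linear_add[OF D(2)] linear_scale[OF D(2)]
          linear_add[OF D'(2)] linear_scale[OF D'(2)] scaleR_add_right)
    show "\<exists>C. \<forall>v. N (D t v + D' t v) \<le> C * norm v" for t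
    proof -
      obtain C1 where C1: "\<And>v. N (D t v) \<le> C1 * norm v" using linE[OF D(3)] by blast
      obtain C2 where C2: "\<And>v. N (D' t v) \<le> C2 * norm v" using linE[OF D'(3)] by blast
      have "N (D t v + D' t v) \<le> (C1 + C2) * norm v" for v
        using Lip.N_triangle[OF D(1) D'(1), of t v t v] C1[of v] C2[of v] by (simp add: distrib_right)
      then show ?thesis by blast
    qed
    show "\<exists>C. \<forall>\<^sub>F u in nhds 0. N (F (t + u) + G (t + u) - (F t + G t) - (D t u + D' t u)) \<le> C * (norm u)\<^sup>2" for t
    proof -
      obtain C where C: "\<forall>\<^sub>F u in nhds 0. N (F (t + u) - F t - D t u) \<le> C * (norm u)\<^sup>2"
        using quadE[OF D(4)] by blast
      obtain C' where C': "\<forall>\<^sub>F u in nhds 0. N (G (t + u) - G t - D' t u) \<le> C' * (norm u)\<^sup>2"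
        using quadE[OF D'(4)] by blast
      have "\<forall>\<^sub>F u in nhds 0. N (F (t + u) + G (t + u) - (F t + G t) - (D t u + D' t u)) \<le> (C + C') * (norm u)\<^sup>2"
        using C C'
      proof eventually_elim
        case (elim u)
        have eq: "F (t + u) + G (t + u) - (F t + G t) - (D t u + D' t u)
            = (F (t + u) - F t - D t u) + (G (t + u) - G t - D' t u)" by simp
        have "N (F (t + u) + G (t + u) - (F t + G t) - (D t u + D' t u))
            \<le> N (F (t + u) - F t - D t u) + N (G (t + u) - G t - D' t u)"
          unfolding eq by (intro Lip.N_triangle Lip.V_diff FV D(1) D'(1))
        then show ?case using elim by (simp add: distrib_right)
      qed
      then show ?thesis by blast
    qed
    show "fC n (\<lambda>t. D t v + D' t v)" for v by (rule Suc.IH[OF D(5) D'(5)])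
  qed (rule Lip.V_add[OF FV] Lip.V_add[OF D(1) D'(1)])+
qed

lemma fC_scaleR: "fC n F \<Longrightarrow> fC n (\<lambda>t. c *\<^sub>R F t)"
  by (rule fC_linear_op[where S = "\<lambda>f. c *\<^sub>R f" and M = "\<bar>c\<bar>"])
    (auto simp: Lip.V_scale scaleR_add_right Lip.N_scale)

lemma fC_diff: "fC n F \<Longrightarrow> fC n G \<Longrightarrow> fC n (\<lambda>t. F t - G t)"
  using fC_add[OF _ fC_scaleR[of n G "-1"], of F] by simp

lemma fC_avg: "fC n F \<Longrightarrow> fC n (\<lambda>t. avg (F t))"
  by (rule fC_linear_op[where S = avg and M = "2 + 4 / \<delta>0"])
    (use \<delta>0(1) in \<open>auto simp: avg_Lip1 avg_add avg_scale Lip1_D\<close>)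

text \<open>The scalar \<open>F t x0\<close> is carried as a multiple of \<open>e\<close>, so that
  it remains a family in \<open>V\<close>.\<close>

lemma fC_eval: "fC n F \<Longrightarrow> fC n (\<lambda>t. F t x0 *\<^sub>R e)"
  by (rule fC_linear_op[where S = "\<lambda>f. f x0 *\<^sub>R e" and M = 1])
    (auto simp: Lip.V_scale e_Lip1 scaleR_add_left abs_le_lip_norm)

lemma N_mult: "f \<in> V \<Longrightarrow> g \<in> V \<Longrightarrow> N f \<le> a \<Longrightarrow> N g \<le> b \<Longrightarrow> N (f * g) \<le> a * b"
  using Lip1_mult(2)[of f g] Lip.N_nonneg[of f] Lip.N_nonneg[of g]
    mult_mono[of "N f" a "N g" b] by linarith

text \<open>Besides the two remainders, the product of the two increments is left over; it is
  quadratic since both families are Lipschitz at \<open>t\<close>.\<close>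

lemma fC_mult: "fC n F \<Longrightarrow> fC n G \<Longrightarrow> fC n (\<lambda>t. F t * G t)"
proof (induction n arbitrary: F G)
  case 0
  have FV: "F t \<in> V" "G t \<in> V" for t using fC_V 0 by auto
  have q: "\<exists>C. \<forall>\<^sub>F u in nhds 0. N (F (t + u) * G (t + u) - F t * G t) \<le> C * norm u" for t
  proof -
    obtain C where C: "0 \<le> C" "\<forall>\<^sub>F u in nhds 0. N (F (t + u) - F t) \<le> C * norm u" using lip_0E[OF 0(1)] by blast
    obtain C' where C': "0 \<le> C'" "\<forall>\<^sub>F u in nhds 0. N (G (t + u) - G t) \<le> C' * norm u" using lip_0E[OF 0(2)] by blast
    have "\<forall>\<^sub>F u in nhds 0. N (F (t + u) * G (t + u) - F t * G t) \<le> (C * N (G t) + N (F t) * C' + C * C') * norm u"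
      using C(2) C'(2) eventually_small_norm[OF zero_less_one, of 1]
    proof eventually_elim
      case (elim u)
      let ?a = "F (t + u) - F t" and ?b = "G (t + u) - G t"
      have ab: "?a \<in> V" "?b \<in> V" by (intro Lip.V_diff FV)+
      have eq: "F (t + u) * G (t + u) - F t * G t = (?a * G t + F t * ?b) + ?a * ?b"
        by (simp add: algebra_simps)
      have "N (F (t + u) * G (t + u) - F t * G t) \<le> (N (?a * G t) + N (F t * ?b)) + N (?a * ?b)"
        unfolding eq using Lip.N_triangle[OF Lip.V_add[OF Lip1_mult(1)[OF ab(1) FV(2)] Lip1_mult(1)[OF FV(1) ab(2)]] Lip1_mult(1)[OF ab], of t t]
          Lip.N_triangle[OF Lip1_mult(1)[OF ab(1) FV(2)] Lip1_mult(1)[OF FV(1) ab(2)], of t t] by linarith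
      also have "\<dots> \<le> (C * norm u * N (G t) + N (F t) * (C' * norm u)) + (C * norm u) * (C' * norm u)"
        by (intro add_mono N_mult ab FV elim order_refl)
      also have "(C * norm u) * (C' * norm u) \<le> (C * norm u) * (C' * 1)"
        using elim C C' by (intro mult_left_mono) auto
      finally show ?case by (simp add: algebra_simps)
    qed
    then show ?thesis by blast
  qed
  show ?case by (rule fC_0I[OF Lip1_mult(1)[OF FV] q])
next
  case (Suc n)
  have FV: "F t \<in> V" "G t \<in> V" for t using fC_V Suc.prems by auto
  obtain D where D: "\<And>t v. D t v \<in> V" "\<And>t. linear (D t)" "\<And>t. \<exists>C. \<forall>v. N (D t v) \<le> C * norm v"
    "\<And>t. \<exists>C. \<forall>\<^sub>F u in nhds 0. N (F (t + u) - F t - D t u) \<le> C * (norm u)\<^sup>2" "\<And>v. fC n (\<lambda>t. D t v)"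
    using Suc.prems(1) by (rule fC_SucE) blast
  obtain D' where D': "\<And>t v. D' t v \<in> V" "\<And>t. linear (D' t)" "\<And>t. \<exists>C. \<forall>v. N (D' t v) \<le> C * norm v"
    "\<And>t. \<exists>C. \<forall>\<^sub>F u in nhds 0. N (G (t + u) - G t - D' t u) \<le> C * (norm u)\<^sup>2" "\<And>v. fC n (\<lambda>t. D' t v)"
    using Suc.prems(2) by (rule fC_SucE) blast
  show ?case
  proof (rule fC_SucI[where D = "\<lambda>t v. D t v * G t + F t * D' t v"])
    show "F t * G t \<in> V" for t by (intro Lip1_mult FV)
    show "D t v * G t + F t * D' t v \<in> V" for t v by (intro Lip.V_add Lip1_mult FV D(1) D'(1))
    show "linear (\<lambda>v. D t v * G t + F t * D' t v)" for t
      by (rule linearI) (auto simp: linear_add[OF D(2)] linear_scale[OF D(2)]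
          linear_add[OF D'(2)] linear_scale[OF D'(2)] fun_eq_iff algebra_simps)
    show "\<exists>C. \<forall>v. N (D t v * G t + F t * D' t v) \<le> C * norm v" for t
    proof -
      obtain C1 where C1: "\<And>v. N (D t v) \<le> C1 * norm v" using linE[OF D(3)] by blast
      obtain C2 where C2: "\<And>v. N (D' t v) \<le> C2 * norm v" using linE[OF D'(3)] by blast
      have "N (D t v * G t + F t * D' t v) \<le> (C1 * N (G t) + N (F t) * C2) * norm v" for v
      proof -
        have "N (D t v * G t + F t * D' t v) \<le> N (D t v * G t) + N (F t * D' t v)"
          by (intro Lip.N_triangle Lip1_mult FV D(1) D'(1))
        also have "\<dots> \<le> C1 * norm v * N (G t) + N (F t) * (C2 * norm v)"
          by (intro add_mono N_mult FV D(1) D'(1) C1 C2 order_refl)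
        finally show ?thesis by (simp add: algebra_simps)
      qed
      then show ?thesis by blast
    qed
    show "\<exists>C. \<forall>\<^sub>F u in nhds 0. N (F (t + u) * G (t + u) - F t * G t - (D t u * G t + F t * D' t u)) \<le> C * (norm u)\<^sup>2" for t
    proof -
      obtain C1 where C1: "\<forall>\<^sub>F u in nhds 0. N (F (t + u) - F t - D t u) \<le> C1 * (norm u)\<^sup>2"
        using quadE[OF D(4)] by blast
      obtain C2 where C2: "\<forall>\<^sub>F u in nhds 0. N (G (t + u) - G t - D' t u) \<le> C2 * (norm u)\<^sup>2"
        using quadE[OF D'(4)] by blast
      obtain C where C: "\<forall>\<^sub>F u in nhds 0. N (F (t + u) - F t) \<le> C * norm u"
        using lip_0E[OF fC_0[OF Suc.prems(1)]] by blast
      obtain C' where C': "\<forall>\<^sub>F u in nhds 0. N (G (t + u) - G t) \<le> C' * norm u"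
        using lip_0E[OF fC_0[OF Suc.prems(2)]] by blast
      have "\<forall>\<^sub>F u in nhds 0. N (F (t + u) * G (t + u) - F t * G t - (D t u * G t + F t * D' t u))
          \<le> (C1 * N (G t) + N (F t) * C2 + C * C') * (norm u)\<^sup>2"
        using C1 C2 C C'
      proof eventually_elim
        case (elim u)
        let ?a = "F (t + u) - F t" and ?b = "G (t + u) - G t"
        let ?a' = "F (t + u) - F t - D t u" and ?b' = "G (t + u) - G t - D' t u"
        have ab: "?a \<in> V" "?b \<in> V" "?a' \<in> V" "?b' \<in> V" by (intro Lip.V_diff FV D(1) D'(1))+
        have eq: "F (t + u) * G (t + u) - F t * G t - (D t u * G t + F t * D' t u)
            = (?a' * G t + F t * ?b') + ?a * ?b"
          by (simp add: algebra_simps)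
        have "N (F (t + u) * G (t + u) - F t * G t - (D t u * G t + F t * D' t u))
            \<le> (N (?a' * G t) + N (F t * ?b')) + N (?a * ?b)"
          unfolding eq using Lip.N_triangle[OF Lip.V_add[OF Lip1_mult(1)[OF ab(3) FV(2)] Lip1_mult(1)[OF FV(1) ab(4)]] Lip1_mult(1)[OF ab(1,2)], of t t]
            Lip.N_triangle[OF Lip1_mult(1)[OF ab(3) FV(2)] Lip1_mult(1)[OF FV(1) ab(4)], of t t] by linarith
        also have "\<dots> \<le> (C1 * (norm u)\<^sup>2 * N (G t) + N (F t) * (C2 * (norm u)\<^sup>2)) + (C * norm u) * (C' * norm u)"
          by (intro add_mono N_mult ab FV elim order_refl)
        finally show ?case by (simp add: algebra_simps power2_eq_square)
      qed
      then show ?thesis by blast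
    qed
    show "fC n (\<lambda>t. D t v * G t + F t * D' t v)" for v
      by (intro fC_add Suc.IH D(5) D'(5) fC_Suc[OF Suc.prems(1)] fC_Suc[OF Suc.prems(2)])
  qed
qed

lemma Exp_remainder:
  assumes a: "a \<in> V" and le: "N a \<le> 1"
  shows "Exp a - e - a \<in> V" "N (Exp a - e - a) \<le> 3 * (N a)\<^sup>2"
proof -
  let ?m = "sup_norm A a"
  show "Exp a - e - a \<in> V" by (intro Lip.V_diff Exp_Lip1 a e_Lip1(1))
  have m: "\<bar>a x\<bar> \<le> ?m" for x by (rule abs_le_sup[OF Lip1_D(4)[OF a]])
  have m1: "0 \<le> ?m" "?m \<le> 1" "0 \<le> lip a"
    using sup_le_lip_norm[OF a] le C0.N_nonneg[OF Lip1_D(4)[OF a]] Lip1_D(1)[OF a] by auto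
  have eq: "(Exp a - e - a) x = exp (a x) - 1 - a x" if "x \<in> \<Omega>" for x using that by (simp add: Exp_def e_def)
  have "N (Exp a - e - a) \<le> 3 * ?m * ?m + 3 * ?m * lip a"
  proof (rule lip_norm_le)
    fix x y assume xy: "x \<in> \<Omega>" "y \<in> \<Omega>"
    have "3 * ?m * \<bar>a x - 0\<bar> \<le> 3 * ?m * ?m" using m[of x] m1 by (intro mult_left_mono) auto
    moreover have "\<bar>(exp (a x) - 1 - a x) - (exp 0 - 1 - 0)\<bar> \<le> 3 * ?m * \<bar>a x - 0\<bar>"
      by (rule exp_diff_remainder[OF m]) (use m1 in auto)
    ultimately show "\<bar>(Exp a - e - a) x\<bar> \<le> 3 * ?m * ?m"
      unfolding eq[OF xy(1)] by simp
    have "\<bar>(Exp a - e - a) x - (Exp a - e - a) y\<bar> \<le> 3 * ?m * \<bar>a x - a y\<bar>"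
      unfolding eq[OF xy(1)] eq[OF xy(2)] by (rule exp_diff_remainder[OF m m m1(2)])
    also have "\<dots> \<le> 3 * ?m * (lip a * dOmega x y)" using Lip1_D(2)[OF a xy] m1 by (intro mult_left_mono) auto
    finally show "\<bar>(Exp a - e - a) x - (Exp a - e - a) y\<bar> \<le> 3 * ?m * lip a * dOmega x y" by (simp add: mult.assoc)
  qed (use m1 Lip1_D(3)[OF a] in \<open>auto simp: Exp_def e_def\<close>)
  also have "\<dots> = 3 * (?m * N a)" by (simp add: lip_norm_eq algebra_simps)
  also have "\<dots> \<le> 3 * (N a * N a)"
    using sup_le_lip_norm[OF a] Lip.N_nonneg[OF a] by (intro mult_left_mono mult_right_mono) auto
  finally show "N (Exp a - e - a) \<le> 3 * (N a)\<^sup>2" by (simp add: power2_eq_square)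
qed

lemma Exp_diff_eq: "f \<in> V \<Longrightarrow> a \<in> V \<Longrightarrow> Exp (f + a) - Exp f = Exp f * (Exp a - e - a) + Exp f * a"
  using Lip1_D(3)[of a] by (auto simp: fun_eq_iff Exp_def e_def exp_add algebra_simps)

text \<open>The derivative is \<open>Exp (F t)\<close> times that of \<open>F\<close>; the product
  rule and the induction hypothesis for the factor \<open>Exp (F t)\<close> close the
  induction.\<close>

lemma fC_Exp: "fC n F \<Longrightarrow> fC n (\<lambda>t. Exp (F t))"
proof (induction n)
  case 0
  have FV: "F t \<in> V" for t using fC_V 0 by auto
  have "\<exists>C. \<forall>\<^sub>F u in nhds 0. N (Exp (F (t + u)) - Exp (F t)) \<le> C * norm u" for t
  proof -
    obtain C where C: "0 \<le> C" "\<forall>\<^sub>F u in nhds 0. N (F (t + u) - F t) \<le> C * norm u" using lip_0E[OF 0] by blast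
    have "\<forall>\<^sub>F u in nhds 0. N (Exp (F (t + u)) - Exp (F t)) \<le> (4 * N (Exp (F t)) * C) * norm u"
      using C(2) eventually_small_norm[OF zero_less_one, of C]
    proof eventually_elim
      case (elim u)
      define a where "a = F (t + u) - F t"
      have Fa: "F (t + u) = F t + a" by (simp add: a_def)
      have a: "a \<in> V" unfolding a_def by (intro Lip.V_diff FV)
      have aC: "N a \<le> C * norm u" unfolding a_def by (rule elim(1))
      have a1: "N a \<le> 1" using aC elim by linarith
      have EV: "Exp (F t) \<in> V" by (intro Exp_Lip1 FV)
      have "N (Exp (F (t + u)) - Exp (F t)) \<le> N (Exp (F t) * (Exp a - e - a)) + N (Exp (F t) * a)"
        unfolding Fa Exp_diff_eq[OF FV a] by (intro Lip.N_triangle Lip1_mult EV a Exp_remainder a1)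
      also have "\<dots> \<le> N (Exp (F t)) * (3 * (N a)\<^sup>2) + N (Exp (F t)) * N a"
        by (intro add_mono N_mult EV a Exp_remainder a1 order_refl)
      also have "\<dots> \<le> N (Exp (F t)) * (3 * N a) + N (Exp (F t)) * N a"
        using mult_right_mono[OF a1 Lip.N_nonneg[OF a]] Lip.N_nonneg[OF EV]
        by (intro add_mono mult_left_mono) (auto simp: power2_eq_square)
      also have "\<dots> = 4 * N (Exp (F t)) * N a" by simp
      also have "\<dots> \<le> 4 * N (Exp (F t)) * (C * norm u)"
        using aC Lip.N_nonneg[OF EV] by (intro mult_left_mono) auto
      finally show ?case by (simp add: mult.assoc)
    qed
    then show ?thesis by blast
  qed
  then show ?case using FV Exp_Lip1 by simp
next
  case (Suc n)
  have FV: "F t \<in> V" for t using fC_V Suc.prems by auto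
  have EV: "Exp (F t) \<in> V" for t by (intro Exp_Lip1 FV)
  obtain D where D: "\<And>t v. D t v \<in> V" "\<And>t. linear (D t)" "\<And>t. \<exists>C. \<forall>v. N (D t v) \<le> C * norm v"
    "\<And>t. \<exists>C. \<forall>\<^sub>F u in nhds 0. N (F (t + u) - F t - D t u) \<le> C * (norm u)\<^sup>2" "\<And>v. fC n (\<lambda>t. D t v)"
    using Suc.prems(1) by (rule fC_SucE) blast
  show ?case
  proof (rule fC_SucI[where D = "\<lambda>t v. Exp (F t) * D t v"])
    show "linear (\<lambda>v. Exp (F t) * D t v)" for t
      by (rule linearI) (auto simp: linear_add[OF D(2)] linear_scale[OF D(2)] fun_eq_iff algebra_simps)
    show "\<exists>C. \<forall>v. N (Exp (F t) * D t v) \<le> C * norm v" for t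
    proof -
      obtain C1 where C1: "\<And>v. N (D t v) \<le> C1 * norm v" using linE[OF D(3)] by blast
      have "N (Exp (F t) * D t v) \<le> N (Exp (F t)) * (C1 * norm v)" for v
        by (rule N_mult[OF EV D(1) order_refl C1])
      then have "N (Exp (F t) * D t v) \<le> (N (Exp (F t)) * C1) * norm v" for v
        by (simp add: mult.assoc)
      then show ?thesis by blast
    qed
    show "\<exists>C. \<forall>\<^sub>F u in nhds 0. N (Exp (F (t + u)) - Exp (F t) - Exp (F t) * D t u) \<le> C * (norm u)\<^sup>2" for t
    proof -
      obtain C1 where C1: "\<forall>\<^sub>F u in nhds 0. N (F (t + u) - F t - D t u) \<le> C1 * (norm u)\<^sup>2"
        using quadE[OF D(4)] by blast
      obtain C where C: "0 \<le> C" "\<forall>\<^sub>F u in nhds 0. N (F (t + u) - F t) \<le> C * norm u"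
        using lip_0E[OF fC_0[OF Suc.prems(1)]] by blast
      have "\<forall>\<^sub>F u in nhds 0. N (Exp (F (t + u)) - Exp (F t) - Exp (F t) * D t u)
          \<le> (N (Exp (F t)) * (3 * C\<^sup>2) + N (Exp (F t)) * C1) * (norm u)\<^sup>2"
        using C1 C(2) eventually_small_norm[OF zero_less_one, of C]
      proof eventually_elim
        case (elim u)
        let ?a = "F (t + u) - F t"
        let ?b = "F (t + u) - F t - D t u"
        have a: "?a \<in> V" "?b \<in> V" by (intro Lip.V_diff FV D(1))+
        have a1: "N ?a \<le> 1" using elim by linarith
        have "Exp (F (t + u)) - Exp (F t) = Exp (F t) * (Exp ?a - e - ?a) + Exp (F t) * ?a"
          using Exp_diff_eq[OF FV[of t] a(1)] by simp
        then have eq: "Exp (F (t + u)) - Exp (F t) - Exp (F t) * D t u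
            = Exp (F t) * (Exp ?a - e - ?a) + Exp (F t) * ?b"
          by (simp add: algebra_simps)
        have sq: "(N ?a)\<^sup>2 \<le> C\<^sup>2 * (norm u)\<^sup>2"
          using power_mono[OF elim(2) Lip.N_nonneg[OF a(1)], of 2] by (simp add: power_mult_distrib)
        have "N (Exp (F (t + u)) - Exp (F t) - Exp (F t) * D t u)
            \<le> N (Exp (F t) * (Exp ?a - e - ?a)) + N (Exp (F t) * ?b)"
          unfolding eq by (intro Lip.N_triangle Lip1_mult EV a Exp_remainder a1)
        also have "\<dots> \<le> N (Exp (F t)) * (3 * (C\<^sup>2 * (norm u)\<^sup>2)) + N (Exp (F t)) * (C1 * (norm u)\<^sup>2)"
          using sq by (intro add_mono N_mult EV a Exp_remainder(1) order_trans[OF Exp_remainder(2)] a1 order_refl elim) auto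
        finally show ?case by (simp add: algebra_simps)
      qed
      then show ?thesis by blast
    qed
    show "fC n (\<lambda>t. Exp (F t) * D t v)" for v
      by (intro fC_mult D(5) Suc.IH fC_Suc[OF Suc.prems])
  qed (rule EV Lip1_mult(1)[OF EV D(1)])+
qed

text \<open>Evaluation at \<open>x0\<close> is bounded by the norm, and a quadratic remainder
  divided by \<open>norm u\<close> still tends to 0.\<close>

lemma fC_times_differentiable: "fC n F \<Longrightarrow> times_differentiable n (\<lambda>t. F t x0)"
proof (induction n arbitrary: F)
  case 0
  have FV: "F t \<in> V" for t using fC_V 0 by auto
  have "isCont (\<lambda>t. F t x0) t" for t
  proof -
    obtain C where C: "0 \<le> C" "\<forall>\<^sub>F u in nhds 0. N (F (t + u) - F t) \<le> C * norm u" using lip_0E[OF 0] by blast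
    have "\<forall>\<^sub>F u in at 0. norm (F (t + u) x0 - F t x0) \<le> C * norm u"
      using filter_leD[OF at_within_le_nhds C(2)]
    proof eventually_elim
      case (elim u)
      then show ?case using abs_le_lip_norm[OF Lip.V_diff[OF FV[of "t + u"] FV[of t]], of x0] by simp
    qed
    moreover have "((\<lambda>u. C * norm u) \<longlongrightarrow> 0) (at (0::'b))"
      by (intro tendsto_mult_right_zero tendsto_norm_zero tendsto_ident_at)
    ultimately have "((\<lambda>u. F (t + u) x0 - F t x0) \<longlongrightarrow> 0) (at 0)" by (rule Lim_null_comparison)
    then have "((\<lambda>u. F (t + u) x0) \<longlongrightarrow> F t x0) (at 0)" by (rule LIM_zero_cancel)
    then show ?thesis by (simp add: isCont_iff)
  qed
  then show ?case by (simp add: continuous_at_imp_continuous_on)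
next
  case (Suc n)
  have FV: "F t \<in> V" for t using fC_V Suc.prems by auto
  obtain D where D: "\<And>t v. D t v \<in> V" "\<And>t. linear (D t)" "\<And>t. \<exists>C. \<forall>v. N (D t v) \<le> C * norm v"
    "\<And>t. \<exists>C. \<forall>\<^sub>F u in nhds 0. N (F (t + u) - F t - D t u) \<le> C * (norm u)\<^sup>2" "\<And>v. fC n (\<lambda>t. D t v)"
    using Suc.prems(1) by (rule fC_SucE) blast
  have der: "((\<lambda>t. F t x0) has_derivative (\<lambda>v. D t v x0)) (at t)" for t
    unfolding has_derivative_at
  proof
    obtain C1 where C1: "\<And>v. N (D t v) \<le> C1 * norm v" using linE[OF D(3)] by blast
    show "bounded_linear (\<lambda>v. D t v x0)"
    proof (rule bounded_linear_intro[where K = C1])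
      show "norm (D t v x0) \<le> norm v * C1" for v
        using abs_le_lip_norm[OF D(1), of t v x0] C1[of v] by (simp add: mult.commute)
    qed (simp_all add: linear_add[OF D(2)] linear_scale[OF D(2)])
    obtain C where C: "0 \<le> C" "\<forall>\<^sub>F u in nhds 0. N (F (t + u) - F t - D t u) \<le> C * (norm u)\<^sup>2"
      using quadE[OF D(4)] by blast
    have "\<forall>\<^sub>F u in at 0. norm (norm (F (t + u) x0 - F t x0 - D t u x0) / norm u) \<le> C * norm u"
      using filter_leD[OF at_within_le_nhds C(2)]
    proof eventually_elim
      case (elim u)
      then have "\<bar>F (t + u) x0 - F t x0 - D t u x0\<bar> \<le> C * (norm u)\<^sup>2"
        using abs_le_lip_norm[OF Lip.V_diff[OF Lip.V_diff[OF FV[of "t + u"] FV[of t]] D(1)[of t u]], of x0] by simp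
      then have "\<bar>F (t + u) x0 - F t x0 - D t u x0\<bar> / norm u \<le> C * (norm u)\<^sup>2 / norm u"
        by (rule divide_right_mono) simp
      then show ?case by (cases "u = 0") (auto simp: power2_eq_square)
    qed
    moreover have "((\<lambda>u. C * norm u) \<longlongrightarrow> 0) (at (0::'b))"
      by (intro tendsto_mult_right_zero tendsto_norm_zero tendsto_ident_at)
    ultimately show "((\<lambda>u. norm (F (t + u) x0 - F t x0 - D t u x0) / norm u) \<longlongrightarrow> 0) (at 0)"
      by (rule Lim_null_comparison)
  qed
  have "frechet_derivative (\<lambda>t. F t x0) (at t) = (\<lambda>v. D t v x0)" for t
    by (rule frechet_derivative_at[OF der, symmetric])
  then show ?case using der Suc.IH[OF D(5)] by (auto simp: differentiable_def)
qed

section \<open>Leading eigenfunctions and the comparison principle\<close>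

lemma potential_I:
  assumes "\<phi> \<in> V" "lip \<phi> \<le> lc" "\<And>x. \<bar>\<phi> x\<bar> \<le> B"
  shows "potential \<rho> A \<phi> lc B"
proof unfold_locales
  show "0 \<le> lc" using Lip1_D(1)[OF assms(1)] assms(2) by linarith
  show "0 \<le> B" using assms(3)[of x0] by linarith
qed (use assms in auto)

definition pr :: "((nat \<Rightarrow> 'a) \<Rightarrow> real) \<Rightarrow> real" where "pr \<phi> = ln (r_transfer \<rho> A \<phi>)"

text \<open>Identity minus a normalised transfer operator, whose kernel is spanned by the
  eigenfunction; the rank one term coming from the normalisation \<open>h x0 = 1\<close> removes
  this kernel.\<close>

definition bord :: "((nat \<Rightarrow> 'a) \<Rightarrow> real) \<Rightarrow> ((nat \<Rightarrow> 'a) \<Rightarrow> real) \<Rightarrow> ((nat \<Rightarrow> 'a) \<Rightarrow> real) \<Rightarrow> (nat \<Rightarrow> 'a) \<Rightarrow> real" where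
  "bord E h f = f - avg (E * f) + f x0 *\<^sub>R h"

text \<open>Dividing by the leading eigenvalue makes eigenfunctions fixed points; written as an
  exponential, it lets the pressure enter like a potential.\<close>

definition nExp :: "((nat \<Rightarrow> 'a) \<Rightarrow> real) \<Rightarrow> (nat \<Rightarrow> 'a) \<Rightarrow> real" where
  "nExp \<phi> = Exp (\<phi> - pr \<phi> *\<^sub>R e)"

text \<open>The last two conjuncts make the bordered operator an isomorphism; they travel with the
  eigenfunction because its uniqueness follows from the bound.\<close>

definition eigenfun :: "((nat \<Rightarrow> 'a) \<Rightarrow> real) \<Rightarrow> ((nat \<Rightarrow> 'a) \<Rightarrow> real) \<Rightarrow> bool" where
  "eigenfun \<phi> h \<longleftrightarrow> h \<in> V \<and> h x0 = 1 \<and> (\<forall>x\<in>\<Omega>. 0 < h x) \<and> avg (nExp \<phi> * h) = h \<and>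
     (\<exists>M\<ge>0. \<forall>f\<in>V. N f \<le> M * N (bord (nExp \<phi>) h f)) \<and> (\<forall>g\<in>V. \<exists>f\<in>V. bord (nExp \<phi>) h f = g)"

lemma nExp_eq: "0 < r_transfer \<rho> A \<phi> \<Longrightarrow> nExp \<phi> = (1 / r_transfer \<rho> A \<phi>) *\<^sub>R Exp \<phi>"
  by (auto simp: nExp_def Exp_def e_def pr_def exp_diff fun_eq_iff)

lemma avg_nExp: "0 < r_transfer \<rho> A \<phi> \<Longrightarrow> avg (nExp \<phi> * f) = (1 / r_transfer \<rho> A \<phi>) *\<^sub>R LL \<phi> f"
proof -
  assume "0 < r_transfer \<rho> A \<phi>"
  then have "nExp \<phi> * f = (1 / r_transfer \<rho> A \<phi>) *\<^sub>R (Exp \<phi> * f)"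
    unfolding nExp_eq[OF \<open>0 < r_transfer \<rho> A \<phi>\<close>] by (auto simp: fun_eq_iff)
  then show ?thesis by (simp only: avg_scale LL_def)
qed

lemma (in potential) eigenfun_ex:
  "\<exists>h. eigenfun \<phi> h \<and> lip_norm A h \<le> CK (lc + 2) / kap"
  "0 < r_transfer \<rho> A \<phi>"
  "simple_dominating_eigenvalue (Lip1 A) (lip_norm A) TT (r_transfer \<rho> A \<phi>)"
proof -
  have "(\<exists>h. eigenfun \<phi> h \<and> lip_norm A h \<le> CK (lc + 2) / kap) \<and> 0 < r_transfer \<rho> A \<phi> \<and>
    simple_dominating_eigenvalue (Lip1 A) (lip_norm A) TT (r_transfer \<rho> A \<phi>)"
  proof (rule spectral_gap)
    fix h r
    assume h: "h \<in> Lip1 A" "h x0 = 1" "lip_norm A h \<le> CK (lc + 2) / kap" "\<And>x. x \<in> \<Omega> \<Longrightarrow> 0 < h x"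
      and r: "0 < r" "LL \<phi> h = r *\<^sub>R h" and rt: "r_transfer \<rho> A \<phi> = r"
      and sd: "simple_dominating_eigenvalue (Lip1 A) (lip_norm A) TT r"
      and M: "\<exists>M\<ge>0. \<forall>f\<in>Lip1 A. lip_norm A f \<le> M * lip_norm A (f - (1 / r) *\<^sub>R LL \<phi> f + f x0 *\<^sub>R h)"
        "\<And>g. g \<in> Lip1 A \<Longrightarrow> \<exists>f\<in>Lip1 A. f - (1 / r) *\<^sub>R LL \<phi> f + f x0 *\<^sub>R h = g"
    have b: "bord (nExp \<phi>) h f = f - (1 / r) *\<^sub>R LL \<phi> f + f x0 *\<^sub>R h" for f
      unfolding bord_def using avg_nExp[of \<phi> f] rt r(1) by simp
    have "avg (nExp \<phi> * h) = h" using avg_nExp[of \<phi> h] rt r by simp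
    then have "eigenfun \<phi> h" unfolding eigenfun_def b using h M by blast
    then show ?thesis using h(3) r(1) rt sd by blast
  qed
  then show "\<exists>h. eigenfun \<phi> h \<and> lip_norm A h \<le> CK (lc + 2) / kap"
    "0 < r_transfer \<rho> A \<phi>"
    "simple_dominating_eigenvalue (Lip1 A) (lip_norm A) TT (r_transfer \<rho> A \<phi>)" by blast+
qed

lemma potential_Lip1: "\<phi> \<in> V \<Longrightarrow> potential \<rho> A \<phi> (lip \<phi>) (sup_norm A \<phi>)"
  by (rule potential_I) (auto simp: abs_le_sup Lip1_D)

lemma r_pos: "\<phi> \<in> V \<Longrightarrow> 0 < r_transfer \<rho> A \<phi>"
  using potential.eigenfun_ex(2)[OF potential_Lip1] .

definition eigf :: "((nat \<Rightarrow> 'a) \<Rightarrow> real) \<Rightarrow> (nat \<Rightarrow> 'a) \<Rightarrow> real" where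
  "eigf \<phi> = (SOME h. eigenfun \<phi> h)"

lemma eigenfun_eigf: "\<phi> \<in> V \<Longrightarrow> eigenfun \<phi> (eigf \<phi>)"
proof -
  assume "\<phi> \<in> V"
  then obtain h where "eigenfun \<phi> h" using potential.eigenfun_ex(1)[OF potential_Lip1] by blast
  then show ?thesis unfolding eigf_def by (rule someI[of "eigenfun \<phi>"])
qed

lemma eigf:
  assumes "\<phi> \<in> V"
  shows "eigf \<phi> \<in> V" "eigf \<phi> x0 = 1" "x \<in> \<Omega> \<Longrightarrow> 0 < eigf \<phi> x" "avg (nExp \<phi> * eigf \<phi>) = eigf \<phi>"
    "\<exists>M\<ge>0. \<forall>f\<in>V. N f \<le> M * N (bord (nExp \<phi>) (eigf \<phi>) f)"
    "g \<in> V \<Longrightarrow> \<exists>f\<in>V. bord (nExp \<phi>) (eigf \<phi>) f = g"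
  using eigenfun_eigf[OF assms] unfolding eigenfun_def by blast+

lemma nExp_V: "\<phi> \<in> V \<Longrightarrow> nExp \<phi> \<in> V"
  unfolding nExp_def by (intro Exp_Lip1 Lip.V_diff Lip.V_scale e_Lip1(1))

lemma bord_add:
  assumes "E \<in> V" "f \<in> V" "g \<in> V"
  shows "bord E h (f + g) = bord E h f + bord E h g"
proof -
  have "avg (E * (f + g)) = avg (E * f) + avg (E * g)"
    unfolding distrib_left by (intro avg_add Lip1_D(4) Lip1_mult assms)
  then show ?thesis by (auto simp: bord_def fun_eq_iff algebra_simps)
qed

lemma bord_scale: "bord E h (c *\<^sub>R f) = c *\<^sub>R bord E h f"
proof -
  have "E * (c *\<^sub>R f) = c *\<^sub>R (E * f)" by (auto simp: fun_eq_iff)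
  then have "avg (E * (c *\<^sub>R f)) = c *\<^sub>R avg (E * f)" by (simp only: avg_scale)
  then show ?thesis by (auto simp: bord_def fun_eq_iff algebra_simps)
qed

lemma bord_diff:
  assumes "E \<in> V" "f \<in> V" "g \<in> V"
  shows "bord E h (f - g) = bord E h f - bord E h g"
proof -
  have "bord E h (f + (-1) *\<^sub>R g) = bord E h f + (-1) *\<^sub>R bord E h g"
    by (simp only: bord_add[OF assms(1,2) Lip.V_scale[OF assms(3)]] bord_scale)
  then show ?thesis by simp
qed

text \<open>The bordered operator of \<open>eigf \<phi>\<close> sends \<open>h\<close> and
  \<open>eigf \<phi>\<close> to the same function, and it is injective. This lets the chosen
  \<open>eigf\<close> inherit the norm bound of the constructed eigenfunction.\<close>

lemma eigenfun_unique:
  assumes \<phi>: "\<phi> \<in> V" and h: "eigenfun \<phi> h"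
  shows "h = eigf \<phi>"
proof -
  let ?k = "eigf \<phi>"
  have hV: "h \<in> V" and h': "avg (nExp \<phi> * h) = h" "h x0 = 1" using h by (auto simp: eigenfun_def)
  obtain M where M: "\<And>f. f \<in> V \<Longrightarrow> N f \<le> M * N (bord (nExp \<phi>) ?k f)" using eigf(5)[OF \<phi>] by blast
  have "bord (nExp \<phi>) ?k h = ?k" "bord (nExp \<phi>) ?k ?k = ?k"
    unfolding bord_def h' eigf(2,4)[OF \<phi>] by auto
  then have "bord (nExp \<phi>) ?k (h - ?k) = 0"
    by (simp add: bord_diff nExp_V \<phi> hV eigf)
  then have "N (h - ?k) \<le> 0" using M[OF Lip.V_diff[OF hV eigf(1)[OF \<phi>]]] e_Lip1(2)[of 0] by simp
  then have "\<bar>(h - ?k) x\<bar> \<le> 0" for x using abs_le_lip_norm[OF Lip.V_diff[OF hV eigf(1)[OF \<phi>]], of x] by linarith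
  then show ?thesis by (auto simp: fun_eq_iff)
qed

lemma eigf_bound:
  assumes "\<phi> \<in> V" "lip \<phi> \<le> lc" "\<And>x. \<bar>\<phi> x\<bar> \<le> B"
  shows "N (eigf \<phi>) \<le> CK (lc + 2) / potential.kap \<rho> A lc B"
proof -
  obtain h where h: "eigenfun \<phi> h" "N h \<le> CK (lc + 2) / potential.kap \<rho> A lc B"
    using potential.eigenfun_ex(1)[OF potential_I[OF assms]] by blast
  then show ?thesis using eigenfun_unique[OF assms(1) h(1)] by simp
qed

lemma LL_eigf: "\<phi> \<in> V \<Longrightarrow> LL \<phi> (eigf \<phi>) = r_transfer \<rho> A \<phi> *\<^sub>R eigf \<phi>"
  using eigf(4)[of \<phi>] avg_nExp[OF r_pos, of \<phi> "eigf \<phi>"] r_pos[of \<phi>]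
  by (metis divide_self_if less_irrefl nonzero_divide_eq_eq scaleR_one scaleR_scaleR mult.commute)

text \<open>Collatz-Wielandt comparison: where \<open>eigf \<phi> / g\<close> is maximal,
  \<open>m *\<^sub>R g\<close> touches the eigenfunction from above, and one application of
  \<open>LL \<phi>\<close> compares \<open>r\<close> with \<open>s\<close>. The upper bounds on the
  pressure below are all obtained by a choice of \<open>g\<close>.\<close>

lemma r_le:
  assumes \<phi>: "\<phi> \<in> V" and g: "g \<in> C0 A" "\<And>x. x \<in> \<Omega> \<Longrightarrow> 0 < g x"
    and le: "\<And>x. x \<in> \<Omega> \<Longrightarrow> LL \<phi> g x \<le> s * g x"
  shows "r_transfer \<rho> A \<phi> \<le> s"
proof -
  let ?h = "eigf \<phi>"
  have hC: "?h \<in> C0 A" by (rule Lip1_D(4)[OF eigf(1)[OF \<phi>]])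
  have "continuous_on \<Omega> (\<lambda>x. ?h x / g x)"
    using g(2) by (intro continuous_on_divide C0_D hC g(1)) fastforce
  from continuous_attains_sup[OF compact_Omega Omega_nonempty this] obtain y where
    y: "y \<in> \<Omega>" "\<And>x. x \<in> \<Omega> \<Longrightarrow> ?h x / g x \<le> ?h y / g y" by blast
  define m where "m = ?h y / g y"
  have m: "0 < m" "m * g y = ?h y" using eigf(3)[OF \<phi> y(1)] g(2)[OF y(1)] by (auto simp: m_def)
  have "?h x \<le> (m *\<^sub>R g) x" if "x \<in> \<Omega>" for x
    using y(2)[OF that] g(2)[OF that] by (simp add: m_def[symmetric] field_simps)
  then have "LL \<phi> ?h y \<le> LL \<phi> (m *\<^sub>R g) y"
    by (intro LL_mono Lip1_D(4)[OF \<phi>] hC C0.V_scale g(1))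
  also have "\<dots> \<le> m * (s * g y)" using mult_left_mono[OF le[OF y(1)], of m] m by (simp add: LL_scale)
  also have "\<dots> = s * ?h y" using m by (simp add: mult_ac)
  finally have "r_transfer \<rho> A \<phi> * ?h y \<le> s * ?h y" by (simp add: LL_eigf[OF \<phi>])
  then show ?thesis using eigf(3)[OF \<phi> y(1)] by simp
qed

lemma pr_le:
  assumes "\<phi> \<in> V" "g \<in> C0 A" "\<And>x. x \<in> \<Omega> \<Longrightarrow> 0 < g x" "\<And>x. x \<in> \<Omega> \<Longrightarrow> LL \<phi> g x \<le> exp s * g x"
  shows "pr \<phi> \<le> s"
  unfolding pr_def using r_le[OF assms] r_pos[OF assms(1)] by (metis exp_gt_zero ln_exp ln_le_cancel_iff)

lemma exp_pr: "\<phi> \<in> V \<Longrightarrow> exp (pr \<phi>) = r_transfer \<rho> A \<phi>"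
  unfolding pr_def by (simp add: r_pos)

text \<open>The eigenfunction of \<open>\<phi>2\<close> is the test function.\<close>

lemma pr_mono:
  assumes \<phi>: "\<phi>1 \<in> V" "\<phi>2 \<in> V" and le: "\<And>x. x \<in> \<Omega> \<Longrightarrow> \<phi>1 x \<le> \<phi>2 x + c"
  shows "pr \<phi>1 \<le> pr \<phi>2 + c"
proof (rule pr_le[OF \<phi>(1)])
  let ?h = "eigf \<phi>2"
  show hC: "?h \<in> C0 A" by (rule Lip1_D(4)[OF eigf(1)[OF \<phi>(2)]])
  show hp: "0 < ?h x" if "x \<in> \<Omega>" for x by (rule eigf(3)[OF \<phi>(2) that])
  fix x assume x: "x \<in> \<Omega>"
  have "LL \<phi>1 ?h x \<le> avg (exp c *\<^sub>R (Exp \<phi>2 * ?h)) x"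
    unfolding LL_def
  proof (rule avg_mono)
    show "Exp \<phi>1 * ?h \<in> C0 A" "exp c *\<^sub>R (Exp \<phi>2 * ?h) \<in> C0 A"
      by (intro C0.V_scale C0_mult Exp_C0 Lip1_D(4) \<phi> eigf(1))+
    fix y assume y: "y \<in> \<Omega>"
    have "exp (\<phi>1 y) \<le> exp c * exp (\<phi>2 y)" using le[OF y] by (simp add: exp_add[symmetric] add.commute)
    then show "(Exp \<phi>1 * ?h) y \<le> (exp c *\<^sub>R (Exp \<phi>2 * ?h)) y"
      using y hp[OF y] mult_right_mono[of "exp (\<phi>1 y)" "exp c * exp (\<phi>2 y)" "?h y"] by (simp add: Exp_def mult.assoc)
  qed
  also have "\<dots> = exp c * LL \<phi>2 ?h x" by (simp add: avg_scale LL_def)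
  also have "\<dots> = exp (pr \<phi>2 + c) * ?h x" by (simp add: LL_eigf \<phi> exp_add exp_pr)
  finally show "LL \<phi>1 ?h x \<le> exp (pr \<phi>2 + c) * ?h x" .
qed

lemma pr_lipschitz:
  assumes \<phi>: "\<phi>1 \<in> V" "\<phi>2 \<in> V"
  shows "\<bar>pr \<phi>1 - pr \<phi>2\<bar> \<le> N (\<phi>1 - \<phi>2)"
proof -
  have *: "\<bar>\<phi>1 x - \<phi>2 x\<bar> \<le> N (\<phi>1 - \<phi>2)" for x
    using abs_le_lip_norm[OF Lip.V_diff[OF \<phi>], of x] by simp
  have "pr \<phi>1 \<le> pr \<phi>2 + N (\<phi>1 - \<phi>2)" by (rule pr_mono[OF \<phi>]) (use * in \<open>simp add: abs_le_iff algebra_simps\<close>)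
  moreover have "pr \<phi>2 \<le> pr \<phi>1 + N (\<phi>1 - \<phi>2)"
    by (rule pr_mono[OF \<phi>(2,1)]) (use * in \<open>simp add: abs_le_iff algebra_simps\<close>)
  ultimately show ?thesis by linarith
qed

section \<open>Linear equations with the bordered operator\<close>

definition "Ka = 2 + 4 / \<delta>0"

lemma Ka: "0 \<le> Ka" "f \<in> V \<Longrightarrow> N (avg f) \<le> Ka * N f"
  using \<delta>0(1) avg_Lip1(2) by (auto simp: Ka_def)

lemma Ka_le: "f \<in> V \<Longrightarrow> N f \<le> c \<Longrightarrow> N (avg f) \<le> Ka * c"
  using Ka(2)[of f] mult_left_mono[OF _ Ka(1), of "N f" c] by linarith

lemma scale_le: "f \<in> V \<Longrightarrow> \<bar>c\<bar> \<le> a \<Longrightarrow> N f \<le> b \<Longrightarrow> N (c *\<^sub>R f) \<le> a * b"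
  using Lip.N_scale[of f c] Lip.N_nonneg[of f] mult_mono[of "\<bar>c\<bar>" a "N f" b] by linarith

end

text \<open>The constant in \<open>bounded\<close> may vary with \<open>t\<close>: only
  perturbations of the operator at a fixed \<open>t\<close> are made.\<close>

locale bordered = shift_system +
  fixes E H :: "'v::real_normed_vector \<Rightarrow> (nat \<Rightarrow> 'a) \<Rightarrow> real"
  assumes bounded: "\<And>t. \<exists>M\<ge>0. \<forall>f\<in>V. N f \<le> M * N (bord (E t) (H t) f)"
    and surj: "\<And>t g. g \<in> V \<Longrightarrow> \<exists>f\<in>V. bord (E t) (H t) f = g"
    and E_in: "\<And>t. E t \<in> V" and H_in: "\<And>t. H t \<in> V"
begin

abbreviation "M t \<equiv> bord (E t) (H t)"

lemma M_inj: "f \<in> V \<Longrightarrow> g \<in> V \<Longrightarrow> M t f = M t g \<Longrightarrow> f = g"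
proof
  fix x assume fg: "f \<in> V" "g \<in> V" and eq: "M t f = M t g"
  obtain C where C: "\<And>f. f \<in> V \<Longrightarrow> N f \<le> C * N (M t f)" using bounded by blast
  have "M t (f - g) = 0" by (simp add: bord_diff E_in fg eq)
  then have "N (f - g) \<le> 0" using C[OF Lip.V_diff[OF fg]] e_Lip1(2)[of 0] by simp
  then show "f x = g x" using abs_le_lip_norm[OF Lip.V_diff[OF fg], of x] by simp
qed

text \<open>Used with \<open>s = t + u\<close>, where the equation for the solution is known while
  the inverse bound is available at \<open>t\<close>.\<close>

lemma M_change:
  assumes "f \<in> V"
  shows "M t f = M s f + avg ((E s - E t) * f) - f x0 *\<^sub>R (H s - H t)"
proof -
  have "avg ((E s - E t) * f) = avg (E s * f) - avg (E t * f)"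
    unfolding left_diff_distrib by (intro avg_diff Lip1_D(4) Lip1_mult E_in assms)
  then show ?thesis by (auto simp: bord_def fun_eq_iff algebra_simps)
qed

text \<open>Differentiating \<open>M t (G t) = F t\<close> gives an equation with the same operator
  for the derivative of \<open>G\<close>. Its data are one level less smooth than \<open>E\<close>,
  \<open>H\<close>, \<open>F\<close>, so the induction hypothesis applies, first to \<open>G\<close>
  itself and then to its derivative.\<close>

lemma fC_solve:
  assumes "fC n E" "fC n H" "fC n F" "\<And>t. G t \<in> V" "\<And>t. M t (G t) = F t"
  shows "fC n G"
  using assms
proof (induction n arbitrary: F G)
  case 0
  note GV = 0(4) and MG = 0(5)
  have FV: "F t \<in> V" for t by (rule fC_V[OF 0(3)])
  have "\<exists>C. \<forall>\<^sub>F u in nhds 0. N (G (t + u) - G t) \<le> C * norm u" for t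
  proof -
    obtain C where C: "0 \<le> C" "\<And>f. f \<in> V \<Longrightarrow> N f \<le> C * N (M t f)" using bounded by blast
    obtain Ce where Ce: "0 \<le> Ce" "\<forall>\<^sub>F u in nhds 0. N (E (t + u) - E t) \<le> Ce * norm u" using lip_0E[OF 0(1)] by blast
    obtain Ch where Ch: "0 \<le> Ch" "\<forall>\<^sub>F u in nhds 0. N (H (t + u) - H t) \<le> Ch * norm u" using lip_0E[OF 0(2)] by blast
    obtain Cf where Cf: "0 \<le> Cf" "\<forall>\<^sub>F u in nhds 0. N (F (t + u) - F t) \<le> Cf * norm u" using lip_0E[OF 0(3)] by blast
    \<comment> \<open>No bound on \<open>N (G (t + u))\<close> is known yet; once
      \<open>k * norm u\<close> is at most 1/2, the term containing it is absorbed into the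
      left-hand side.\<close>
    define k where "k = C * (Ka * Ce + Ch)"
    have "\<forall>\<^sub>F u in nhds 0. N (G (t + u) - G t) \<le> (2 * (C * Cf + k * N (G t))) * norm u"
      using Ce(2) Ch(2) Cf(2) eventually_small_norm[of "1/2" k, simplified]
    proof eventually_elim
      case (elim u)
      let ?G = "G (t + u)"
      have d: "?G - G t \<in> V" "E (t + u) - E t \<in> V" "H (t + u) - H t \<in> V" "F (t + u) - F t \<in> V"
        by (intro Lip.V_diff GV E_in H_in FV)+
      have "M t (?G - G t) = (F (t + u) - F t) + avg ((E (t + u) - E t) * ?G) - ?G x0 *\<^sub>R (H (t + u) - H t)"
        unfolding bord_diff[OF E_in GV GV] M_change[OF GV, of t "t + u" "t + u"] MG by simp
      then have "N (M t (?G - G t)) \<le> (N (F (t + u) - F t) + N (avg ((E (t + u) - E t) * ?G))) + N (?G x0 *\<^sub>R (H (t + u) - H t))"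
        using Lip.N_minus_le[OF Lip.V_add[OF d(4) avg_Lip1(1)[OF Lip1_mult(1)[OF d(2) GV[of "t + u"]]]] Lip.V_scale[OF d(3), of "?G x0"]]
          Lip.N_triangle[OF d(4) avg_Lip1(1)[OF Lip1_mult(1)[OF d(2) GV[of "t + u"]]]] by simp
      also have "\<dots> \<le> (Cf * norm u + Ka * (Ce * norm u * N ?G)) + N ?G * (Ch * norm u)"
        by (intro add_mono Ka_le N_mult scale_le Lip1_mult(1) elim d GV abs_le_lip_norm order_refl)
      finally have "C * N (M t (?G - G t)) \<le> C * ((Cf * norm u + Ka * (Ce * norm u * N ?G)) + N ?G * (Ch * norm u))"
        using C(1) by (rule mult_left_mono)
      then have "N (?G - G t) \<le> C * ((Cf * norm u + Ka * (Ce * norm u * N ?G)) + N ?G * (Ch * norm u))"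
        using C(2)[OF d(1)] by linarith
      also have "\<dots> = C * Cf * norm u + k * norm u * N ?G" by (simp add: k_def algebra_simps)
      finally have 1: "N (?G - G t) \<le> C * Cf * norm u + k * norm u * N ?G" .
      have "N ((?G - G t) + G t) \<le> N (?G - G t) + N (G t)" by (intro Lip.N_triangle d GV)
      then have 2: "N ?G \<le> N (?G - G t) + N (G t)" by simp
      have k0: "0 \<le> k * norm u" using C(1) Ka(1) Ce(1) Ch(1) by (simp add: k_def)
      have "k * norm u * N ?G \<le> k * norm u * (N (?G - G t) + N (G t))" using 2 k0 by (rule mult_left_mono)
      also have "\<dots> \<le> 1 / 2 * N (?G - G t) + k * norm u * N (G t)"
        using mult_right_mono[OF elim(4) Lip.N_nonneg[OF d(1)]] by (simp add: distrib_left)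
      finally have "N (?G - G t) \<le> C * Cf * norm u + (1 / 2 * N (?G - G t) + k * norm u * N (G t))" using 1 by linarith
      then show ?case by (simp add: algebra_simps)
    qed
    then show ?thesis by blast
  qed
  then show ?case by (intro fC_0I GV)
next
  case (Suc n)
  note GV = Suc.prems(4) and MG = Suc.prems(5)
  have FV: "F t \<in> V" for t by (rule fC_V[OF Suc.prems(3)])
  have fn: "fC n E" "fC n H" "fC n F" using Suc.prems(1-3) by (auto intro: fC_Suc simp del: fC.simps)
  have Gn: "fC n G" by (rule Suc.IH[OF fn GV MG])
  obtain De where De: "\<And>t v. De t v \<in> V" "\<And>t. linear (De t)" "\<And>t. \<exists>C. \<forall>v. N (De t v) \<le> C * norm v"
    "\<And>t. \<exists>C. \<forall>\<^sub>F u in nhds 0. N (E (t + u) - E t - De t u) \<le> C * (norm u)\<^sup>2" "\<And>v. fC n (\<lambda>t. De t v)"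
    using Suc.prems(1) by (rule fC_SucE) blast
  obtain Dh where Dh: "\<And>t v. Dh t v \<in> V" "\<And>t. linear (Dh t)" "\<And>t. \<exists>C. \<forall>v. N (Dh t v) \<le> C * norm v"
    "\<And>t. \<exists>C. \<forall>\<^sub>F u in nhds 0. N (H (t + u) - H t - Dh t u) \<le> C * (norm u)\<^sup>2" "\<And>v. fC n (\<lambda>t. Dh t v)"
    using Suc.prems(2) by (rule fC_SucE) blast
  obtain Df where Df: "\<And>t v. Df t v \<in> V" "\<And>t. linear (Df t)" "\<And>t. \<exists>C. \<forall>v. N (Df t v) \<le> C * norm v"
    "\<And>t. \<exists>C. \<forall>\<^sub>F u in nhds 0. N (F (t + u) - F t - Df t u) \<le> C * (norm u)\<^sup>2" "\<And>v. fC n (\<lambda>t. Df t v)"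
    using Suc.prems(3) by (rule fC_SucE) blast
  \<comment> \<open>Formal differentiation of
    \<open>G t - avg (E t * G t) + G t x0 *\<^sub>R H t = F t\<close>, with all terms free of the
    derivative of \<open>G\<close> moved to the right.\<close>
  define R where "R t v = Df t v + avg (De t v * G t) - G t x0 *\<^sub>R Dh t v" for t v
  have RV: "R t v \<in> V" for t v
    unfolding R_def by (intro Lip.V_diff Lip.V_add Lip.V_scale avg_Lip1 Lip1_mult De(1) Dh(1) Df(1) GV)
  have R_add: "R t (v + w) = R t v + R t w" for t v w
  proof -
    have "avg (De t (v + w) * G t) = avg (De t v * G t) + avg (De t w * G t)"
      unfolding linear_add[OF De(2)] distrib_right by (intro avg_add Lip1_D(4) Lip1_mult De(1) GV)
    then show ?thesis unfolding R_def linear_add[OF Df(2)] linear_add[OF Dh(2)]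
      by (auto simp: fun_eq_iff algebra_simps)
  qed
  have R_scale: "R t (c *\<^sub>R v) = c *\<^sub>R R t v" for t c v
  proof -
    have "De t (c *\<^sub>R v) * G t = c *\<^sub>R (De t v * G t)" unfolding linear_scale[OF De(2)] by (auto simp: fun_eq_iff)
    then have "avg (De t (c *\<^sub>R v) * G t) = c *\<^sub>R avg (De t v * G t)" by (simp only: avg_scale)
    then show ?thesis unfolding R_def linear_scale[OF Df(2)] linear_scale[OF Dh(2)]
      by (auto simp: fun_eq_iff algebra_simps)
  qed
  define D where "D t v = (SOME f. f \<in> V \<and> M t f = R t v)" for t v
  have "D t v \<in> V \<and> M t (D t v) = R t v" for t v
  proof -
    have "\<exists>f. f \<in> V \<and> M t f = R t v" using surj[OF RV[of t v], of t] by blast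
    from someI_ex[OF this] show ?thesis unfolding D_def .
  qed
  then have D: "\<And>t v. D t v \<in> V" "\<And>t v. M t (D t v) = R t v" by blast+
  show ?case
  proof (rule fC_SucI[OF GV D(1)])
    show "linear (D t)" for t
    proof (rule linearI)
      show "D t (v + w) = D t v + D t w" for v w
        by (rule M_inj[where t = t, OF D(1) Lip.V_add[OF D(1) D(1)]]) (simp only: bord_add[OF E_in D(1) D(1)] D(2) R_add)
      show "D t (c *\<^sub>R v) = c *\<^sub>R D t v" for c v
        by (rule M_inj[where t = t, OF D(1) Lip.V_scale[OF D(1)]]) (simp only: bord_scale D(2) R_scale)
    qed
    show "\<exists>C. \<forall>v. N (D t v) \<le> C * norm v" for t
    proof -
      obtain C where C: "0 \<le> C" "\<And>f. f \<in> V \<Longrightarrow> N f \<le> C * N (M t f)" using bounded by blast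
      obtain Ce where Ce: "\<And>v. N (De t v) \<le> Ce * norm v" using linE[OF De(3)] by blast
      obtain Ch where Ch: "\<And>v. N (Dh t v) \<le> Ch * norm v" using linE[OF Dh(3)] by blast
      obtain Cf where Cf: "\<And>v. N (Df t v) \<le> Cf * norm v" using linE[OF Df(3)] by blast
      have "N (D t v) \<le> (C * (Cf + Ka * Ce * N (G t) + N (G t) * Ch)) * norm v" for v
      proof -
        have av: "avg (De t v * G t) \<in> V" by (intro avg_Lip1 Lip1_mult De(1) GV)
        have "N (R t v) \<le> (N (Df t v) + N (avg (De t v * G t))) + N (G t x0 *\<^sub>R Dh t v)"
          unfolding R_def using Lip.N_minus_le[OF Lip.V_add[OF Df(1) av] Lip.V_scale[OF Dh(1)]]
            Lip.N_triangle[OF Df(1) av] by (smt (verit))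
        also have "\<dots> \<le> (Cf * norm v + Ka * (Ce * norm v * N (G t))) + N (G t) * (Ch * norm v)"
          by (intro add_mono Ka_le N_mult scale_le Lip1_mult(1) Ce Ch Cf De(1) Dh(1) GV abs_le_lip_norm order_refl)
        finally have "C * N (R t v) \<le> C * ((Cf * norm v + Ka * (Ce * norm v * N (G t))) + N (G t) * (Ch * norm v))"
          using C(1) by (rule mult_left_mono)
        then show ?thesis using C(2)[OF D(1)[of t v]] by (simp add: D(2) algebra_simps)
      qed
      then show ?thesis by blast
    qed
    show "fC n (\<lambda>t. D t v)" for v
    proof (rule Suc.IH[OF fn(1,2) _ D(1) D(2)])
      have "fC n (\<lambda>t. G t x0 *\<^sub>R e * Dh t v)" by (intro fC_mult fC_eval Gn Dh(5))
      moreover have "G t x0 *\<^sub>R e * Dh t v = G t x0 *\<^sub>R Dh t v" for t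
        using Lip1_D(3)[OF Dh(1)] by (auto simp: fun_eq_iff e_def)
      ultimately have "fC n (\<lambda>t. G t x0 *\<^sub>R Dh t v)" by (simp only:)
      then show "fC n (\<lambda>t. R t v)" unfolding R_def
        by (intro fC_diff fC_add fC_avg fC_mult Df(5) De(5) Gn)
    qed
    show "\<exists>C. \<forall>\<^sub>F u in nhds 0. N (G (t + u) - G t - D t u) \<le> C * (norm u)\<^sup>2" for t
    proof -
      obtain C where C: "0 \<le> C" "\<And>f. f \<in> V \<Longrightarrow> N f \<le> C * N (M t f)" using bounded by blast
      obtain Ce where Ce: "\<forall>\<^sub>F u in nhds 0. N (E (t + u) - E t) \<le> Ce * norm u"
        using lip_0E[OF fC_0[OF fn(1)]] by blast
      obtain Ch where Ch: "\<forall>\<^sub>F u in nhds 0. N (H (t + u) - H t) \<le> Ch * norm u"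
        using lip_0E[OF fC_0[OF fn(2)]] by blast
      obtain Cg where Cg: "\<forall>\<^sub>F u in nhds 0. N (G (t + u) - G t) \<le> Cg * norm u"
        using lip_0E[OF fC_0[OF Gn]] by blast
      obtain Qe where Qe: "\<forall>\<^sub>F u in nhds 0. N (E (t + u) - E t - De t u) \<le> Qe * (norm u)\<^sup>2"
        using quadE[OF De(4)] by blast
      obtain Qh where Qh: "\<forall>\<^sub>F u in nhds 0. N (H (t + u) - H t - Dh t u) \<le> Qh * (norm u)\<^sup>2"
        using quadE[OF Dh(4)] by blast
      obtain Qf where Qf: "\<forall>\<^sub>F u in nhds 0. N (F (t + u) - F t - Df t u) \<le> Qf * (norm u)\<^sup>2"
        using quadE[OF Df(4)] by blast
      have "\<forall>\<^sub>F u in nhds 0. N (G (t + u) - G t - D t u) \<le>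
          (C * (Qf + Ka * Qe * N (G t) + Ka * Ce * Cg + N (G t) * Qh + Cg * Ch)) * (norm u)\<^sup>2"
        using Ce Ch Cg Qe Qh Qf
      proof eventually_elim
        case (elim u)
        let ?n = "norm u"
        define g where "g = G (t + u) - G t"
        define E1 where "E1 = E (t + u) - E t"
        define H1 where "H1 = H (t + u) - H t"
        define E2 where "E2 = E1 - De t u"
        define H2 where "H2 = H1 - Dh t u"
        define F2 where "F2 = F (t + u) - F t - Df t u"
        have in_V: "g \<in> V" "E1 \<in> V" "H1 \<in> V" "E2 \<in> V" "H2 \<in> V" "F2 \<in> V"
          unfolding g_def E1_def H1_def E2_def H2_def F2_def
          by (intro Lip.V_diff GV E_in H_in FV De(1) Dh(1) Df(1))+
        have b: "N E1 \<le> Ce * ?n" "N H1 \<le> Ch * ?n" "N g \<le> Cg * ?n" "N E2 \<le> Qe * ?n\<^sup>2" "N H2 \<le> Qh * ?n\<^sup>2" "N F2 \<le> Qf * ?n\<^sup>2"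
          using elim by (simp_all add: g_def E1_def H1_def E2_def H2_def F2_def)
        have Mg: "M t (G (t + u)) = F (t + u) + avg (E1 * G (t + u)) - G (t + u) x0 *\<^sub>R H1"
          unfolding E1_def H1_def M_change[OF GV, of t "t + u" "t + u"] MG ..
        have Gu: "G (t + u) = G t + g" by (simp add: g_def)
        have E1': "E1 = De t u + E2" and H1': "H1 = Dh t u + H2" by (simp_all add: E2_def H2_def)
        have a1: "avg (E1 * G (t + u)) = (avg (De t u * G t) + avg (E2 * G t)) + avg (E1 * g)"
        proof -
          have "avg (E1 * G (t + u)) = avg (E1 * G t) + avg (E1 * g)"
            unfolding Gu distrib_left by (intro avg_add Lip1_D(4) Lip1_mult in_V GV)
          also have "avg (E1 * G t) = avg (De t u * G t) + avg (E2 * G t)"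
            unfolding E1' distrib_right by (intro avg_add Lip1_D(4) Lip1_mult in_V GV De(1))
          finally show ?thesis .
        qed
        \<comment> \<open>After the first order terms cancel, every summand carries a second order
          remainder (\<open>E2\<close>, \<open>H2\<close>, \<open>F2\<close>) or a product of two
          increments.\<close>
        let ?X1 = "avg (E2 * G t)" and ?X2 = "avg (E1 * g)" and ?X3 = "G t x0 *\<^sub>R H2" and ?X4 = "g x0 *\<^sub>R H1"
        have XV: "?X1 \<in> V" "?X2 \<in> V" "?X3 \<in> V" "?X4 \<in> V"
          by (intro avg_Lip1 Lip1_mult Lip.V_scale in_V GV)+
        have "M t (G (t + u) - G t - D t u) = M t (G (t + u)) - F t - R t u"
          unfolding bord_diff[OF E_in Lip.V_diff[OF GV GV] D(1)] bord_diff[OF E_in GV GV] MG D(2) ..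
        also have "\<dots> = F2 + ?X1 + ?X2 - ?X3 - ?X4"
          unfolding Mg a1 R_def F2_def unfolding Gu unfolding H1' by (auto simp: fun_eq_iff algebra_simps)
        finally have Md: "M t (G (t + u) - G t - D t u) = F2 + ?X1 + ?X2 - ?X3 - ?X4" .
        have "N (M t (G (t + u) - G t - D t u)) \<le> N F2 + N ?X1 + N ?X2 + N ?X3 + N ?X4"
          unfolding Md using Lip.N_minus_le[OF Lip.V_diff[OF Lip.V_add[OF Lip.V_add[OF in_V(6) XV(1)] XV(2)] XV(3)] XV(4)]
            Lip.N_minus_le[OF Lip.V_add[OF Lip.V_add[OF in_V(6) XV(1)] XV(2)] XV(3)]
            Lip.N_triangle[OF Lip.V_add[OF in_V(6) XV(1)] XV(2)] Lip.N_triangle[OF in_V(6) XV(1)] by linarith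
        also have "\<dots> \<le> Qf * ?n\<^sup>2 + Ka * (Qe * ?n\<^sup>2 * N (G t)) + Ka * (Ce * ?n * (Cg * ?n)) + N (G t) * (Qh * ?n\<^sup>2) + Cg * ?n * (Ch * ?n)"
          by (intro add_mono Ka_le N_mult scale_le Lip1_mult(1) b in_V GV abs_le_lip_norm order_refl order_trans[OF abs_le_lip_norm b(3)])
        finally have "C * N (M t (G (t + u) - G t - D t u)) \<le> C * (Qf * ?n\<^sup>2 + Ka * (Qe * ?n\<^sup>2 * N (G t)) + Ka * (Ce * ?n * (Cg * ?n)) + N (G t) * (Qh * ?n\<^sup>2) + Cg * ?n * (Ch * ?n))"
          using C(1) by (rule mult_left_mono)
        then have "N (G (t + u) - G t - D t u) \<le> C * (Qf * ?n\<^sup>2 + Ka * (Qe * ?n\<^sup>2 * N (G t)) + Ka * (Ce * ?n * (Cg * ?n)) + N (G t) * (Qh * ?n\<^sup>2) + Cg * ?n * (Ch * ?n))"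
          using C(2)[OF Lip.V_diff[OF Lip.V_diff[OF GV GV] D(1)], of "t + u" t t u] by linarith
        then show ?case by (simp add: algebra_simps power2_eq_square)
      qed
      then show ?thesis by blast
    qed
  qed
qed

end

section \<open>Smoothness of the pressure\<close>

lemma exp_remainder: "\<bar>y\<bar> \<le> 1 \<Longrightarrow> \<bar>exp y - 1 - y\<bar> \<le> 3 * y\<^sup>2" for y :: real
  using exp_diff_remainder[of y "\<bar>y\<bar>" 0] by (simp add: power2_eq_square abs_mult_self_eq mult.assoc)

lemma exp_minus_one_abs: "\<bar>y\<bar> \<le> 1 \<Longrightarrow> \<bar>exp y - 1\<bar> \<le> 4 * \<bar>y\<bar>" for y :: real
proof -
  assume y: "\<bar>y\<bar> \<le> 1"
  have "y\<^sup>2 \<le> \<bar>y\<bar>" using mult_right_mono[OF y, of "\<bar>y\<bar>"] by (simp add: power2_eq_square abs_mult_self_eq)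
  then show ?thesis using exp_remainder[OF y] by linarith
qed

locale potential_family = shift_system +
  fixes \<psi> :: "'q::finite \<Rightarrow> (nat \<Rightarrow> 'a) \<Rightarrow> real"
  assumes \<psi>: "\<And>i. \<psi> i \<in> Lip1 A"
begin

definition \<Phi> :: "real ^ 'q \<Rightarrow> (nat \<Rightarrow> 'a) \<Rightarrow> real" where "\<Phi> t = (\<Sum>i\<in>UNIV. (t $ i) *\<^sub>R \<psi> i)"

definition K\<psi> :: real where "K\<psi> = (\<Sum>i\<in>UNIV. N (\<psi> i))"

lemma \<Phi>_V: "\<Phi> t \<in> V"
  unfolding \<Phi>_def by (intro Lip.V_sum Lip.V_scale \<psi>)

lemma \<Phi>_add: "\<Phi> (s + t) = \<Phi> s + \<Phi> t"
  by (simp add: \<Phi>_def scaleR_add_left sum.distrib)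

lemma \<Phi>_scale: "\<Phi> (c *\<^sub>R t) = c *\<^sub>R \<Phi> t"
  by (simp add: \<Phi>_def scaleR_sum_right)

lemma linear_\<Phi>: "linear \<Phi>"
  by (rule linearI) (simp_all add: \<Phi>_add \<Phi>_scale)

lemma K\<psi>: "0 \<le> K\<psi>"
  unfolding K\<psi>_def by (intro sum_nonneg Lip.N_nonneg \<psi>)

lemma \<Phi>_bound: "N (\<Phi> t) \<le> K\<psi> * norm t"
proof -
  define S where "S I = (\<Sum>i\<in>I. (t $ i) *\<^sub>R \<psi> i)" for I
  define n where "n I = N (S I)" for I
  have "finite I \<Longrightarrow> n I \<le> (\<Sum>i\<in>I. norm t * N (\<psi> i))" for I
  proof (induction I rule: finite_induct)
    case empty
    have "n {} = 0" using e_Lip1(2)[of 0] by (simp add: S_def n_def)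
    then show ?case by simp
  next
    case (insert j I)
    have "n (insert j I) = N ((t $ j) *\<^sub>R \<psi> j + S I)" using insert(1,2) by (simp add: S_def n_def)
    moreover have "N ((t $ j) *\<^sub>R \<psi> j + S I) \<le> N ((t $ j) *\<^sub>R \<psi> j) + N (S I)"
      unfolding S_def by (intro Lip.N_triangle Lip.V_sum Lip.V_scale \<psi>)
    moreover have "N ((t $ j) *\<^sub>R \<psi> j) \<le> norm t * N (\<psi> j)"
      by (intro scale_le \<psi> order_refl component_le_norm_cart)
    ultimately show ?case using insert by (simp add: n_def)
  qed
  from this[of UNIV] show ?thesis by (simp add: \<Phi>_def S_def n_def K\<psi>_def sum_distrib_left mult.commute)
qed

abbreviation P where "P t \<equiv> pr (\<Phi> t)"

lemma pressure_eq: "pressure \<rho> A \<psi> t = P t"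
proof -
  have "(\<lambda>\<omega>. \<Sum>i\<in>UNIV. t $ i * \<psi> i \<omega>) = \<Phi> t" by (auto simp: fun_eq_iff \<Phi>_def sum_fun_apply)
  then show ?thesis by (simp add: pressure_def pr_def)
qed

abbreviation E where "E t \<equiv> nExp (\<Phi> t)"
abbreviation H where "H t \<equiv> eigf (\<Phi> t)"

sublocale bordered \<rho> A "\<lambda>t. nExp (\<Phi> t)" "\<lambda>t. eigf (\<Phi> t)"
  by unfold_locales (use eigf[OF \<Phi>_V] nExp_V[OF \<Phi>_V] in auto)

lemma N_0: "N 0 = 0"
  using e_Lip1(2)[of 0] by simp

lemma fC_\<Phi>: "fC n \<Phi>"
proof (cases n)
  case 0
  have "\<exists>C. \<forall>\<^sub>F u in nhds 0. N (\<Phi> (t + u) - \<Phi> t) \<le> C * norm u" for t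
    using \<Phi>_bound by (intro exI[of _ K\<psi>] always_eventually) (simp add: \<Phi>_add)
  then show ?thesis unfolding 0 by (intro fC_0I \<Phi>_V)
next
  case (Suc m)
  show ?thesis unfolding Suc
  proof (rule fC_SucI[OF \<Phi>_V \<Phi>_V linear_\<Phi>])
    show "\<exists>C. \<forall>v. N (\<Phi> v) \<le> C * norm v" using \<Phi>_bound by blast
    show "\<exists>C. \<forall>\<^sub>F u in nhds 0. N (\<Phi> (t + u) - \<Phi> t - \<Phi> u) \<le> C * (norm u)\<^sup>2" for t
      by (intro exI[of _ 0] always_eventually) (simp add: \<Phi>_add N_0)
  qed (intro fC_const \<Phi>_V)
qed

lemma P_lip: "\<bar>P (t + u) - P t\<bar> \<le> K\<psi> * norm u"
  using pr_lipschitz[OF \<Phi>_V \<Phi>_V, of "t + u" t] \<Phi>_bound[of u] by (simp add: \<Phi>_add)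

text \<open>All potentials with parameter within distance 1 of \<open>t\<close> share the bounds
  \<open>lc = b\<close> and \<open>B = b\<close>, hence the same cone constants and, by
  \<open>eigf_bound\<close>, one bound on the eigenfunctions.\<close>

lemma H_bound: "\<exists>B\<ge>0. \<forall>u. norm u \<le> 1 \<longrightarrow> N (H (t + u)) \<le> B"
proof -
  define b where "b = K\<psi> * (norm t + 1)"
  define B where "B = CK (b + 2) / potential.kap \<rho> A b b"
  have "N (H (t + u)) \<le> B" if "norm u \<le> 1" for u
  proof -
    have "N (\<Phi> (t + u)) \<le> K\<psi> * norm (t + u)" by (rule \<Phi>_bound)
    also have "\<dots> \<le> b" unfolding b_def
      using norm_triangle_ineq[of t u] that K\<psi> by (intro mult_left_mono) auto
    finally have n: "N (\<Phi> (t + u)) \<le> b" .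
    have "lip (\<Phi> (t + u)) \<le> b"
      using n C0.N_nonneg[OF Lip1_D(4)[OF \<Phi>_V[of "t + u"]]] by (simp add: lip_norm_eq)
    moreover have "\<bar>\<Phi> (t + u) x\<bar> \<le> b" for x
      using abs_le_lip_norm[OF \<Phi>_V[of "t + u"], of x] n by linarith
    ultimately show ?thesis unfolding B_def by (rule eigf_bound[OF \<Phi>_V])
  qed
  then show ?thesis by (intro exI[of _ "\<bar>B\<bar>"]) (auto intro: order_trans[OF _ abs_ge_self])
qed

lemma M_H: "M t (H t) = H t"
  unfolding bord_def eigf(2,4)[OF \<Phi>_V] by simp

lemma E_shift: "E t * Exp (\<Phi> u) = exp (P (t + u) - P t) *\<^sub>R E (t + u)"
  by (auto simp: fun_eq_iff nExp_def Exp_def e_def \<Phi>_add exp_add[symmetric])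

lemma H_V: "H t \<in> V" by (rule eigf(1)[OF \<Phi>_V])

lemma E_V: "E t \<in> V" by (rule nExp_V[OF \<Phi>_V])

text \<open>The increments of eigenfunction and pressure form a single unknown
  \<open>d + c *\<^sub>R H t\<close>. Since \<open>d\<close> vanishes at \<open>x0\<close> and
  \<open>H t\<close> is 1 there, evaluation at \<open>x0\<close> separates them again.\<close>

lemma increment:
  fixes t u
  defines "d \<equiv> H (t + u) - H t" and "c \<equiv> exp (P (t + u) - P t) - 1"
  shows "M t (d + c *\<^sub>R H t) = avg (E t * ((Exp (\<Phi> u) - e) * H (t + u))) - c *\<^sub>R d"
proof -
  let ?h = "H (t + u)"
  have hV: "?h \<in> V" by (rule H_V)
  have "E t * ((Exp (\<Phi> u) - e) * ?h) = exp (P (t + u) - P t) *\<^sub>R (E (t + u) * ?h) - E t * ?h"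
  proof
    fix x
    have "e x * ?h x = ?h x" using fun_cong[OF e_mult[OF Lip1_D(4)[OF hV]], of x] by simp
    moreover have "E t x * Exp (\<Phi> u) x = exp (P (t + u) - P t) * E (t + u) x"
      using fun_cong[OF E_shift[of t u], of x] by simp
    ultimately have "E t x * ((Exp (\<Phi> u) x - e x) * ?h x) = exp (P (t + u) - P t) * E (t + u) x * ?h x - E t x * ?h x"
      by (metis (no_types, lifting) left_diff_distrib mult.assoc right_diff_distrib)
    then show "(E t * ((Exp (\<Phi> u) - e) * ?h)) x = (exp (P (t + u) - P t) *\<^sub>R (E (t + u) * ?h) - E t * ?h) x" by simp
  qed
  then have "avg (E t * ((Exp (\<Phi> u) - e) * ?h)) = avg (exp (P (t + u) - P t) *\<^sub>R (E (t + u) * ?h)) - avg (E t * ?h)"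
    by (simp only:) (intro avg_diff Lip1_D(4) Lip.V_scale Lip1_mult E_V hV)
  also have "avg (exp (P (t + u) - P t) *\<^sub>R (E (t + u) * ?h)) = exp (P (t + u) - P t) *\<^sub>R ?h"
    unfolding avg_scale eigf(4)[OF \<Phi>_V] ..
  finally have 1: "avg (E t * ((Exp (\<Phi> u) - e) * ?h)) = exp (P (t + u) - P t) *\<^sub>R ?h - avg (E t * ?h)" .
  have 2: "M t (d + c *\<^sub>R H t) = M t ?h - M t (H t) + c *\<^sub>R M t (H t)"
    unfolding d_def by (simp only: bord_add[OF E_V Lip.V_diff[OF hV H_V] Lip.V_scale[OF H_V]] bord_diff[OF E_V hV H_V] bord_scale)
  have 3: "M t ?h = ?h - avg (E t * ?h) + H t" unfolding bord_def eigf(2)[OF \<Phi>_V] by simp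
  show ?thesis unfolding 2 3 1 M_H by (auto simp: fun_eq_iff d_def c_def algebra_simps)
qed

text \<open>Linearisation of \<open>increment\<close>: the derivative of that single unknown in
  direction \<open>v\<close>. Its value at \<open>x0\<close> is the derivative of the pressure, and
  \<open>Y t v - Y t v x0 *\<^sub>R H t\<close> that of the eigenfunction.\<close>

definition Y :: "real ^ 'q \<Rightarrow> real ^ 'q \<Rightarrow> (nat \<Rightarrow> 'a) \<Rightarrow> real" where
  "Y t v = (SOME f. f \<in> V \<and> M t f = avg (E t * (\<Phi> v * H t)))"

lemma RY_V: "avg (E t * (\<Phi> v * H t)) \<in> V"
  by (intro avg_Lip1 Lip1_mult E_V H_V \<Phi>_V)

lemma Y: "Y t v \<in> V" "M t (Y t v) = avg (E t * (\<Phi> v * H t))"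
proof -
  have "\<exists>f. f \<in> V \<and> M t f = avg (E t * (\<Phi> v * H t))" using surj[OF RY_V, of t t v] by blast
  from someI_ex[OF this] show "Y t v \<in> V" "M t (Y t v) = avg (E t * (\<Phi> v * H t))" unfolding Y_def by auto
qed

lemma linear_Y: "linear (Y t)"
proof (rule linearI)
  fix v w c
  have "E t * (\<Phi> (v + w) * H t) = E t * (\<Phi> v * H t) + E t * (\<Phi> w * H t)"
    by (simp add: \<Phi>_add algebra_simps)
  then have "avg (E t * (\<Phi> (v + w) * H t)) = avg (E t * (\<Phi> v * H t)) + avg (E t * (\<Phi> w * H t))"
    by (simp only:) (intro avg_add Lip1_D(4) Lip1_mult E_V H_V \<Phi>_V)
  then show "Y t (v + w) = Y t v + Y t w"
    by (intro M_inj[where t = t, OF Y(1) Lip.V_add[OF Y(1) Y(1)]]) (simp only: bord_add[OF E_V Y(1) Y(1)] Y(2))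
  have "E t * (\<Phi> (c *\<^sub>R v) * H t) = c *\<^sub>R (E t * (\<Phi> v * H t))"
    by (auto simp: \<Phi>_scale fun_eq_iff)
  then have "avg (E t * (\<Phi> (c *\<^sub>R v) * H t)) = c *\<^sub>R avg (E t * (\<Phi> v * H t))"
    by (simp only: avg_scale)
  then show "Y t (c *\<^sub>R v) = c *\<^sub>R Y t v"
    by (intro M_inj[where t = t, OF Y(1) Lip.V_scale[OF Y(1)]]) (simp only: bord_scale Y(2))
qed

lemma Y_bound: "\<exists>C\<ge>0. \<forall>v. N (Y t v) \<le> C * norm v"
proof -
  obtain C where C: "0 \<le> C" "\<And>f. f \<in> V \<Longrightarrow> N f \<le> C * N (M t f)" using bounded by blast
  have "N (Y t v) \<le> (C * (Ka * (N (E t) * (K\<psi> * N (H t))))) * norm v" for v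
  proof -
    have "N (avg (E t * (\<Phi> v * H t))) \<le> Ka * (N (E t) * (K\<psi> * norm v * N (H t)))"
      by (intro Ka_le N_mult Lip1_mult(1) \<Phi>_bound E_V H_V \<Phi>_V order_refl)
    then have "C * N (avg (E t * (\<Phi> v * H t))) \<le> C * (Ka * (N (E t) * (K\<psi> * norm v * N (H t))))"
      using C(1) by (rule mult_left_mono)
    then show ?thesis using C(2)[OF Y(1), of t v] by (simp add: Y(2) mult_ac)
  qed
  moreover have "0 \<le> C * (Ka * (N (E t) * (K\<psi> * N (H t))))"
    by (intro mult_nonneg_nonneg C Ka(1) K\<psi> Lip.N_nonneg E_V H_V)
  ultimately show ?thesis by blast
qed

lemma Exp_minus_e:
  assumes "w \<in> V" "N w \<le> 1" shows "Exp w - e \<in> V" "N (Exp w - e) \<le> 4 * N w"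
proof -
  show "Exp w - e \<in> V" by (intro Lip.V_diff Exp_Lip1 assms e_Lip1(1))
  have "N ((Exp w - e - w) + w) \<le> N (Exp w - e - w) + N w"
    by (intro Lip.N_triangle Exp_remainder(1) assms)
  also have "\<dots> \<le> 3 * (N w)\<^sup>2 + N w" using Exp_remainder(2)[OF assms] by linarith
  also have "(N w)\<^sup>2 \<le> N w"
    using mult_right_mono[OF assms(2) Lip.N_nonneg[OF assms(1)]] by (simp add: power2_eq_square)
  finally show "N (Exp w - e) \<le> 4 * N w" by simp
qed

text \<open>A bootstrap: \<open>H_bound\<close> and \<open>P_lip\<close> make the right-hand side of
  \<open>increment\<close> of order \<open>norm u\<close>, hence also \<open>d\<close>; inserting
  this once more makes the deviation from \<open>Y t u\<close> quadratic. \<open>C1\<close> and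
  \<open>C2\<close> collect the factors of the two passes.\<close>

lemma increment_bounds:
  "\<exists>C\<ge>0. \<forall>\<^sub>F u in nhds 0. N (H (t + u) - H t) \<le> C * norm u \<and>
     N (H (t + u) - H t + (exp (P (t + u) - P t) - 1) *\<^sub>R H t - Y t u) \<le> C * (norm u)\<^sup>2"
proof -
  obtain C where C: "0 \<le> C" "\<And>f. f \<in> V \<Longrightarrow> N f \<le> C * N (M t f)" using bounded by blast
  obtain B where B: "0 \<le> B" "\<And>u. norm u \<le> 1 \<Longrightarrow> N (H (t + u)) \<le> B" using H_bound by blast
  let ?NE = "N (E t)" and ?Nh = "N (H t)"
  have nn: "0 \<le> ?NE" "0 \<le> ?Nh" by (intro Lip.N_nonneg E_V H_V)+
  define C1 where "C1 = C * (Ka * (?NE * (4 * K\<psi> * B)) + 4 * K\<psi> * (B + ?Nh)) + 4 * K\<psi> * ?Nh"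
  define C2 where "C2 = C * (Ka * (?NE * (3 * K\<psi>\<^sup>2 * B)) + Ka * (?NE * (K\<psi> * C1)) + 4 * K\<psi> * C1)"
  have C12: "0 \<le> C1" "0 \<le> C2"
    unfolding C2_def C1_def by (intro add_nonneg_nonneg mult_nonneg_nonneg C(1) Ka(1) K\<psi> B(1) nn; simp add: K\<psi>)+
  have "\<forall>\<^sub>F u in nhds 0. N (H (t + u) - H t) \<le> C1 * norm u \<and>
     N (H (t + u) - H t + (exp (P (t + u) - P t) - 1) *\<^sub>R H t - Y t u) \<le> C2 * (norm u)\<^sup>2"
    using eventually_small_norm[OF zero_less_one, of 1] eventually_small_norm[OF zero_less_one, of K\<psi>]
  proof eventually_elim
    case (elim u)
    let ?n = "norm u" and ?w = "\<Phi> u" and ?h = "H (t + u)"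
    define d where "d = H (t + u) - H t"
    define c where "c = exp (P (t + u) - P t) - 1"
    have n1: "?n \<le> 1" using elim by simp
    have hV: "?h \<in> V" "N ?h \<le> B" using H_V B(2)[OF n1] by auto
    have dV: "d \<in> V" unfolding d_def by (intro Lip.V_diff H_V)
    have wV: "?w \<in> V" "N ?w \<le> K\<psi> * ?n" "N ?w \<le> 1" using \<Phi>_V \<Phi>_bound[of u] elim by auto
    have y: "\<bar>P (t + u) - P t\<bar> \<le> K\<psi> * ?n" by (rule P_lip)
    have c: "\<bar>c\<bar> \<le> 4 * K\<psi> * ?n"
    proof -
      have "\<bar>P (t + u) - P t\<bar> \<le> 1" using y elim by linarith
      from order_trans[OF exp_minus_one_abs[OF this] mult_left_mono[OF y, of 4]]
      show ?thesis unfolding c_def mult.assoc by simp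
    qed
    have inc: "M t (d + c *\<^sub>R H t) = avg (E t * ((Exp ?w - e) * ?h)) - c *\<^sub>R d"
      unfolding d_def c_def by (rule increment)
    have Ne: "N (Exp ?w - e) \<le> 4 * K\<psi> * ?n" using Exp_minus_e(2)[OF wV(1,3)] wV(2) by linarith
    have d0: "N d \<le> B + ?Nh" unfolding d_def using Lip.N_minus_le[OF hV(1) H_V[of t]] hV(2) by linarith
    have sV: "d + c *\<^sub>R H t \<in> V" by (intro Lip.V_add Lip.V_scale dV H_V)
    have aV: "avg (E t * ((Exp ?w - e) * ?h)) \<in> V"
      by (intro avg_Lip1 Lip1_mult E_V hV Exp_minus_e(1) wV)
    have "N (M t (d + c *\<^sub>R H t)) \<le> N (avg (E t * ((Exp ?w - e) * ?h))) + N (c *\<^sub>R d)"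
      unfolding inc by (intro Lip.N_minus_le aV Lip.V_scale dV)
    also have "\<dots> \<le> Ka * (?NE * (4 * K\<psi> * ?n * B)) + 4 * K\<psi> * ?n * (B + ?Nh)"
      by (intro add_mono Ka_le N_mult scale_le Lip1_mult(1) E_V hV Exp_minus_e(1) wV Ne c d0 dV order_refl)
    finally have "C * N (M t (d + c *\<^sub>R H t)) \<le> C * (Ka * (?NE * (4 * K\<psi> * ?n * B)) + 4 * K\<psi> * ?n * (B + ?Nh))"
      using C(1) by (rule mult_left_mono)
    then have 1: "N (d + c *\<^sub>R H t) \<le> C * (Ka * (?NE * (4 * K\<psi> * ?n * B)) + 4 * K\<psi> * ?n * (B + ?Nh))"
      using C(2)[OF sV] by linarith
    have "N ((d + c *\<^sub>R H t) - c *\<^sub>R H t) \<le> N (d + c *\<^sub>R H t) + N (c *\<^sub>R H t)"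
      by (intro Lip.N_minus_le sV Lip.V_scale H_V)
    moreover have "N (c *\<^sub>R H t) \<le> 4 * K\<psi> * ?n * ?Nh" by (intro scale_le H_V c order_refl)
    ultimately have "N d \<le> C * (Ka * (?NE * (4 * K\<psi> * ?n * B)) + 4 * K\<psi> * ?n * (B + ?Nh)) + 4 * K\<psi> * ?n * ?Nh"
      using 1 by simp
    also have "\<dots> = C1 * ?n" by (simp add: C1_def algebra_simps)
    finally have d: "N d \<le> C1 * ?n" .
    let ?X1 = "avg (E t * ((Exp ?w - e - ?w) * ?h))" and ?X2 = "avg (E t * (?w * d))"
    have XV: "?X1 \<in> V" "?X2 \<in> V"
      by (intro avg_Lip1 Lip1_mult E_V hV Exp_remainder(1) wV dV)+
    \<comment> \<open>To first order \<open>Exp ?w - e\<close> is \<open>?w\<close> and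
      \<open>?h\<close> is \<open>H t\<close>; \<open>?X1\<close> and \<open>?X2\<close> are the two
      errors.\<close>
    have split: "avg (E t * ((Exp ?w - e) * ?h)) = avg (E t * (?w * H t)) + (?X1 + ?X2)"
    proof -
      have "E t * ((Exp ?w - e) * ?h) = E t * (?w * H t) + (E t * ((Exp ?w - e - ?w) * ?h) + E t * (?w * d))"
        by (simp add: d_def algebra_simps)
      then have "avg (E t * ((Exp ?w - e) * ?h)) = avg (E t * (?w * H t)) + avg (E t * ((Exp ?w - e - ?w) * ?h) + E t * (?w * d))"
        by (simp only:) (intro avg_add Lip1_D(4) Lip.V_add Lip1_mult E_V H_V Exp_remainder(1) wV dV)
      also have "avg (E t * ((Exp ?w - e - ?w) * ?h) + E t * (?w * d)) = ?X1 + ?X2"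
        by (intro avg_add Lip1_D(4) Lip1_mult E_V H_V Exp_remainder(1) wV dV)
      finally show ?thesis .
    qed
    have zV: "d + c *\<^sub>R H t - Y t u \<in> V" by (intro Lip.V_diff sV Y)
    have M2: "M t (d + c *\<^sub>R H t - Y t u) = (?X1 + ?X2) - c *\<^sub>R d"
      unfolding bord_diff[OF E_V sV Y(1)] inc Y(2) split by simp
    have "N (M t (d + c *\<^sub>R H t - Y t u)) \<le> (N ?X1 + N ?X2) + N (c *\<^sub>R d)"
      unfolding M2 using Lip.N_minus_le[OF Lip.V_add[OF XV] Lip.V_scale[OF dV, of c]] Lip.N_triangle[OF XV] by linarith
    also have "\<dots> \<le> (Ka * (?NE * (3 * (K\<psi> * ?n)\<^sup>2 * B)) + Ka * (?NE * (K\<psi> * ?n * (C1 * ?n)))) + 4 * K\<psi> * ?n * (C1 * ?n)"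
    proof (intro add_mono Ka_le N_mult scale_le Lip1_mult(1) E_V hV Exp_remainder(1) wV c d dV order_refl)
      have "(N ?w)\<^sup>2 \<le> (K\<psi> * ?n)\<^sup>2" by (rule power_mono[OF wV(2) Lip.N_nonneg[OF wV(1)]])
      then show "N (Exp ?w - e - ?w) \<le> 3 * (K\<psi> * ?n)\<^sup>2" using Exp_remainder(2)[OF wV(1,3)] by linarith
    qed
    finally have "C * N (M t (d + c *\<^sub>R H t - Y t u)) \<le>
        C * ((Ka * (?NE * (3 * (K\<psi> * ?n)\<^sup>2 * B)) + Ka * (?NE * (K\<psi> * ?n * (C1 * ?n)))) + 4 * K\<psi> * ?n * (C1 * ?n))"
      using C(1) by (rule mult_left_mono)
    then have "N (d + c *\<^sub>R H t - Y t u) \<le>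
        C * ((Ka * (?NE * (3 * (K\<psi> * ?n)\<^sup>2 * B)) + Ka * (?NE * (K\<psi> * ?n * (C1 * ?n)))) + 4 * K\<psi> * ?n * (C1 * ?n))"
      using C(2)[OF zV] by linarith
    also have "\<dots> = C2 * ?n\<^sup>2" by (simp add: C2_def power2_eq_square algebra_simps)
    finally show ?case using d by (simp only: d_def c_def)
  qed
  then have "\<forall>\<^sub>F u in nhds 0. N (H (t + u) - H t) \<le> (C1 + C2) * norm u \<and>
     N (H (t + u) - H t + (exp (P (t + u) - P t) - 1) *\<^sub>R H t - Y t u) \<le> (C1 + C2) * (norm u)\<^sup>2"
  proof eventually_elim
    case (elim u)
    have "C1 * norm u \<le> (C1 + C2) * norm u" "C2 * (norm u)\<^sup>2 \<le> (C1 + C2) * (norm u)\<^sup>2"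
      using C12 by (auto intro: mult_right_mono)
    then show ?case using elim by linarith
  qed
  then show ?thesis using C12 by (intro exI[of _ "C1 + C2"]) auto
qed

text \<open>A joint induction, since the data of the equation for \<open>Y\<close> involve both
  pressure and eigenfunction: smoothness of both at level \<open>n\<close> makes \<open>Y\<close>
  smooth at level \<open>n\<close>, and \<open>Y\<close> contains both derivatives. The real
  function \<open>P\<close> is represented by multiples of \<open>e\<close>.\<close>

lemma smooth: "fC n (\<lambda>t. P t *\<^sub>R e) \<and> fC n (\<lambda>t. H t)"
proof -
  define Q where "Q n \<longleftrightarrow> fC n (\<lambda>t. P t *\<^sub>R e) \<and> fC n (\<lambda>t. H t)" for n
  have "Q n"
  proof (induction n)
    case 0
    have Pe: "P t *\<^sub>R e \<in> V" for t by (intro Lip.V_scale e_Lip1(1))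
    have "\<exists>C. \<forall>\<^sub>F u in nhds 0. N (P (t + u) *\<^sub>R e - P t *\<^sub>R e) \<le> C * norm u" for t
      unfolding scaleR_left_diff_distrib[symmetric] e_Lip1(2)
      using P_lip by (intro exI[of _ K\<psi>] always_eventually) simp
    moreover have "\<exists>C. \<forall>\<^sub>F u in nhds 0. N (H (t + u) - H t) \<le> C * norm u" for t
      using increment_bounds[of t] by (auto elim: eventually_mono)
    ultimately show ?case unfolding Q_def by (intro conjI fC_0I Pe H_V)
  next
    case (Suc n)
    have fE: "fC n (\<lambda>t. E t)"
      unfolding nExp_def by (intro fC_Exp fC_diff fC_\<Phi> conjunct1[OF Suc[unfolded Q_def]])
    have fH: "fC n (\<lambda>t. H t)" by (rule conjunct2[OF Suc[unfolded Q_def]])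
    have fY: "fC n (\<lambda>t. Y t v)" for v
      by (rule fC_solve[OF fE fH _ Y]) (intro fC_avg fC_mult fE fH fC_const \<Phi>_V)
    have eval: "fC n (\<lambda>t. Y t v x0 *\<^sub>R e)" for v by (rule fC_eval[OF fY])
    have quad: "\<exists>C\<ge>0. \<forall>\<^sub>F u in nhds 0. \<bar>P (t + u) - P t - Y t u x0\<bar> \<le> C * (norm u)\<^sup>2 \<and>
        N (H (t + u) - H t - (Y t u - Y t u x0 *\<^sub>R H t)) \<le> C * (norm u)\<^sup>2" for t
    proof -
      obtain C where C: "0 \<le> C" "\<forall>\<^sub>F u in nhds 0. N (H (t + u) - H t) \<le> C * norm u \<and>
         N (H (t + u) - H t + (exp (P (t + u) - P t) - 1) *\<^sub>R H t - Y t u) \<le> C * (norm u)\<^sup>2"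
        using increment_bounds by blast
      have nh: "0 \<le> N (H t)" by (intro Lip.N_nonneg H_V)
      have "\<forall>\<^sub>F u in nhds 0. \<bar>P (t + u) - P t - Y t u x0\<bar> \<le> (C * (1 + N (H t)) + 3 * K\<psi>\<^sup>2) * (norm u)\<^sup>2 \<and>
        N (H (t + u) - H t - (Y t u - Y t u x0 *\<^sub>R H t)) \<le> (C * (1 + N (H t)) + 3 * K\<psi>\<^sup>2) * (norm u)\<^sup>2"
        using C(2) eventually_small_norm[OF zero_less_one, of K\<psi>]
      proof eventually_elim
        case (elim u)
        define c where "c = exp (P (t + u) - P t) - 1"
        define z where "z = H (t + u) - H t + c *\<^sub>R H t - Y t u"
        have zV: "z \<in> V" unfolding z_def by (intro Lip.V_diff Lip.V_add Lip.V_scale H_V Y)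
        have Nz: "N z \<le> C * (norm u)\<^sup>2" using elim(1) by (simp only: z_def c_def)
        \<comment> \<open>The increment of \<open>H\<close> vanishes at \<open>x0\<close>, so only
          the pressure is left there; \<open>c\<close> differs from its increment by a quadratic
          term.\<close>
        have "z x0 = c - Y t u x0" by (simp add: z_def eigf(2)[OF \<Phi>_V])
        then have cY: "\<bar>c - Y t u x0\<bar> \<le> C * (norm u)\<^sup>2" using abs_le_lip_norm[OF zV, of x0] Nz by simp
        have y1: "\<bar>P (t + u) - P t\<bar> \<le> 1" using P_lip[of t u] elim(2) by linarith
        have "(P (t + u) - P t)\<^sup>2 \<le> (K\<psi> * norm u)\<^sup>2" using P_lip[of t u] by (metis abs_ge_zero power2_abs power_mono)
        then have "\<bar>c - (P (t + u) - P t)\<bar> \<le> 3 * (K\<psi>\<^sup>2 * (norm u)\<^sup>2)"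
          using exp_remainder[OF y1] by (simp add: c_def power_mult_distrib)
        then have 1: "\<bar>P (t + u) - P t - Y t u x0\<bar> \<le> (C + 3 * K\<psi>\<^sup>2) * (norm u)\<^sup>2"
          using cY by (simp add: distrib_right)
        have eq: "H (t + u) - H t - (Y t u - Y t u x0 *\<^sub>R H t) = z - (c - Y t u x0) *\<^sub>R H t"
          by (auto simp: fun_eq_iff z_def algebra_simps)
        have "N (z - (c - Y t u x0) *\<^sub>R H t) \<le> N z + N ((c - Y t u x0) *\<^sub>R H t)"
          by (intro Lip.N_minus_le zV Lip.V_scale H_V)
        also have "\<dots> \<le> C * (norm u)\<^sup>2 + C * (norm u)\<^sup>2 * N (H t)"
          by (intro add_mono Nz scale_le cY H_V order_refl)
        finally have 2: "N (z - (c - Y t u x0) *\<^sub>R H t) \<le> C * (1 + N (H t)) * (norm u)\<^sup>2" by (simp add: algebra_simps)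
        have "(C + 3 * K\<psi>\<^sup>2) * (norm u)\<^sup>2 \<le> (C * (1 + N (H t)) + 3 * K\<psi>\<^sup>2) * (norm u)\<^sup>2"
          "C * (1 + N (H t)) * (norm u)\<^sup>2 \<le> (C * (1 + N (H t)) + 3 * K\<psi>\<^sup>2) * (norm u)\<^sup>2"
          using C(1) nh by (auto intro!: mult_right_mono simp: distrib_left)
        then show ?case unfolding eq using 1 2 by linarith
      qed
      moreover have "0 \<le> C * (1 + N (H t)) + 3 * K\<psi>\<^sup>2" using C(1) nh by simp
      ultimately show ?thesis by blast
    qed
    have Ye: "Y t v x0 *\<^sub>R e \<in> V" and Yh: "Y t v - Y t v x0 *\<^sub>R H t \<in> V" for t v
      by (intro Lip.V_diff Lip.V_scale e_Lip1(1) H_V Y)+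
    have "fC (Suc n) (\<lambda>t. P t *\<^sub>R e)"
    proof (rule fC_SucI[OF _ Ye])
      show "linear (\<lambda>v. Y t v x0 *\<^sub>R e)" for t
        by (rule linearI) (simp_all add: linear_add[OF linear_Y] linear_scale[OF linear_Y] scaleR_add_left)
      show "\<exists>C. \<forall>v. N (Y t v x0 *\<^sub>R e) \<le> C * norm v" for t
        unfolding e_Lip1(2) using Y_bound[of t] abs_le_lip_norm[OF Y(1)] by (meson order_trans)
      show "\<exists>C. \<forall>\<^sub>F u in nhds 0. N (P (t + u) *\<^sub>R e - P t *\<^sub>R e - Y t u x0 *\<^sub>R e) \<le> C * (norm u)\<^sup>2" for t
        unfolding scaleR_left_diff_distrib[symmetric] e_Lip1(2)
        using quad[of t] by (auto elim: eventually_mono)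
    qed (intro Lip.V_scale e_Lip1(1) eval)+
    moreover have "fC (Suc n) (\<lambda>t. H t)"
    proof (rule fC_SucI[OF H_V Yh])
      show "linear (\<lambda>v. Y t v - Y t v x0 *\<^sub>R H t)" for t
        by (rule linearI) (auto simp: linear_add[OF linear_Y] linear_scale[OF linear_Y] fun_eq_iff algebra_simps)
      show "\<exists>C. \<forall>v. N (Y t v - Y t v x0 *\<^sub>R H t) \<le> C * norm v" for t
      proof -
        obtain C where C: "0 \<le> C" "\<And>v. N (Y t v) \<le> C * norm v" using Y_bound by blast
        have "N (Y t v - Y t v x0 *\<^sub>R H t) \<le> (C + C * N (H t)) * norm v" for v
        proof -
          have "N (Y t v - Y t v x0 *\<^sub>R H t) \<le> N (Y t v) + N (Y t v x0 *\<^sub>R H t)"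
            by (intro Lip.N_minus_le Y Lip.V_scale H_V)
          also have "\<dots> \<le> C * norm v + C * norm v * N (H t)"
            by (intro add_mono C scale_le H_V order_refl order_trans[OF abs_le_lip_norm[OF Y(1)] C(2)])
          finally show ?thesis by (simp add: algebra_simps)
        qed
        then show ?thesis by blast
      qed
      show "\<exists>C. \<forall>\<^sub>F u in nhds 0. N (H (t + u) - H t - (Y t u - Y t u x0 *\<^sub>R H t)) \<le> C * (norm u)\<^sup>2" for t
        using quad[of t] by (auto elim: eventually_mono)
      show "fC n (\<lambda>t. Y t v - Y t v x0 *\<^sub>R H t)" for v
      proof -
        have "fC n (\<lambda>t. Y t v x0 *\<^sub>R e * H t)" by (intro fC_mult eval fH)
        moreover have "Y t v x0 *\<^sub>R e * H t = Y t v x0 *\<^sub>R H t" for t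
          using Lip1_D(3)[OF H_V] by (auto simp: fun_eq_iff e_def)
        ultimately have "fC n (\<lambda>t. Y t v x0 *\<^sub>R H t)" by (simp only:)
        then show ?thesis by (intro fC_diff fY)
      qed
    qed
    ultimately show ?case unfolding Q_def by blast
  qed
  then show ?thesis by (simp only: Q_def)
qed

theorem pressure_smooth: "infinitely_differentiable (pressure \<rho> A \<psi>)"
proof -
  have "times_differentiable n (\<lambda>t. (P t *\<^sub>R e) x0)" for n
    by (rule fC_times_differentiable) (use smooth in blast)
  then have "infinitely_differentiable (\<lambda>t. P t)" by (simp add: infinitely_differentiable_def)
  moreover have "pressure \<rho> A \<psi> = (\<lambda>t. P t)" by (rule ext) (rule pressure_eq)
  ultimately show ?thesis by simp
qed

end

section \<open>Convexity of the pressure\<close>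

context potential_family
begin

lemma cont_shift: "continuous_on S (shift :: (nat \<Rightarrow> 'a) \<Rightarrow> _)"
proof (rule continuous_on_coordinatewise_then_product)
  fix i show "continuous_on S (\<lambda>x::nat \<Rightarrow> 'a. shift x i)"
    unfolding shift_def by (rule continuous_on_product_then_coordinatewise[OF continuous_on_id])
qed

lemma shift_pow_in: "x \<in> \<Omega> \<Longrightarrow> (shift ^^ k) x \<in> \<Omega>"
  by (induction k) (auto intro: shift_in)

lemma cont_shift_pow: "continuous_on \<Omega> (shift ^^ k)"
proof (induction k)
  case (Suc k)
  have "continuous_on \<Omega> (\<lambda>x. shift ((shift ^^ k) x))"
    by (rule continuous_on_compose2[OF cont_shift[of UNIV] Suc]) simp
  then show ?case by (simp add: o_def)
qed (simp add: continuous_on_id)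

lemma cont_Birkhoff: "continuous_on \<Omega> f \<Longrightarrow> continuous_on \<Omega> (\<lambda>x. f ((shift ^^ k) x))"
  by (rule continuous_on_compose2[OF _ cont_shift_pow]) (auto intro: shift_pow_in)

text \<open>Up to the coboundary of \<open>v\<close>, the potential equals its Birkhoff average, so \<open>Exp (- v)\<close> is a
  test function for the comparison principle.\<close>

lemma pr_le_Birkhoff:
  assumes \<phi>: "\<phi> \<in> V" and n: "0 < n"
    and le: "\<And>x. x \<in> \<Omega> \<Longrightarrow> (\<Sum>k<n. \<phi> ((shift ^^ k) x)) / real n \<le> c"
  shows "pr \<phi> \<le> c"
proof -
  \<comment> \<open>With weights falling linearly from 1, \<open>v y - v (shift y)\<close> is
    \<open>\<phi> y\<close> minus the Birkhoff average at \<open>shift y\<close>.\<close>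
  define v where "v x = (if x \<in> \<Omega> then \<Sum>k<n. (1 - real k / real n) * \<phi> ((shift ^^ k) x) else 0)" for x
  have \<phi>C: "\<phi> \<in> C0 A" by (rule Lip1_D(4)[OF \<phi>])
  have vC: "v \<in> C0 A"
  proof (rule C0_I)
    have "continuous_on \<Omega> (\<lambda>x. \<Sum>k<n. (1 - real k / real n) * \<phi> ((shift ^^ k) x))"
      by (intro continuous_on_sum continuous_on_mult continuous_on_const cont_Birkhoff C0_D(1)[OF \<phi>C])
    then show "continuous_on \<Omega> v"
      by (rule continuous_on_eq) (simp add: v_def)
  qed (simp add: v_def)
  have mvC: "(-1) *\<^sub>R v \<in> C0 A" by (rule C0.V_scale[OF vC])
  let ?g = "Exp ((-1) *\<^sub>R v)"
  have gC: "?g \<in> C0 A" by (rule Exp_C0[OF mvC])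
  have coboundary: "\<phi> y - v y + v (shift y) \<le> c" if y: "y \<in> \<Omega>" for y
  proof -
    define a where "a k = \<phi> ((shift ^^ k) y)" for k
    have v1: "v y = (\<Sum>k<n. (1 - real k / real n) * a k)" using y by (simp add: v_def a_def)
    have v2: "v (shift y) = (\<Sum>k<n. (1 - real k / real n) * a (Suc k))"
      using shift_in[OF y] by (simp add: v_def a_def funpow_swap1)
    have "v (shift y) - v y = (\<Sum>k<n. (1 - real (Suc k) / real n) * a (Suc k) - (1 - real k / real n) * a k) + (\<Sum>k<n. a (Suc k)) / real n"
      unfolding v1 v2 sum_divide_distrib sum_subtractf[symmetric] sum.distrib[symmetric]
      using n by (intro sum.cong) (auto simp: field_simps)
    also have "(\<Sum>k<n. (1 - real (Suc k) / real n) * a (Suc k) - (1 - real k / real n) * a k) = - a 0"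
      using sum_lessThan_telescope[of "\<lambda>k. (1 - real k / real n) * a k" n] n by simp
    also have "(\<Sum>k<n. a (Suc k)) / real n \<le> c"
      using le[OF shift_in[OF y]] by (simp add: a_def funpow_swap1)
    finally show ?thesis by (simp add: a_def)
  qed
  show ?thesis
  proof (rule pr_le[OF \<phi> gC])
    fix x assume x: "x \<in> \<Omega>"
    show "0 < ?g x" using x by (simp add: Exp_def)
    interpret prob_space \<rho> by (rule prob)
    \<comment> \<open>For the preimage \<open>y = cons t x\<close> one has
      \<open>shift y = x\<close>, so \<open>coboundary\<close> bounds the exponent by
      \<open>c - v x\<close>, uniformly in \<open>t\<close>.\<close>
    have "(Exp \<phi> * ?g) (cons t x) \<le> exp c * ?g x" for t
    proof (cases "cons t x \<in> \<Omega>")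
      case True
      have "exp (\<phi> (cons t x) - v (cons t x)) \<le> exp (c - v x)" using coboundary[OF True] by simp
      then show ?thesis using True x by (simp add: Exp_def exp_diff exp_minus field_simps)
    qed (simp add: Exp_def)
    then have "(\<integral>t. (Exp \<phi> * ?g) (cons t x) \<partial>\<rho>) \<le> (\<integral>t. exp c * ?g x \<partial>\<rho>)"
      by (intro integral_mono cons_integrable[OF C0_mult[OF Exp_C0[OF \<phi>C] gC] x]) auto
    then show "LL \<phi> ?g x \<le> exp c * ?g x" using x by (simp add: LL_def avg_def prob_space)
  qed
qed

text \<open>The test function is the weighted geometric mean of the two eigenfunctions. Hoelder's
  inequality is obtained from convexity of the exponential, after normalising at the point
  \<open>x\<close> by \<open>\<alpha>\<close> and \<open>\<beta>\<close>, which makes both averages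
  1.\<close>

lemma P_convex: "convex_on UNIV (\<lambda>t. P t)"
proof (rule convex_onI)
  fix s :: real and t t' :: "real ^ 'q" assume s: "0 < s" "s < 1"
  let ?h = "H t" and ?h' = "H t'"
  define \<phi> where "\<phi> = \<Phi> ((1 - s) *\<^sub>R t + s *\<^sub>R t')"
  define b where "b x = (if x \<in> \<Omega> then (1 - s) * ln (?h x) + s * ln (?h' x) else 0)" for x
  have hC: "?h \<in> C0 A" "?h' \<in> C0 A" by (intro Lip1_D(4) H_V)+
  have hp: "0 < ?h x" "0 < ?h' x" if "x \<in> \<Omega>" for x using eigf(3)[OF \<Phi>_V that] by auto
  have bC: "b \<in> C0 A"
  proof (rule C0_I)
    have "continuous_on \<Omega> (\<lambda>x. (1 - s) * ln (?h x) + s * ln (?h' x))"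
      by (intro continuous_on_add continuous_on_mult continuous_on_const continuous_on_ln C0_D(1) hC)
         (use hp in fastforce)+
    then show "continuous_on \<Omega> b" by (rule continuous_on_eq) (simp add: b_def)
  qed (simp add: b_def)
  have \<phi>V: "\<phi> \<in> V" unfolding \<phi>_def by (rule \<Phi>_V)
  have \<phi>x: "\<phi> x = (1 - s) * \<Phi> t x + s * \<Phi> t' x" for x unfolding \<phi>_def \<Phi>_add \<Phi>_scale by simp
  have "pr \<phi> \<le> (1 - s) * P t + s * P t'"
  proof (rule pr_le[OF \<phi>V Exp_C0[OF bC]])
    fix x assume x: "x \<in> \<Omega>"
    show "0 < Exp b x" using x by (simp add: Exp_def)
    define \<alpha> where "\<alpha> = P t + ln (?h x)"
    define \<beta> where "\<beta> = P t' + ln (?h' x)"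
    define f where "f = ((1 - s) * exp (- \<alpha>)) *\<^sub>R (Exp (\<Phi> t) * ?h) + (s * exp (- \<beta>)) *\<^sub>R (Exp (\<Phi> t') * ?h')"
    have fC: "((1 - s) * exp (- \<alpha>)) *\<^sub>R (Exp (\<Phi> t) * ?h) \<in> C0 A" "(s * exp (- \<beta>)) *\<^sub>R (Exp (\<Phi> t') * ?h') \<in> C0 A"
      by (intro C0.V_scale C0_mult Exp_C0 Lip1_D(4) \<Phi>_V H_V)+
    have le: "(Exp \<phi> * Exp b) y \<le> (exp ((1 - s) * \<alpha> + s * \<beta>) *\<^sub>R f) y" if y: "y \<in> \<Omega>" for y
    proof -
      let ?a = "\<Phi> t y + ln (?h y) - \<alpha>" and ?b = "\<Phi> t' y + ln (?h' y) - \<beta>"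
      have "exp ((1 - s) *\<^sub>R ?a + s *\<^sub>R ?b) \<le> (1 - s) * exp ?a + s * exp ?b"
        using convex_onD[OF exp_convex, of s ?a ?b] s by simp
      moreover have "exp ?a = exp (- \<alpha>) * (exp (\<Phi> t y) * ?h y)" "exp ?b = exp (- \<beta>) * (exp (\<Phi> t' y) * ?h' y)"
        using hp[OF y] by (simp_all add: exp_diff exp_add exp_minus field_simps)
      ultimately have "exp ((1 - s) *\<^sub>R ?a + s *\<^sub>R ?b) \<le> f y" using y by (simp add: f_def Exp_def mult.assoc)
      then have "exp ((1 - s) * \<alpha> + s * \<beta>) * exp ((1 - s) *\<^sub>R ?a + s *\<^sub>R ?b) \<le> exp ((1 - s) * \<alpha> + s * \<beta>) * f y"
        by (intro mult_left_mono) auto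
      moreover have "(Exp \<phi> * Exp b) y = exp ((1 - s) * \<alpha> + s * \<beta>) * exp ((1 - s) *\<^sub>R ?a + s *\<^sub>R ?b)"
        using y by (simp add: Exp_def b_def \<phi>x exp_add[symmetric] algebra_simps)
      ultimately show ?thesis by simp
    qed
    have inv: "exp (- \<alpha>) = inverse (exp (P t) * ?h x)" "exp (- \<beta>) = inverse (exp (P t') * ?h' x)"
      using hp[OF x] unfolding exp_minus by (simp_all add: \<alpha>_def \<beta>_def exp_add)
    have L: "LL (\<Phi> t) ?h x = exp (P t) * ?h x" "LL (\<Phi> t') ?h' x = exp (P t') * ?h' x"
      by (simp_all add: LL_eigf[OF \<Phi>_V] exp_pr[OF \<Phi>_V])
    have nz: "exp (P t) * ?h x \<noteq> 0" "exp (P t') * ?h' x \<noteq> 0" using hp[OF x] by auto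
    have "exp (- \<alpha>) * LL (\<Phi> t) ?h x = 1" "exp (- \<beta>) * LL (\<Phi> t') ?h' x = 1"
      unfolding inv L by (rule left_inverse[OF nz(1)], rule left_inverse[OF nz(2)])
    then have one: "(1 - s) * exp (- \<alpha>) * LL (\<Phi> t) ?h x + s * exp (- \<beta>) * LL (\<Phi> t') ?h' x = 1"
      by (simp add: mult.assoc)
    have "LL \<phi> (Exp b) x \<le> avg (exp ((1 - s) * \<alpha> + s * \<beta>) *\<^sub>R f) x"
      unfolding LL_def using le
      by (intro avg_mono C0_mult Exp_C0 Lip1_D(4)[OF \<phi>V] bC C0.V_scale) (auto simp only: f_def intro!: C0.V_add fC)
    also have "\<dots> = exp ((1 - s) * \<alpha> + s * \<beta>) * ((1 - s) * exp (- \<alpha>) * LL (\<Phi> t) ?h x + s * exp (- \<beta>) * LL (\<Phi> t') ?h' x)"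
      unfolding avg_scale f_def avg_add[OF fC] by (simp add: avg_scale LL_def)
    also have "(1 - s) * exp (- \<alpha>) * LL (\<Phi> t) ?h x + s * exp (- \<beta>) * LL (\<Phi> t') ?h' x = 1"
      by (rule one)
    also have "exp ((1 - s) * \<alpha> + s * \<beta>) * 1 = exp ((1 - s) * P t + s * P t') * Exp b x"
      using x by (simp add: Exp_def b_def \<alpha>_def \<beta>_def exp_add[symmetric] algebra_simps)
    finally show "LL \<phi> (Exp b) x \<le> exp ((1 - s) * P t + s * P t') * Exp b x" .
  qed
  then show "P ((1 - s) *\<^sub>R t + s *\<^sub>R t') \<le> (1 - s) * P t + s * P t'" by (simp only: \<phi>_def)
qed simp

lemma entropy_finite:
  assumes "GDERIV (pressure \<rho> A \<psi>) t :> z"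
  shows "\<bar>entropy_H \<rho> A z \<psi>\<bar> \<noteq> \<infinity>"
proof -
  have pe: "pressure \<rho> A \<psi> = (\<lambda>t. P t)" by (rule ext) (rule pressure_eq)
  have tangent: "P t - t \<bullet> z \<le> P s - s \<bullet> z" for s
  proof -
    define f where "f c = P (t + c *\<^sub>R (s - t))" for c :: real
    have "convex_on UNIV f"
    proof (rule convex_onI)
      fix u x y :: real assume u: "0 < u" "u < 1"
      have "t + ((1 - u) * x + u * y) *\<^sub>R (s - t) = (1 - u) *\<^sub>R (t + x *\<^sub>R (s - t)) + u *\<^sub>R (t + y *\<^sub>R (s - t))"
        by (simp add: algebra_simps)
      then show "f ((1 - u) *\<^sub>R x + u *\<^sub>R y) \<le> (1 - u) * f x + u * f y"
        using convex_onD[OF P_convex, of u "t + x *\<^sub>R (s - t)" "t + y *\<^sub>R (s - t)"] u by (simp add: f_def)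
    qed simp
    moreover have "(f has_real_derivative (s - t) \<bullet> z) (at 0)"
    proof -
      have 1: "((\<lambda>c::real. t + c *\<^sub>R (s - t)) has_derivative (\<lambda>c. c *\<^sub>R (s - t))) (at 0)"
        by (auto intro!: derivative_eq_intros)
      have "((\<lambda>t. P t) has_derivative (\<lambda>h. h \<bullet> z)) (at (t + 0 *\<^sub>R (s - t)))"
        using assms unfolding gderiv_def pe by simp
      from has_derivative_compose[OF 1 this] show ?thesis
        unfolding f_def has_field_derivative_def by (simp add: mult.commute[of _ "(s - t) \<bullet> z"])
    qed
    ultimately have "f 1 - f 0 \<ge> (s - t) \<bullet> z * (1 - 0)"
      by (intro convex_on_imp_above_tangent[where A = UNIV]) auto
    then show ?thesis by (simp add: f_def inner_diff_left)
  qed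
  have "entropy_H \<rho> A z \<psi> = ereal (P t - t \<bullet> z)"
    unfolding entropy_H_def pe
  proof (rule antisym)
    show "(INF s. ereal (P s - s \<bullet> z)) \<le> ereal (P t - t \<bullet> z)" by (rule INF_lower) simp
    show "ereal (P t - t \<bullet> z) \<le> (INF s. ereal (P s - s \<bullet> z))" by (rule INF_greatest) (simp add: tangent)
  qed
  then show ?thesis by simp
qed

end

section \<open>Weak limits of measures on a compact metric space\<close>

text \<open>At the first index \<open>j\<close> where the bits differ, the terms differ by
  \<open>(1 / 3) ^ j\<close>, while all later terms together contribute at most half of it. In base
  2 carries would destroy injectivity.\<close>

lemma ternary_code_inj:
  fixes b b' :: "nat \<Rightarrow> real"
  assumes b: "\<And>j. b j \<in> {0, 1}" "\<And>j. b' j \<in> {0, 1}"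
    and eq: "(\<Sum>j. b j / 3 ^ j) = (\<Sum>j. b' j / 3 ^ j)"
  shows "b = b'"
proof (rule ccontr)
  assume "b \<noteq> b'"
  then have "\<exists>j. b j \<noteq> b' j" by auto
  define j where "j = (LEAST j. b j \<noteq> b' j)"
  have j: "b j \<noteq> b' j" unfolding j_def by (rule LeastI_ex) fact
  have lt: "b i = b' i" if "i < j" for i using not_less_Least[of i] that unfolding j_def by blast
  define c where "c i = (b i - b' i) / 3 ^ i" for i
  have c_le: "\<bar>c i\<bar> \<le> (1 / 3) ^ i" for i
    using b(1)[of i] b(2)[of i] by (auto simp: c_def power_divide)
  have g: "summable (\<lambda>i. (1 / 3 :: real) ^ i)" by (rule summable_geometric) simp
  have sm: "summable (\<lambda>i. x i / 3 ^ i)" if "\<And>j. x j \<in> {0, 1}" for x :: "nat \<Rightarrow> real"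
  proof (rule summable_comparison_test'[OF g])
    show "norm (x i / 3 ^ i) \<le> (1 / 3) ^ i" for i
      using that[of i] by (auto simp: power_divide)
  qed
  have csm: "summable c" by (rule summable_comparison_test'[OF g]) (use c_le in auto)
  have "(\<Sum>i. c i) = 0"
    unfolding c_def diff_divide_distrib using suminf_diff[OF sm[of b, OF b(1)] sm[of b', OF b(2)]] eq by simp
  also have "(\<Sum>i. c i) = (\<Sum>i. c (i + Suc j)) + (\<Sum>i<Suc j. c i)"
    by (rule suminf_split_initial_segment[OF csm])
  also have "(\<Sum>i<Suc j. c i) = c j" using lt by (simp add: c_def)
  finally have "\<bar>c j\<bar> = \<bar>\<Sum>i. c (i + Suc j)\<bar>" by simp
  also have "\<dots> \<le> (\<Sum>i. (1 / 3) ^ (i + Suc j))"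
    using norm_suminf_le[of "\<lambda>i. c (i + Suc j)" "\<lambda>i. (1 / 3) ^ (i + Suc j)"] c_le
      summable_ignore_initial_segment[OF g, of "Suc j"] unfolding real_norm_def by blast
  also have "\<dots> = (\<Sum>i. (1 / 3) ^ i * (1 / 3) ^ Suc j)" by (simp only: power_add)
  also have "\<dots> = (\<Sum>i. (1 / 3) ^ i) * (1 / 3) ^ Suc j" by (rule suminf_mult2[OF g, symmetric])
  also have "\<dots> = (1 / 3) ^ j / 2" by (simp add: suminf_geometric)
  finally have "\<bar>c j\<bar> \<le> (1 / 3) ^ j / 2" .
  moreover have "\<bar>c j\<bar> = (1 / 3) ^ j" using j b(1)[of j] b(2)[of j] by (auto simp: c_def power_divide)
  ultimately show False by simp
qed

text \<open>A point is coded by a sequence of bits, the bit \<open>j\<close> telling on which side of the annulus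
  \<open>\<rho> j \<le> dist x (q j) \<le> 2 \<rho> j\<close> it lies (both values are allowed inside the annulus, which
  makes the set of codes closed).\<close>

lemma compact_as_image_of_reals:
  fixes S :: "'b::metric_space set"
  assumes S: "compact S" "S \<noteq> {}"
  obtains K :: "real set" and \<pi> where "compact K" "continuous_on K \<pi>" "\<pi> ` K = S"
proof -
  define F where "F k = (SOME F. finite F \<and> S \<subseteq> (\<Union>q\<in>F. ball q (1 / real (Suc k))))" for k
  have F: "finite (F k)" "S \<subseteq> (\<Union>q\<in>F k. ball q (1 / real (Suc k)))" for k
  proof -
    have "0 < 1 / real (Suc k)" by simp
    with S(1) have "\<exists>F. finite F \<and> S \<subseteq> (\<Union>q\<in>F. ball q (1 / real (Suc k)))"
      unfolding compact_eq_totally_bounded by (elim conjE allE impE)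
    from someI_ex[OF this] show "finite (F k)" "S \<subseteq> (\<Union>q\<in>F k. ball q (1 / real (Suc k)))"
      unfolding F_def by (fact conjunct1, fact conjunct2)
  qed
  \<comment> \<open>All points of the finite nets, tagged with their scale; enumerated below as
    centres \<open>q j\<close> with radii \<open>\<rho> j\<close>.\<close>
  define J where "J = (\<Union>k. F k \<times> {k})"
  have "countable J" unfolding J_def by (rule countable_UN[OF countableI_type]) (simp add: countable_finite F(1))
  moreover have "J \<noteq> {}"
  proof -
    obtain s where "s \<in> S" using S by blast
    then obtain q where "q \<in> F 0" using F(2)[of 0] by blast
    then show ?thesis by (auto simp: J_def)
  qed
  ultimately have rJ: "range (from_nat_into J) = J" by (simp add: range_from_nat_into)
  define q where "q j = fst (from_nat_into J j)" for j
  define \<rho> where "\<rho> j = 1 / real (Suc (snd (from_nat_into J j)))" for j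
  have \<rho>: "0 < \<rho> j" for j by (simp add: \<rho>_def)
  have fine: "\<exists>j. \<rho> j < \<epsilon> \<and> dist x (q j) < \<rho> j" if x: "x \<in> S" and \<epsilon>: "0 < \<epsilon>" for x \<epsilon>
  proof -
    obtain k where k: "1 / real (Suc k) < \<epsilon>" using nat_approx_posE[OF \<epsilon>] by blast
    obtain y where y: "y \<in> F k" "dist x y < 1 / real (Suc k)" using F(2)[of k] x by (auto simp: dist_commute)
    then have "(y, k) \<in> range (from_nat_into J)" unfolding rJ by (auto simp: J_def)
    then obtain j where "from_nat_into J j = (y, k)" by (metis imageE)
    then show ?thesis using k y by (intro exI[of _ j]) (simp add: q_def \<rho>_def)
  qed
  define C where "C = {b :: nat \<Rightarrow> real. \<forall>j. b j \<in> {0, 1}}"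
  have C_compact: "compact C"
  proof -
    have "C = PiE UNIV (\<lambda>_. {0, 1})" by (auto simp: C_def PiE_def Pi_def)
    moreover have "compactin (product_topology (\<lambda>_::nat. euclidean :: real topology) UNIV) (PiE UNIV (\<lambda>_. {0, 1}))"
      unfolding compactin_PiE by auto
    ultimately show ?thesis by (simp add: euclidean_product_topology)
  qed
  \<comment> \<open>Multiplication by the bit, or by 1 minus the bit, expresses the two implications
    of \<open>R_iff\<close> as closed conditions.\<close>
  define R where "R = (C \<times> S) \<inter> (\<Inter>j. {p. fst p j * dist (snd p) (q j) \<le> fst p j * (2 * \<rho> j)}
      \<inter> {p. (1 - fst p j) * \<rho> j \<le> (1 - fst p j) * dist (snd p) (q j)})"
  have coord: "continuous_on UNIV (\<lambda>p :: (nat \<Rightarrow> real) \<times> 'b. fst p j)" for j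
    by (rule continuous_on_product_then_coordinatewise[OF continuous_on_fst[OF continuous_on_id]])
  have dst: "continuous_on UNIV (\<lambda>p :: (nat \<Rightarrow> real) \<times> 'b. dist (snd p) (q j))" for j
    by (rule continuous_on_dist[OF continuous_on_snd[OF continuous_on_id] continuous_on_const])
  have R_compact: "compact R"
    unfolding R_def
    by (intro compact_Int_closed compact_Times C_compact S(1) closed_INT ballI closed_Int closed_Collect_le
        continuous_on_mult continuous_on_diff continuous_on_const coord dst)
  have R_iff: "(b, x) \<in> R \<longleftrightarrow> b \<in> C \<and> x \<in> S \<and>
      (\<forall>j. (b j = 1 \<longrightarrow> dist x (q j) \<le> 2 * \<rho> j) \<and> (b j = 0 \<longrightarrow> \<rho> j \<le> dist x (q j)))" for b x
  proof -
    have "(b j * dist x (q j) \<le> b j * (2 * \<rho> j) \<and> (1 - b j) * \<rho> j \<le> (1 - b j) * dist x (q j)) \<longleftrightarrow>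
      ((b j = 1 \<longrightarrow> dist x (q j) \<le> 2 * \<rho> j) \<and> (b j = 0 \<longrightarrow> \<rho> j \<le> dist x (q j)))" if "b \<in> C" for j
    proof -
      have "b j = 0 \<or> b j = 1" using that by (auto simp: C_def)
      then show ?thesis by auto
    qed
    then show ?thesis unfolding R_def by auto
  qed
  define code where "code b = (\<Sum>j. b j / 3 ^ j)" for b :: "nat \<Rightarrow> real"
  have code_cont: "continuous_on C code"
  proof -
    have "uniform_limit C (\<lambda>n b. \<Sum>j<n. b j / 3 ^ j) code sequentially"
      unfolding code_def
    proof (rule Weierstrass_m_test)
      show "norm (b j / 3 ^ j) \<le> (1 / 3 :: real) ^ j" if "b \<in> C" for b j
      proof -
        have "b j = 0 \<or> b j = 1" using that by (auto simp: C_def)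
        then show ?thesis by (auto simp: power_divide)
      qed
      show "summable (\<lambda>j. (1 / 3 :: real) ^ j)" by (rule summable_geometric) simp
    qed
    moreover have "continuous_on C (\<lambda>b. \<Sum>j<n. b j / 3 ^ j)" for n
      by (intro continuous_on_sum continuous_on_divide continuous_on_const
          continuous_on_product_then_coordinatewise[OF continuous_on_id]) simp
    ultimately show ?thesis
      by (intro uniform_limit_theorem[of C "\<lambda>n b. \<Sum>j<n. b j / 3 ^ j"]) (auto intro: always_eventually)
  qed
  \<comment> \<open>The compact graph of the future \<open>\<pi>\<close>: it is single valued over
    its projection \<open>K\<close>, and preimages of closed sets are projections of compact sets,
    which gives continuity.\<close>
  define G where "G = (\<lambda>p. (code (fst p), snd p)) ` R"
  have G_compact: "compact G"
    unfolding G_def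
  proof (rule compact_continuous_image[OF _ R_compact])
    have "continuous_on R (\<lambda>p. code (fst p))"
      by (rule continuous_on_compose2[OF code_cont continuous_on_fst[OF continuous_on_id]]) (auto simp: R_def)
    then show "continuous_on R (\<lambda>p. (code (fst p), snd p))"
      by (intro continuous_on_Pair continuous_on_snd continuous_on_id)
  qed
  have single: "x = y" if xy: "(r, x) \<in> G" "(r, y) \<in> G" for r x y
  proof (rule ccontr)
    assume ne: "x \<noteq> y"
    obtain b b' where b: "(b, x) \<in> R" "(b', y) \<in> R" "r = code b" "r = code b'"
      using xy by (auto simp: G_def)
    have "b = b'"
    proof (rule ternary_code_inj)
      show "b j \<in> {0, 1}" "b' j \<in> {0, 1}" for j using b(1,2) by (auto simp: R_iff C_def)
      show "(\<Sum>j. b j / 3 ^ j) = (\<Sum>j. b' j / 3 ^ j)" using b(3,4) by (simp add: code_def)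
    qed
    have xS: "x \<in> S" using b(1) by (simp add: R_iff)
    \<comment> \<open>A net ball around \<open>x\<close> of radius below a third of the distance:
      its bit must be 1, and the common code then puts \<open>y\<close> within
      \<open>2 * \<rho> j\<close> of the same centre.\<close>
    have "0 < dist x y / 3" using ne by simp
    from fine[OF xS this] obtain j where j: "\<rho> j < dist x y / 3" "dist x (q j) < \<rho> j" by blast
    have "b j \<noteq> 0" using b(1) j(2) by (auto simp: R_iff)
    then have "b j = 1" using b(1) by (auto simp: R_iff C_def)
    then have "dist y (q j) \<le> 2 * \<rho> j" using b(2) \<open>b = b'\<close> by (simp add: R_iff)
    then have "dist x y < 3 * \<rho> j" using j(2) dist_triangle2[of x y "q j"] by linarith
    then show False using j(1) by simp
  qed
  have onto: "\<exists>r. (r, x) \<in> G" if "x \<in> S" for x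
  proof -
    define b :: "nat \<Rightarrow> real" where "b j = (if dist x (q j) \<le> \<rho> j then 1 else 0)" for j
    have "dist x (q j) \<le> 2 * \<rho> j" if "dist x (q j) \<le> \<rho> j" for j using that \<rho>[of j] by linarith
    then have "(b, x) \<in> R" using that by (auto simp: R_iff C_def b_def)
    then have "(code b, x) \<in> G" unfolding G_def by (rule rev_image_eqI) simp
    then show ?thesis by blast
  qed
  define K where "K = fst ` G"
  define \<pi> where "\<pi> r = (THE x. (r, x) \<in> G)" for r
  have \<pi>: "\<pi> r = x" if "(r, x) \<in> G" for r x
    unfolding \<pi>_def using that single by (intro the_equality) auto
  have K_compact: "compact K" unfolding K_def
    by (intro compact_continuous_image G_compact continuous_on_fst continuous_on_id)
  have "continuous_on K \<pi>"
    unfolding continuous_on_closed_vimage[OF compact_imp_closed[OF K_compact]]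
  proof (intro allI impI)
    fix B :: "'b set" assume B: "closed B"
    have "\<pi> -` B \<inter> K = fst ` (G \<inter> (UNIV \<times> B))" using \<pi> by (force simp: K_def)
    moreover have "compact (fst ` (G \<inter> (UNIV \<times> B)))"
      by (intro compact_continuous_image compact_Int_closed G_compact closed_Times B closed_UNIV
          continuous_on_fst continuous_on_id)
    ultimately show "closed (\<pi> -` B \<inter> K)" by (simp add: compact_imp_closed)
  qed
  moreover have "\<pi> ` K = S"
  proof
    show "\<pi> ` K \<subseteq> S"
    proof
      fix x assume "x \<in> \<pi> ` K"
      then obtain r y where "(r, y) \<in> G" "x = \<pi> r" by (auto simp: K_def)
      then show "x \<in> S" using \<pi>[of r y] by (auto simp: G_def R_iff)
    qed
    show "S \<subseteq> \<pi> ` K"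
    proof
      fix x assume "x \<in> S"
      then obtain r where "(r, x) \<in> G" using onto by blast
      then show "x \<in> \<pi> ` K" using \<pi>[of r x] by (force simp: K_def)
    qed
  qed
  ultimately show ?thesis using K_compact that by blast
qed

text \<open>The measures are moved to the line by a section \<open>c\<close> of
  \<open>\<pi>\<close>, tightness gives a weakly convergent subsequence there, and its limit is
  moved back by \<open>\<pi>\<close>. The section can be arbitrary since every function is
  measurable for a pmf.\<close>

lemma weak_limit_on_compact:
  fixes S :: "'b::metric_space set" and p :: "nat \<Rightarrow> 'b pmf"
  assumes S: "compact S" "S \<noteq> {}" and p: "\<And>n. set_pmf (p n) \<subseteq> S"
  shows "\<exists>(r :: nat \<Rightarrow> nat) \<mu>. strict_mono r \<and> prob_space \<mu> \<and> sets \<mu> = sets (restrict_space borel S) \<and>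
    (\<forall>f :: 'b \<Rightarrow> real. continuous_on S f \<longrightarrow> (\<lambda>n. measure_pmf.expectation (p (r n)) f) \<longlonglongrightarrow> (\<integral>x. f x \<partial>\<mu>))"
proof -
  obtain K :: "real set" and \<pi> where K: "compact K" "continuous_on K \<pi>" "\<pi> ` K = S"
    using compact_as_image_of_reals[OF S] by blast
  obtain s0 where s0: "s0 \<in> S" using S(2) by blast
  define c where "c = inv_into K \<pi>"
  have c: "c x \<in> K" "\<pi> (c x) = x" if "x \<in> S" for x
    using that K(3) by (auto simp: c_def inv_into_into f_inv_into_f)
  define D where "D n = distr (measure_pmf (map_pmf c (p n))) borel (\<lambda>x. x)" for n
  have D_int: "integral\<^sup>L (D n) f = measure_pmf.expectation (p n) (\<lambda>x. f (c x))" if "f \<in> borel_measurable borel" for n and f :: "real \<Rightarrow> real"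
    unfolding D_def using that by (subst integral_distr) auto
  have D: "real_distribution (D n)" for n
  proof -
    interpret prob_space "D n" unfolding D_def by (rule prob_space.prob_space_distr) (auto intro: prob_space_measure_pmf)
    show ?thesis by unfold_locales (simp add: D_def)
  qed
  obtain a where a: "\<And>x. x \<in> K \<Longrightarrow> \<bar>x\<bar> \<le> a" using compact_imp_bounded[OF K(1)] by (auto simp: bounded_real)
  have "tight D"
    unfolding tight_def
  proof (intro conjI allI impI D)
    fix \<epsilon> :: real assume \<epsilon>: "0 < \<epsilon>"
    have "measure (D n) {- \<bar>a\<bar> - 1<..\<bar>a\<bar> + 1} = 1" for n
    proof -
      have "measure (D n) {- \<bar>a\<bar> - 1<..\<bar>a\<bar> + 1} = measure (measure_pmf (map_pmf c (p n))) {- \<bar>a\<bar> - 1<..\<bar>a\<bar> + 1}"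
        unfolding D_def by (subst measure_distr) auto
      also have "\<dots> = 1"
      proof (rule measure_pmf.prob_eq_1[THEN iffD2])
        show "AE x in measure_pmf (map_pmf c (p n)). x \<in> {- \<bar>a\<bar> - 1<..\<bar>a\<bar> + 1}"
          unfolding AE_measure_pmf_iff
        proof
          fix x assume "x \<in> set_pmf (map_pmf c (p n))"
          then obtain y where "y \<in> S" "x = c y" using p[of n] by auto
          then have "\<bar>x\<bar> \<le> a" using a c(1) by simp
          then show "x \<in> {- \<bar>a\<bar> - 1<..\<bar>a\<bar> + 1}" by auto
        qed
      qed simp
      finally show ?thesis .
    qed
    then show "\<exists>a b. a < b \<and> (\<forall>n. 1 - \<epsilon> < measure (D n) {a<..b})"
      using \<epsilon> by (intro exI[of _ "- \<bar>a\<bar> - 1"] exI[of _ "\<bar>a\<bar> + 1"]) auto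
  qed
  from tight_imp_convergent_subsubsequence[OF this, of id] obtain r M where
    r: "strict_mono r" and M: "real_distribution M" and w: "weak_conv_m (D \<circ> id \<circ> r) M"
    by (auto simp: strict_mono_def)
  interpret M: real_distribution M by fact
  have conv: "(\<lambda>n. measure_pmf.expectation (p (r n)) (\<lambda>x. g (c x))) \<longlonglongrightarrow> integral\<^sup>L M g"
    if g: "continuous_on UNIV g" "\<And>x. \<bar>g x\<bar> \<le> B" for g :: "real \<Rightarrow> real" and B
  proof -
    have "(\<lambda>n. integral\<^sup>L ((D \<circ> id \<circ> r) n) g) \<longlonglongrightarrow> integral\<^sup>L M g"
    proof (rule weak_conv_imp_integral_bdd_continuous_conv[OF _ M w])
      show "real_distribution ((D \<circ> id \<circ> r) n)" for n using D by simp
      show "isCont g x" for x using g(1) by (simp add: continuous_on_eq_continuous_at)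
      show "norm (g x) \<le> B" for x using g(2) by simp
    qed
    then show ?thesis using D_int[OF borel_measurable_continuous_onI[OF g(1)]] by simp
  qed
  have Kc: "closed K" by (rule compact_imp_closed[OF K(1)])
  have Kne: "K \<noteq> {}" using K(3) S(2) by auto
  \<comment> \<open>The distance to \<open>K\<close>, truncated at 1, is a bounded continuous test
    function with integral 0 along the sequence.\<close>
  have MK: "AE x in M. x \<in> K"
  proof -
    define g where "g x = min 1 (infdist x K)" for x
    have gc: "continuous_on UNIV g" unfolding g_def
      by (intro continuous_on_min continuous_on_const continuous_on_infdist continuous_on_id)
    have g0: "0 \<le> g x" "\<bar>g x\<bar> \<le> 1" for x using infdist_nonneg[of x K] by (auto simp: g_def)
    have "measure_pmf.expectation (p n) (\<lambda>x. g (c x)) = measure_pmf.expectation (p n) (\<lambda>x. 0)" for n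
      using p[of n] c(1) by (intro integral_cong_AE) (auto simp: AE_measure_pmf_iff g_def)
    with conv[OF gc g0(2)] have "(\<lambda>n. 0) \<longlonglongrightarrow> integral\<^sup>L M g" by simp
    then have "integral\<^sup>L M g = 0" by (rule LIMSEQ_unique) (rule tendsto_const)
    moreover have "integrable M g"
      by (rule M.integrable_const_bound[where B = 1])
        (use g0 borel_measurable_continuous_onI[OF gc] in auto)
    ultimately have "AE x in M. g x = 0"
      using integral_nonneg_eq_0_iff_AE[of M g] g0 by auto
    then show ?thesis
    proof eventually_elim
      case (elim x)
      then have "infdist x K = 0" using infdist_nonneg[of x K] by (simp add: g_def min_def split: if_splits)
      then show ?case using in_closed_iff_infdist_zero[OF Kc Kne] by simp
    qed
  qed
  define \<pi>' where "\<pi>' x = (if x \<in> K then \<pi> x else s0)" for x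
  have \<pi>'_borel: "\<pi>' \<in> borel \<rightarrow>\<^sub>M borel"
    unfolding \<pi>'_def using Kc K(2) by (intro borel_measurable_continuous_on_if) auto
  have \<pi>'_meas: "\<pi>' \<in> M \<rightarrow>\<^sub>M restrict_space borel S"
  proof (rule measurable_restrict_space2)
    show "\<pi>' \<in> space M \<rightarrow> S" using K(3) s0 by (auto simp: \<pi>'_def)
    show "\<pi>' \<in> M \<rightarrow>\<^sub>M borel" using \<pi>'_borel by simp
  qed
  define \<mu> where "\<mu> = distr M (restrict_space borel S) \<pi>'"
  show ?thesis
  proof (intro exI[of _ r] exI[of _ \<mu>] conjI allI impI)
    show "strict_mono r" by (rule r)
    show "prob_space \<mu>" unfolding \<mu>_def by (rule M.prob_space_distr[OF \<pi>'_meas])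
    show "sets \<mu> = sets (restrict_space borel S)" by (simp add: \<mu>_def)
    fix f :: "'b \<Rightarrow> real" assume f: "continuous_on S f"
    have "bounded (f ` S)" by (intro compact_imp_bounded compact_continuous_image f S)
    then obtain B where B: "\<And>x. x \<in> S \<Longrightarrow> \<bar>f x\<bar> \<le> B" by (auto simp: bounded_real)
    have B0: "0 \<le> B" using B[OF s0] by linarith
    have "continuous_on K (\<lambda>x. f (\<pi> x))" by (rule continuous_on_compose2[OF f K(2)]) (use K(3) in auto)
    \<comment> \<open>\<open>f\<close> composed with \<open>\<pi>\<close> lives on \<open>K\<close>
      only, whereas weak convergence tests bounded continuous functions on the whole line.\<close>
    then have "\<exists>g. continuous_on UNIV g \<and> (\<forall>x\<in>K. g x = f (\<pi> x)) \<and> (\<forall>x. norm (g x) \<le> B)"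
    proof (rule Tietze[of K "\<lambda>x. f (\<pi> x)" UNIV B])
      show "closedin (top_of_set UNIV) K" using Kc by simp
      show "0 \<le> B" by (rule B0)
      show "norm (f (\<pi> x)) \<le> B" if "x \<in> K" for x using B K(3) that by auto
    next
      fix g :: "real \<Rightarrow> real"
      assume "continuous_on UNIV g" "\<And>x. x \<in> K \<Longrightarrow> g x = f (\<pi> x)" "\<And>x. x \<in> UNIV \<Longrightarrow> norm (g x) \<le> B"
      then show ?thesis by (intro exI[of _ g]) auto
    qed
    then obtain g :: "real \<Rightarrow> real" where "continuous_on UNIV g \<and> (\<forall>x\<in>K. g x = f (\<pi> x)) \<and> (\<forall>x. norm (g x) \<le> B)" by (elim exE)
    then have g: "continuous_on UNIV g" "\<And>x. x \<in> K \<Longrightarrow> g x = f (\<pi> x)" "\<And>x. norm (g x) \<le> B" by simp_all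
    have "(\<lambda>n. measure_pmf.expectation (p (r n)) (\<lambda>x. g (c x))) \<longlonglongrightarrow> integral\<^sup>L M g"
      using g(3) by (intro conv[OF g(1), of B]) simp
    moreover have "measure_pmf.expectation (p n) (\<lambda>x. g (c x)) = measure_pmf.expectation (p n) f" for n
      using p[of n] c g(2) by (intro integral_cong_AE) (auto simp: AE_measure_pmf_iff)
    moreover have "integral\<^sup>L M g = (\<integral>x. f x \<partial>\<mu>)"
    proof -
      have fm: "f \<in> borel_measurable (restrict_space borel S)" by (rule borel_measurable_continuous_on_restrict[OF f])
      have "(\<integral>x. f x \<partial>\<mu>) = (\<integral>x. f (\<pi>' x) \<partial>M)" unfolding \<mu>_def by (rule integral_distr[OF \<pi>'_meas fm])
      also have "\<dots> = integral\<^sup>L M g"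
      proof (rule integral_cong_AE)
        show "(\<lambda>x. f (\<pi>' x)) \<in> borel_measurable M" by (rule measurable_compose[OF \<pi>'_meas fm])
        show "g \<in> borel_measurable M" using borel_measurable_continuous_onI[OF g(1)] by simp
        show "AE x in M. f (\<pi>' x) = g x" using MK by eventually_elim (simp add: \<pi>'_def g(2))
      qed
      finally show ?thesis by simp
    qed
    ultimately show "(\<lambda>n. measure_pmf.expectation (p (r n)) f) \<longlonglongrightarrow> (\<integral>x. f x \<partial>\<mu>)" by simp
  qed
qed

text \<open>The indicator of a closed set is the decreasing limit of the functions
  \<open>f k\<close>, and closed sets form a generator stable under intersection. Both measures are
  pushed to the whole type for this.\<close>

lemma measure_eq_by_continuous:
  fixes S :: "'b::metric_space set"
  assumes S: "closed S" and M: "prob_space M" "prob_space M'"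
    and sets: "sets M = sets (restrict_space borel S)" "sets M' = sets (restrict_space borel S)"
    and eq: "\<And>f :: 'b \<Rightarrow> real. continuous_on UNIV f \<Longrightarrow> (\<And>x. \<bar>f x\<bar> \<le> 1) \<Longrightarrow> (\<integral>x. f x \<partial>M) = (\<integral>x. f x \<partial>M')"
  shows "M = M'"
proof -
  interpret M: prob_space M by fact
  interpret M': prob_space M' by fact
  have sp: "space M = S" "space M' = S" using sets_eq_imp_space_eq[OF sets(1)] sets_eq_imp_space_eq[OF sets(2)]
    by (auto simp: space_restrict_space)
  have id: "(\<lambda>x. x) \<in> M \<rightarrow>\<^sub>M borel" "(\<lambda>x. x) \<in> M' \<rightarrow>\<^sub>M borel"
    using measurable_restrict_space1[of "\<lambda>x. x" borel borel S] measurable_cong_sets[OF sets(1) refl] measurable_cong_sets[OF sets(2) refl] by auto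
  define L where "L = distr M borel (\<lambda>x. x)"
  define L' where "L' = distr M' borel (\<lambda>x. x)"
  interpret L: prob_space L unfolding L_def by (rule M.prob_space_distr[OF id(1)])
  interpret L': prob_space L' unfolding L'_def by (rule M'.prob_space_distr[OF id(2)])
  have closed_eq: "emeasure L C = emeasure L' C" if C: "closed C" for C
  proof (cases "C = {}")
    case False
    define f where "f k x = max 0 (1 - real k * infdist x C)" for k :: nat and x
    have fc: "continuous_on UNIV (f k)" for k
      unfolding f_def by (intro continuous_on_max continuous_on_const continuous_on_diff continuous_on_mult
          continuous_on_infdist continuous_on_id)
    have f1: "\<bar>f k x\<bar> \<le> 1" for k x
      using infdist_nonneg[of x C] by (auto simp: f_def)
    have lim: "(\<lambda>k. f k x) \<longlonglongrightarrow> indicat_real C x" for x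
    proof (cases "x \<in> C")
      case True
      then show ?thesis by (simp add: f_def)
    next
      case x: False
      then have d: "0 < infdist x C" using in_closed_iff_infdist_zero[OF C False] infdist_nonneg[of x C] by (metis less_eq_real_def)
      obtain m :: nat where m: "1 / infdist x C < real m" using reals_Archimedean2 by blast
      have "f k x = 0" if "k \<ge> m" for k
      proof -
        have "1 / infdist x C < real k" using m that by linarith
        then have "1 < real k * infdist x C" using d by (simp add: field_simps)
        then show ?thesis by (simp add: f_def)
      qed
      then have "(\<lambda>k. f k x) \<longlonglongrightarrow> 0" by (intro tendsto_eventually) (auto simp: eventually_sequentially)
      then show ?thesis using x by simp
    qed
    have meas: "f k \<in> borel_measurable borel" for k by (rule borel_measurable_continuous_onI[OF fc])
    have Cm: "C \<in> sets borel" using C by simp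
    have conv: "(\<lambda>k. integral\<^sup>L N (f k)) \<longlonglongrightarrow> measure N C" if "prob_space N" "sets N = sets borel" for N :: "'b measure"
    proof -
      interpret N: prob_space N by fact
      have "(\<lambda>k. integral\<^sup>L N (f k)) \<longlonglongrightarrow> integral\<^sup>L N (indicat_real C)"
        using f1 lim meas Cm measurable_cong_sets[OF that(2) refl, of borel]
        by (intro integral_dominated_convergence[where w = "\<lambda>_. 1"]) auto
      then show ?thesis using Cm that(2) by simp
    qed
    have "integral\<^sup>L L (f k) = integral\<^sup>L L' (f k)" for k
      unfolding L_def L'_def using integral_distr[OF id(1) meas] integral_distr[OF id(2) meas] eq[OF fc f1] by simp
    then have "measure L C = measure L' C"
      using conv[OF L.prob_space_axioms] conv[OF L'.prob_space_axioms] LIMSEQ_unique by (auto simp: L_def L'_def)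
    then show ?thesis by (simp add: L.emeasure_eq_measure L'.emeasure_eq_measure)
  qed simp
  have "L = L'"
  proof (rule measure_eqI_generator_eq[where E = "Collect closed" and \<Omega> = UNIV and A = "\<lambda>_. UNIV"])
    show "Int_stable (Collect closed :: 'b set set)" by (auto simp: Int_stable_def)
    show "sets L = sigma_sets UNIV (Collect closed)" "sets L' = sigma_sets UNIV (Collect closed)"
      by (auto simp: L_def L'_def borel_eq_closed)
  qed (use closed_eq L.emeasure_finite in auto)
  show ?thesis
  proof (rule measure_eqI)
    show "sets M = sets M'" using sets by simp
    fix X assume X: "X \<in> sets M"
    then obtain Y where Y: "Y \<in> sets borel" "X = S \<inter> Y" unfolding sets by (auto simp: sets_restrict_space)
    have XB: "X \<in> sets borel" using Y S by auto
    have "(\<lambda>x. x) -` X \<inter> S = X" using Y(2) by auto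
    then have "emeasure M X = emeasure L X" "emeasure M' X = emeasure L' X"
      unfolding L_def L'_def using emeasure_distr[OF id(1) XB] emeasure_distr[OF id(2) XB] sp by auto
    then show "emeasure M X = emeasure M' X" using \<open>L = L'\<close> by simp
  qed
qed

section \<open>The rotation set\<close>

context potential_family
begin

lemma shift_measurable: "shift \<in> restrict_space borel \<Omega> \<rightarrow>\<^sub>M restrict_space borel \<Omega>"
  by (rule measurable_restrict_space3) (auto intro: borel_measurable_continuous_onI cont_shift shift_in)

text \<open>The error \<open>2 * B / n\<close> is that of an orbit segment of length
  \<open>n\<close>, caused by its two ends. Finite support makes every function integrable and
  mixtures explicit.\<close>

definition almost_invariant :: "nat \<Rightarrow> (nat \<Rightarrow> 'a) pmf \<Rightarrow> bool" where
  "almost_invariant n p \<longleftrightarrow> finite (set_pmf p) \<and> set_pmf p \<subseteq> \<Omega> \<and>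
     (\<forall>f B. (\<forall>x\<in>\<Omega>. \<bar>f x\<bar> \<le> B) \<longrightarrow>
       \<bar>measure_pmf.expectation p (\<lambda>x. f (shift x)) - measure_pmf.expectation p f\<bar> \<le> 2 * B / real n)"

definition AI :: "nat \<Rightarrow> (real ^ 'q) set" where
  "AI n = {w. \<exists>p. almost_invariant n p \<and> (\<forall>i. measure_pmf.expectation p (\<psi> i) = w $ i)}"

definition Birkhoff :: "nat \<Rightarrow> (nat \<Rightarrow> 'a) \<Rightarrow> real ^ 'q" where
  "Birkhoff n x = (\<chi> i. (\<Sum>k<n. \<psi> i ((shift ^^ k) x)) / real n)"

lemma Birkhoff_AI:
  assumes n: "0 < n" and x: "x \<in> \<Omega>" shows "Birkhoff n x \<in> AI n"
proof -
  define p where "p = map_pmf (\<lambda>k. (shift ^^ k) x) (pmf_of_set {..<n})"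
  have ne: "{..<n} \<noteq> {}" using n by auto
  have ex: "measure_pmf.expectation p f = (\<Sum>k<n. f ((shift ^^ k) x)) / real n" for f :: "_ \<Rightarrow> real"
    unfolding p_def using integral_pmf_of_set[OF ne finite_lessThan] by simp
  have set: "set_pmf p = (\<lambda>k. (shift ^^ k) x) ` {..<n}"
    unfolding p_def using set_pmf_of_set[OF ne] by simp
  have "almost_invariant n p"
    unfolding almost_invariant_def
  proof (intro conjI allI impI)
    show "finite (set_pmf p)" "set_pmf p \<subseteq> \<Omega>" unfolding set using shift_pow_in[OF x] by auto
    fix f :: "(nat \<Rightarrow> 'a) \<Rightarrow> real" and B assume B: "\<forall>x\<in>\<Omega>. \<bar>f x\<bar> \<le> B"
    have "measure_pmf.expectation p (\<lambda>x. f (shift x)) - measure_pmf.expectation p f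
        = (\<Sum>k<n. f ((shift ^^ Suc k) x) - f ((shift ^^ k) x)) / real n"
      unfolding ex by (simp add: sum_subtractf diff_divide_distrib)
    also have "\<dots> = (f ((shift ^^ n) x) - f x) / real n"
      using sum_lessThan_telescope[of "\<lambda>k. f ((shift ^^ k) x)" n] by simp
    also have "\<bar>\<dots>\<bar> \<le> 2 * B / real n"
      using B[rule_format, OF x] B[rule_format, OF shift_pow_in[OF x, of n]] n
      by (auto simp: abs_divide intro!: divide_right_mono)
    finally show "\<bar>measure_pmf.expectation p (\<lambda>x. f (shift x)) - measure_pmf.expectation p f\<bar> \<le> 2 * B / real n" .
  qed
  then show ?thesis unfolding AI_def using ex by (auto simp: Birkhoff_def)
qed

text \<open>A Bernoulli choice between two measures averages their invariance errors, so the bound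
  is kept. Being convex, \<open>AI n\<close> absorbs convex hulls without explicit convex
  combinations.\<close>

lemma convex_AI: "convex (AI n)"
  unfolding convex_alt
proof (intro ballI allI impI, elim conjE)
  fix w w' and u :: real assume w: "w \<in> AI n" "w' \<in> AI n" and u: "0 \<le> u" "u \<le> 1"
  obtain p p' where p: "almost_invariant n p" "\<And>i. measure_pmf.expectation p (\<psi> i) = w $ i"
    and p': "almost_invariant n p'" "\<And>i. measure_pmf.expectation p' (\<psi> i) = w' $ i"
    using w by (auto simp: AI_def)
  define q where "q = bind_pmf (bernoulli_pmf u) (\<lambda>b. if b then p' else p)"
  have fin: "finite (set_pmf p)" "finite (set_pmf p')" using p p' by (auto simp: almost_invariant_def)
  have ex: "measure_pmf.expectation q f = (1 - u) * measure_pmf.expectation p f + u * measure_pmf.expectation p' f" for f :: "_ \<Rightarrow> real"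
  proof -
    have "measure_pmf.expectation q f = (\<Sum>b\<in>(UNIV :: bool set). pmf (bernoulli_pmf u) b *\<^sub>R measure_pmf.expectation (if b then p' else p) f)"
      unfolding q_def by (rule pmf_expectation_bind) (use fin in auto)
    then show ?thesis using u by (simp add: UNIV_bool)
  qed
  have "almost_invariant n q"
    unfolding almost_invariant_def
  proof (intro conjI allI impI)
    have sub: "set_pmf q \<subseteq> set_pmf p \<union> set_pmf p'" unfolding q_def by (auto split: if_splits)
    then show "finite (set_pmf q)" using fin finite_subset by blast
    show "set_pmf q \<subseteq> \<Omega>" using sub p(1) p'(1) by (auto simp: almost_invariant_def)
    fix f :: "(nat \<Rightarrow> 'a) \<Rightarrow> real" and B assume B: "\<forall>x\<in>\<Omega>. \<bar>f x\<bar> \<le> B"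
    let ?d = "measure_pmf.expectation p (\<lambda>x. f (shift x)) - measure_pmf.expectation p f"
    let ?d' = "measure_pmf.expectation p' (\<lambda>x. f (shift x)) - measure_pmf.expectation p' f"
    have d: "\<bar>?d\<bar> \<le> 2 * B / real n" "\<bar>?d'\<bar> \<le> 2 * B / real n" using p(1) p'(1) B by (auto simp: almost_invariant_def)
    have "measure_pmf.expectation q (\<lambda>x. f (shift x)) - measure_pmf.expectation q f = (1 - u) * ?d + u * ?d'"
      unfolding ex by (simp add: algebra_simps)
    also have "\<bar>\<dots>\<bar> \<le> (1 - u) * \<bar>?d\<bar> + u * \<bar>?d'\<bar>"
      using abs_triangle_ineq[of "(1 - u) * ?d" "u * ?d'"] u by (simp add: abs_mult)
    also have "\<dots> \<le> (1 - u) * (2 * B / real n) + u * (2 * B / real n)"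
      using d u by (intro add_mono mult_left_mono) auto
    also have "\<dots> = 2 * B / real n" by (simp only: distrib_right[symmetric]) simp
    finally show "\<bar>measure_pmf.expectation q (\<lambda>x. f (shift x)) - measure_pmf.expectation q f\<bar> \<le> 2 * B / real n" .
  qed
  then show "(1 - u) *\<^sub>R w + u *\<^sub>R w' \<in> AI n" unfolding AI_def using p(2) p'(2) by (auto simp: ex)
qed

text \<open>Along the subsequence the invariance error is at most \<open>2 / (n + 1)\<close> for
  test functions bounded by 1, while the integrals of \<open>\<psi>\<close> equal \<open>z\<close>
  throughout; both facts pass to the weak limit.\<close>

lemma AI_limit:
  assumes z: "\<And>n. 0 < n \<Longrightarrow> z \<in> AI n"
  shows "z \<in> rotation_set A \<psi>"
proof -
  have "\<exists>p. almost_invariant (Suc n) p \<and> (\<forall>i. measure_pmf.expectation p (\<psi> i) = z $ i)" for n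
    using z[of "Suc n"] by (simp add: AI_def)
  then obtain p where p: "\<And>n. almost_invariant (Suc n) (p n)" "\<And>n i. measure_pmf.expectation (p n) (\<psi> i) = z $ i"
    by metis
  have "set_pmf (p n) \<subseteq> \<Omega>" for n using p(1) by (simp add: almost_invariant_def)
  from weak_limit_on_compact[of _ p, OF compact_Omega Omega_nonempty this] obtain r \<mu> where
    "strict_mono r \<and> prob_space \<mu> \<and> sets \<mu> = sets (restrict_space borel \<Omega>) \<and>
      (\<forall>f :: _ \<Rightarrow> real. continuous_on \<Omega> f \<longrightarrow> (\<lambda>n. measure_pmf.expectation (p (r n)) f) \<longlonglongrightarrow> (\<integral>x. f x \<partial>\<mu>))"
    by (elim exE)
  then have r: "strict_mono r" and \<mu>: "prob_space \<mu>" "sets \<mu> = sets (restrict_space borel \<Omega>)"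
    and lim: "\<And>f :: _ \<Rightarrow> real. continuous_on \<Omega> f \<Longrightarrow> (\<lambda>n. measure_pmf.expectation (p (r n)) f) \<longlonglongrightarrow> (\<integral>x. f x \<partial>\<mu>)"
    by simp_all
  have sh: "shift \<in> \<mu> \<rightarrow>\<^sub>M \<mu>" using shift_measurable measurable_cong_sets[OF \<mu>(2) \<mu>(2)] by simp
  have "distr \<mu> \<mu> shift = \<mu>"
  proof (rule measure_eq_by_continuous[OF closed_Omega])
    show "prob_space (distr \<mu> \<mu> shift)" by (rule prob_space.prob_space_distr[OF \<mu>(1) sh])
    fix f :: "(nat \<Rightarrow> 'a) \<Rightarrow> real" assume f: "continuous_on UNIV f" "\<And>x. \<bar>f x\<bar> \<le> 1"
    have f\<Omega>: "continuous_on \<Omega> f" using f(1) continuous_on_subset by blast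
    have fm: "f \<in> borel_measurable \<mu>"
      using borel_measurable_continuous_on_restrict[OF f\<Omega>] measurable_cong_sets[OF \<mu>(2) refl] by blast
    have fs: "continuous_on \<Omega> (\<lambda>x. f (shift x))"
      by (rule continuous_on_compose2[OF f(1) cont_shift]) simp
    have "\<bar>measure_pmf.expectation (p (r n)) (\<lambda>x. f (shift x)) - measure_pmf.expectation (p (r n)) f\<bar> \<le> 2 / real (Suc n)" for n
    proof -
      have "\<bar>measure_pmf.expectation (p (r n)) (\<lambda>x. f (shift x)) - measure_pmf.expectation (p (r n)) f\<bar> \<le> 2 * 1 / real (Suc (r n))"
        using p(1)[of "r n"] f(2) unfolding almost_invariant_def by blast
      also have "\<dots> \<le> 2 / real (Suc n)"
        using seq_suble[OF r, of n] by (simp add: frac_le)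
      finally show ?thesis .
    qed
    then have ev: "\<forall>\<^sub>F n in sequentially. norm (measure_pmf.expectation (p (r n)) (\<lambda>x. f (shift x)) - measure_pmf.expectation (p (r n)) f) \<le> 2 / real (Suc n)"
      unfolding real_norm_def by (intro always_eventually allI)
    have "(\<lambda>n. 2 / real (Suc n)) \<longlonglongrightarrow> 0"
      using LIMSEQ_Suc[OF lim_const_over_n[of "2 :: real"]] by simp
    from Lim_null_comparison[OF ev this]
    have "(\<integral>x. f (shift x) \<partial>\<mu>) - (\<integral>x. f x \<partial>\<mu>) = 0"
      using LIMSEQ_unique[OF tendsto_diff[OF lim[OF fs] lim[OF f\<Omega>]]] by blast
    then show "(\<integral>x. f x \<partial>(distr \<mu> \<mu> shift)) = (\<integral>x. f x \<partial>\<mu>)"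
      using integral_distr[OF sh fm] by simp
  qed (use \<mu> in simp_all)
  then have inv: "\<mu> \<in> invariant_measures A" using \<mu> by (simp add: invariant_measures_def)
  have "(\<integral>x. \<psi> i x \<partial>\<mu>) = z $ i" for i
  proof -
    have "(\<lambda>n. z $ i) \<longlonglongrightarrow> (\<integral>x. \<psi> i x \<partial>\<mu>)"
      using lim[OF C0_D(1)[OF Lip1_D(4)[OF \<psi>]], of i] by (simp add: p(2))
    then show ?thesis by (rule LIMSEQ_unique) (rule tendsto_const)
  qed
  then have "z = (\<chi> i. \<integral>x. \<psi> i x \<partial>\<mu>)" by (simp add: vec_eq_iff)
  then show ?thesis unfolding rotation_set_def using inv by blast
qed

lemma entropy_infinite:
  assumes z: "z \<notin> rotation_set A \<psi>"
  shows "entropy_H \<rho> A z \<psi> = - \<infinity>"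
proof (rule ccontr)
  assume ne: "entropy_H \<rho> A z \<psi> \<noteq> - \<infinity>"
  then have "- \<infinity> < entropy_H \<rho> A z \<psi>" by simp
  from ereal_dense2[OF this] obtain m where m: "ereal m < entropy_H \<rho> A z \<psi>" by (elim exE conjE)
  have lower: "m \<le> P t - t \<bullet> z" for t
  proof -
    have "entropy_H \<rho> A z \<psi> \<le> ereal (pressure \<rho> A \<psi> t - t \<bullet> z)"
      unfolding entropy_H_def by (rule INF_lower) simp
    with m have "ereal m \<le> ereal (pressure \<rho> A \<psi> t - t \<bullet> z)" by (rule less_imp_le[OF less_le_trans])
    then show ?thesis by (simp only: ereal_less_eq pressure_eq)
  qed
  have "z \<in> AI n" if n: "0 < n" for n
  proof -
    have cont: "continuous_on \<Omega> (Birkhoff n)"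
      unfolding Birkhoff_def[abs_def]
      by (intro continuous_on_vec_lambda continuous_on_divide continuous_on_sum continuous_on_const
          cont_Birkhoff C0_D(1) Lip1_D(4) \<psi>) (use n in simp)
    have cl: "closed (convex hull (Birkhoff n ` \<Omega>))"
      by (intro compact_imp_closed compact_convex_hull compact_continuous_image cont compact_Omega)
    have "z \<in> convex hull (Birkhoff n ` \<Omega>)"
    proof (rule ccontr)
      assume "z \<notin> convex hull (Birkhoff n ` \<Omega>)"
      from separating_hyperplane_closed_point[OF convex_convex_hull cl this] obtain a b where
        ab: "a \<bullet> z < b" "\<And>w. w \<in> convex hull (Birkhoff n ` \<Omega>) \<Longrightarrow> b < a \<bullet> w" by blast
      \<comment> \<open>At the parameter \<open>- s *\<^sub>R a\<close>, pressure minus linear term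
        is at most \<open>- s * (b - a \<bullet> z)\<close>; this \<open>s\<close> makes the bound
        \<open>- (\<bar>m\<bar> + 1)\<close>, which is below \<open>m\<close>.\<close>
      define s where "s = (\<bar>m\<bar> + 1) / (b - a \<bullet> z)"
      have s: "0 < s" using ab(1) by (simp add: s_def)
      have "pr (\<Phi> ((- s) *\<^sub>R a)) \<le> - s * b"
      proof (rule pr_le_Birkhoff[OF \<Phi>_V n])
        fix x assume x: "x \<in> \<Omega>"
        have "(\<Sum>k<n. \<Phi> ((- s) *\<^sub>R a) ((shift ^^ k) x)) = (\<Sum>k<n. \<Sum>i\<in>UNIV. (- s * a $ i) * \<psi> i ((shift ^^ k) x))"
          by (simp add: \<Phi>_def sum_fun_apply)
        also have "\<dots> = (\<Sum>i\<in>UNIV. \<Sum>k<n. (- s * a $ i) * \<psi> i ((shift ^^ k) x))" by (rule sum.swap)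
        also have "\<dots> = (\<Sum>i\<in>UNIV. (- s * a $ i) * (\<Sum>k<n. \<psi> i ((shift ^^ k) x)))"
          by (simp only: sum_distrib_left)
        finally have "(\<Sum>k<n. \<Phi> ((- s) *\<^sub>R a) ((shift ^^ k) x)) / real n = - s * (a \<bullet> Birkhoff n x)"
          by (simp add: inner_vec_def Birkhoff_def sum_divide_distrib sum_distrib_left sum_negf mult.assoc)
        also have "\<dots> \<le> - s * b"
          using s ab(2)[OF hull_inc[of "Birkhoff n x"]] x by (simp add: less_imp_le)
        finally show "(\<Sum>k<n. \<Phi> ((- s) *\<^sub>R a) ((shift ^^ k) x)) / real n \<le> - s * b" .
      qed
      then have "m \<le> - s * b + s * (a \<bullet> z)" using lower[of "(- s) *\<^sub>R a"] by simp
      also have "\<dots> = - (s * (b - a \<bullet> z))" by (simp add: algebra_simps)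
      also have "\<dots> = - (\<bar>m\<bar> + 1)" using ab(1) by (simp add: s_def)
      finally show False by linarith
    qed
    also have "convex hull (Birkhoff n ` \<Omega>) \<subseteq> AI n"
    proof (rule hull_minimal)
      show "Birkhoff n ` \<Omega> \<subseteq> AI n" using Birkhoff_AI[OF n] by (rule image_subsetI)
    qed (rule convex_AI)
    finally show ?thesis .
  qed
  from AI_limit[OF this] z show False by (rule notE[rotated])
qed

end

theorem theorem1:
  fixes \<rho> :: "'a::metric_space measure"
    and A :: "'a \<Rightarrow> 'a \<Rightarrow> real"
  assumes compact_E: "compact (UNIV :: 'a set)"
    and prob: "prob_space \<rho>"
    and borel: "sets \<rho> = sets borel"
    and full_support: "\<And>U. open U \<Longrightarrow> U \<noteq> {} \<Longrightarrow> measure \<rho> U > 0"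
    and ball_continuous: "\<forall>\<^sub>F \<epsilon> in at_right 0. continuous_on UNIV (\<lambda>x. measure \<rho> (ball x \<epsilon>))"
    and A_values: "\<And>x y. A x y \<in> {0, 1}"
    and A_continuous: "continuous_on UNIV (\<lambda>(x, y). A x y)"
    and A_Lipschitz: "\<exists>L. \<forall>x. L-lipschitz_on UNIV (A x)"
    and A_mixing: "\<exists>N\<ge>1. \<forall>n\<ge>N. \<forall>a b. \<exists>z :: nat \<Rightarrow> 'a.
        z 0 = a \<and> z n = b \<and> (\<Prod>i<n. A (z i) (z (Suc i))) = 1"
  shows "(\<forall>\<phi>\<in>Lip1 A.
            simple_dominating_eigenvalue (Lip1 A) (lip_norm A) (transfer_op \<rho> A \<phi>) (r_transfer \<rho> A \<phi>)) \<and>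
         (\<forall>\<psi> :: 'q::finite \<Rightarrow> (nat \<Rightarrow> 'a) \<Rightarrow> real. (\<forall>i. \<psi> i \<in> Lip1 A) \<longrightarrow>
            infinitely_differentiable (pressure \<rho> A \<psi>) \<and>
            (\<forall>z. (z \<notin> rotation_set A \<psi> \<longrightarrow> entropy_H \<rho> A z \<psi> = - \<infinity>) \<and>
                 ((\<exists>t. GDERIV (pressure \<rho> A \<psi>) t :> z) \<longrightarrow> \<bar>entropy_H \<rho> A z \<psi>\<bar> \<noteq> \<infinity>)))"
proof -
  interpret shift_system \<rho> A
  proof (rule shift_system.intro)
    show "compact (UNIV :: 'a set)" "prob_space \<rho>" "sets \<rho> = sets borel"
      by (fact compact_E prob borel)+
    show "\<And>U. open U \<Longrightarrow> U \<noteq> {} \<Longrightarrow> measure \<rho> U > 0" by (fact full_support)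
    show "\<And>x y. A x y \<in> {0, 1}" by (fact A_values)
    show "continuous_on UNIV (\<lambda>(x, y). A x y)" by (fact A_continuous)
    show "\<exists>N\<ge>1. \<forall>n\<ge>N. \<forall>a b. \<exists>z :: nat \<Rightarrow> 'a.
        z 0 = a \<and> z n = b \<and> (\<Prod>i<n. A (z i) (z (Suc i))) = 1" by (fact A_mixing)
  qed
  have family: "potential_family \<rho> A \<psi>" if "\<forall>i. \<psi> i \<in> Lip1 A" for \<psi> :: "'q \<Rightarrow> (nat \<Rightarrow> 'a) \<Rightarrow> real"
    by (rule potential_family.intro[OF shift_system_axioms potential_family_axioms.intro]) (rule that[rule_format])
  show ?thesis
  proof (intro conjI ballI allI impI)
    fix \<phi> assume "\<phi> \<in> Lip1 A"
    then show "simple_dominating_eigenvalue (Lip1 A) (lip_norm A) (transfer_op \<rho> A \<phi>) (r_transfer \<rho> A \<phi>)"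
      by (rule potential.eigenfun_ex(3)[OF potential_Lip1])
  next
    fix \<psi> :: "'q \<Rightarrow> (nat \<Rightarrow> 'a) \<Rightarrow> real" assume "\<forall>i. \<psi> i \<in> Lip1 A"
    then show "infinitely_differentiable (pressure \<rho> A \<psi>)"
      by (rule potential_family.pressure_smooth[OF family])
  next
    fix \<psi> :: "'q \<Rightarrow> (nat \<Rightarrow> 'a) \<Rightarrow> real" and z
    assume "\<forall>i. \<psi> i \<in> Lip1 A" "z \<notin> rotation_set A \<psi>"
    then show "entropy_H \<rho> A z \<psi> = - \<infinity>"
      by (rule potential_family.entropy_infinite[OF family])
  next
    fix \<psi> :: "'q \<Rightarrow> (nat \<Rightarrow> 'a) \<Rightarrow> real" and z
    assume \<psi>: "\<forall>i. \<psi> i \<in> Lip1 A" and "\<exists>t. GDERIV (pressure \<rho> A \<psi>) t :> z"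
    then obtain t where "GDERIV (pressure \<rho> A \<psi>) t :> z" by (elim exE)
    then show "\<bar>entropy_H \<rho> A z \<psi>\<bar> \<noteq> \<infinity>"
      by (rule potential_family.entropy_finite[OF family[OF \<psi>]])
  qed
qed

end
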